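(* Let $Z$ be an irreducible continuous-time Markov chain on $\{e_1,\dots,e_d\}\subset\mathbb{R}^d$ with generator $Q$ and stationary distribution $\pi$, and for $n\in\mathbb{N}$ let $Z^n$ be the Markov chain with generator $nQ$. Let $\lambda\in\mathbb{R}^d_+$, $\lambda_\infty=\lambda^{\mathrm T}\pi$, and let $N^n$ be the Markov-modulated binomial counting process with $n$ obligors and intensity $\lambda^{\mathrm T}Z^n$, i.e. $$\mathrm{d}N^n_t=\lambda^{\mathrm T}Z^n_t(n-N^n_t)\,\mathrm{d}t+\mathrm{d}M^n_t,\qquad N^n_0=0.$$ Let $\varrho_t=1-\exp(-\lambda_\infty t)$ (the solution of $\dot\varrho_t=\lambda_\infty(1-\varrho_t)$, $\varrho_0=0$). Then $\hat N^n_t:=n^{-1/2}(N^n_t-n\varrho_t)$ converges weakly, as $n\to\infty$, to the solution $\hat N$ of $$\mathrm{d}\hat N_t=-\lambda_\infty\hat N_t\,\mathrm{d}t+\mathrm{d}B_t+\mathrm{d}G_t,\qquad \hat N_0=0,$$ where $G$ is a Gaussian martingale with $\langle G\rangle_t=\frac{V}{2\lambda_\infty}(1-\exp(-2\lambda_\infty t))$, $V=\lambda^{\mathrm T}(\mathrm{diag}\{\pi\}D^{\mathrm T}+D\,\mathrm{diag}\{\pi\})\lambda$, and $B$ is a Gaussian martingale with $\langle B\rangle_t=1-\exp(-\lambda_\infty t)$, independent of $G$.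
   Context: Generator convention: $q_{ji}\ge0$ ($i\ne j$) is the jump rate from $e_i$ to $e_j$, $q_{ii}=-\sum_{j\ne i}q_{ji}$; $\pi$ is the column vector with $Q\pi=0$, $\mathbf 1^{\mathrm T}\pi=1$. With $\Pi=\pi\mathbf 1^{\mathrm T}$, the deviation matrix is $D=(\Pi-Q)^{-1}-\Pi$ (equivalently $D=\int_0^\infty(e^{Qs}-\Pi)\mathrm{d}s$). The Markov-modulated binomial counting process: conditionally on the path of $Z^n$, the $n$ default times are independent with $\mathbb{P}(\tau^i>t\mid Z^n)=\exp(-\int_0^t\lambda^{\mathrm T}Z^n_s\mathrm{d}s)$, and $N^n_t=\#\{i:\tau^i\le t\}$; $M^n$ is a martingale w.r.t. $\sigma(N^n_s,s\le t)\vee\sigma(Z^n)$. Standing assumption: $N^n$ and $Z^n$ never jump simultaneously. Convergence is in distribution in the Skorokhod space. *)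

theory Defs
  imports "HOL-Analysis.Analysis" "HOL-Probability.Probability"
begin

section \<open>Matrices, generators, deviation matrix\<close>

text \<open>Convention: Q \$ j \$ i is the jump rate from state i to state j (column convention),
  so the transition matrix at time t is mexp (t *R Q), with entry (j,i) = P(Z_t = e_j | Z_0 = e_i).\<close>

fun matpow :: "real^'n^'n \<Rightarrow> nat \<Rightarrow> real^'n^'n" where
  "matpow A 0 = mat 1"
| "matpow A (Suc k) = A ** matpow A k"

definition mexp :: "real^'n^'n \<Rightarrow> real^'n^'n" where
  "mexp A = (\<Sum>k. (1 / fact k) *\<^sub>R matpow A k)"

definition is_generator :: "real^'n^'n \<Rightarrow> bool" where
  "is_generator Q \<longleftrightarrow> (\<forall>i j. i \<noteq> j \<longrightarrow> Q $ j $ i \<ge> 0) \<and>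
     (\<forall>i. Q $ i $ i = - (\<Sum>j\<in>UNIV - {i}. Q $ j $ i))"

text \<open>Irreducible: every state can be reached from every other state via positive jump rates.\<close>
definition irreducible_generator :: "real^'n^'n \<Rightarrow> bool" where
  "irreducible_generator Q \<longleftrightarrow> (\<forall>i j. (i, j) \<in> {(i, j). i \<noteq> j \<and> Q $ j $ i > 0}\<^sup>*)"

definition Pi_mat :: "real^'n \<Rightarrow> real^'n^'n" where
  "Pi_mat p = (\<chi> i j. p $ i)"   \<comment> \<open>\<open>\<Pi> = \<pi> 1\<^sup>T\<close>\<close>

definition deviation_matrix :: "real^'n^'n \<Rightarrow> real^'n \<Rightarrow> real^'n^'n" where
  "deviation_matrix Q p = matrix_inv (Pi_mat p - Q) - Pi_mat p"

definition diag_mat :: "real^'n \<Rightarrow> real^'n^'n" where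
  "diag_mat p = (\<chi> i j. if i = j then p $ i else 0)"

definition asympt_var :: "real^'n^'n \<Rightarrow> real^'n \<Rightarrow> real^'n \<Rightarrow> real" where
  "asympt_var Q p lam =
     lam \<bullet> ((diag_mat p ** transpose (deviation_matrix Q p)
             + deviation_matrix Q p ** diag_mat p) *v lam)"

section \<open>Continuous-time Markov chains on a finite state space\<close>

text \<open>Right-continuous paths with left limits for the discrete topology on the state space.\<close>
definition piecewise_const_cadlag :: "(real \<Rightarrow> 'd) \<Rightarrow> bool" where
  "piecewise_const_cadlag z \<longleftrightarrow>
     (\<forall>t\<ge>0. (\<exists>e>0. \<forall>s. t \<le> s \<and> s < t + e \<longrightarrow> z s = z t) \<and>
            (t > 0 \<longrightarrow> (\<exists>e>0. \<exists>c. \<forall>s. t - e < s \<and> s < t \<longrightarrow> z s = c)))"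

text \<open>Z is a continuous-time Markov chain (arbitrary initial law) with generator Q.\<close>
definition ctmc :: "'a measure \<Rightarrow> real^'d^'d \<Rightarrow> (real \<Rightarrow> 'a \<Rightarrow> 'd::finite) \<Rightarrow> bool" where
  "ctmc M Q Z \<longleftrightarrow> prob_space M \<and>
     (\<forall>t\<ge>0. Z t \<in> measurable M (count_space UNIV)) \<and>
     (\<forall>\<omega>\<in>space M. piecewise_const_cadlag (\<lambda>t. Z t \<omega>)) \<and>
     (\<forall>ts ss. sorted_wrt (<) ts \<and> ts \<noteq> [] \<and> hd ts \<ge> 0 \<and> length ss = length ts \<longrightarrow>
        measure M {\<omega>\<in>space M. \<forall>m<length ts. Z (ts!m) \<omega> = ss!m}
        = measure M {\<omega>\<in>space M. Z (ts!0) \<omega> = ss!0} *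
          (\<Prod>m<length ts - 1. mexp ((ts!Suc m - ts!m) *\<^sub>R Q) $ (ss!Suc m) $ (ss!m)))"

section \<open>Markov-modulated binomial default times\<close>

text \<open>Conditionally on the path of Z, the n default times tau 0, ..., tau (n-1) are independent with
  P(tau i > t | Z) = exp(- int_0^t lam^T Z_s ds). Default times may be infinite.\<close>
definition mm_binomial_defaults ::
  "'a measure \<Rightarrow> real^'d \<Rightarrow> (real \<Rightarrow> 'a \<Rightarrow> 'd) \<Rightarrow> nat \<Rightarrow> (nat \<Rightarrow> 'a \<Rightarrow> ereal) \<Rightarrow> bool" where
  "mm_binomial_defaults M lam Z n \<tau> \<longleftrightarrow>
     (\<forall>i<n. \<tau> i \<in> borel_measurable M) \<and>
     (\<forall>A \<in> sigma_sets (space M) {{\<omega>\<in>space M. Z s \<omega> = j} | s j. s \<ge> 0}.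
        \<forall>t::nat \<Rightarrow> real. (\<forall>i<n. t i \<ge> 0) \<longrightarrow>
          measure M (A \<inter> {\<omega>\<in>space M. \<forall>i<n. \<tau> i \<omega> > ereal (t i)})
          = (\<integral>\<omega>\<in>A. (\<Prod>i<n. exp (- integral {0..t i} (\<lambda>s. lam $ Z s \<omega>))) \<partial>M))"

definition counting_process :: "nat \<Rightarrow> (nat \<Rightarrow> 'a \<Rightarrow> ereal) \<Rightarrow> real \<Rightarrow> 'a \<Rightarrow> nat" where
  "counting_process n \<tau> t \<omega> = card {i. i < n \<and> \<tau> i \<omega> \<le> ereal t}"

section \<open>Skorokhod space D[0,oo) and convergence in distribution\<close>

definition cadlag_path :: "(real \<Rightarrow> real) \<Rightarrow> bool" where
  "cadlag_path x \<longleftrightarrow> (\<forall>t\<ge>0. continuous (at_right t) x) \<and> (\<forall>t>0. \<exists>l. (x \<longlongrightarrow> l) (at_left t))"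

text \<open>Skorokhod J1 convergence on D[0,oo) (Ethier--Kurtz, Prop. 3.5.3).\<close>
definition skorokhod_conv :: "(nat \<Rightarrow> real \<Rightarrow> real) \<Rightarrow> (real \<Rightarrow> real) \<Rightarrow> bool" where
  "skorokhod_conv xs x \<longleftrightarrow> (\<exists>ls :: nat \<Rightarrow> real \<Rightarrow> real.
     (\<forall>k. strict_mono_on {0..} (ls k) \<and> continuous_on {0..} (ls k) \<and> ls k ` {0..} = {0..}) \<and>
     (\<forall>e>0. eventually (\<lambda>k. \<forall>t\<ge>0. \<bar>ls k t - t\<bar> \<le> e) sequentially) \<and>
     (\<forall>T>0. \<forall>e>0. eventually (\<lambda>k. \<forall>t\<in>{0..T}. \<bar>xs k (ls k t) - x t\<bar> \<le> e) sequentially))"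

definition skorokhod_continuous :: "((real \<Rightarrow> real) \<Rightarrow> real) \<Rightarrow> bool" where
  "skorokhod_continuous f \<longleftrightarrow> (\<forall>xs x. (\<forall>k. cadlag_path (xs k)) \<and> cadlag_path x \<and> skorokhod_conv xs x
      \<longrightarrow> (\<lambda>k. f (xs k)) \<longlonglongrightarrow> f x)"

text \<open>Convergence in distribution in D[0,oo): E f(X_k) \<rightarrow> E f(Y) for all bounded Skorokhod-continuous
  (Borel = product-measurable) functionals f.\<close>
definition conv_distr_D ::
  "(nat \<Rightarrow> 'a measure) \<Rightarrow> (nat \<Rightarrow> real \<Rightarrow> 'a \<Rightarrow> real) \<Rightarrow> 'b measure \<Rightarrow> (real \<Rightarrow> 'b \<Rightarrow> real) \<Rightarrow> bool" where
  "conv_distr_D M X P Y \<longleftrightarrow>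
     (\<forall>f. f \<in> borel_measurable (Pi\<^sub>M UNIV (\<lambda>_. borel)) \<and> bounded (range f) \<and> skorokhod_continuous f
        \<longrightarrow> (\<lambda>k. \<integral>\<omega>. f (\<lambda>t. X k t \<omega>) \<partial>M k) \<longlonglongrightarrow> (\<integral>\<omega>. f (\<lambda>t. Y t \<omega>) \<partial>P))"

section \<open>Gaussian martingales\<close>

text \<open>Continuous Gaussian martingale X with deterministic bracket h (X_0 = 0): increments over
  disjoint intervals are independent centered Gaussians with variance h t - h s.\<close>
definition gaussian_martingale :: "'b measure \<Rightarrow> (real \<Rightarrow> 'b \<Rightarrow> real) \<Rightarrow> (real \<Rightarrow> real) \<Rightarrow> bool" where
  "gaussian_martingale P X h \<longleftrightarrow>
     (\<forall>t\<ge>0. X t \<in> borel_measurable P) \<and>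
     (\<forall>\<omega>\<in>space P. X 0 \<omega> = 0 \<and> continuous_on {0..} (\<lambda>t. X t \<omega>)) \<and>
     (\<forall>ts (u :: nat \<Rightarrow> real). sorted_wrt (<) ts \<and> ts \<noteq> [] \<and> hd ts \<ge> 0 \<longrightarrow>
        (\<integral>\<omega>. cis (\<Sum>m<length ts - 1. u m * (X (ts!Suc m) \<omega> - X (ts!m) \<omega>)) \<partial>P)
        = complex_of_real (exp (- (\<Sum>m<length ts - 1. (u m)\<^sup>2 * (h (ts!Suc m) - h (ts!m))) / 2)))"

end

theory Submission
  imports Defs "HOL-Real_Asymp.Real_Asymp"
begin

text \<open>Write \<open>\<Lambda>\<^sub>t\<close> for the integrated intensity and \<open>K\<^sub>t = exp (linf * t) * Nhat\<^sub>t\<close>. Given the chain, the default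
  times are i.i.d., so the characteristic function of the increments of \<open>K\<close> on a time grid is the expectation of
  the \<open>n\<close>-th power of a mixture over grid cells. Its expansion separates a binomial part, deterministic in the
  limit, from a factor linear in the increments of \<open>sqrt n * (\<Lambda>\<^sub>t - linf * t)\<close>. These increments are handled by a
  perturbed test function \<open>1 + \<i> \<theta> f / sqrt n - \<theta>\<^sup>2 f2 / n\<close> built from the deviation matrix, which is nearly an
  eigenfunction of the tilted generator with eigenvalue \<open>- \<theta>\<^sup>2 V / 2\<close>. Hence \<open>K\<close> has, in the limit, independent
  Gaussian increments with variance function \<open>exp (linf * t) - 1 + V * t\<close>.

  The same test function with a real parameter bounds exponential moments and so fourth moments of increments on
  scales \<open>\<eta> \<ge> C / n\<close>; dyadic chaining, combined on the finest scale with the monotonicity of the counting process,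
  controls the oscillation. For limits with continuous paths, this together with the finite-dimensional convergence
  suffices, because a bounded Skorokhod-continuous functional is approximated from both sides, near continuous
  paths, by functionals that are Lipschitz for locally uniform convergence.

  The limit is built from two independent Brownian motions on \<open>[0, 1]\<close> (Levy's construction), run with the
  clocks \<open>1 - exp (- linf * t)\<close> and \<open>1 - exp (- 2 * linf * t)\<close>; the equation for \<open>Nh\<close> is solved pathwise.\<close>

text \<open>Why \<open>K\<close>: given the chain, \<open>exp (linf * t)\<close> times the survival
  indicator of one obligor has mean \<open>exp (- (\<Lambda>\<^sub>t - linf * t))\<close>. The drift
  is gone, so the chain enters the means only through its fluctuations of order
  \<open>1 / sqrt n\<close>; without these the weighted indicator would have orthogonal increments.
  Hence two variance contributions that simply add. The chain is specified by its finite-dimensional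
  distributions, so generator arguments are run on grids of mesh \<open>\<eta> / r\<close>, with
  \<open>r\<close> sent to infinity before \<open>n\<close>. The obstacle to tightness is that one
  default is a jump of size \<open>1 / sqrt n\<close>: fourth-moment bounds of order
  \<open>\<eta>\<^sup>2\<close> fail in general for cells much shorter than \<open>1 / n\<close>.
  Chaining stops at mesh \<open>n powr (- 3 / 4)\<close>, where they still hold while the drift
  \<open>sqrt n * \<eta>\<close> of a cell already vanishes. If \<open>linf = 0\<close>, the
  quotient \<open>V / (2 * linf)\<close> is 0 by convention; this is the right value because then
  \<open>lam = 0\<close> and \<open>V = 0\<close>. The limit has to live on a measure over the
  reals, so pairs of Gaussian sequences are coded injectively by real numbers.\<close>

lemma pow4_le_exp: "x^4 \<le> 256 * exp x" if "x \<ge> 0" for x :: real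
proof -
  \<comment> \<open>The factor 256 is \<open>4^4\<close>, from the fourth power of
    \<open>x / 4\<close>.\<close>
  have "(1 + x / real 4) ^ 4 \<le> exp x" using that by (intro exp_ge_one_plus_x_over_n_power_n) auto
  moreover have "(x / 4) ^ 4 \<le> (1 + x / 4) ^ 4" using that by (intro power_mono) auto
  ultimately have "(x / 4) ^ 4 \<le> exp x" by simp
  then show ?thesis by (simp add: power_divide)
qed

text \<open>Bounds a maximum by a quantity of computable expectation: with the sum of all fourth
  powers of a level in place of \<open>x^4\<close>, it holds for every increment of that level at
  once, and \<open>a\<close> is tuned to the level.\<close>

lemma abs_le_pow4: "\<bar>x\<bar> \<le> a + x^4 / a^3" if "a > 0" for a x :: real
proof (cases "\<bar>x\<bar> \<le> a")
  case True
  have "0 \<le> x^4 / a^3" using that by simp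
  then show ?thesis using True by linarith
next
  case False
  then have "a^3 \<le> \<bar>x\<bar>^3" using that by (intro power_mono) auto
  then have "\<bar>x\<bar> * a^3 \<le> \<bar>x\<bar> * \<bar>x\<bar>^3" by (intro mult_left_mono) auto
  also have "\<dots> = x^4" by (simp add: power4_eq_xxxx power3_eq_cube)
  finally have "\<bar>x\<bar> \<le> x^4 / a^3" using that by (simp add: pos_le_divide_eq)
  then show ?thesis using that by linarith
qed

section \<open>The Poisson equation\<close>

lemma generator_colsum: "is_generator Q \<Longrightarrow> (\<Sum>j\<in>UNIV. Q $ j $ i) = 0"
  by (simp add: is_generator_def sum.remove[of UNIV i])

text \<open>Nothing is assumed about the sign of \<open>p\<close>. Sum \<open>Q *v p = 0\<close>
  over the set \<open>S\<close> of states of positive mass: states in \<open>S\<close> can only lose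
  mass to the outside, and states outside carry mass at most zero into \<open>S\<close>, so all
  terms \<open>a i * p $ i\<close> are at most zero and hence vanish. Thus no rate leads out of
  \<open>S\<close>, and irreducibility makes \<open>S\<close> the whole space.\<close>

lemma stationary_pos:
  fixes Q :: "real^'d::finite^'d"
  assumes Q: "is_generator Q" "irreducible_generator Q"
    and p: "Q *v p = 0" "(\<Sum>i\<in>UNIV. p $ i) = 1"
  shows "p $ i > 0"
proof -
  define S where "S = {i. p $ i > 0}"
  have "\<exists>i. p $ i > 0"
  proof (rule ccontr)
    assume "\<nexists>i. p $ i > 0"
    then have "(\<Sum>i\<in>UNIV. p $ i) \<le> 0"
      by (intro sum_nonpos) (auto simp: not_less)
    with p(2) show False by simp
  qed
  then obtain i0 where i0: "i0 \<in> S" by (auto simp: S_def)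
  define a where "a i = (\<Sum>j\<in>S. Q $ j $ i)" for i
  have "(\<Sum>j\<in>S. (Q *v p) $ j) = 0" using p(1) by simp
  then have tot: "(\<Sum>i\<in>UNIV. a i * p $ i) = 0"
    by (simp add: matrix_vector_mult_def a_def sum_distrib_right sum.swap[of _ S])
  have off: "a i = - (\<Sum>j\<in>-S. Q $ j $ i)" for i
    using generator_colsum[OF Q(1), of i] sum.subset_diff[of S UNIV "\<lambda>j. Q $ j $ i"]
    by (simp add: a_def Compl_eq_Diff_UNIV)
  have np: "a i * p $ i \<le> 0" for i
  proof (cases "i \<in> S")
    case True
    have "Q $ j $ i \<ge> 0" if "j \<in> -S" for j
      using Q(1) True that unfolding is_generator_def by (metis ComplD)
    then have "0 \<le> (\<Sum>j\<in>-S. Q $ j $ i)" by (rule sum_nonneg)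
    then have "a i \<le> 0" unfolding off by simp
    with True show ?thesis by (auto simp: S_def mult_nonpos_nonneg)
  next
    case False
    have "Q $ j $ i \<ge> 0" if "j \<in> S" for j
      using Q(1) False that unfolding is_generator_def by metis
    then have "a i \<ge> 0" unfolding a_def by (simp add: sum_nonneg)
    with False show ?thesis by (auto simp: S_def mult_nonneg_nonpos)
  qed
  have zero: "a i * p $ i = 0" for i
    using sum_nonneg_eq_0_iff[of UNIV "\<lambda>i. - (a i * p $ i)"] np tot by (simp add: sum_negf)
  have closed: "j \<in> S" if "i \<in> S" "i \<noteq> j" "Q $ j $ i > 0" for i j
  proof (rule ccontr)
    assume j: "j \<notin> S"
    have "a i = 0" using zero[of i] that(1) by (auto simp: S_def)
    then have "(\<Sum>j\<in>-S. Q $ j $ i) = 0" using off[of i] by simp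
    moreover have "\<forall>j\<in>-S. 0 \<le> Q $ j $ i"
      using Q(1) that(1) unfolding is_generator_def by (metis ComplD)
    ultimately have "Q $ j $ i = 0"
      using j by (subst (asm) sum_nonneg_eq_0_iff) auto
    with that show False by simp
  qed
  have "(i0, i) \<in> {(i, j). i \<noteq> j \<and> Q $ j $ i > 0}\<^sup>*"
    using Q(2) by (auto simp: irreducible_generator_def)
  then have "i \<in> S"
    by (induction rule: rtrancl_induct) (use i0 closed in auto)
  then show ?thesis by (simp add: S_def)
qed

text \<open>Every \<open>p + c x\<close> is again stationary with total mass one, hence positive by
  the previous lemma; a nonzero entry of \<open>x\<close> contradicts this for
  \<open>c = - p $ i / x $ i\<close>.\<close>

lemma stationary_unique:
  fixes Q :: "real^'d::finite^'d"
  assumes Q: "is_generator Q" "irreducible_generator Q"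
    and p: "Q *v p = 0" "(\<Sum>i\<in>UNIV. p $ i) = 1"
    and x: "Q *v x = 0" "(\<Sum>i\<in>UNIV. x $ i) = 0"
  shows "x = 0"
proof -
  have pos: "p $ i + c * x $ i > 0" for i c
    using stationary_pos[OF Q, of "p + c *\<^sub>R x" i] p x
    by (simp add: matrix_vector_right_distrib matrix_vector_mult_scaleR sum.distrib sum_distrib_left[symmetric])
  have "x $ i = 0" for i
  proof (rule ccontr)
    assume "x $ i \<noteq> 0"
    then show False using pos[of i "- p $ i / x $ i"] by simp
  qed
  then show ?thesis by (simp add: vec_eq_iff)
qed

lemma Pi_mat_mult_vec: "Pi_mat p *v x = (\<Sum>i\<in>UNIV. x $ i) *\<^sub>R p"
  by (simp add: vec_eq_iff Pi_mat_def matrix_vector_mult_def sum_distrib_left sum_distrib_right mult.commute)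

lemma generator_sum_zero:
  assumes "is_generator Q" shows "(\<Sum>i\<in>UNIV. (Q *v x) $ i) = 0"
proof -
  have "(\<Sum>i\<in>UNIV. (Q *v x) $ i) = (\<Sum>j\<in>UNIV. (\<Sum>i\<in>UNIV. Q $ i $ j) * x $ j)"
    by (simp add: matrix_vector_mult_def sum_distrib_right) (rule sum.swap)
  then show ?thesis by (simp add: generator_colsum[OF assms])
qed

text \<open>For \<open>x\<close> in the kernel, \<open>Q *v x\<close> is a multiple of
  \<open>p\<close>. The columns of \<open>Q\<close> sum to zero, so the factor, which is the mass of
  \<open>x\<close>, vanishes; then \<open>x\<close> is a null vector of \<open>Q\<close> of mass
  zero.\<close>

lemma Pi_mat_minus_generator_invertible:
  fixes Q :: "real^'d::finite^'d"
  assumes Q: "is_generator Q" "irreducible_generator Q"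
    and p: "Q *v p = 0" "(\<Sum>i\<in>UNIV. p $ i) = 1"
  shows "invertible (Pi_mat p - Q)"
proof -
  have "x = 0" if x: "(Pi_mat p - Q) *v x = 0" for x
  proof -
    have eq: "(\<Sum>i\<in>UNIV. x $ i) *\<^sub>R p = Q *v x"
      using x by (simp add: matrix_vector_mult_diff_rdistrib Pi_mat_mult_vec)
    define c where "c = (\<Sum>i\<in>UNIV. x $ i)"
    have "(\<Sum>i\<in>UNIV. (c *\<^sub>R p) $ i) = 0"
      unfolding eq[folded c_def] by (rule generator_sum_zero[OF Q(1)])
    moreover have "(\<Sum>i\<in>UNIV. (c *\<^sub>R p) $ i) = c * (\<Sum>i\<in>UNIV. p $ i)"
      by (simp add: sum_distrib_left)
    ultimately have c0: "c = 0" using p(2) by simp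
    then have s: "(\<Sum>i\<in>UNIV. x $ i) = 0" by (simp add: c_def)
    have "Q *v x = 0" using eq[folded c_def] c0 by simp
    then show ?thesis using s by (rule stationary_unique[OF Q p])
  qed
  then show ?thesis
    by (simp add: invertible_left_inverse matrix_left_invertible_ker)
qed

text \<open>Let \<open>R\<close> be the inverse of \<open>\<Pi> - Q\<close>. Since
  \<open>(\<Pi> - Q) p = p\<close>, also \<open>R p = p\<close> and \<open>R \<Pi> = \<Pi>\<close>;
  since \<open>\<Pi> Q = 0\<close>, subtracting \<open>\<Pi>\<close> from \<open>R\<close> does not
  change the product with \<open>Q\<close>.\<close>

lemma deviation_poisson:
  fixes Q :: "real^'d::finite^'d"
  assumes Q: "is_generator Q" "irreducible_generator Q"
    and p: "Q *v p = 0" "(\<Sum>i\<in>UNIV. p $ i) = 1"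
  shows "deviation_matrix Q p ** Q = Pi_mat p - mat 1"
    and "deviation_matrix Q p *v p = 0"
proof -
  define R where "R = matrix_inv (Pi_mat p - Q)"
  have inv: "R ** (Pi_mat p - Q) = mat 1"
    using Pi_mat_minus_generator_invertible[OF assms] unfolding invertible_def R_def matrix_inv_def
    by (rule someI2_ex) simp
  have Pp: "(Pi_mat p - Q) *v p = p"
    using p by (simp add: matrix_vector_mult_diff_rdistrib Pi_mat_mult_vec)
  have Rp: "R *v p = p"
  proof -
    have "R *v p = R *v ((Pi_mat p - Q) *v p)" by (simp add: Pp)
    also have "\<dots> = p" by (simp add: matrix_vector_mul_assoc inv)
    finally show ?thesis .
  qed
  show "deviation_matrix Q p *v p = 0"
    using Rp p by (simp add: deviation_matrix_def R_def[symmetric] matrix_vector_mult_diff_rdistrib Pi_mat_mult_vec)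
  show "deviation_matrix Q p ** Q = Pi_mat p - mat 1"
  proof (rule matrix_eq[THEN iffD2], rule allI)
    fix x
    have "R *v (Q *v x) = R *v (Pi_mat p *v x) - R *v ((Pi_mat p - Q) *v x)"
      by (simp add: matrix_vector_mult_diff_rdistrib matrix_vector_mult_diff_distrib)
    also have "\<dots> = Pi_mat p *v x - x"
      by (simp add: matrix_vector_mul_assoc[of R "Pi_mat p - Q"] inv Pi_mat_mult_vec matrix_vector_mult_scaleR Rp)
    finally show "(deviation_matrix Q p ** Q) *v x = (Pi_mat p - mat 1) *v x"
      by (simp add: deviation_matrix_def R_def[symmetric] matrix_vector_mul_assoc[symmetric]
          matrix_vector_mult_diff_rdistrib Pi_mat_mult_vec[of p "Q *v x"] generator_sum_zero[OF Q(1)])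
  qed
qed

text \<open>The transposed deviation matrix, since functions of the state pair with probability
  column vectors: for an irreducible chain, \<open>dev_fun Q p v i\<close> is the integral over time
  of the mean of \<open>v\<close> at time \<open>s\<close>, started in \<open>i\<close>, minus the
  stationary mean of \<open>v\<close>.\<close>

definition dev_fun :: "real^'d^'d \<Rightarrow> real^'d::finite \<Rightarrow> ('d \<Rightarrow> real) \<Rightarrow> 'd \<Rightarrow> real" where
  "dev_fun Q p v i = (\<Sum>j\<in>UNIV. deviation_matrix Q p $ j $ i * v j)"

lemma dev_fun_poisson:
  fixes Q :: "real^'d::finite^'d"
  assumes Q: "is_generator Q" "irreducible_generator Q"
    and p: "Q *v p = 0" "(\<Sum>i\<in>UNIV. p $ i) = 1"
  shows "(\<Sum>j\<in>UNIV. Q $ j $ i * dev_fun Q p v j) = (\<Sum>j\<in>UNIV. p $ j * v j) - v i"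
proof -
  have "(\<Sum>j\<in>UNIV. Q $ j $ i * dev_fun Q p v j)
    = (\<Sum>k\<in>UNIV. (\<Sum>j\<in>UNIV. deviation_matrix Q p $ k $ j * Q $ j $ i) * v k)"
    by (simp only: dev_fun_def sum_distrib_left sum_distrib_right mult_ac) (rule sum.swap)
  also have "\<dots> = (\<Sum>k\<in>UNIV. (deviation_matrix Q p ** Q) $ k $ i * v k)"
    by (simp add: matrix_matrix_mult_def)
  also have "\<dots> = (\<Sum>k\<in>UNIV. p $ k * v k) - v i"
    unfolding deviation_poisson(1)[OF assms]
    by (simp add: Pi_mat_def mat_def left_diff_distrib sum_subtractf mult_delta_left)
  finally show ?thesis .
qed

lemma dev_fun_mean:
  fixes Q :: "real^'d::finite^'d"
  assumes "is_generator Q" "irreducible_generator Q"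
    and "Q *v p = 0" "(\<Sum>i\<in>UNIV. p $ i) = 1"
  shows "(\<Sum>i\<in>UNIV. p $ i * dev_fun Q p v i) = 0"
proof -
  have "(\<Sum>i\<in>UNIV. p $ i * dev_fun Q p v i) = (\<Sum>j\<in>UNIV. (deviation_matrix Q p *v p) $ j * v j)"
    by (simp only: dev_fun_def sum_distrib_left matrix_vector_mult_def sum_distrib_right vec_lambda_beta mult_ac)
      (rule sum.swap)
  also have "\<dots> = 0" unfolding deviation_poisson(2)[OF assms] by simp
  finally show ?thesis .
qed

text \<open>The two matrices in \<open>asympt_var\<close> are transposes of each other, so their
  quadratic forms agree.\<close>

lemma asympt_var_eq:
  fixes Q :: "real^'d::finite^'d"
  shows "asympt_var Q p lam = 2 * (\<Sum>i\<in>UNIV. p $ i * lam $ i * dev_fun Q p (\<lambda>j. lam $ j) i)"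
proof -
  have 1: "(diag_mat p ** A) $ i $ j = p $ i * A $ i $ j" for A :: "real^'d^'d" and i j
    by (simp add: diag_mat_def matrix_matrix_mult_def mult_delta_left)
  have 2: "(A ** diag_mat p) $ i $ j = A $ i $ j * p $ j" for A :: "real^'d^'d" and i j
    by (simp add: diag_mat_def matrix_matrix_mult_def mult_delta_right)
  let ?D = "deviation_matrix Q p"
  let ?S = "\<Sum>i\<in>UNIV. \<Sum>j\<in>UNIV. lam $ i * (p $ i * ?D $ j $ i * lam $ j)"
  have e: "(diag_mat p ** transpose ?D + ?D ** diag_mat p) $ i $ j = p $ i * ?D $ j $ i + ?D $ i $ j * p $ j" for i j
    by (simp add: 1 2 transpose_def)
  have "asympt_var Q p lam = (\<Sum>i\<in>UNIV. \<Sum>j\<in>UNIV. lam $ i * ((p $ i * ?D $ j $ i + ?D $ i $ j * p $ j) * lam $ j))"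
    unfolding asympt_var_def inner_vec_def matrix_vector_mult_def e sum_distrib_left by (simp add: sum_distrib_left)
  also have "\<dots> = ?S + (\<Sum>i\<in>UNIV. \<Sum>j\<in>UNIV. lam $ i * (?D $ i $ j * p $ j * lam $ j))"
    by (simp only: distrib_left distrib_right sum.distrib)
  also have "(\<Sum>i\<in>UNIV. \<Sum>j\<in>UNIV. lam $ i * (?D $ i $ j * p $ j * lam $ j)) = ?S"
    by (subst sum.swap) (simp only: mult_ac)
  also have "?S = (\<Sum>i\<in>UNIV. p $ i * lam $ i * dev_fun Q p (\<lambda>j. lam $ j) i)"
    by (simp only: dev_fun_def sum_distrib_left mult_ac)
  finally show ?thesis by simp
qed

section \<open>Transition probabilities on a time grid\<close>

lemma matpow_entry_bound:
  fixes A :: "real^'n::finite^'n"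
  defines "a \<equiv> \<Sum>i\<in>UNIV. \<Sum>j\<in>UNIV. \<bar>A $ i $ j\<bar>"
  shows "\<bar>matpow A k $ i $ j\<bar> \<le> a ^ k"
proof (induction k arbitrary: i j)
  case 0
  then show ?case by (simp add: mat_def)
next
  case (Suc k)
  have "\<bar>matpow A (Suc k) $ i $ j\<bar> \<le> (\<Sum>l\<in>UNIV. \<bar>A $ i $ l\<bar> * \<bar>matpow A k $ l $ j\<bar>)"
    by (simp add: matrix_matrix_mult_def abs_mult[symmetric] sum_abs)
  also have "\<dots> \<le> (\<Sum>l\<in>UNIV. \<bar>A $ i $ l\<bar> * a ^ k)"
    by (intro sum_mono mult_left_mono Suc) auto
  also have "\<dots> = (\<Sum>l\<in>UNIV. \<bar>A $ i $ l\<bar>) * a ^ k" by (simp add: sum_distrib_right)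
  also have "\<dots> \<le> a * a ^ k"
    unfolding a_def by (intro mult_right_mono member_le_sum) (auto intro!: sum_nonneg zero_le_power)
  finally show ?case by simp
qed

text \<open>Powers of \<open>A\<close> are dominated entrywise by powers of \<open>a\<close>, so the
  remainder is at most \<open>exp a - 1 - a\<close>, which is at most \<open>a\<^sup>2\<close> on
  the unit interval.\<close>

lemma mexp_taylor:
  fixes A :: "real^'n::finite^'n"
  defines "a \<equiv> \<Sum>i\<in>UNIV. \<Sum>j\<in>UNIV. \<bar>A $ i $ j\<bar>"
  assumes a1: "a \<le> 1"
  shows "\<bar>mexp A $ i $ j - ((mat 1 :: real^'n^'n) $ i $ j + A $ i $ j)\<bar> \<le> a\<^sup>2"
proof -
  define T where "T k = (1 / fact k :: real) *\<^sub>R matpow A k" for k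
  define C where "C = real (CARD('n)) * real (CARD('n))"
  have a0: "a \<ge> 0" unfolding a_def by (intro sum_nonneg) auto
  have ent: "\<bar>T k $ i $ j\<bar> \<le> a ^ k / fact k" for k i j
    using matpow_entry_bound[of A k i j] by (simp add: T_def a_def divide_right_mono)
  \<comment> \<open>The norm bound serves summability in the space of matrices, after which entries
    may be taken inside \<open>suminf\<close>.\<close>
  have nrm: "norm (T k) \<le> C * (a ^ k / fact k)" for k
  proof -
    have "norm (T k) \<le> (\<Sum>i\<in>UNIV. norm (T k $ i))"
      unfolding norm_vec_def by (rule L2_set_le_sum) auto
    also have "\<dots> \<le> (\<Sum>i\<in>(UNIV::'n set). \<Sum>j\<in>(UNIV::'n set). \<bar>T k $ i $ j\<bar>)"
      by (intro sum_mono norm_le_l1_cart)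
    also have "\<dots> \<le> (\<Sum>i\<in>(UNIV::'n set). \<Sum>j\<in>(UNIV::'n set). a ^ k / fact k)"
      by (intro sum_mono ent)
    finally show ?thesis by (simp add: C_def)
  qed
  have se: "summable (\<lambda>k. a ^ k / fact k)"
    using summable_exp[of a] by (simp add: field_simps)
  have sT: "summable T"
    by (rule summable_comparison_test'[OF summable_mult[OF se]]) (rule nrm)
  have "(\<lambda>k. T k $ i) sums (suminf T $ i)"
    by (rule bounded_linear.sums[OF bounded_linear_vec_nth summable_sums[OF sT]])
  then have "(\<lambda>k. T k $ i $ j) sums (suminf T $ i $ j)"
    by (rule bounded_linear.sums[OF bounded_linear_vec_nth])
  then have "(\<lambda>k. T (k + 2) $ i $ j) sums (suminf T $ i $ j - (\<Sum>k<2. T k $ i $ j))"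
    by (rule sums_split_initial_segment)
  moreover have "(\<Sum>k<2. T k $ i $ j) = (mat 1 :: real^'n^'n) $ i $ j + A $ i $ j"
    by (simp add: T_def numeral_2_eq_2)
  ultimately have t: "(\<lambda>k. T (k + 2) $ i $ j) sums (mexp A $ i $ j - ((mat 1 :: real^'n^'n) $ i $ j + A $ i $ j))"
    unfolding mexp_def T_def[abs_def, symmetric] by simp
  have "(\<lambda>k. a ^ k / fact k) sums exp a"
    using exp_converges[of a] by (simp add: field_simps)
  then have "(\<lambda>k. a ^ (k + 2) / fact (k + 2)) sums (exp a - (\<Sum>k<2. a ^ k / fact k))"
    by (rule sums_split_initial_segment)
  then have e: "(\<lambda>k. a ^ (k + 2) / fact (k + 2)) sums (exp a - (1 + a))"
    by (simp add: numeral_2_eq_2)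
  have "\<bar>mexp A $ i $ j - ((mat 1 :: real^'n^'n) $ i $ j + A $ i $ j)\<bar> \<le> exp a - (1 + a)"
    by (rule norm_sums_le[OF t e, unfolded real_norm_def]) (rule ent)
  also have "\<dots> \<le> a\<^sup>2" using exp_bound[OF a0 a1] by simp
  finally show ?thesis .
qed

text \<open>Measurability is asked of the fibres, so that \<open>X\<close> may take values in a type
  without a sigma-algebra, such as lists of states.\<close>

lemma (in prob_space) integral_finite_valued:
  fixes H :: "'c \<Rightarrow> 'e::{banach, second_countable_topology}"
  assumes "finite A" "\<And>\<omega>. \<omega> \<in> space M \<Longrightarrow> X \<omega> \<in> A"
    and "\<And>a. a \<in> A \<Longrightarrow> {\<omega>\<in>space M. X \<omega> = a} \<in> sets M"
  shows "integrable M (\<lambda>\<omega>. H (X \<omega>))"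
    and "(\<integral>\<omega>. H (X \<omega>) \<partial>M) = (\<Sum>a\<in>A. prob {\<omega>\<in>space M. X \<omega> = a} *\<^sub>R H a)"
proof -
  have eq: "H (X \<omega>) = (\<Sum>a\<in>A. indicat_real {\<omega>\<in>space M. X \<omega> = a} \<omega> *\<^sub>R H a)" if "\<omega> \<in> space M" for \<omega>
  proof -
    have "(\<Sum>a\<in>A. indicat_real {\<omega>\<in>space M. X \<omega> = a} \<omega> *\<^sub>R H a) = (\<Sum>a\<in>A. if X \<omega> = a then H a else 0)"
      using that by (intro sum.cong) (auto simp: indicator_def)
    then show ?thesis using assms(1) assms(2)[OF that] by simp
  qed
  have int: "integrable M (\<lambda>\<omega>. indicat_real {\<omega>\<in>space M. X \<omega> = a} \<omega> *\<^sub>R H a)" if "a \<in> A" for a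
    using assms(3)[OF that] by (intro integrable_scaleR_left integrable_real_indicator) (auto simp: less_top[symmetric])
  show "integrable M (\<lambda>\<omega>. H (X \<omega>))"
    by (subst Bochner_Integration.integrable_cong[OF refl eq]) (auto intro!: Bochner_Integration.integrable_sum int)
  have "(\<integral>\<omega>. H (X \<omega>) \<partial>M) = (\<integral>\<omega>. (\<Sum>a\<in>A. indicat_real {\<omega>\<in>space M. X \<omega> = a} \<omega> *\<^sub>R H a) \<partial>M)"
    by (intro Bochner_Integration.integral_cong eq refl)
  also have "\<dots> = (\<Sum>a\<in>A. \<integral>\<omega>. indicat_real {\<omega>\<in>space M. X \<omega> = a} \<omega> *\<^sub>R H a \<partial>M)"
    by (intro Bochner_Integration.integral_sum int)
  also have "\<dots> = (\<Sum>a\<in>A. prob {\<omega>\<in>space M. X \<omega> = a} *\<^sub>R H a)"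
  proof (intro sum.cong refl)
    fix a assume "a \<in> A"
    note [measurable] = assms(3)[OF this]
    show "(\<integral>\<omega>. indicat_real {\<omega>\<in>space M. X \<omega> = a} \<omega> *\<^sub>R H a \<partial>M) = prob {\<omega>\<in>space M. X \<omega> = a} *\<^sub>R H a"
      by (subst integral_scaleR_left) (auto simp: Int_absorb1 subset_eq less_top[symmetric])
  qed
  finally show "(\<integral>\<omega>. H (X \<omega>) \<partial>M) = (\<Sum>a\<in>A. prob {\<omega>\<in>space M. X \<omega> = a} *\<^sub>R H a)" .
qed

text \<open>Encodes measurability with respect to the chain at the grid times up to
  \<open>J\<close>. With finitely many states, functional dependence on these values already makes
  \<open>\<Phi>\<close> a simple random variable, so no filtration has to be carried along.\<close>

definition grid_fun :: "'a measure \<Rightarrow> (real \<Rightarrow> 'a \<Rightarrow> 'd) \<Rightarrow> real \<Rightarrow> nat \<Rightarrow> ('a \<Rightarrow> 'c) \<Rightarrow> bool" where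
  "grid_fun M Z \<delta> J \<Phi> \<longleftrightarrow> (\<forall>\<omega>\<in>space M. \<forall>\<omega>'\<in>space M.
     (\<forall>l\<le>J. Z (real l * \<delta>) \<omega> = Z (real l * \<delta>) \<omega>') \<longrightarrow> \<Phi> \<omega> = \<Phi> \<omega>')"

lemma grid_fun_integral:
  fixes Z :: "real \<Rightarrow> 'a \<Rightarrow> 'd::finite" and \<Phi> :: "'a \<Rightarrow> 'e::{banach, second_countable_topology}"
  assumes Z: "ctmc M Q Z" and \<delta>: "\<delta> > 0" and \<Phi>: "grid_fun M Z \<delta> J \<Phi>"
  defines "L \<equiv> \<lambda>\<omega>. map (\<lambda>l. Z (real l * \<delta>) \<omega>) [0..<Suc J]"
  obtains F where "\<And>\<omega>. \<omega> \<in> space M \<Longrightarrow> \<Phi> \<omega> = F (L \<omega>)" "integrable M \<Phi>"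
    "(\<integral>\<omega>. \<Phi> \<omega> \<partial>M) = (\<Sum>ss | length ss = Suc J. measure M {\<omega>\<in>space M. L \<omega> = ss} *\<^sub>R F ss)"
proof -
  interpret prob_space M using Z by (simp add: ctmc_def)
  have meas: "Z t \<in> measurable M (count_space UNIV)" if "t \<ge> 0" for t
    using Z that by (simp add: ctmc_def)
  have ev: "{\<omega>\<in>space M. L \<omega> = ss} = (if length ss = Suc J then {\<omega>\<in>space M. \<forall>l\<le>J. Z (real l * \<delta>) \<omega> = ss ! l} else {})" for ss
    by (auto simp: L_def list_eq_iff_nth_eq simp del: upt_Suc)
  have sets: "{\<omega>\<in>space M. L \<omega> = ss} \<in> sets M" for ss
  proof -
    have [measurable]: "Z (real l * \<delta>) \<in> measurable M (count_space UNIV)" for l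
      using \<delta> by (intro meas) simp
    show ?thesis unfolding ev by (cases "length ss = Suc J") simp_all
  qed
  \<comment> \<open>Any outcome with these grid values will do, by \<open>grid_fun\<close>.\<close>
  define F where "F ss = \<Phi> (SOME \<omega>. \<omega> \<in> space M \<and> L \<omega> = ss)" for ss
  have F: "\<Phi> \<omega> = F (L \<omega>)" if "\<omega> \<in> space M" for \<omega>
  proof -
    define \<omega>' where "\<omega>' = (SOME \<omega>'. \<omega>' \<in> space M \<and> L \<omega>' = L \<omega>)"
    have "\<omega>' \<in> space M \<and> L \<omega>' = L \<omega>" unfolding \<omega>'_def by (rule someI[of _ \<omega>]) (use that in simp)
    then have \<omega>': "\<omega>' \<in> space M" and eq: "L \<omega>' = L \<omega>" by auto
    have "Z (real l * \<delta>) \<omega> = Z (real l * \<delta>) \<omega>'" if "l \<le> J" for l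
      using that arg_cong[OF eq, of "\<lambda>xs. xs ! l"] by (simp add: L_def nth_map del: upt_Suc)
    then have "\<Phi> \<omega> = \<Phi> \<omega>'"
      using \<Phi> that \<omega>' unfolding grid_fun_def by blast
    then show ?thesis unfolding F_def \<omega>'_def .
  qed
  have fin: "finite {ss :: 'd list. length ss = Suc J}"
    using finite_lists_length_eq[of "UNIV::'d set" "Suc J"] by simp
  have i: "integrable M (\<lambda>\<omega>. F (L \<omega>))" "(\<integral>\<omega>. F (L \<omega>) \<partial>M) = (\<Sum>ss | length ss = Suc J. measure M {\<omega>\<in>space M. L \<omega> = ss} *\<^sub>R F ss)"
    by (rule integral_finite_valued[OF fin _ sets]; simp add: L_def)+
  show ?thesis
  proof (rule that[of F])
    show "integrable M \<Phi>" using i(1) by (subst Bochner_Integration.integrable_cong[OF refl F])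
    show "(\<integral>\<omega>. \<Phi> \<omega> \<partial>M) = (\<Sum>ss | length ss = Suc J. measure M {\<omega>\<in>space M. L \<omega> = ss} *\<^sub>R F ss)"
      using i(2) by (subst Bochner_Integration.integral_cong[OF refl F])
  qed (rule F)
qed

text \<open>The formula in \<open>ctmc\<close> is a product over all steps, so the lists
  \<open>ss\<close> and \<open>ss @ [x]\<close> differ by one factor. In this multiplicative form of
  the Markov property, lists of probability zero need no separate treatment.\<close>

lemma ctmc_grid_step_prob:
  fixes Z :: "real \<Rightarrow> 'a \<Rightarrow> 'd::finite"
  assumes Z: "ctmc M Q Z" and \<delta>: "\<delta> > 0" and ss: "length ss = Suc J"
  defines "L \<equiv> \<lambda>J \<omega>. map (\<lambda>l. Z (real l * \<delta>) \<omega>) [0..<Suc J]"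
  shows "measure M {\<omega>\<in>space M. L (Suc J) \<omega> = ss @ [x]}
     = measure M {\<omega>\<in>space M. L J \<omega> = ss} * mexp (\<delta> *\<^sub>R Q) $ x $ last ss"
proof -
  define ts where "ts J = map (\<lambda>l. real l * \<delta>) [0..<Suc J]" for J
  have srt: "sorted_wrt (<) (ts J)" for J
    using \<delta> by (auto simp: ts_def sorted_wrt_iff_nth_less simp del: upt_Suc)
  have fdd: "measure M {\<omega>\<in>space M. \<forall>m<length ts. Z (ts ! m) \<omega> = ss ! m}
        = measure M {\<omega>\<in>space M. Z (ts ! 0) \<omega> = ss ! 0} *
          (\<Prod>m<length ts - 1. mexp ((ts ! Suc m - ts ! m) *\<^sub>R Q) $ (ss ! Suc m) $ (ss ! m))"
    if "sorted_wrt (<) ts \<and> ts \<noteq> [] \<and> hd ts \<ge> 0 \<and> length ss = length ts" for ts ss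
    by (rule Z[unfolded ctmc_def, THEN conjunct2, THEN conjunct2, THEN conjunct2, THEN spec, THEN spec, THEN mp, OF that])
  have key: "measure M {\<omega>\<in>space M. L J \<omega> = ss} = measure M {\<omega>\<in>space M. Z 0 \<omega> = ss ! 0} *
       (\<Prod>m<J. mexp (\<delta> *\<^sub>R Q) $ (ss ! Suc m) $ (ss ! m))" if len: "length ss = Suc J" for J ss
  proof -
    have "{\<omega>\<in>space M. L J \<omega> = ss} = {\<omega>\<in>space M. \<forall>m<length (ts J). Z (ts J ! m) \<omega> = ss ! m}"
      using len by (auto simp: L_def ts_def list_eq_iff_nth_eq simp del: upt_Suc)
    also have "measure M \<dots> = measure M {\<omega>\<in>space M. Z (ts J ! 0) \<omega> = ss ! 0} *
          (\<Prod>m<length (ts J) - 1. mexp ((ts J ! Suc m - ts J ! m) *\<^sub>R Q) $ (ss ! Suc m) $ (ss ! m))"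
    proof -
      have "ts J \<noteq> []" "hd (ts J) \<ge> 0" "length ss = length (ts J)"
        using len by (simp_all add: ts_def hd_map del: upt_Suc)
      then show ?thesis using srt[of J] by (intro fdd conjI)
    qed
    also have "(\<Prod>m<length (ts J) - 1. mexp ((ts J ! Suc m - ts J ! m) *\<^sub>R Q) $ (ss ! Suc m) $ (ss ! m))
       = (\<Prod>m<J. mexp (\<delta> *\<^sub>R Q) $ (ss ! Suc m) $ (ss ! m))"
      by (intro prod.cong) (auto simp: ts_def nth_append algebra_simps simp del: upt_Suc)
    finally show ?thesis by (simp add: ts_def nth_append del: upt_Suc)
  qed
  have "(\<Prod>m<J. mexp (\<delta> *\<^sub>R Q) $ ((ss @ [x]) ! Suc m) $ ((ss @ [x]) ! m))
      = (\<Prod>m<J. mexp (\<delta> *\<^sub>R Q) $ (ss ! Suc m) $ (ss ! m))"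
    using ss by (intro prod.cong) (auto simp: nth_append)
  moreover have "last ss = ss ! J" using ss by (subst last_conv_nth) auto
  ultimately show ?thesis
    using ss by (subst (1 2) key) (auto simp: nth_append)
qed

text \<open>The Markov property without conditional expectations: the newest grid value is
  integrated out against one transition, under any weight that depends on the past. The sum over
  lists is split into prefix and last state.\<close>

lemma ctmc_grid_markov:
  fixes Z :: "real \<Rightarrow> 'a \<Rightarrow> 'd::finite" and \<Phi> :: "'a \<Rightarrow> complex"
  assumes Z: "ctmc M Q Z" and \<delta>: "\<delta> > 0" and \<Phi>: "grid_fun M Z \<delta> J \<Phi>"
  shows "(\<integral>\<omega>. \<Phi> \<omega> * v (Z (real (Suc J) * \<delta>) \<omega>) \<partial>M)
    = (\<integral>\<omega>. \<Phi> \<omega> * (\<Sum>x\<in>UNIV. of_real (mexp (\<delta> *\<^sub>R Q) $ x $ Z (real J * \<delta>) \<omega>) * v x) \<partial>M)"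
proof -
  interpret prob_space M using Z by (simp add: ctmc_def)
  define L where "L J \<omega> = map (\<lambda>l. Z (real l * \<delta>) \<omega>) [0..<Suc J]" for J \<omega>
  obtain F where F: "\<And>\<omega>. \<omega> \<in> space M \<Longrightarrow> \<Phi> \<omega> = F (L J \<omega>)"
    using grid_fun_integral[OF Z \<delta> \<Phi>] unfolding L_def by metis
  have meas: "Z t \<in> measurable M (count_space UNIV)" if "t \<ge> 0" for t
    using Z that by (simp add: ctmc_def)
  have ev: "{\<omega>\<in>space M. L J \<omega> = ss} = (if length ss = Suc J then {\<omega>\<in>space M. \<forall>l\<le>J. Z (real l * \<delta>) \<omega> = ss ! l} else {})" for ss J
    by (auto simp: L_def list_eq_iff_nth_eq simp del: upt_Suc)
  have sets: "{\<omega>\<in>space M. L J \<omega> = ss} \<in> sets M" for ss J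
  proof -
    have [measurable]: "Z (real l * \<delta>) \<in> measurable M (count_space UNIV)" for l
      using \<delta> by (intro meas) simp
    show ?thesis unfolding ev by (cases "length ss = Suc J") simp_all
  qed
  have fin: "finite {ss :: 'd list. length ss = K}" for K
    using finite_lists_length_eq[of "UNIV::'d set" K] by simp
  have len: "length (L J \<omega>) = Suc J" for J \<omega> by (simp add: L_def)
  have last: "last (L J \<omega>) = Z (real J * \<delta>) \<omega>" and but: "butlast (L (Suc J) \<omega>) = L J \<omega>" for J \<omega>
    by (simp_all add: L_def butlast_append)
  let ?p = "\<lambda>J ss. prob {\<omega>\<in>space M. L J \<omega> = ss}"
  let ?m = "\<lambda>x y. mexp (\<delta> *\<^sub>R Q) $ x $ y"
  have img: "{ss :: 'd list. length ss = Suc (Suc J)} = (\<lambda>(ss, x). ss @ [x]) ` ({ss. length ss = Suc J} \<times> UNIV)"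
  proof (intro set_eqI iffI)
    fix ss :: "'d list" assume "ss \<in> {ss. length ss = Suc (Suc J)}"
    then have "ss = butlast ss @ [last ss]" "length (butlast ss) = Suc J" by (auto simp flip: length_0_conv)
    then show "ss \<in> (\<lambda>(ss, x). ss @ [x]) ` ({ss. length ss = Suc J} \<times> UNIV)"
      by (intro image_eqI[of _ _ "(butlast ss, last ss)"]) auto
  qed auto
  have inj: "inj_on (\<lambda>(ss, x). ss @ [x]) ({ss :: 'd list. length ss = Suc J} \<times> UNIV)"
    by (auto simp: inj_on_def)
  have "(\<integral>\<omega>. \<Phi> \<omega> * v (Z (real (Suc J) * \<delta>) \<omega>) \<partial>M)
     = (\<integral>\<omega>. (\<lambda>ss. F (butlast ss) * v (last ss)) (L (Suc J) \<omega>) \<partial>M)"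
    by (intro Bochner_Integration.integral_cong refl) (simp only: F last but)
  also have "\<dots> = (\<Sum>ss | length ss = Suc (Suc J). ?p (Suc J) ss *\<^sub>R (F (butlast ss) * v (last ss)))"
    using integral_finite_valued(2)[OF fin _ sets, of "Suc J" "Suc (Suc J)" "\<lambda>ss. F (butlast ss) * v (last ss)"]
    by (simp add: len)
  also have "\<dots> = (\<Sum>(ss, x)\<in>{ss. length ss = Suc J} \<times> UNIV. ?p (Suc J) (ss @ [x]) *\<^sub>R (F ss * v x))"
    unfolding img by (subst sum.reindex[OF inj]) (simp add: case_prod_beta)
  also have "\<dots> = (\<Sum>ss | length ss = Suc J. \<Sum>x\<in>UNIV. ?p (Suc J) (ss @ [x]) *\<^sub>R (F ss * v x))"
    by (rule sum.cartesian_product[symmetric])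
  also have "\<dots> = (\<Sum>ss | length ss = Suc J. ?p J ss *\<^sub>R (F ss * (\<Sum>x\<in>UNIV. of_real (?m x (last ss)) * v x)))"
    using ctmc_grid_step_prob[OF Z \<delta>, folded L_def]
    by (intro sum.cong refl) (simp add: sum_distrib_left scaleR_conv_of_real mult_ac)
  also have "\<dots> = (\<integral>\<omega>. (\<lambda>ss. F ss * (\<Sum>x\<in>UNIV. of_real (?m x (last ss)) * v x)) (L J \<omega>) \<partial>M)"
    using integral_finite_valued(2)[OF fin _ sets, of J "Suc J" "\<lambda>ss. F ss * (\<Sum>x\<in>UNIV. of_real (?m x (last ss)) * v x)"]
    by (simp add: len)
  also have "\<dots> = (\<integral>\<omega>. \<Phi> \<omega> * (\<Sum>x\<in>UNIV. of_real (?m x (Z (real J * \<delta>) \<omega>)) * v x) \<partial>M)"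
    by (intro Bochner_Integration.integral_cong refl) (simp only: F last)
  finally show ?thesis .
qed

section \<open>Perturbed test functions\<close>

lemma riemann_step_has_integral:
  fixes x :: "real \<Rightarrow> real"
  assumes h: "h > 0"
  shows "((\<lambda>s. x (a + (of_int \<lfloor>(s - a) / h\<rfloor> + 1) * h)) has_integral (\<Sum>l<m. h * x (a + real (Suc l) * h))) {a..a + real m * h}"
proof (induction m)
  case 0
  show ?case by (simp add: has_integral_refl)
next
  case (Suc m)
  let ?f = "\<lambda>s. x (a + (of_int \<lfloor>(s - a) / h\<rfloor> + 1) * h)"
  have "((\<lambda>s. x (a + real (Suc m) * h)) has_integral (h * x (a + real (Suc m) * h))) (cbox (a + real m * h) (a + real (Suc m) * h))"
    using has_integral_const_real[of "x (a + real (Suc m) * h)" "a + real m * h" "a + real (Suc m) * h"] h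
    by (simp add: algebra_simps)
  then have "(?f has_integral (h * x (a + real (Suc m) * h))) (cbox (a + real m * h) (a + real (Suc m) * h))"
  proof (rule has_integral_spike_interior)
    fix s assume "s \<in> box (a + real m * h) (a + real (Suc m) * h)"
    then have "real m * h < s - a" "s - a < real (Suc m) * h" by auto
    then have "real m < (s - a) / h" "(s - a) / h < real (Suc m)" using h by (simp_all add: field_simps)
    then have "\<lfloor>(s - a) / h\<rfloor> = int m" by (intro floor_unique) auto
    then show "?f s = x (a + real (Suc m) * h)" by (simp add: add.commute)
  qed
  then have "(?f has_integral ((\<Sum>l<m. h * x (a + real (Suc l) * h)) + h * x (a + real (Suc m) * h))) {a..a + real (Suc m) * h}"
    using h by (intro has_integral_combine[OF _ _ Suc]) (auto simp: algebra_simps)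
  then show ?case by simp
qed

text \<open>The next grid point approaches \<open>s\<close> from the right, so right continuity
  gives pointwise convergence of the step functions; dominated convergence then yields integrability
  and the limit together.\<close>

lemma riemann_sums_right:
  fixes x :: "real \<Rightarrow> real"
  assumes ab: "a < b" and rc: "\<And>s. a \<le> s \<Longrightarrow> s < b \<Longrightarrow> (x \<longlongrightarrow> x s) (at_right s)"
    and bd: "\<And>s. a \<le> s \<Longrightarrow> s \<le> b \<Longrightarrow> \<bar>x s\<bar> \<le> B"
  shows "x integrable_on {a..b}"
    and "(\<lambda>r. \<Sum>l<r. (b - a) / real r * x (a + real (Suc l) * ((b - a) / real r))) \<longlonglongrightarrow> integral {a..b} x"
proof -
  define h where "h r = (b - a) / real (Suc r)" for r
  have h: "h r > 0" for r using ab by (simp add: h_def)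
  \<comment> \<open>At \<open>s = b\<close> the next grid point would lie beyond \<open>b\<close>,
    where nothing is known about \<open>x\<close>.\<close>
  define f where "f r s = (if s = b then x b else x (a + (of_int \<lfloor>(s - a) / h r\<rfloor> + 1) * h r))" for r s
  have bh: "a + real (Suc r) * h r = b" for r by (simp add: h_def)
  have fi: "(f r has_integral (\<Sum>l<Suc r. h r * x (a + real (Suc l) * h r))) {a..b}" for r
    using riemann_step_has_integral[OF h, of x a r "Suc r"] unfolding bh
    by (rule has_integral_spike_finite[rotated 2, of _ _ _ "{b}"]) (auto simp: f_def)
  have next_pt: "s < a + (of_int \<lfloor>(s - a) / h r\<rfloor> + 1) * h r"
       "a + (of_int \<lfloor>(s - a) / h r\<rfloor> + 1) * h r \<le> s + h r"
       "a + (of_int \<lfloor>(s - a) / h r\<rfloor> + 1) * h r \<le> b" if "a \<le> s" "s < b" for s r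
  proof -
    have "(s - a) / h r < of_int \<lfloor>(s - a) / h r\<rfloor> + 1" by linarith
    then show "s < a + (of_int \<lfloor>(s - a) / h r\<rfloor> + 1) * h r"
      unfolding pos_divide_less_eq[OF h] by linarith
    have "of_int \<lfloor>(s - a) / h r\<rfloor> \<le> (s - a) / h r" by linarith
    then have "of_int \<lfloor>(s - a) / h r\<rfloor> * h r \<le> s - a"
      unfolding pos_le_divide_eq[OF h] .
    then show "a + (of_int \<lfloor>(s - a) / h r\<rfloor> + 1) * h r \<le> s + h r"
      unfolding distrib_right by linarith
    have "(s - a) / h r < (b - a) / h r" using that h[of r] by (simp add: divide_strict_right_mono)
    also have "\<dots> = of_int (int (Suc r))" using ab by (simp add: h_def)
    finally have "\<lfloor>(s - a) / h r\<rfloor> < int (Suc r)" by (simp add: floor_less_iff)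
    then have "of_int \<lfloor>(s - a) / h r\<rfloor> + 1 \<le> real (Suc r)" by linarith
    then have "(of_int \<lfloor>(s - a) / h r\<rfloor> + 1) * h r \<le> real (Suc r) * h r" using h[of r] by (intro mult_right_mono) auto
    then show "a + (of_int \<lfloor>(s - a) / h r\<rfloor> + 1) * h r \<le> b" using bh[of r] by linarith
  qed
  have h0: "h \<longlonglongrightarrow> 0"
    unfolding h_def by (rule LIMSEQ_Suc[OF lim_const_over_n])
  have conv: "(\<lambda>r. f r s) \<longlonglongrightarrow> x s" if s: "s \<in> {a..b}" for s
  proof (cases "s = b")
    case False
    then have s': "a \<le> s" "s < b" using s by auto
    let ?y = "\<lambda>r. a + (of_int \<lfloor>(s - a) / h r\<rfloor> + 1) * h r"
    have "?y \<longlonglongrightarrow> s"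
    proof (rule tendsto_sandwich)
      show "\<forall>\<^sub>F r in sequentially. s \<le> ?y r" using next_pt(1)[OF s'] by (simp add: less_imp_le)
      show "\<forall>\<^sub>F r in sequentially. ?y r \<le> s + h r" using next_pt(2)[OF s'] by simp
      show "(\<lambda>r. s + h r) \<longlonglongrightarrow> s" using tendsto_add[OF tendsto_const h0, of s] by simp
    qed simp
    then have "filterlim ?y (at_right s) sequentially"
      unfolding filterlim_at using next_pt(1)[OF s']
      by (auto intro!: always_eventually simp: less_imp_neq[THEN not_sym])
    then have "(\<lambda>r. x (?y r)) \<longlonglongrightarrow> x s"
      by (rule filterlim_compose[OF rc[OF s']])
    then show ?thesis using False by (simp add: f_def)
  qed (simp add: f_def)
  have le: "norm (f r s) \<le> B" if "s \<in> {a..b}" for r s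
  proof (cases "s = b")
    case True then show ?thesis using bd[of b] ab by (simp add: f_def)
  next
    case False
    then have s': "a \<le> s" "s < b" using that by auto
    show ?thesis using False next_pt[OF s', of r] s' bd[of "a + (of_int \<lfloor>(s - a) / h r\<rfloor> + 1) * h r"]
      by (simp add: f_def)
  qed
  have D: "x integrable_on {a..b} \<and> (\<lambda>r. integral {a..b} (f r)) \<longlonglongrightarrow> integral {a..b} x"
    using dominated_convergence[of f "{a..b}" "\<lambda>_. B" x] fi le conv
    by (auto simp: has_integral_integrable_integral integrable_const_ivl)
  then show "x integrable_on {a..b}" by blast
  have "integral {a..b} (f r) = (\<Sum>l<Suc r. (b - a) / real (Suc r) * x (a + real (Suc l) * ((b - a) / real (Suc r))))" for r
    using fi[of r] by (simp only: integral_unique h_def)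
  with D have "(\<lambda>r. \<Sum>l<Suc r. (b - a) / real (Suc r) * x (a + real (Suc l) * ((b - a) / real (Suc r)))) \<longlonglongrightarrow> integral {a..b} x"
    by simp
  then show "(\<lambda>r. \<Sum>l<r. (b - a) / real r * x (a + real (Suc l) * ((b - a) / real r))) \<longlonglongrightarrow> integral {a..b} x"
    by (rule LIMSEQ_imp_Suc)
qed

section \<open>One step of the tilted semigroup\<close>

lemma mexp_zero: "mexp (0 :: real^'n::finite^'n) $ i $ j = (if i = j then 1 else 0)"
  using mexp_taylor[of "0 :: real^'n^'n" i j] by (simp add: mat_def)

lemma mexp_has_derivative_0:
  fixes A :: "real^'n::finite^'n"
  shows "((\<lambda>\<delta>. mexp (\<delta> *\<^sub>R A) $ i $ j) has_real_derivative A $ i $ j) (at 0)"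
proof -
  \<comment> \<open>The summand 1 makes \<open>1 / a\<close> a legitimate radius even for
    \<open>A = 0\<close>.\<close>
  define a where "a = (\<Sum>i\<in>UNIV. \<Sum>j\<in>UNIV. \<bar>A $ i $ j\<bar>) + 1"
  have a1: "a \<ge> 1" unfolding a_def by (simp add: sum_nonneg)
  have a: "(\<Sum>i\<in>UNIV. \<Sum>j\<in>UNIV. \<bar>A $ i $ j\<bar>) \<le> a" by (simp add: a_def)
  let ?q = "\<lambda>h. (mexp (h *\<^sub>R A) $ i $ j - mexp (0 *\<^sub>R A) $ i $ j) / h - A $ i $ j"
  have bnd: "\<bar>?q h\<bar> \<le> a\<^sup>2 * \<bar>h\<bar>" if h: "h \<noteq> 0" "\<bar>h\<bar> < 1 / a" for h
  proof -
    have e: "(\<Sum>k\<in>UNIV. \<Sum>l\<in>UNIV. \<bar>(h *\<^sub>R A) $ k $ l\<bar>) = \<bar>h\<bar> * (\<Sum>i\<in>UNIV. \<Sum>j\<in>UNIV. \<bar>A $ i $ j\<bar>)"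
      by (simp add: abs_mult sum_distrib_left)
    have "\<bar>h\<bar> * (\<Sum>i\<in>UNIV. \<Sum>j\<in>UNIV. \<bar>A $ i $ j\<bar>) \<le> \<bar>h\<bar> * a"
      by (intro mult_left_mono a) auto
    moreover have "\<bar>h\<bar> * a \<le> 1" using h a1 by (simp add: field_simps)
    ultimately have "\<bar>mexp (h *\<^sub>R A) $ i $ j - ((mat 1 :: real^'n^'n) $ i $ j + (h *\<^sub>R A) $ i $ j)\<bar>
        \<le> (\<bar>h\<bar> * (\<Sum>i\<in>UNIV. \<Sum>j\<in>UNIV. \<bar>A $ i $ j\<bar>))\<^sup>2"
      using mexp_taylor[of "h *\<^sub>R A" i j] unfolding e by linarith
    also have "\<dots> \<le> (\<bar>h\<bar> * a)\<^sup>2"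
      by (intro power_mono mult_left_mono a) (auto intro!: mult_nonneg_nonneg sum_nonneg)
    finally have "\<bar>mexp (h *\<^sub>R A) $ i $ j - ((mat 1 :: real^'n^'n) $ i $ j + h * A $ i $ j)\<bar> \<le> (\<bar>h\<bar> * a)\<^sup>2"
      by simp
    moreover have "?q h = (mexp (h *\<^sub>R A) $ i $ j - ((mat 1 :: real^'n^'n) $ i $ j + h * A $ i $ j)) / h"
      using h by (simp add: mexp_zero mat_def field_simps)
    ultimately show ?thesis using h by (simp add: power2_eq_square field_simps abs_mult)
  qed
  have "((\<lambda>h. (mexp (h *\<^sub>R A) $ i $ j - mexp (0 *\<^sub>R A) $ i $ j) / h - A $ i $ j) \<longlongrightarrow> 0) (at 0)"
  proof (rule Lim_null_comparison)
    show "\<forall>\<^sub>F h in at 0. norm (?q h) \<le> a\<^sup>2 * \<bar>h\<bar>"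
      unfolding eventually_at using a1 bnd by (intro exI[of _ "1/a"]) auto
    show "((\<lambda>h. a\<^sup>2 * \<bar>h\<bar>) \<longlongrightarrow> 0) (at 0)"
      by (auto intro!: tendsto_eq_intros)
  qed
  then show ?thesis
    unfolding DERIV_def using LIM_zero_iff[of "\<lambda>h. (mexp (h *\<^sub>R A) $ i $ j - mexp (0 *\<^sub>R A) $ i $ j) / h"] by simp
qed

text \<open>One grid step of the Feynman-Kac semigroup with potential \<open>c * g\<close>. The
  parameter \<open>c\<close> is complex so that characteristic functions and exponential moments
  share the expansion; uniformity in \<open>i\<close> comes from the finiteness of the state
  space.\<close>

lemma tilted_step_expansion:
  fixes A :: "real^'n::finite^'n" and v :: "'n \<Rightarrow> complex" and g :: "'n \<Rightarrow> real"
  assumes "\<epsilon> > 0"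
  shows "\<forall>\<^sub>F \<delta> in at_right 0. \<forall>i. norm ((\<Sum>j\<in>UNIV. of_real (mexp (\<delta> *\<^sub>R A) $ j $ i) * (exp (c * of_real (\<delta> * g j)) * v j))
      - (v i + of_real \<delta> * (c * of_real (g i) * v i + (\<Sum>j\<in>UNIV. of_real (A $ j $ i) * v j)))) \<le> \<epsilon> * \<delta>"
proof -
  let ?\<phi> = "\<lambda>i \<delta>. \<Sum>j\<in>UNIV. of_real (mexp (\<delta> *\<^sub>R A) $ j $ i) * (exp (c * of_real (\<delta> * g j)) * v j)"
  let ?L = "\<lambda>i. c * of_real (g i) * v i + (\<Sum>j\<in>UNIV. of_real (A $ j $ i) * v j)"
  have \<phi>0: "?\<phi> i 0 = v i" for i
  proof -
    have "?\<phi> i 0 = (\<Sum>j\<in>UNIV. if j = i then v j else 0)"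
      by (intro sum.cong) (auto simp: mexp_zero)
    then show ?thesis by simp
  qed
  have ed: "((\<lambda>\<delta>::real. exp (c * of_real (\<delta> * g j))) has_vector_derivative c * of_real (g j)) (at 0)" for j
  proof -
    have "((\<lambda>\<delta>::real. exp (c * of_real (\<delta> * g j))) has_vector_derivative (c * of_real (g j)) * exp (c * of_real (0 * g j))) (at 0)"
      by (rule field_vector_diff_chain_at[of _ _ _ exp, unfolded o_def])
         (auto intro!: derivative_eq_intros simp: has_vector_derivative_def scaleR_conv_of_real fun_eq_iff)
    then show ?thesis by simp
  qed
  have md: "((\<lambda>\<delta>. complex_of_real (mexp (\<delta> *\<^sub>R A) $ j $ i)) has_vector_derivative of_real (A $ j $ i)) (at 0)" for i j
    by (rule has_vector_derivative_of_real) (rule mexp_has_derivative_0)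
  have "(?\<phi> i has_vector_derivative ?L i) (at 0)" for i
  proof -
    have "(?\<phi> i has_vector_derivative (\<Sum>j\<in>UNIV. of_real (mexp (0 *\<^sub>R A) $ j $ i) * (c * of_real (g j) * v j)
        + of_real (A $ j $ i) * (exp (c * of_real (0 * g j)) * v j))) (at 0)"
      by (intro has_vector_derivative_sum has_vector_derivative_mult md has_vector_derivative_mult_left ed)
    moreover have "(\<Sum>j\<in>UNIV. of_real (mexp (0 *\<^sub>R A) $ j $ i) * (c * of_real (g j) * v j)) = c * of_real (g i) * v i"
    proof -
      have "(\<Sum>j\<in>UNIV. of_real (mexp (0 *\<^sub>R A) $ j $ i) * (c * of_real (g j) * v j))
          = (\<Sum>j\<in>UNIV. if j = i then c * of_real (g j) * v j else 0)"
        by (intro sum.cong) (auto simp: mexp_zero)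
      then show ?thesis by simp
    qed
    ultimately show ?thesis by (simp add: sum.distrib)
  qed
  then have "\<forall>i. \<forall>\<^sub>F \<delta> in at_right 0. norm (?\<phi> i \<delta> - (v i + of_real \<delta> * ?L i)) \<le> \<epsilon> * \<delta>"
  proof (intro allI)
    fix i
    have "(?\<phi> i has_derivative (\<lambda>h. h *\<^sub>R ?L i)) (at 0)"
      using \<open>\<And>i. (?\<phi> i has_vector_derivative ?L i) (at 0)\<close>[of i] by (simp only: has_vector_derivative_def)
    then obtain d where d: "d > 0" "\<And>\<delta>. norm (\<delta> - 0) < d \<Longrightarrow> norm (?\<phi> i \<delta> - ?\<phi> i 0 - (\<delta> - 0) *\<^sub>R ?L i) \<le> \<epsilon> * norm (\<delta> - 0)"
      using assms unfolding has_derivative_at_alt by blast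
    show "\<forall>\<^sub>F \<delta> in at_right 0. norm (?\<phi> i \<delta> - (v i + of_real \<delta> * ?L i)) \<le> \<epsilon> * \<delta>"
    proof (rule eventually_at_rightI[of 0 d])
      fix \<delta> assume "\<delta> \<in> {0<..<d}"
      then show "norm (?\<phi> i \<delta> - (v i + of_real \<delta> * ?L i)) \<le> \<epsilon> * \<delta>"
        using d(2)[of \<delta>] unfolding \<phi>0 by (simp add: scaleR_conv_of_real diff_diff_eq)
    qed (rule d)
  qed
  then show ?thesis by (intro eventually_all_finite) (drule spec, assumption)
qed

text \<open>The assumption \<open>B \<ge> 0\<close> covers a non-integrable \<open>f\<close>, whose
  integral is 0 by convention.\<close>

lemma (in prob_space) norm_expectation_le:
  fixes f :: "'a \<Rightarrow> 'e::{banach, second_countable_topology}"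
  assumes "\<And>\<omega>. \<omega> \<in> space M \<Longrightarrow> norm (f \<omega>) \<le> B" "B \<ge> 0"
  shows "norm (\<integral>\<omega>. f \<omega> \<partial>M) \<le> B"
proof (cases "integrable M f")
  case True
  have "norm (\<integral>\<omega>. f \<omega> \<partial>M) \<le> (\<integral>\<omega>. norm (f \<omega>) \<partial>M)" by (rule integral_norm_bound)
  also have "\<dots> \<le> B" using True assms by (intro integral_le_const) auto
  finally show ?thesis .
qed (simp add: not_integrable_integral_eq assms)

section \<open>Correctors and asymptotic variance of the modulated chain\<close>

locale modulated_chain =
  fixes Q :: "real^'d::finite^'d" and p lam :: "real^'d"
  assumes gen: "is_generator Q" and irr: "irreducible_generator Q"
    and stat: "Q *v p = 0" and mass: "(\<Sum>i\<in>UNIV. p $ i) = 1"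
    and lam_nonneg: "\<And>i. lam $ i \<ge> 0"
begin

definition linf where "linf = lam \<bullet> p"
definition V where "V = asympt_var Q p lam"
definition g where "g i = lam $ i - linf"
text \<open>\<open>f\<close> and \<open>f2\<close> are the first and second corrector of the
  averaging expansion: the generator applied to \<open>f\<close> cancels the centred intensity
  \<open>g\<close>, and applied to \<open>f2\<close> it replaces \<open>g * f\<close> by its
  stationary mean \<open>V / 2\<close>.\<close>

definition f where "f = dev_fun Q p (\<lambda>i. lam $ i)"
definition f2 where "f2 = dev_fun Q p (\<lambda>i. g i * f i)"
text \<open>One constant for all data, at least 1 so that its powers can be compared.\<close>

definition B where "B = 1 + (\<Sum>i\<in>UNIV. \<bar>g i\<bar> + \<bar>f i\<bar> + \<bar>f2 i\<bar> + \<bar>lam $ i\<bar>)"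

lemma linf_eq: "linf = (\<Sum>i\<in>UNIV. p $ i * lam $ i)"
  by (simp add: linf_def inner_vec_def mult.commute)

lemma poisson_f: "(\<Sum>j\<in>UNIV. Q $ j $ i * f j) = - g i"
  unfolding f_def dev_fun_poisson[OF gen irr stat mass] by (simp add: g_def linf_eq)

text \<open>Centring the intensity does not change the sum, because \<open>f\<close> has stationary
  mean zero.\<close>

lemma V_eq: "V = 2 * (\<Sum>i\<in>UNIV. p $ i * (g i * f i))"
proof -
  have "(\<Sum>i\<in>UNIV. p $ i * (g i * f i)) = (\<Sum>i\<in>UNIV. p $ i * lam $ i * f i) - linf * (\<Sum>i\<in>UNIV. p $ i * f i)"
    by (simp add: g_def sum_distrib_left sum_subtractf[symmetric] algebra_simps)
  also have "(\<Sum>i\<in>UNIV. p $ i * f i) = 0"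
    unfolding f_def by (rule dev_fun_mean[OF gen irr stat mass])
  finally show ?thesis by (simp add: V_def asympt_var_eq f_def)
qed

lemma poisson_f2: "(\<Sum>j\<in>UNIV. Q $ j $ i * f2 j) = V / 2 - g i * f i"
  unfolding f2_def dev_fun_poisson[OF gen irr stat mass] V_eq by simp

lemma p_pos: "p $ i > 0"
  by (rule stationary_pos[OF gen irr stat mass])

lemma linf_nonneg: "linf \<ge> 0"
  unfolding linf_eq by (intro sum_nonneg mult_nonneg_nonneg less_imp_le[OF p_pos] lam_nonneg)

text \<open>For \<open>linf = 0\<close> the term \<open>V / (2 * linf)\<close> of the limit
  evaluates to 0, and this lemma makes that the right value: the weights \<open>p\<close> are
  positive, so a vanishing mean of a nonnegative intensity kills every term of
  \<open>V\<close>.\<close>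

lemma V_zero: "linf = 0 \<Longrightarrow> V = 0"
proof -
  assume "linf = 0"
  then have "p $ i * lam $ i = 0" for i
    unfolding linf_eq using sum_nonneg_eq_0_iff[of UNIV "\<lambda>i. p $ i * lam $ i"] p_pos lam_nonneg
    by (simp add: less_imp_le)
  then show "V = 0" unfolding V_def asympt_var_eq by (simp only: mult_zero_left mult_zero_right sum.neutral_const)
qed

text \<open>\<open>V\<close> is a Dirichlet form of \<open>f\<close>. Expand the square: the squares
  of \<open>f j\<close> vanish by stationarity, the squares of \<open>f i\<close> by the column
  sums, and the mixed terms give \<open>V\<close> by the Poisson equation.\<close>

lemma V_nonneg: "V \<ge> 0"
proof -
  have row: "(\<Sum>i\<in>UNIV. Q $ j $ i * p $ i) = 0" for j
    using stat by (simp add: matrix_vector_mult_def vec_eq_iff)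
  have "(\<Sum>i\<in>UNIV. \<Sum>j\<in>UNIV. p $ i * Q $ j $ i * (f j - f i)\<^sup>2)
     = (\<Sum>i\<in>UNIV. \<Sum>j\<in>UNIV. (f j)\<^sup>2 * (Q $ j $ i * p $ i)) - 2 * (\<Sum>i\<in>UNIV. p $ i * f i * (\<Sum>j\<in>UNIV. Q $ j $ i * f j))
       + (\<Sum>i\<in>UNIV. p $ i * (f i)\<^sup>2 * (\<Sum>j\<in>UNIV. Q $ j $ i))"
    unfolding sum_distrib_left sum_subtractf[symmetric] sum.distrib[symmetric]
    by (intro sum.cong refl) (simp add: power2_eq_square algebra_simps)
  also have "(\<Sum>i\<in>UNIV. \<Sum>j\<in>UNIV. (f j)\<^sup>2 * (Q $ j $ i * p $ i)) = 0"
    by (subst sum.swap) (simp add: sum_distrib_left[symmetric] row)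
  also have "(\<Sum>i\<in>UNIV. p $ i * f i * (\<Sum>j\<in>UNIV. Q $ j $ i * f j)) = - (V / 2)"
    unfolding poisson_f V_eq by (simp add: sum_negf mult_ac)
  finally have eq: "V = (\<Sum>i\<in>UNIV. \<Sum>j\<in>UNIV. p $ i * Q $ j $ i * (f j - f i)\<^sup>2)"
    by (simp add: generator_colsum[OF gen])
  have "0 \<le> p $ i * Q $ j $ i * (f j - f i)\<^sup>2" for i j
    using gen p_pos[of i] by (cases "i = j") (auto simp: is_generator_def)
  then show ?thesis unfolding eq by (intro sum_nonneg)
qed

lemma B_bounds: "\<bar>g i\<bar> \<le> B" "\<bar>f i\<bar> \<le> B" "\<bar>f2 i\<bar> \<le> B" "lam $ i \<le> B" "B \<ge> 1"
proof -
  have "\<bar>g i\<bar> + \<bar>f i\<bar> + \<bar>f2 i\<bar> + \<bar>lam $ i\<bar> \<le> (\<Sum>i\<in>UNIV. \<bar>g i\<bar> + \<bar>f i\<bar> + \<bar>f2 i\<bar> + \<bar>lam $ i\<bar>)"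
    by (rule member_le_sum) auto
  then show "\<bar>g i\<bar> \<le> B" "\<bar>f i\<bar> \<le> B" "\<bar>f2 i\<bar> \<le> B" "lam $ i \<le> B" unfolding B_def by linarith+
  show "B \<ge> 1" unfolding B_def by (simp add: sum_nonneg)
qed

end

lemma ctmc_path_integral:
  fixes h :: "'d::finite \<Rightarrow> real"
  assumes Z: "ctmc M Q Z" and ab: "0 \<le> a" "a < b" and \<omega>: "\<omega> \<in> space M"
  shows "(\<lambda>s. h (Z s \<omega>)) integrable_on {a..b}"
    and "(\<lambda>r. \<Sum>l<r. (b - a) / real r * h (Z (a + real (Suc l) * ((b - a) / real r)) \<omega>)) \<longlonglongrightarrow> integral {a..b} (\<lambda>s. h (Z s \<omega>))"
proof -
  have rc: "((\<lambda>s. h (Z s \<omega>)) \<longlongrightarrow> h (Z s \<omega>)) (at_right s)" if "a \<le> s" "s < b" for s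
  proof (rule tendsto_eventually)
    have "s \<ge> 0" using ab that by simp
    moreover have "piecewise_const_cadlag (\<lambda>t. Z t \<omega>)" using Z \<omega> by (simp add: ctmc_def)
    ultimately obtain e where e: "e > 0" "\<forall>t. s \<le> t \<and> t < s + e \<longrightarrow> Z t \<omega> = Z s \<omega>"
      unfolding piecewise_const_cadlag_def by metis
    show "\<forall>\<^sub>F t in at_right s. h (Z t \<omega>) = h (Z s \<omega>)"
    proof (rule eventually_at_rightI[of s "s + e"])
      fix t assume "t \<in> {s<..<s + e}"
      then show "h (Z t \<omega>) = h (Z s \<omega>)" using e(2)[rule_format, of t] by simp
    qed (use e in simp)
  qed
  have bd: "\<bar>h (Z s \<omega>)\<bar> \<le> (\<Sum>i\<in>UNIV. \<bar>h i\<bar>)" for s by (rule member_le_sum) auto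
  show "(\<lambda>s. h (Z s \<omega>)) integrable_on {a..b}"
    by (rule riemann_sums_right(1)[OF ab(2) rc bd])
  show "(\<lambda>r. \<Sum>l<r. (b - a) / real r * h (Z (a + real (Suc l) * ((b - a) / real r)) \<omega>)) \<longlonglongrightarrow> integral {a..b} (\<lambda>s. h (Z s \<omega>))"
    by (rule riemann_sums_right(2)[OF ab(2) rc bd])
qed

lemma ctmc_measurable:
  fixes h :: "'d::finite \<Rightarrow> real"
  assumes "ctmc M Q Z" "t \<ge> 0"
  shows "(\<lambda>\<omega>. h (Z t \<omega>)) \<in> borel_measurable M"
proof -
  have "Z t \<in> measurable M (count_space UNIV)" using assms by (simp add: ctmc_def)
  then show ?thesis by (rule measurable_compose) simp
qed

text \<open>Measurability in \<open>\<omega>\<close> is given time by time, so the path integral is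
  obtained as a limit of Riemann sums.\<close>

lemma ctmc_path_integral_measurable:
  fixes h :: "'d::finite \<Rightarrow> real"
  assumes Z: "ctmc M Q Z" and ab: "0 \<le> a"
  shows "(\<lambda>\<omega>. integral {a..b} (\<lambda>s. h (Z s \<omega>))) \<in> borel_measurable M"
proof (cases "a < b")
  case True
  show ?thesis
  proof (rule borel_measurable_LIMSEQ_real)
    show "(\<lambda>r. \<Sum>l<r. (b - a) / real r * h (Z (a + real (Suc l) * ((b - a) / real r)) \<omega>)) \<longlonglongrightarrow> integral {a..b} (\<lambda>s. h (Z s \<omega>))"
      if "\<omega> \<in> space M" for \<omega>
      by (rule ctmc_path_integral(2)[OF Z ab True that])
    show "(\<lambda>\<omega>. \<Sum>l<r. (b - a) / real r * h (Z (a + real (Suc l) * ((b - a) / real r)) \<omega>)) \<in> borel_measurable M" for r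
      using True ab by (intro borel_measurable_sum borel_measurable_times borel_measurable_const ctmc_measurable[OF Z])
        (auto intro!: add_nonneg_nonneg mult_nonneg_nonneg divide_nonneg_nonneg)
  qed
next
  case False
  then have "integral {a..b} F = 0" for F :: "real \<Rightarrow> real"
    by (cases "a = b") auto
  then show ?thesis by simp
qed

text \<open>One step under the tilt multiplies \<open>v\<close> by
  \<open>1 - \<delta> * \<kappa>\<close> up to a defect \<open>\<delta> * e\<close>. With an
  imaginary tilt the weight collected so far has norm at most 1, and so has the factor
  \<open>1 - \<delta> * \<kappa>\<close>; defects are therefore never amplified and simply add up
  over \<open>m\<close> steps.\<close>

lemma grid_tilt_iterate:
  fixes Z :: "real \<Rightarrow> 'a \<Rightarrow> 'd::finite" and \<Phi> :: "'a \<Rightarrow> complex" and g :: "'d \<Rightarrow> real"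
  assumes Z: "ctmc M Q Z" and \<delta>: "\<delta> > 0" and \<Phi>: "grid_fun M Z \<delta> J \<Phi>"
    and \<Phi>1: "\<And>\<omega>. \<omega> \<in> space M \<Longrightarrow> norm (\<Phi> \<omega>) \<le> 1" and c: "Re c = 0"
    and step: "\<And>i. norm ((\<Sum>j\<in>UNIV. of_real (mexp (\<delta> *\<^sub>R Q) $ j $ i) * (exp (c * of_real (\<delta> * g j)) * v j))
       - of_real (1 - \<delta> * \<kappa>) * v i) \<le> \<delta> * e"
    and \<kappa>: "0 \<le> \<kappa>" "\<delta> * \<kappa> \<le> 1"
  shows "norm ((\<integral>\<omega>. \<Phi> \<omega> * exp (c * of_real (\<Sum>l<m. \<delta> * g (Z (real (J + Suc l) * \<delta>) \<omega>))) * v (Z (real (J + m) * \<delta>) \<omega>) \<partial>M)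
     - of_real ((1 - \<delta> * \<kappa>) ^ m) * (\<integral>\<omega>. \<Phi> \<omega> * v (Z (real J * \<delta>) \<omega>) \<partial>M)) \<le> real m * (\<delta> * e)"
proof (induction m)
  case 0
  then show ?case by simp
next
  case (Suc m)
  interpret prob_space M using Z by (simp add: ctmc_def)
  define S where "S m \<omega> = (\<Sum>l<m. \<delta> * g (Z (real (J + Suc l) * \<delta>) \<omega>))" for m \<omega>
  define E where "E m \<omega> = \<Phi> \<omega> * exp (c * of_real (S m \<omega>))" for m \<omega>
  define w where "w j = exp (c * of_real (\<delta> * g j)) * v j" for j
  define \<phi> where "\<phi> i = (\<Sum>j\<in>UNIV. of_real (mexp (\<delta> *\<^sub>R Q) $ j $ i) * w j)" for i
  let ?k = "complex_of_real (1 - \<delta> * \<kappa>)"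
  have e0: "\<delta> * e \<ge> 0" using order_trans[OF norm_ge_zero step] .
  \<comment> \<open>The weight after \<open>m\<close> steps looks at grid times up to
    \<open>J + m\<close> only, so the next transition may be integrated out.\<close>
  have gE: "grid_fun M Z \<delta> (J + m) (E m)"
    unfolding grid_fun_def
  proof (intro ballI impI)
    fix \<omega> \<omega>' assume *: "\<omega> \<in> space M" "\<omega>' \<in> space M" "\<forall>l\<le>J + m. Z (real l * \<delta>) \<omega> = Z (real l * \<delta>) \<omega>'"
    have "\<Phi> \<omega> = \<Phi> \<omega>'" using \<Phi> * unfolding grid_fun_def by (meson le_add1 le_trans)
    moreover have "S m \<omega> = S m \<omega>'" unfolding S_def using *(3) by (intro sum.cong refl) (simp del: of_nat_add of_nat_Suc)
    ultimately show "E m \<omega> = E m \<omega>'" by (simp add: E_def)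
  qed
  have gEh: "grid_fun M Z \<delta> (J + m) (\<lambda>\<omega>. E m \<omega> * h (Z (real (J + m) * \<delta>) \<omega>))" for h :: "'d \<Rightarrow> complex"
    using gE unfolding grid_fun_def by (metis le_refl)
  have int: "integrable M (\<lambda>\<omega>. E m \<omega> * h (Z (real (J + m) * \<delta>) \<omega>))" for h :: "'d \<Rightarrow> complex"
    using grid_fun_integral[OF Z \<delta> gEh] by metis
  have "(\<integral>\<omega>. E (Suc m) \<omega> * v (Z (real (J + Suc m) * \<delta>) \<omega>) \<partial>M)
      = (\<integral>\<omega>. E m \<omega> * w (Z (real (Suc (J + m)) * \<delta>) \<omega>) \<partial>M)"
    by (intro Bochner_Integration.integral_cong refl)
       (simp add: E_def S_def w_def exp_add distrib_left mult_ac)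
  also have "\<dots> = (\<integral>\<omega>. E m \<omega> * \<phi> (Z (real (J + m) * \<delta>) \<omega>) \<partial>M)"
    unfolding \<phi>_def by (rule ctmc_grid_markov[OF Z \<delta> gE])
  finally have eq: "(\<integral>\<omega>. E (Suc m) \<omega> * v (Z (real (J + Suc m) * \<delta>) \<omega>) \<partial>M)
     = (\<integral>\<omega>. E m \<omega> * \<phi> (Z (real (J + m) * \<delta>) \<omega>) \<partial>M)" .
  let ?a = "\<integral>\<omega>. E m \<omega> * v (Z (real (J + m) * \<delta>) \<omega>) \<partial>M"
  have "(\<integral>\<omega>. E m \<omega> * \<phi> (Z (real (J + m) * \<delta>) \<omega>) \<partial>M) - ?k * ?a
     = (\<integral>\<omega>. E m \<omega> * (\<lambda>i. \<phi> i - ?k * v i) (Z (real (J + m) * \<delta>) \<omega>) \<partial>M)"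
  proof -
    have "?k * ?a = (\<integral>\<omega>. E m \<omega> * (\<lambda>i. ?k * v i) (Z (real (J + m) * \<delta>) \<omega>) \<partial>M)"
      by (subst Bochner_Integration.integral_mult_right_zero[symmetric])
         (intro Bochner_Integration.integral_cong refl, simp only: mult_ac)
    then show ?thesis
      using Bochner_Integration.integral_diff[OF int[of \<phi>] int[of "\<lambda>i. ?k * v i"]]
      by (simp only: right_diff_distrib)
  qed
  also have "norm \<dots> \<le> \<delta> * e"
  proof (rule norm_expectation_le[OF _ e0])
    fix \<omega> assume "\<omega> \<in> space M"
    then have "norm (E m \<omega>) \<le> 1" using \<Phi>1[of \<omega>] c by (simp add: E_def norm_mult norm_exp_eq_Re)
    moreover have "norm ((\<lambda>i. \<phi> i - ?k * v i) (Z (real (J + m) * \<delta>) \<omega>)) \<le> \<delta> * e"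
      using step by (simp add: \<phi>_def w_def)
    ultimately show "norm (E m \<omega> * (\<lambda>i. \<phi> i - ?k * v i) (Z (real (J + m) * \<delta>) \<omega>)) \<le> \<delta> * e"
      unfolding norm_mult using mult_mono[of "norm (E m \<omega>)" 1] by fastforce
  qed
  finally have 1: "norm ((\<integral>\<omega>. E (Suc m) \<omega> * v (Z (real (J + Suc m) * \<delta>) \<omega>) \<partial>M) - ?k * ?a) \<le> \<delta> * e"
    unfolding eq .
  let ?b = "\<integral>\<omega>. \<Phi> \<omega> * v (Z (real J * \<delta>) \<omega>) \<partial>M"
  have "norm (?k * (?a - of_real ((1 - \<delta> * \<kappa>) ^ m) * ?b)) \<le> 1 * norm (?a - of_real ((1 - \<delta> * \<kappa>) ^ m) * ?b)"
    unfolding norm_mult using \<kappa> \<delta> by (intro mult_right_mono) (auto simp del: of_real_diff)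
  also have "\<dots> \<le> real m * (\<delta> * e)" using Suc by (simp add: E_def S_def del: of_real_diff)
  finally have 2: "norm (?k * ?a - of_real ((1 - \<delta> * \<kappa>) ^ Suc m) * ?b) \<le> real m * (\<delta> * e)"
    by (simp only: right_diff_distrib power_Suc of_real_mult mult.assoc)
  let ?x = "\<integral>\<omega>. E (Suc m) \<omega> * v (Z (real (J + Suc m) * \<delta>) \<omega>) \<partial>M"
  have tele: "x - z = (x - y) + (y - z)" for x y z :: complex by simp
  have "norm (?x - of_real ((1 - \<delta> * \<kappa>) ^ Suc m) * ?b)
      = norm ((?x - ?k * ?a) + (?k * ?a - of_real ((1 - \<delta> * \<kappa>) ^ Suc m) * ?b))"
    by (rule arg_cong[OF tele])
  also have "\<dots> \<le> \<delta> * e + real m * (\<delta> * e)"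
    by (rule norm_triangle_mono[OF 1 2])
  also have "\<dots> = real (Suc m) * (\<delta> * e)" by (simp add: algebra_simps)
  finally show ?case by (simp only: E_def S_def)
qed

section \<open>Fluctuations of the integrated intensity\<close>

lemma grid_fun_riemann:
  fixes c :: "nat \<Rightarrow> complex" and g :: "'d \<Rightarrow> real"
  shows "grid_fun M Z \<delta> (k * r) (\<lambda>\<omega>. exp (\<Sum>k'<k. c k' * of_real (\<Sum>l<r. \<delta> * g (Z (real (k' * r + Suc l) * \<delta>) \<omega>))))"
  unfolding grid_fun_def
proof (intro ballI impI arg_cong[of _ _ exp] sum.cong refl arg_cong2[of _ _ _ _ "(*)"] arg_cong[of _ _ complex_of_real] arg_cong[of _ _ g])
  fix \<omega> \<omega>' k' l assume *: "\<forall>l\<le>k * r. Z (real l * \<delta>) \<omega> = Z (real l * \<delta>) \<omega>'" "k' \<in> {..<k}" "l \<in> {..<r}"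
  \<comment> \<open>The last grid point of cell \<open>k'\<close> has index
    \<open>Suc k' * r\<close>, which is still within the range when \<open>k' < k\<close>.\<close>
  then have "Suc k' * r \<le> k * r" by (intro mult_right_mono) auto
  then have "k' * r + Suc l \<le> k * r" using * by auto
  with * show "Z (real (k' * r + Suc l) * \<delta>) \<omega> = Z (real (k' * r + Suc l) * \<delta>) \<omega>'" by blast
qed

text \<open>With mesh \<open>\<eta> / r\<close> the ends of all cells are grid points: cell
  \<open>k\<close> uses the indices \<open>k * r + 1\<close> to \<open>k * r + r\<close>, so one
  grid serves every cell.\<close>

lemma cell_riemann:
  fixes g :: "'d::finite \<Rightarrow> real"
  assumes Z: "ctmc M Q Z" and \<eta>: "\<eta> > 0" and \<omega>: "\<omega> \<in> space M"
  shows "(\<lambda>r. \<Sum>l<r. \<eta> / real r * g (Z (real (k * r + Suc l) * (\<eta> / real r)) \<omega>))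
     \<longlonglongrightarrow> integral {real k * \<eta>..real (Suc k) * \<eta>} (\<lambda>s. g (Z s \<omega>))"
proof -
  have ab: "0 \<le> real k * \<eta>" "real k * \<eta> < real (Suc k) * \<eta>" using \<eta> by (auto intro!: mult_strict_right_mono)
  have e: "real (Suc k) * \<eta> - real k * \<eta> = \<eta>" by (simp add: algebra_simps)
  have "(\<Sum>l<r. \<eta> / real r * g (Z (real k * \<eta> + real (Suc l) * (\<eta> / real r)) \<omega>))
      = (\<Sum>l<r. \<eta> / real r * g (Z (real (k * r + Suc l) * (\<eta> / real r)) \<omega>))" for r
  proof (intro sum.cong refl)
    fix l assume "l \<in> {..<r}"
    then have "r > 0" by auto
    then have "real k * \<eta> + real (Suc l) * (\<eta> / real r) = real (k * r + Suc l) * (\<eta> / real r)"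
      by (simp add: field_simps)
    then show "\<eta> / real r * g (Z (real k * \<eta> + real (Suc l) * (\<eta> / real r)) \<omega>)
        = \<eta> / real r * g (Z (real (k * r + Suc l) * (\<eta> / real r)) \<omega>)" by simp
  qed
  then show ?thesis using ctmc_path_integral(2)[OF Z ab \<omega>, of g] unfolding e by simp
qed

lemma ctmc_riemann_measurable:
  fixes g :: "'d::finite \<Rightarrow> real"
  assumes Z: "ctmc M Q Z" and \<eta>: "\<eta> > 0"
  shows "(\<lambda>\<omega>. \<Sum>l<r. \<eta> / real r * g (Z (real (k * r + Suc l) * (\<eta> / real r)) \<omega>)) \<in> borel_measurable M"
  using \<eta> by (intro borel_measurable_sum borel_measurable_times borel_measurable_const ctmc_measurable[OF Z]) auto

lemma norm_exp_imag_sum: "norm (exp (\<Sum>k\<in>A. \<i> * complex_of_real (a k) * complex_of_real (b k))) = 1"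
  by (simp add: norm_exp_eq_Re)

context modulated_chain
begin

text \<open>Increment of the centred integrated intensity
  \<open>\<Lambda>\<^sub>t - linf * t\<close> over the \<open>k\<close>-th cell of width
  \<open>\<eta>\<close>.\<close>

definition cell :: "(real \<Rightarrow> 'a \<Rightarrow> 'd) \<Rightarrow> real \<Rightarrow> nat \<Rightarrow> 'a \<Rightarrow> real" where
  "cell Z \<eta> k \<omega> = integral {real k * \<eta>..real (Suc k) * \<eta>} (\<lambda>s. g (Z s \<omega>))"

lemma cell_measurable: "ctmc M A Z \<Longrightarrow> \<eta> > 0 \<Longrightarrow> cell Z \<eta> k \<in> borel_measurable M"
  unfolding cell_def[abs_def] by (rule ctmc_path_integral_measurable) auto

definition corrector :: "nat \<Rightarrow> real \<Rightarrow> 'd \<Rightarrow> complex" where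
  "corrector n \<theta> i = 1 + \<i> * of_real (\<theta> * f i / sqrt n) - of_real (\<theta>\<^sup>2 * f2 i / n)"

lemma corrector_bound:
  assumes "n \<ge> 1"
  shows "norm (corrector n \<theta> i - 1) \<le> (\<bar>\<theta>\<bar> + \<theta>\<^sup>2) * B / sqrt n"
proof -
  have n: "1 \<le> sqrt (real n)" "sqrt (real n) \<le> real n"
    using assms by (auto intro!: real_le_lsqrt simp: power2_eq_square)
  have "norm (corrector n \<theta> i - 1) \<le> norm (\<i> * of_real (\<theta> * f i / sqrt n)) + norm (complex_of_real (\<theta>\<^sup>2 * f2 i / n))"
    unfolding corrector_def by (metis add_diff_cancel_left' add_diff_eq norm_triangle_ineq4)
  also have "\<dots> = \<bar>\<theta>\<bar> * \<bar>f i\<bar> / sqrt n + \<theta>\<^sup>2 * \<bar>f2 i\<bar> / n"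
    using assms by (simp only: norm_mult norm_of_real norm_ii abs_mult abs_divide) simp
  also have "\<dots> \<le> \<bar>\<theta>\<bar> * B / sqrt n + \<theta>\<^sup>2 * B / sqrt n"
    using n B_bounds(1-4)[of i] B_bounds(5) by (intro add_mono frac_le mult_left_mono) auto
  finally show ?thesis by (simp add: add_divide_distrib algebra_simps)
qed

text \<open>The first term comes from the tilt acting on the \<open>f2\<close> part of the
  corrector, the second from the eigenvalue acting on the difference between corrector and
  1.\<close>

definition err :: "real \<Rightarrow> real" where
  "err \<theta> = \<bar>\<theta>\<bar>^3 * B\<^sup>2 + \<theta>\<^sup>2 * V / 2 * ((\<bar>\<theta>\<bar> + \<theta>\<^sup>2) * B)"

text \<open>Collect powers of \<open>sqrt n\<close>. At order \<open>sqrt n\<close>, the tilt of 1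
  cancels against the generator on \<open>f\<close> by the first Poisson equation. At order 1, the
  tilt of \<open>f\<close> and the generator on \<open>f2\<close> combine to the constant
  \<open>- \<theta>\<^sup>2 * V / 2\<close> by the second. All other terms carry a factor
  \<open>1 / sqrt n\<close>.\<close>

lemma corrector_generator:
  assumes "n \<ge> 1"
  shows "norm (\<i> * of_real (\<theta> * sqrt n) * of_real (g i) * corrector n \<theta> i
       + (\<Sum>j\<in>UNIV. of_real ((real n *\<^sub>R Q) $ j $ i) * corrector n \<theta> j)
       + of_real (\<theta>\<^sup>2 * V / 2) * corrector n \<theta> i) \<le> err \<theta> / sqrt n"
proof -
  define s where "s = sqrt (real n)"
  have s: "s \<ge> 1" "real n = s * s" using assms by (auto simp: s_def)
  have "(\<Sum>j\<in>UNIV. of_real ((real n *\<^sub>R Q) $ j $ i) * corrector n \<theta> j)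
     = of_real (real n * (\<Sum>j\<in>UNIV. Q $ j $ i)) + \<i> * of_real (real n * \<theta> / s * (\<Sum>j\<in>UNIV. Q $ j $ i * f j))
       - of_real (real n * \<theta>\<^sup>2 / n * (\<Sum>j\<in>UNIV. Q $ j $ i * f2 j))"
    unfolding corrector_def s_def[symmetric] sum_distrib_left of_real_sum sum.distrib[symmetric] sum_subtractf[symmetric]
    by (intro sum.cong refl) (simp add: algebra_simps)
  also have "\<dots> = - (\<i> * of_real (s * \<theta> * g i)) - of_real (\<theta>\<^sup>2 * (V / 2 - g i * f i))"
    unfolding generator_colsum[OF gen] poisson_f poisson_f2 using s by simp
  finally have eq: "(\<Sum>j\<in>UNIV. of_real ((real n *\<^sub>R Q) $ j $ i) * corrector n \<theta> j)
     = - (\<i> * of_real (s * \<theta> * g i)) - of_real (\<theta>\<^sup>2 * (V / 2 - g i * f i))" .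
  have A: "\<i> * of_real (\<theta> * s) * of_real (g i) * corrector n \<theta> i
      = \<i> * of_real (s * \<theta> * g i) - of_real (\<theta>\<^sup>2 * (g i * f i)) - \<i> * of_real (\<theta>^3 * g i * f2 i / s)"
    unfolding corrector_def s_def[symmetric] using s
    by (simp add: complex_eq_iff field_simps power2_eq_square power3_eq_cube)
  have "\<i> * of_real (\<theta> * sqrt n) * of_real (g i) * corrector n \<theta> i
       + (\<Sum>j\<in>UNIV. of_real ((real n *\<^sub>R Q) $ j $ i) * corrector n \<theta> j)
       + of_real (\<theta>\<^sup>2 * V / 2) * corrector n \<theta> i
     = - (\<i> * of_real (\<theta>^3 * g i * f2 i / s)) + of_real (\<theta>\<^sup>2 * V / 2) * (corrector n \<theta> i - 1)"
    unfolding eq s_def[symmetric] A by (simp add: algebra_simps)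
  also have "norm \<dots> \<le> \<bar>\<theta>\<bar>^3 * B\<^sup>2 / s + \<theta>\<^sup>2 * V / 2 * ((\<bar>\<theta>\<bar> + \<theta>\<^sup>2) * B / s)"
  proof (rule norm_triangle_mono)
    have "\<bar>g i\<bar> * \<bar>f2 i\<bar> \<le> B * B" using B_bounds(1-4)[of i] B_bounds(5) by (intro mult_mono) auto
    then have "\<bar>\<theta>\<bar>^3 * (\<bar>g i\<bar> * \<bar>f2 i\<bar>) / s \<le> \<bar>\<theta>\<bar>^3 * (B * B) / s"
      using s by (intro divide_right_mono mult_left_mono) auto
    then show "norm (- (\<i> * complex_of_real (\<theta>^3 * g i * f2 i / s))) \<le> \<bar>\<theta>\<bar>^3 * B\<^sup>2 / s"
      using s by (simp add: norm_mult norm_divide norm_power power2_eq_square mult.assoc)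
    show "norm (of_real (\<theta>\<^sup>2 * V / 2) * (corrector n \<theta> i - 1)) \<le> \<theta>\<^sup>2 * V / 2 * ((\<bar>\<theta>\<bar> + \<theta>\<^sup>2) * B / s)"
      unfolding norm_mult norm_of_real using corrector_bound[OF assms, of \<theta> i] V_nonneg
      by (intro mult_mono) (auto simp: s_def)
  qed
  also have "\<dots> = err \<theta> / sqrt n" unfolding err_def s_def by (simp add: add_divide_distrib)
  finally show ?thesis .
qed

text \<open>The past cells form a weight of norm one, and \<open>grid_tilt_iterate\<close> carries
  the corrector through cell \<open>k\<close>. Two errors survive as the mesh tends to zero: the
  eigenfunction defect over time \<open>\<eta>\<close>, and the distance of the corrector from 1,
  paid once at each end of the cell.\<close>

lemma cell_char:
  fixes Z :: "real \<Rightarrow> 'a \<Rightarrow> 'd" and u :: "nat \<Rightarrow> real"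
  assumes Z: "ctmc M (real n *\<^sub>R Q) Z" and n: "n \<ge> 1" and \<eta>: "\<eta> > 0"
  defines "\<Psi> \<equiv> \<lambda>k \<omega>. exp (\<Sum>k'<k. \<i> * of_real (u k' * sqrt n) * of_real (cell Z \<eta> k' \<omega>))"
  shows "norm ((\<integral>\<omega>. \<Psi> (Suc k) \<omega> \<partial>M) - of_real (exp (- (u k)\<^sup>2 * V / 2 * \<eta>)) * (\<integral>\<omega>. \<Psi> k \<omega> \<partial>M))
     \<le> (\<eta> * err (u k) + 2 * ((\<bar>u k\<bar> + (u k)\<^sup>2) * B)) / sqrt n"
proof -
  interpret prob_space M using Z by (simp add: ctmc_def)
  define \<theta> where "\<theta> = u k"
  define \<kappa> where "\<kappa> = \<theta>\<^sup>2 * V / 2"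
  define v where "v = corrector n \<theta>"
  define b where "b = (\<bar>\<theta>\<bar> + \<theta>\<^sup>2) * B / sqrt n"
  define e0 where "e0 = err \<theta> / sqrt n"
  define R where "R r k \<omega> = (\<Sum>l<r. \<eta> / real r * g (Z (real (k * r + Suc l) * (\<eta> / real r)) \<omega>))" for r k \<omega>
  define \<Phi> where "\<Phi> r k \<omega> = exp (\<Sum>k'<k. \<i> * of_real (u k' * sqrt n) * of_real (R r k' \<omega>))" for r k \<omega>
  have \<kappa>0: "\<kappa> \<ge> 0" using V_nonneg by (simp add: \<kappa>_def)
  have b0: "b \<ge> 0" using B_bounds(5) by (simp add: b_def)
  have [measurable]: "R r k \<in> borel_measurable M" for r k
    unfolding R_def[abs_def] by (rule ctmc_riemann_measurable[OF Z \<eta>])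
  note [measurable] = cell_measurable[OF Z \<eta>]
  have lim: "(\<lambda>r. \<integral>\<omega>. \<Phi> r k \<omega> \<partial>M) \<longlonglongrightarrow> (\<integral>\<omega>. \<Psi> k \<omega> \<partial>M)" for k
  proof (rule integral_dominated_convergence[where w = "\<lambda>_. 1"])
    show "\<Psi> k \<in> borel_measurable M" unfolding \<Psi>_def by measurable
    show "\<Phi> r k \<in> borel_measurable M" for r unfolding \<Phi>_def by measurable
    show "AE \<omega> in M. (\<lambda>r. \<Phi> r k \<omega>) \<longlonglongrightarrow> \<Psi> k \<omega>"
      unfolding \<Phi>_def \<Psi>_def R_def cell_def
      by (intro AE_I2 tendsto_intros tendsto_sum cell_riemann[OF Z \<eta>])
    show "AE \<omega> in M. norm (\<Phi> r k \<omega>) \<le> 1" for r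
      unfolding \<Phi>_def norm_exp_imag_sum by simp
  qed simp
  \<comment> \<open>Here \<open>\<epsilon>\<close> is the remainder of the one-step expansion
    relative to the mesh; it is removed only after \<open>r\<close> has gone to infinity.\<close>
  have key: "norm ((\<integral>\<omega>. \<Psi> (Suc k) \<omega> \<partial>M) - of_real (exp (- \<kappa> * \<eta>)) * (\<integral>\<omega>. \<Psi> k \<omega> \<partial>M)) \<le> \<eta> * (e0 + \<epsilon>) + 2 * b"
    if \<epsilon>: "\<epsilon> > 0" for \<epsilon>
  proof -
    have h: "filterlim (\<lambda>r. \<eta> / real r) (at_right 0) sequentially"
      unfolding filterlim_at using \<eta> lim_const_over_n[of \<eta>]
      by (auto intro!: eventually_sequentiallyI[of 1])
    have "\<forall>\<^sub>F \<delta> in at_right 0. \<delta> * \<kappa> \<le> 1"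
    proof -
      have "((\<lambda>\<delta>. \<delta> * \<kappa>) \<longlongrightarrow> 0) (at_right 0)" by (auto intro!: tendsto_eq_intros)
      then have "\<forall>\<^sub>F \<delta> in at_right 0. \<delta> * \<kappa> < 1" by (rule order_tendstoD) simp
      then show ?thesis by (rule eventually_mono) simp
    qed
    from eventually_conj[OF this tilted_step_expansion[OF \<epsilon>, of "real n *\<^sub>R Q" "\<i> * of_real (\<theta> * sqrt n)" g v]]
    have "\<forall>\<^sub>F r in sequentially. (\<eta> / real r) * \<kappa> \<le> 1 \<and> (\<forall>i. norm ((\<Sum>j\<in>UNIV. of_real (mexp ((\<eta> / real r) *\<^sub>R (real n *\<^sub>R Q)) $ j $ i) * (exp (\<i> * of_real (\<theta> * sqrt n) * of_real ((\<eta> / real r) * g j)) * v j))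
      - (v i + of_real (\<eta> / real r) * (\<i> * of_real (\<theta> * sqrt n) * of_real (g i) * v i + (\<Sum>j\<in>UNIV. of_real ((real n *\<^sub>R Q) $ j $ i) * v j)))) \<le> \<epsilon> * (\<eta> / real r))"
      by (rule eventually_compose_filterlim[OF _ h])
    then have ev: "\<forall>\<^sub>F r in sequentially. norm ((\<integral>\<omega>. \<Phi> r (Suc k) \<omega> \<partial>M) - of_real ((1 - \<eta> / real r * \<kappa>) ^ r) * (\<integral>\<omega>. \<Phi> r k \<omega> \<partial>M)) \<le> \<eta> * (e0 + \<epsilon>) + 2 * b"
      using eventually_gt_at_top[of 0]
    proof eventually_elim
      case (elim r)
      define \<delta> where "\<delta> = \<eta> / real r"
      define c where "c = \<i> * of_real (\<theta> * sqrt n)"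
      define \<phi> where "\<phi> i = (\<Sum>j\<in>UNIV. of_real (mexp (\<delta> *\<^sub>R (real n *\<^sub>R Q)) $ j $ i) * (exp (c * of_real (\<delta> * g j)) * v j))" for i
      define L where "L i = c * of_real (g i) * v i + (\<Sum>j\<in>UNIV. of_real ((real n *\<^sub>R Q) $ j $ i) * v j)" for i
      have \<delta>: "\<delta> > 0" using \<eta> elim by (simp add: \<delta>_def)
      have \<delta>\<kappa>: "\<delta> * \<kappa> \<le> 1" using elim by (simp add: \<delta>_def)
      have st: "norm (\<phi> i - (v i + of_real \<delta> * L i)) \<le> \<epsilon> * \<delta>" for i
        using elim unfolding \<phi>_def L_def c_def \<delta>_def by blast
      have step: "norm (\<phi> i - of_real (1 - \<delta> * \<kappa>) * v i) \<le> \<delta> * (e0 + \<epsilon>)" for i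
      proof -
        have "\<phi> i - of_real (1 - \<delta> * \<kappa>) * v i = (\<phi> i - (v i + of_real \<delta> * L i)) + of_real \<delta> * (L i + of_real \<kappa> * v i)"
          by (simp add: algebra_simps)
        also have "norm \<dots> \<le> \<epsilon> * \<delta> + \<delta> * e0"
        proof (rule norm_triangle_mono[OF st])
          have "norm (L i + of_real \<kappa> * v i) \<le> e0"
            using corrector_generator[OF n, of \<theta> i] unfolding L_def c_def \<kappa>_def v_def e0_def .
          then show "norm (of_real \<delta> * (L i + of_real \<kappa> * v i)) \<le> \<delta> * e0"
            unfolding norm_mult using \<delta> by (intro mult_mono) auto
        qed
        finally show ?thesis by (simp add: algebra_simps)
      qed
      have gf: "grid_fun M Z \<delta> (k * r) (\<Phi> r k)"
        using grid_fun_riemann[of M Z \<delta> k r "\<lambda>k'. \<i> * of_real (u k' * sqrt n)" g]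
        unfolding \<Phi>_def[abs_def] R_def \<delta>_def .
      have \<Phi>1: "norm (\<Phi> r k \<omega>) = 1" for k \<omega> unfolding \<Phi>_def norm_exp_imag_sum ..
      let ?zk = "\<lambda>\<omega>. Z (real (k * r) * \<delta>) \<omega>" and ?zs = "\<lambda>\<omega>. Z (real (k * r + r) * \<delta>) \<omega>"
      have "norm ((\<integral>\<omega>. \<Phi> r k \<omega> * exp (c * of_real (\<Sum>l<r. \<delta> * g (Z (real (k * r + Suc l) * \<delta>) \<omega>))) * v (?zs \<omega>) \<partial>M)
         - of_real ((1 - \<delta> * \<kappa>) ^ r) * (\<integral>\<omega>. \<Phi> r k \<omega> * v (?zk \<omega>) \<partial>M)) \<le> real r * (\<delta> * (e0 + \<epsilon>))"
        by (rule grid_tilt_iterate[OF Z \<delta> gf _ _ _ \<kappa>0 \<delta>\<kappa>]) (use step in \<open>simp_all add: \<Phi>1 c_def \<phi>_def\<close>)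
      moreover have "real r * (\<delta> * (e0 + \<epsilon>)) = \<eta> * (e0 + \<epsilon>)" using elim by (simp add: \<delta>_def)
      moreover have "\<Phi> r k \<omega> * exp (c * of_real (\<Sum>l<r. \<delta> * g (Z (real (k * r + Suc l) * \<delta>) \<omega>))) = \<Phi> r (Suc k) \<omega>" for \<omega>
        unfolding \<Phi>_def c_def \<theta>_def R_def \<delta>_def by (simp only: sum.lessThan_Suc exp_add)
      ultimately have 1: "norm ((\<integral>\<omega>. \<Phi> r (Suc k) \<omega> * v (?zs \<omega>) \<partial>M) - of_real ((1 - \<delta> * \<kappa>) ^ r) * (\<integral>\<omega>. \<Phi> r k \<omega> * v (?zk \<omega>) \<partial>M)) \<le> \<eta> * (e0 + \<epsilon>)"
        by simp
      have vb: "norm (v i - 1) \<le> b" for i unfolding v_def b_def by (rule corrector_bound[OF n])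
      have int: "integrable M (\<lambda>\<omega>. \<Phi> r k \<omega> * w (Z t \<omega>))" if "t \<ge> 0" for k and w :: "'d \<Rightarrow> complex" and t
      proof (rule Bochner_Integration.integrable_bound[OF integrable_const[of "\<Sum>i\<in>UNIV. norm (w i)"]])
        have [measurable]: "Z t \<in> measurable M (count_space UNIV)" using Z that by (simp add: ctmc_def)
        show "(\<lambda>\<omega>. \<Phi> r k \<omega> * w (Z t \<omega>)) \<in> borel_measurable M" unfolding \<Phi>_def by measurable
        show "AE \<omega> in M. norm (\<Phi> r k \<omega> * w (Z t \<omega>)) \<le> norm (\<Sum>i\<in>UNIV. norm (w i))"
        proof (rule AE_I2)
          fix \<omega>
          have "norm (w (Z t \<omega>)) \<le> (\<Sum>i\<in>UNIV. norm (w i))" by (rule member_le_sum) auto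
          then show "norm (\<Phi> r k \<omega> * w (Z t \<omega>)) \<le> norm (\<Sum>i\<in>UNIV. norm (w i))"
            by (simp add: norm_mult \<Phi>1)
        qed
      qed
      have near: "norm ((\<integral>\<omega>. \<Phi> r k \<omega> * v (Z t \<omega>) \<partial>M) - (\<integral>\<omega>. \<Phi> r k \<omega> \<partial>M)) \<le> b" if "t \<ge> 0" for k t
      proof -
        have "(\<integral>\<omega>. \<Phi> r k \<omega> * v (Z t \<omega>) \<partial>M) - (\<integral>\<omega>. \<Phi> r k \<omega> \<partial>M) = (\<integral>\<omega>. \<Phi> r k \<omega> * (v (Z t \<omega>) - 1) \<partial>M)"
          using int[OF that, of k v] int[OF that, of k "\<lambda>_. 1"]
          by (subst Bochner_Integration.integral_diff[symmetric]) (simp_all add: algebra_simps)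
        also have "norm \<dots> \<le> b"
          by (rule norm_expectation_le[OF _ b0]) (simp add: norm_mult \<Phi>1 vb)
        finally show ?thesis .
      qed
      have 2: "norm ((\<integral>\<omega>. \<Phi> r (Suc k) \<omega> * v (?zs \<omega>) \<partial>M) - (\<integral>\<omega>. \<Phi> r (Suc k) \<omega> \<partial>M)) \<le> b"
        and 3: "norm ((\<integral>\<omega>. \<Phi> r k \<omega> * v (?zk \<omega>) \<partial>M) - (\<integral>\<omega>. \<Phi> r k \<omega> \<partial>M)) \<le> b"
        using \<delta> by (auto intro!: near)
      have "norm (complex_of_real ((1 - \<delta> * \<kappa>) ^ r)) \<le> 1"
        using \<delta> \<kappa>0 \<delta>\<kappa> by (auto simp: norm_power simp del: of_real_diff of_real_power intro!: power_le_one)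
      then have 4: "norm (of_real ((1 - \<delta> * \<kappa>) ^ r) * ((\<integral>\<omega>. \<Phi> r k \<omega> * v (?zk \<omega>) \<partial>M) - (\<integral>\<omega>. \<Phi> r k \<omega> \<partial>M))) \<le> b"
        unfolding norm_mult using 3 b0 mult_mono[of _ 1 _ b] by fastforce
      have tri: "norm (y - k * y') \<le> E + 2 * b" if "norm (x - k * x') \<le> E" "norm (x - y) \<le> b" "norm (k * (x' - y')) \<le> b"
        for x x' y y' k :: complex and E
      proof -
        have "y - k * y' = (x - k * x') - (x - y) + k * (x' - y')" by (simp add: algebra_simps)
        also have "norm \<dots> \<le> E + b + b"
          using that by (intro norm_triangle_mono norm_triangle_le_diff) auto
        finally show ?thesis by simp
      qed
      show ?case using tri[OF 1 2 4] unfolding \<delta>_def .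
    qed
    have "(\<lambda>r. (1 - \<eta> / real r * \<kappa>) ^ r) \<longlonglongrightarrow> exp (- \<kappa> * \<eta>)"
      using tendsto_exp_limit_sequentially[of "- \<kappa> * \<eta>"] by (simp add: algebra_simps)
    then have "(\<lambda>r. norm ((\<integral>\<omega>. \<Phi> r (Suc k) \<omega> \<partial>M) - of_real ((1 - \<eta> / real r * \<kappa>) ^ r) * (\<integral>\<omega>. \<Phi> r k \<omega> \<partial>M)))
       \<longlonglongrightarrow> norm ((\<integral>\<omega>. \<Psi> (Suc k) \<omega> \<partial>M) - of_real (exp (- \<kappa> * \<eta>)) * (\<integral>\<omega>. \<Psi> k \<omega> \<partial>M))"
      by (intro tendsto_intros tendsto_of_real lim)
    then show ?thesis by (rule tendsto_upperbound[OF _ ev]) simp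
  qed
  have "norm ((\<integral>\<omega>. \<Psi> (Suc k) \<omega> \<partial>M) - of_real (exp (- \<kappa> * \<eta>)) * (\<integral>\<omega>. \<Psi> k \<omega> \<partial>M)) \<le> \<eta> * e0 + 2 * b"
  proof (rule field_le_epsilon)
    fix e :: real assume "e > 0"
    then show "norm ((\<integral>\<omega>. \<Psi> (Suc k) \<omega> \<partial>M) - of_real (exp (- \<kappa> * \<eta>)) * (\<integral>\<omega>. \<Psi> k \<omega> \<partial>M)) \<le> \<eta> * e0 + 2 * b + e"
    proof -
      have "\<eta> * (e0 + e / \<eta>) + 2 * b = \<eta> * e0 + 2 * b + e" using \<eta> by (simp add: field_simps)
      then show ?thesis using key[of "e / \<eta>"] \<eta> \<open>e > 0\<close> by simp
    qed
  qed
  then show ?thesis unfolding \<kappa>_def e0_def b_def \<theta>_def by (simp add: add_divide_distrib)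
qed

end

section \<open>Real tilts and exponential moments\<close>

lemma ctmc_grid_markov_real:
  fixes Z :: "real \<Rightarrow> 'a \<Rightarrow> 'd::finite" and \<Phi> :: "'a \<Rightarrow> real"
  assumes Z: "ctmc M Q Z" and \<delta>: "\<delta> > 0" and \<Phi>: "grid_fun M Z \<delta> J \<Phi>"
  shows "(\<integral>\<omega>. \<Phi> \<omega> * v (Z (real (Suc J) * \<delta>) \<omega>) \<partial>M)
    = (\<integral>\<omega>. \<Phi> \<omega> * (\<Sum>x\<in>UNIV. mexp (\<delta> *\<^sub>R Q) $ x $ Z (real J * \<delta>) \<omega> * v x) \<partial>M)"
proof -
  have g: "grid_fun M Z \<delta> J (\<lambda>\<omega>. complex_of_real (\<Phi> \<omega>))"
    using \<Phi> unfolding grid_fun_def by metis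
  have "complex_of_real (\<integral>\<omega>. \<Phi> \<omega> * v (Z (real (Suc J) * \<delta>) \<omega>) \<partial>M)
    = complex_of_real (\<integral>\<omega>. \<Phi> \<omega> * (\<Sum>x\<in>UNIV. mexp (\<delta> *\<^sub>R Q) $ x $ Z (real J * \<delta>) \<omega> * v x) \<partial>M)"
    using ctmc_grid_markov[OF Z \<delta> g, of "\<lambda>x. complex_of_real (v x)"]
    by (simp only: integral_complex_of_real[symmetric] of_real_mult of_real_sum)
  then show ?thesis by (simp only: of_real_eq_iff)
qed

text \<open>For a real tilt the weights are not bounded by 1 and additive defects would be
  amplified. Hence the one-sided multiplicative hypothesis: \<open>v\<close> is a supersolution, and
  only the factor \<open>1 + \<delta> * a\<close> is iterated.\<close>

lemma grid_tilt_iterate_real: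
  fixes Z :: "real \<Rightarrow> 'a \<Rightarrow> 'd::finite" and g v :: "'d \<Rightarrow> real"
  assumes Z: "ctmc M Q Z" and \<delta>: "\<delta> > 0"
    and step: "\<And>i. (\<Sum>j\<in>UNIV. mexp (\<delta> *\<^sub>R Q) $ j $ i * (exp (c * (\<delta> * g j)) * v j)) \<le> (1 + \<delta> * a) * v i"
    and a: "1 + \<delta> * a \<ge> 0"
  shows "(\<integral>\<omega>. exp (c * (\<Sum>l<m. \<delta> * g (Z (real (J + Suc l) * \<delta>) \<omega>))) * v (Z (real (J + m) * \<delta>) \<omega>) \<partial>M)
     \<le> (1 + \<delta> * a) ^ m * (\<integral>\<omega>. v (Z (real J * \<delta>) \<omega>) \<partial>M)"
proof (induction m)
  case 0
  then show ?case by simp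
next
  case (Suc m)
  define S where "S m \<omega> = (\<Sum>l<m. \<delta> * g (Z (real (J + Suc l) * \<delta>) \<omega>))" for m \<omega>
  define E where "E m \<omega> = exp (c * S m \<omega>)" for m \<omega>
  define w where "w j = exp (c * (\<delta> * g j)) * v j" for j
  have gE: "grid_fun M Z \<delta> (J + m) (E m)"
    unfolding grid_fun_def E_def S_def
  proof (intro ballI impI arg_cong[of _ _ "\<lambda>x. exp (c * x)"] sum.cong refl arg_cong[of _ _ "\<lambda>x. \<delta> * g x"])
    fix \<omega> \<omega>' l assume "\<forall>l\<le>J + m. Z (real l * \<delta>) \<omega> = Z (real l * \<delta>) \<omega>'" "l \<in> {..<m}"
    then show "Z (real (J + Suc l) * \<delta>) \<omega> = Z (real (J + Suc l) * \<delta>) \<omega>'" by (simp del: of_nat_add of_nat_Suc)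
  qed
  have gEh: "grid_fun M Z \<delta> (J + m) (\<lambda>\<omega>. E m \<omega> * h (Z (real (J + m) * \<delta>) \<omega>))" for h :: "'d \<Rightarrow> real"
    using gE unfolding grid_fun_def by (metis le_refl)
  have int: "integrable M (\<lambda>\<omega>. E m \<omega> * h (Z (real (J + m) * \<delta>) \<omega>))" for h :: "'d \<Rightarrow> real"
    using grid_fun_integral[OF Z \<delta> gEh] by metis
  have "(\<integral>\<omega>. E (Suc m) \<omega> * v (Z (real (J + Suc m) * \<delta>) \<omega>) \<partial>M)
      = (\<integral>\<omega>. E m \<omega> * w (Z (real (Suc (J + m)) * \<delta>) \<omega>) \<partial>M)"
    by (intro Bochner_Integration.integral_cong refl)
       (simp add: E_def S_def w_def exp_add distrib_left mult_ac)
  also have "\<dots> = (\<integral>\<omega>. E m \<omega> * (\<lambda>i. \<Sum>j\<in>UNIV. mexp (\<delta> *\<^sub>R Q) $ j $ i * w j) (Z (real (J + m) * \<delta>) \<omega>) \<partial>M)"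
    by (rule ctmc_grid_markov_real[OF Z \<delta> gE])
  also have "\<dots> \<le> (\<integral>\<omega>. E m \<omega> * (\<lambda>i. (1 + \<delta> * a) * v i) (Z (real (J + m) * \<delta>) \<omega>) \<partial>M)"
    using step by (intro integral_mono int mult_left_mono) (auto simp: w_def E_def)
  also have "\<dots> = (1 + \<delta> * a) * (\<integral>\<omega>. E m \<omega> * v (Z (real (J + m) * \<delta>) \<omega>) \<partial>M)"
    by (subst Bochner_Integration.integral_mult_right_zero[symmetric])
       (intro Bochner_Integration.integral_cong refl, simp only: mult_ac)
  also have "\<dots> \<le> (1 + \<delta> * a) * ((1 + \<delta> * a) ^ m * (\<integral>\<omega>. v (Z (real J * \<delta>) \<omega>) \<partial>M))"
    using Suc a by (intro mult_left_mono) (simp_all only: E_def S_def)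
  finally show ?case by (simp only: E_def S_def power_Suc mult.assoc)
qed

lemma tilted_step_expansion_real:
  fixes A :: "real^'n::finite^'n" and v g :: "'n \<Rightarrow> real"
  assumes "\<epsilon> > 0"
  shows "\<forall>\<^sub>F \<delta> in at_right 0. \<forall>i. \<bar>(\<Sum>j\<in>UNIV. mexp (\<delta> *\<^sub>R A) $ j $ i * (exp (c * (\<delta> * g j)) * v j))
      - (v i + \<delta> * (c * g i * v i + (\<Sum>j\<in>UNIV. A $ j $ i * v j)))\<bar> \<le> \<epsilon> * \<delta>"
  using tilted_step_expansion[OF assms, of A "of_real c" g "\<lambda>i. of_real (v i)"]
proof eventually_elim
  case (elim \<delta>)
  show ?case
  proof
    fix i
    have "(\<Sum>j\<in>UNIV. of_real (mexp (\<delta> *\<^sub>R A) $ j $ i) * (exp (of_real c * of_real (\<delta> * g j)) * of_real (v j)))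
      - (of_real (v i) + of_real \<delta> * (of_real c * of_real (g i) * of_real (v i) + (\<Sum>j\<in>UNIV. of_real (A $ j $ i) * of_real (v j))))
      = complex_of_real ((\<Sum>j\<in>UNIV. mexp (\<delta> *\<^sub>R A) $ j $ i * (exp (c * (\<delta> * g j)) * v j))
      - (v i + \<delta> * (c * g i * v i + (\<Sum>j\<in>UNIV. A $ j $ i * v j))))"
      by (simp only: of_real_mult[symmetric] exp_of_real of_real_sum[symmetric] of_real_add[symmetric] of_real_diff[symmetric])
    then show "\<bar>(\<Sum>j\<in>UNIV. mexp (\<delta> *\<^sub>R A) $ j $ i * (exp (c * (\<delta> * g j)) * v j))
      - (v i + \<delta> * (c * g i * v i + (\<Sum>j\<in>UNIV. A $ j $ i * v j)))\<bar> \<le> \<epsilon> * \<delta>"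
      using elim[rule_format, of i] by (simp only: norm_of_real)
  qed
qed

context modulated_chain
begin

lemma cell_bound:
  assumes Z: "ctmc M A Z" and \<eta>: "\<eta> > 0" and \<omega>: "\<omega> \<in> space M"
  shows "\<bar>cell Z \<eta> k \<omega>\<bar> \<le> \<eta> * B"
proof -
  have "\<bar>\<Sum>l<r. \<eta> / real r * g (Z (real (k * r + Suc l) * (\<eta> / real r)) \<omega>)\<bar> \<le> \<eta> * B" for r
  proof -
    have "\<bar>\<Sum>l<r. \<eta> / real r * g (Z (real (k * r + Suc l) * (\<eta> / real r)) \<omega>)\<bar> \<le> (\<Sum>l<r. \<eta> / real r * B)"
      using \<eta> B_bounds(1) by (intro order_trans[OF sum_abs] sum_mono) (auto simp: abs_mult simp del: of_nat_add of_nat_Suc of_nat_mult intro!: mult_left_mono divide_right_mono)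
    also have "\<dots> \<le> \<eta> * B" using \<eta> B_bounds(5) by (cases "r = 0") auto
    finally show ?thesis .
  qed
  then show ?thesis
    unfolding cell_def
    by (intro tendsto_upperbound[OF tendsto_rabs[OF cell_riemann[OF Z \<eta> \<omega>]]] always_eventually allI) auto
qed

text \<open>An upper bound gets by with the first corrector: for
  \<open>v i = 1 + z * f i / sqrt n\<close> the terms of order \<open>sqrt n\<close> cancel exactly
  and \<open>z\<^sup>2 * g i * f i\<close> is left. The restriction on \<open>z\<close> keeps
  \<open>v\<close> between 1/2 and 3/2, so that it can be exchanged for 1 at both ends, which gives
  the factor 3; the \<open>+ 1\<close> in the exponent absorbs the one-step remainder.\<close>

lemma cell_exp_moment:
  fixes Z :: "real \<Rightarrow> 'a \<Rightarrow> 'd"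
  assumes Z: "ctmc M (real n *\<^sub>R Q) Z" and n: "n \<ge> 1" and \<eta>: "\<eta> > 0"
    and z: "\<bar>z\<bar> * B \<le> sqrt n / 2"
  shows "(\<integral>\<omega>. exp (z * sqrt n * cell Z \<eta> k \<omega>) \<partial>M) \<le> 3 * exp ((2 * B\<^sup>2 * z\<^sup>2 + 1) * \<eta>)"
proof -
  interpret prob_space M using Z by (simp add: ctmc_def)
  define s where "s = sqrt (real n)"
  have s: "s \<ge> 1" "real n = s * s" using n by (auto simp: s_def)
  define v where "v i = 1 + z * f i / s" for i
  define c where "c = z * s"
  define a where "a = 2 * B\<^sup>2 * z\<^sup>2 + 1"
  have a0: "a \<ge> 0" by (simp add: a_def)
  have vb: "1 / 2 \<le> v i" "v i \<le> 3 / 2" for i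
  proof -
    have "\<bar>z * f i\<bar> \<le> \<bar>z\<bar> * B" unfolding abs_mult using B_bounds(2) by (intro mult_left_mono) auto
    also have "\<dots> \<le> s / 2" using z by (simp add: s_def)
    finally have "\<bar>z * f i / s\<bar> \<le> 1 / 2" using s by (simp add: field_simps)
    then show "1 / 2 \<le> v i" "v i \<le> 3 / 2" unfolding v_def by linarith+
  qed
  have L: "c * g i * v i + (\<Sum>j\<in>UNIV. (real n *\<^sub>R Q) $ j $ i * v j) = z\<^sup>2 * (g i * f i)" for i
  proof -
    have "(\<Sum>j\<in>UNIV. (real n *\<^sub>R Q) $ j $ i * v j) = real n * (\<Sum>j\<in>UNIV. Q $ j $ i) + real n * z / s * (\<Sum>j\<in>UNIV. Q $ j $ i * f j)"
      unfolding v_def sum_distrib_left sum.distrib[symmetric] by (intro sum.cong refl) (simp add: algebra_simps)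
    also have "\<dots> = - s * z * g i" unfolding generator_colsum[OF gen] poisson_f using s by simp
    finally show ?thesis unfolding v_def c_def using s by (simp add: field_simps power2_eq_square)
  qed
  have Lb: "z\<^sup>2 * (g i * f i) \<le> 2 * B\<^sup>2 * z\<^sup>2 * v i" for i
  proof -
    have "g i * f i \<le> \<bar>g i\<bar> * \<bar>f i\<bar>" by (metis abs_ge_self abs_mult)
    also have "\<dots> \<le> B * B" using B_bounds(1,2)[of i] B_bounds(5) by (intro mult_mono) auto
    finally have "z\<^sup>2 * (g i * f i) \<le> z\<^sup>2 * (B * B)" by (intro mult_left_mono) auto
    also have "\<dots> \<le> z\<^sup>2 * (B * B) * (2 * v i)"
      using vb(1)[of i] mult_left_mono[of 1 "2 * v i" "z\<^sup>2 * (B * B)"] by simp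
    finally show ?thesis by (simp add: power2_eq_square mult_ac)
  qed
  define R where "R r \<omega> = (\<Sum>l<r. \<eta> / real r * g (Z (real (k * r + Suc l) * (\<eta> / real r)) \<omega>))" for r \<omega>
  have Rb: "\<bar>R r \<omega>\<bar> \<le> \<eta> * B" for r \<omega>
  proof -
    have "\<bar>R r \<omega>\<bar> \<le> (\<Sum>l<r. \<eta> / real r * B)" unfolding R_def
      using \<eta> B_bounds(1) by (intro order_trans[OF sum_abs] sum_mono) (auto simp: abs_mult simp del: of_nat_add of_nat_Suc of_nat_mult intro!: mult_left_mono divide_right_mono)
    also have "\<dots> \<le> \<eta> * B" using \<eta> B_bounds(5) by (cases "r = 0") auto
    finally show ?thesis .
  qed
  have [measurable]: "R r \<in> borel_measurable M" for r
    unfolding R_def[abs_def] by (rule ctmc_riemann_measurable[OF Z \<eta>])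
  note [measurable] = cell_measurable[OF Z \<eta>]
  have eb: "norm (exp (c * R r \<omega>)) \<le> exp (\<bar>c\<bar> * (\<eta> * B))" for r \<omega>
  proof -
    have "c * R r \<omega> \<le> \<bar>c\<bar> * \<bar>R r \<omega>\<bar>" by (metis abs_ge_self abs_mult)
    also have "\<dots> \<le> \<bar>c\<bar> * (\<eta> * B)" using Rb by (intro mult_left_mono) auto
    finally show ?thesis by simp
  qed
  have lim: "(\<lambda>r. \<integral>\<omega>. exp (c * R r \<omega>) \<partial>M) \<longlonglongrightarrow> (\<integral>\<omega>. exp (c * cell Z \<eta> k \<omega>) \<partial>M)"
  proof (rule integral_dominated_convergence[where w = "\<lambda>_. exp (\<bar>c\<bar> * (\<eta> * B))"])
    show "AE \<omega> in M. (\<lambda>r. exp (c * R r \<omega>)) \<longlonglongrightarrow> exp (c * cell Z \<eta> k \<omega>)"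
      unfolding R_def cell_def by (intro AE_I2 tendsto_intros cell_riemann[OF Z \<eta>])
  qed (use eb in auto)
  have h: "filterlim (\<lambda>r. \<eta> / real r) (at_right 0) sequentially"
    unfolding filterlim_at using \<eta> lim_const_over_n[of \<eta>]
    by (auto intro!: eventually_sequentiallyI[of 1])
  \<comment> \<open>The fixed tolerance 1/2 suffices because \<open>v\<close> is at least
    1/2.\<close>
  have "\<forall>\<^sub>F r in sequentially. \<forall>i. \<bar>(\<Sum>j\<in>UNIV. mexp ((\<eta> / real r) *\<^sub>R (real n *\<^sub>R Q)) $ j $ i * (exp (c * ((\<eta> / real r) * g j)) * v j))
      - (v i + (\<eta> / real r) * (c * g i * v i + (\<Sum>j\<in>UNIV. (real n *\<^sub>R Q) $ j $ i * v j)))\<bar> \<le> (1 / 2) * (\<eta> / real r)"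
    by (rule eventually_compose_filterlim[OF tilted_step_expansion_real h]) simp
  then have "\<forall>\<^sub>F r in sequentially. (\<integral>\<omega>. exp (c * R r \<omega>) \<partial>M) \<le> 3 * exp (a * \<eta>)"
    using eventually_gt_at_top[of 0]
  proof eventually_elim
    case (elim r)
    define \<delta> where "\<delta> = \<eta> / real r"
    have \<delta>: "\<delta> > 0" using \<eta> elim by (simp add: \<delta>_def)
    have step: "(\<Sum>j\<in>UNIV. mexp (\<delta> *\<^sub>R (real n *\<^sub>R Q)) $ j $ i * (exp (c * (\<delta> * g j)) * v j)) \<le> (1 + \<delta> * a) * v i" for i
    proof -
      have "(\<Sum>j\<in>UNIV. mexp (\<delta> *\<^sub>R (real n *\<^sub>R Q)) $ j $ i * (exp (c * (\<delta> * g j)) * v j)) \<le> v i + \<delta> * (z\<^sup>2 * (g i * f i)) + 1 / 2 * \<delta>"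
        using elim(1)[rule_format, of i] unfolding L \<delta>_def by linarith
      also have "\<dots> \<le> v i + \<delta> * (2 * B\<^sup>2 * z\<^sup>2 * v i) + v i * \<delta>"
        using \<delta> by (intro add_mono mult_left_mono mult_right_mono Lb vb) auto
      also have "\<dots> = (1 + \<delta> * a) * v i" by (simp add: a_def algebra_simps)
      finally show ?thesis .
    qed
    have [measurable]: "(\<lambda>\<omega>. v (Z t \<omega>)) \<in> borel_measurable M" if "t \<ge> 0" for t
      by (rule ctmc_measurable[OF Z that])
    have nn: "1 + \<delta> * a \<ge> 0" using \<delta> a0 by simp
    have tp: "real (k * r + r) * \<delta> \<ge> 0" "real (k * r) * \<delta> \<ge> 0" using \<delta> by auto
    have int: "integrable M (\<lambda>\<omega>. exp (c * R r \<omega>) * v (Z (real (k * r + r) * \<delta>) \<omega>))"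
    proof (rule Bochner_Integration.integrable_bound[OF integrable_const[of "exp (\<bar>c\<bar> * (\<eta> * B)) * 2"]])
      show "(\<lambda>\<omega>. exp (c * R r \<omega>) * v (Z (real (k * r + r) * \<delta>) \<omega>)) \<in> borel_measurable M"
        using tp by measurable
      show "AE \<omega> in M. norm (exp (c * R r \<omega>) * v (Z (real (k * r + r) * \<delta>) \<omega>)) \<le> norm (exp (\<bar>c\<bar> * (\<eta> * B)) * 2)"
      proof (rule AE_I2)
        fix \<omega>
        have "\<bar>v i\<bar> \<le> 2" for i using vb[of i] by auto
        then show "norm (exp (c * R r \<omega>) * v (Z (real (k * r + r) * \<delta>) \<omega>)) \<le> norm (exp (\<bar>c\<bar> * (\<eta> * B)) * 2)"
          unfolding norm_mult using eb[of r \<omega>] by (intro mult_mono) auto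
      qed
    qed
    have int0: "integrable M (\<lambda>\<omega>. exp (c * R r \<omega>))"
      by (rule Bochner_Integration.integrable_bound[OF integrable_const[of "exp (\<bar>c\<bar> * (\<eta> * B))"]]) (use eb in auto)
    have "(\<integral>\<omega>. exp (c * R r \<omega>) \<partial>M) \<le> (\<integral>\<omega>. 2 * (exp (c * R r \<omega>) * v (Z (real (k * r + r) * \<delta>) \<omega>)) \<partial>M)"
    proof (rule integral_mono[OF int0])
      show "integrable M (\<lambda>\<omega>. 2 * (exp (c * R r \<omega>) * v (Z (real (k * r + r) * \<delta>) \<omega>)))" using int by simp
      fix \<omega>
      have "exp (c * R r \<omega>) * 1 \<le> exp (c * R r \<omega>) * (2 * v (Z (real (k * r + r) * \<delta>) \<omega>))"
        using vb(1)[of "Z (real (k * r + r) * \<delta>) \<omega>"] by (intro mult_left_mono) (linarith, simp)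
      then show "exp (c * R r \<omega>) \<le> 2 * (exp (c * R r \<omega>) * v (Z (real (k * r + r) * \<delta>) \<omega>))" by simp
    qed
    also have "\<dots> = 2 * (\<integral>\<omega>. exp (c * R r \<omega>) * v (Z (real (k * r + r) * \<delta>) \<omega>) \<partial>M)" by simp
    also have "\<dots> \<le> 2 * ((1 + \<delta> * a) ^ r * (\<integral>\<omega>. v (Z (real (k * r) * \<delta>) \<omega>) \<partial>M))"
      using grid_tilt_iterate_real[OF Z \<delta> step nn, where m = r and J = "k * r"]
      by (intro mult_left_mono) (simp_all add: R_def \<delta>_def del: of_nat_add of_nat_mult of_nat_Suc)
    also have "\<dots> \<le> 2 * (exp (a * \<eta>) * (3 / 2))"
    proof (intro mult_left_mono mult_mono)
      have "(1 + \<delta> * a) ^ r \<le> exp (\<delta> * a) ^ r"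
        using \<delta> a0 by (intro power_mono exp_ge_add_one_self) auto
      also have "\<dots> = exp (a * \<eta>)" using elim by (simp add: exp_of_nat_mult[symmetric] \<delta>_def)
      finally show "(1 + \<delta> * a) ^ r \<le> exp (a * \<eta>)" .
      have "norm (\<integral>\<omega>. v (Z (real (k * r) * \<delta>) \<omega>) \<partial>M) \<le> 3 / 2"
      proof (rule norm_expectation_le)
        fix \<omega> show "norm (v (Z (real (k * r) * \<delta>) \<omega>)) \<le> 3 / 2"
          using vb[of "Z (real (k * r) * \<delta>) \<omega>"] by simp
      qed simp
      then show "(\<integral>\<omega>. v (Z (real (k * r) * \<delta>) \<omega>) \<partial>M) \<le> 3 / 2" by simp
      have "0 \<le> v i" for i using vb(1)[of i] by linarith
      then show "0 \<le> (\<integral>\<omega>. v (Z (real (k * r) * \<delta>) \<omega>) \<partial>M)"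
        by (intro Bochner_Integration.integral_nonneg) auto
    qed auto
    finally show ?case by simp
  qed
  then have "(\<integral>\<omega>. exp (c * cell Z \<eta> k \<omega>) \<partial>M) \<le> 3 * exp (a * \<eta>)"
    by (rule tendsto_upperbound[OF lim]) simp
  then show ?thesis by (simp add: c_def s_def a_def)
qed

lemma exp_cell_integrable:
  assumes Z: "ctmc M A Z" and \<eta>: "\<eta> > 0"
  shows "integrable M (\<lambda>\<omega>. exp (z * \<bar>cell Z \<eta> k \<omega>\<bar>))"
proof -
  interpret prob_space M using Z by (simp add: ctmc_def)
  note [measurable] = cell_measurable[OF Z \<eta>]
  have "z * \<bar>cell Z \<eta> k \<omega>\<bar> \<le> \<bar>z\<bar> * (\<eta> * B)" if "\<omega> \<in> space M" for \<omega>
    using mult_mono[OF abs_ge_self[of z] cell_bound[OF Z \<eta> that, of k]] by auto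
  then show ?thesis
    by (intro Bochner_Integration.integrable_bound[OF integrable_const[of "exp (\<bar>z\<bar> * (\<eta> * B))"]]) auto
qed

lemma cell_exp_abs_moment:
  assumes Z: "ctmc M (real n *\<^sub>R Q) Z" and n: "n \<ge> 1" and \<eta>: "\<eta> > 0"
    and z: "z \<ge> 0" "z * B \<le> sqrt n / 2"
  shows "(\<integral>\<omega>. exp (z * (sqrt n * \<bar>cell Z \<eta> k \<omega>\<bar>)) \<partial>M) \<le> 6 * exp ((2 * B\<^sup>2 * z\<^sup>2 + 1) * \<eta>)"
proof -
  interpret prob_space M using Z by (simp add: ctmc_def)
  note [measurable] = cell_measurable[OF Z \<eta>]
  have b: "norm (exp (w * sqrt n * cell Z \<eta> k \<omega>)) \<le> exp (\<bar>w * sqrt n\<bar> * (\<eta> * B))" if "\<omega> \<in> space M" for \<omega> w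
  proof -
    have "w * sqrt n * cell Z \<eta> k \<omega> \<le> \<bar>w * sqrt n\<bar> * \<bar>cell Z \<eta> k \<omega>\<bar>" by (metis abs_ge_self abs_mult)
    also have "\<dots> \<le> \<bar>w * sqrt n\<bar> * (\<eta> * B)" using cell_bound[OF Z \<eta> that] by (intro mult_left_mono) auto
    finally show ?thesis by simp
  qed
  have i: "integrable M (\<lambda>\<omega>. exp (w * sqrt n * cell Z \<eta> k \<omega>))" for w
    by (rule Bochner_Integration.integrable_bound[OF integrable_const[of "exp (\<bar>w * sqrt n\<bar> * (\<eta> * B))"]])
       (use b in auto)
  have "(\<integral>\<omega>. exp (z * (sqrt n * \<bar>cell Z \<eta> k \<omega>\<bar>)) \<partial>M) \<le> (\<integral>\<omega>. exp (z * sqrt n * cell Z \<eta> k \<omega>) + exp ((- z) * sqrt n * cell Z \<eta> k \<omega>) \<partial>M)"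
  proof (rule integral_mono)
    show "integrable M (\<lambda>\<omega>. exp (z * (sqrt n * \<bar>cell Z \<eta> k \<omega>\<bar>)))"
      using exp_cell_integrable[OF Z \<eta>, of "z * sqrt n" k] by (simp add: mult.assoc)
    show "integrable M (\<lambda>\<omega>. exp (z * sqrt n * cell Z \<eta> k \<omega>) + exp ((- z) * sqrt n * cell Z \<eta> k \<omega>))"
      by (intro Bochner_Integration.integrable_add i)
    show "exp (z * (sqrt n * \<bar>cell Z \<eta> k \<omega>\<bar>)) \<le> exp (z * sqrt n * cell Z \<eta> k \<omega>) + exp ((- z) * sqrt n * cell Z \<eta> k \<omega>)" for \<omega>
      by (cases "cell Z \<eta> k \<omega> \<ge> 0") (simp_all add: mult.assoc less_imp_le add_increasing add_increasing2)
  qed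
  also have "\<dots> = (\<integral>\<omega>. exp (z * sqrt n * cell Z \<eta> k \<omega>) \<partial>M) + (\<integral>\<omega>. exp ((- z) * sqrt n * cell Z \<eta> k \<omega>) \<partial>M)"
    by (rule Bochner_Integration.integral_add[OF i i])
  also have "\<dots> \<le> 3 * exp ((2 * B\<^sup>2 * z\<^sup>2 + 1) * \<eta>) + 3 * exp ((2 * B\<^sup>2 * (- z)\<^sup>2 + 1) * \<eta>)"
    using z by (intro add_mono cell_exp_moment[OF Z n \<eta>]) auto
  finally show ?thesis by simp
qed

end

section \<open>Binomial mixtures of default times\<close>

lemma abs_exp_minus_1_le: "\<bar>exp x - 1\<bar> \<le> \<bar>x\<bar> * exp \<bar>x\<bar>" for x :: real
proof (cases "x \<ge> 0")
  case True
  have "1 - x \<le> exp (- x)" using exp_ge_add_one_self[of "- x"] by simp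
  then have "(1 - x) * exp x \<le> exp (- x) * exp x" by (intro mult_right_mono) auto
  then show ?thesis using True by (simp add: exp_minus algebra_simps)
next
  case False
  have "1 + x \<le> exp x" by (rule exp_ge_add_one_self)
  moreover have "- x * 1 \<le> - x * exp (- x)" using False by (intro mult_left_mono) auto
  moreover have "exp x \<le> 1" using False by simp
  ultimately have "1 - exp x \<le> - x * exp (- x)" by linarith
  then show ?thesis using False \<open>exp x \<le> 1\<close> by simp
qed

lemma abs_exp_minus_1_minus_le: "\<bar>exp x - 1 - x\<bar> \<le> x\<^sup>2 * exp \<bar>x\<bar>" for x :: real
proof -
  have "exp x - 1 \<le> x * exp x"
  proof -
    have "1 - x \<le> exp (- x)" using exp_ge_add_one_self[of "- x"] by simp
    then have "(1 - x) * exp x \<le> exp (- x) * exp x" by (intro mult_right_mono) auto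
    then show ?thesis by (simp add: exp_minus algebra_simps)
  qed
  then have "exp x - 1 - x \<le> x * (exp x - 1)" by (simp add: algebra_simps)
  also have "\<dots> \<le> \<bar>x\<bar> * \<bar>exp x - 1\<bar>" by (metis abs_ge_self abs_mult)
  also have "\<dots> \<le> \<bar>x\<bar> * (\<bar>x\<bar> * exp \<bar>x\<bar>)" by (intro mult_left_mono abs_exp_minus_1_le) auto
  also have "\<dots> = x\<^sup>2 * exp \<bar>x\<bar>" by (simp add: power2_eq_square mult.assoc[symmetric])
  finally show ?thesis using exp_ge_add_one_self[of x] by (intro abs_leI) linarith+
qed

text \<open>The real part of the exponent is at most zero, so the quadratic remainder carries no
  exponential factor.\<close>

lemma exp_taylor_halfplane:
  fixes \<alpha> s :: real
  assumes "s \<ge> 0"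
  shows "norm (exp (\<i> * of_real \<alpha> - of_real s) - (1 + (\<i> * of_real \<alpha> - of_real s))) \<le> (\<bar>\<alpha>\<bar> + s)\<^sup>2"
proof -
  have 1: "norm (iexp \<alpha> - 1 - \<i> * of_real \<alpha>) \<le> \<alpha>\<^sup>2 / 2"
    using iexp_approx1[of \<alpha> 1] by (simp add: diff_diff_eq power2_eq_square)
  have e: "0 \<le> 1 - exp (- s)" "1 - exp (- s) \<le> s" using exp_ge_add_one_self[of "- s"] assms by auto
  have 2: "\<bar>exp (- s) - 1 + s\<bar> \<le> s\<^sup>2"
  proof -
    have "1 + s \<le> exp s" by (rule exp_ge_add_one_self)
    then have "(1 + s) * exp (- s) \<le> 1" by (simp add: exp_minus field_simps)
    then have "exp (- s) - 1 + s \<le> s * (1 - exp (- s))" by (simp add: algebra_simps)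
    also have "\<dots> \<le> s * s" using e assms by (intro mult_left_mono) auto
    finally show ?thesis using e by (simp add: power2_eq_square)
  qed
  have ex: "exp (\<i> * of_real \<alpha> - of_real s) = iexp \<alpha> * of_real (exp (- s))"
    by (simp add: exp_diff exp_minus exp_of_real divide_inverse)
  have "exp (\<i> * of_real \<alpha> - of_real s) - (1 + (\<i> * of_real \<alpha> - of_real s))
      = (iexp \<alpha> - 1 - \<i> * of_real \<alpha>) * of_real (exp (- s)) + \<i> * of_real (\<alpha> * (exp (- s) - 1)) + of_real (exp (- s) - 1 + s)"
    unfolding ex by (simp add: algebra_simps)
  also have "norm \<dots> \<le> \<alpha>\<^sup>2 / 2 * 1 + \<bar>\<alpha>\<bar> * s + s\<^sup>2"
  proof (intro norm_triangle_mono)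
    show "norm ((iexp \<alpha> - 1 - \<i> * of_real \<alpha>) * of_real (exp (- s))) \<le> \<alpha>\<^sup>2 / 2 * 1"
      unfolding norm_mult by (intro mult_mono 1) (use assms in auto)
    show "norm (\<i> * complex_of_real (\<alpha> * (exp (- s) - 1))) \<le> \<bar>\<alpha>\<bar> * s"
      unfolding norm_mult norm_of_real abs_mult norm_ii mult_1_left using e by (intro mult_left_mono) auto
    show "norm (complex_of_real (exp (- s) - 1 + s)) \<le> s\<^sup>2" unfolding norm_of_real by (rule 2)
  qed
  also have "\<dots> \<le> (\<bar>\<alpha>\<bar> + s)\<^sup>2" using assms by (simp add: power2_eq_square algebra_simps)
  finally show ?thesis .
qed

text \<open>Summation by parts: \<open>w k\<close> is the probability of surviving the \<open>k\<close>-th grid time, so the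
  weights on the left are the cell probabilities of a default time.\<close>
lemma sum_cells:
  fixes c :: "nat \<Rightarrow> 'e::real_vector"
  shows "(\<Sum>\<kappa>\<le>K. (w \<kappa> - (if \<kappa> < K then w (Suc \<kappa>) else 0)) *\<^sub>R c \<kappa>)
    = (\<Sum>k\<le>K. w k *\<^sub>R (c k - (if k = 0 then 0 else c (k - 1))))"
proof (induction K)
  case (Suc K)
  have "(\<Sum>\<kappa>\<le>K. (w \<kappa> - (if \<kappa> < Suc K then w (Suc \<kappa>) else 0)) *\<^sub>R c \<kappa>)
      = (\<Sum>\<kappa>\<le>K. (w \<kappa> - (if \<kappa> < K then w (Suc \<kappa>) else 0)) *\<^sub>R c \<kappa> - (if \<kappa> = K then w (Suc K) *\<^sub>R c K else 0))"
    by (intro sum.cong) (auto simp: algebra_simps)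
  also have "\<dots> = (\<Sum>\<kappa>\<le>K. (w \<kappa> - (if \<kappa> < K then w (Suc \<kappa>) else 0)) *\<^sub>R c \<kappa>) - w (Suc K) *\<^sub>R c K"
    by (simp add: sum_subtractf)
  finally show ?case using Suc by (simp add: algebra_simps)
qed simp

text \<open>Defaulting in cell \<open>j\<close> or later means surviving the \<open>j\<close>-th
  grid time; this is the summation by parts for that indicator.\<close>

lemma sum_cells_of_bool:
  fixes w :: "nat \<Rightarrow> real"
  assumes "j \<le> K"
  shows "(\<Sum>\<kappa>\<le>K. (w \<kappa> - (if \<kappa> < K then w (Suc \<kappa>) else 0)) * of_bool (j \<le> \<kappa>)) = w j"
proof -
  have "(\<Sum>k\<le>K. w k *\<^sub>R ((of_bool (j \<le> k) :: real) - (if k = 0 then 0 else of_bool (j \<le> k - 1))))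
     = (\<Sum>k\<le>K. if k = j then w j else 0)"
    by (intro sum.cong) auto
  then show ?thesis using sum_cells[of w K "\<lambda>k. of_bool (j \<le> k) :: real"] assms by simp
qed

text \<open>Here \<open>- x \<kappa> / sqrt n\<close> is what an obligor defaulting in cell
  \<open>\<kappa>\<close> contributes, and the hypothesis on \<open>w\<close> says that
  \<open>y k / sqrt n\<close> is the deviation of the integrated intensity from its mean. Under
  \<open>q\<close>, the first moment of \<open>x\<close> is linear in \<open>y / sqrt n\<close> up
  to order \<open>1 / n\<close>, and the second is \<open>\<sigma>\<close> up to order
  \<open>1 / sqrt n\<close>. The \<open>n\<close>-th power costs a factor \<open>n\<close>, so an
  expansion to third order leaves an error of order \<open>1 / sqrt n\<close>. The dependence on
  \<open>y\<close> is explicit because \<open>y\<close> will be random and the bound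
  integrated.\<close>

lemma mixture_char_approx:
  fixes u a y :: "nat \<Rightarrow> real" and n K :: nat
  assumes n: "n \<ge> 1" and a: "\<And>k. k \<le> K \<Longrightarrow> 1 \<le> a k" "\<And>k. k \<le> K \<Longrightarrow> a k \<le> A" "\<And>k. k < K \<Longrightarrow> a k \<le> a (Suc k)"
    and a0: "a 0 = 1" "y 0 = 0" and Cy: "\<And>k. k \<le> K \<Longrightarrow> \<bar>y k\<bar> \<le> Cy * sqrt n"
    and w: "\<And>k. w k = exp (- y k / sqrt n) / a k" and wdec: "\<And>k. k < K \<Longrightarrow> w (Suc k) \<le> w k"
  defines "q \<equiv> \<lambda>\<kappa>. w \<kappa> - (if \<kappa> < K then w (Suc \<kappa>) else 0)"
    and "x \<equiv> \<lambda>\<kappa>. \<Sum>j<K. u j * (a (Suc j) * of_bool (Suc j \<le> \<kappa>) - a j * of_bool (j \<le> \<kappa>))"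
    and "\<sigma> \<equiv> \<Sum>j<K. (u j)\<^sup>2 * (a (Suc j) - a j)"
    and "U \<equiv> \<Sum>j<K. \<bar>u j\<bar>"
  shows "norm ((\<Sum>\<kappa>\<le>K. of_real (q \<kappa>) * exp (\<i> * of_real (- x \<kappa> / sqrt n))) ^ n
        - exp (\<i> * of_real (\<Sum>j<K. u j * (y (Suc j) - y j)) - of_real (\<sigma> / 2)))
     \<le> (2 * U * exp Cy + 2 * U\<^sup>2 * A\<^sup>2 * exp Cy + (2 * U * A)^3 / 6 + 8 * U\<^sup>2 + \<sigma>\<^sup>2 / 2) * (1 + (\<Sum>k\<le>K. (y k)\<^sup>2)) / sqrt n"
proof -
  define s where "s = sqrt (real n)"
  have s: "s \<ge> 1" "real n = s * s" using n by (auto simp: s_def)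
  \<comment> \<open>\<open>S\<close> dominates 1, every \<open>(y k)\<^sup>2\<close> and therefore
    every \<open>\<bar>y k\<bar>\<close>, so each error can be bounded linearly in
    \<open>S\<close>.\<close>
  define S where "S = 1 + (\<Sum>k\<le>K. (y k)\<^sup>2)"
  define D where "D = (\<Sum>j<K. u j * (y (Suc j) - y j))"
  have yS: "(y k)\<^sup>2 \<le> S" if "k \<le> K" for k
    using member_le_sum[of k "{..K}" "\<lambda>k. (y k)\<^sup>2"] that by (simp add: S_def)
  have S1: "S \<ge> 1" by (simp add: S_def sum_nonneg)
  have A1: "A \<ge> 1" using a(1)[of 0] a(2)[of 0] by simp
  have U0: "U \<ge> 0" unfolding U_def by (intro sum_nonneg) auto
  have yc: "\<bar>y k / s\<bar> \<le> Cy" if "k \<le> K" for k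
    using Cy[OF that, folded s_def] s(1) by (simp add: abs_divide pos_divide_le_eq)
  have q0: "q \<kappa> \<ge> 0" if "\<kappa> \<le> K" for \<kappa>
    using wdec[of \<kappa>] a(1)[OF that] by (cases "\<kappa> < K") (simp_all add: q_def, simp add: w)
  have qsum: "(\<Sum>\<kappa>\<le>K. q \<kappa>) = 1"
    using sum_cells_of_bool[of 0 K w] a0 by (simp add: q_def w)
  have qb: "(\<Sum>\<kappa>\<le>K. q \<kappa> * of_bool (j \<le> \<kappa>)) = w j" if "j \<le> K" for j
    using sum_cells_of_bool[OF that, of w] by (simp add: q_def)
  \<comment> \<open>The weights \<open>a\<close> cancel the mean survival probabilities and leave
    the fluctuation.\<close>
  have aw: "a k * w k = exp (- y k / s)" if "k \<le> K" for k
    using a(1)[OF that] by (simp add: w s_def)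
  define X where "X = 2 * U * A"
  have xb: "\<bar>x \<kappa>\<bar> \<le> X" for \<kappa>
  proof -
    have "\<bar>x \<kappa>\<bar> \<le> (\<Sum>j<K. \<bar>u j\<bar> * (A + A))" unfolding x_def
    proof (intro order_trans[OF sum_abs] sum_mono)
      fix j assume "j \<in> {..<K}"
      then have b: "0 \<le> a (Suc j)" "a (Suc j) \<le> A" "0 \<le> a j" "a j \<le> A"
        using a(1,2)[of j] a(1,2)[of "Suc j"] by auto
      have "\<bar>a (Suc j) * of_bool (Suc j \<le> \<kappa>) - a j * of_bool (j \<le> \<kappa>)\<bar> \<le> A + A"
        using b by (cases "Suc j \<le> \<kappa>"; cases "j \<le> \<kappa>") auto
      then show "\<bar>u j * (a (Suc j) * of_bool (Suc j \<le> \<kappa>) - a j * of_bool (j \<le> \<kappa>))\<bar> \<le> \<bar>u j\<bar> * (A + A)"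
        unfolding abs_mult by (intro mult_left_mono) auto
    qed
    then show ?thesis by (simp add: X_def U_def sum_distrib_left sum_distrib_right mult_ac)
  qed
  define s1 where "s1 = (\<Sum>\<kappa>\<le>K. q \<kappa> * x \<kappa>)"
  define s2 where "s2 = (\<Sum>\<kappa>\<le>K. q \<kappa> * (x \<kappa>)\<^sup>2)"
  have s1_eq: "s1 = (\<Sum>j<K. u j * (exp (- y (Suc j) / s) - exp (- y j / s)))"
  proof -
    have "s1 = (\<Sum>j<K. \<Sum>\<kappa>\<le>K. q \<kappa> * (u j * (a (Suc j) * of_bool (Suc j \<le> \<kappa>) - a j * of_bool (j \<le> \<kappa>))))"
      unfolding s1_def x_def sum_distrib_left by (rule sum.swap)
    also have "\<dots> = (\<Sum>j<K. u j * (a (Suc j) * (\<Sum>\<kappa>\<le>K. q \<kappa> * of_bool (Suc j \<le> \<kappa>)) - a j * (\<Sum>\<kappa>\<le>K. q \<kappa> * of_bool (j \<le> \<kappa>))))"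
      unfolding sum_distrib_left sum_subtractf[symmetric] by (intro sum.cong refl) (simp only: right_diff_distrib mult_ac)
    also have "\<dots> = (\<Sum>j<K. u j * (exp (- y (Suc j) / s) - exp (- y j / s)))"
    proof (intro sum.cong refl)
      fix j assume "j \<in> {..<K}"
      then have j: "j \<le> K" "Suc j \<le> K" by auto
      show "u j * (a (Suc j) * (\<Sum>\<kappa>\<le>K. q \<kappa> * of_bool (Suc j \<le> \<kappa>)) - a j * (\<Sum>\<kappa>\<le>K. q \<kappa> * of_bool (j \<le> \<kappa>)))
         = u j * (exp (- y (Suc j) / s) - exp (- y j / s))"
        unfolding qb[OF j(1)] qb[OF j(2)] aw[OF j(1)] aw[OF j(2)] ..
    qed
    finally show ?thesis .
  qed
  \<comment> \<open>The linear terms of \<open>s * s1\<close> give \<open>- D\<close>; what remains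
    are the second-order remainders \<open>h\<close>.\<close>
  have E1: "\<bar>s * s1 + D\<bar> \<le> 2 * U * exp Cy * S / s"
  proof -
    define h where "h k = s * (exp (- y k / s) - 1 - (- y k / s))" for k
    have hb: "\<bar>h k\<bar> \<le> S * exp Cy / s" if "k \<le> K" for k
    proof -
      have "\<bar>h k\<bar> = s * \<bar>exp (- y k / s) - 1 - (- y k / s)\<bar>" using s unfolding h_def abs_mult by simp
      also have "\<dots> \<le> s * ((- y k / s)\<^sup>2 * exp \<bar>- y k / s\<bar>)" using s by (intro mult_left_mono abs_exp_minus_1_minus_le) auto
      also have "\<dots> = (y k)\<^sup>2 * exp \<bar>y k / s\<bar> / s" using s by (simp add: power2_eq_square)
      also have "\<dots> \<le> S * exp Cy / s" using s yc[OF that] yS[OF that] S1 by (intro divide_right_mono mult_mono) auto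
      finally show ?thesis .
    qed
    have "s * s1 + D = (\<Sum>j<K. u j * (h (Suc j) - h j))"
      unfolding s1_eq D_def h_def sum_distrib_left sum.distrib[symmetric] using s
      by (intro sum.cong refl) (simp add: field_simps)
    also have "\<bar>\<dots>\<bar> \<le> (\<Sum>j<K. \<bar>u j\<bar> * (2 * (S * exp Cy / s)))"
    proof (intro order_trans[OF sum_abs] sum_mono)
      fix j assume "j \<in> {..<K}"
      then have "\<bar>h (Suc j) - h j\<bar> \<le> 2 * (S * exp Cy / s)" using hb[of j] hb[of "Suc j"] by auto
      then show "\<bar>u j * (h (Suc j) - h j)\<bar> \<le> \<bar>u j\<bar> * (2 * (S * exp Cy / s))"
        unfolding abs_mult by (intro mult_left_mono) auto
    qed
    also have "\<dots> = 2 * U * exp Cy * S / s" unfolding sum_distrib_right[symmetric] U_def[symmetric] by simp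
    finally show ?thesis .
  qed
  have E2: "\<bar>s2 - \<sigma>\<bar> \<le> 4 * U\<^sup>2 * A\<^sup>2 * exp Cy * S / s"
  proof -
    have dw: "\<bar>w k - 1 / a k\<bar> \<le> S * exp Cy / s" if "k \<le> K" for k
    proof -
      have "\<bar>w k - 1 / a k\<bar> = \<bar>exp (- y k / s) - 1\<bar> / a k"
        using a(1)[OF that] by (simp add: w s_def diff_divide_distrib[symmetric])
      also have "\<dots> \<le> \<bar>exp (- y k / s) - 1\<bar> / 1" using a(1)[OF that] by (intro divide_left_mono) auto
      also have "\<dots> \<le> \<bar>- y k / s\<bar> * exp \<bar>- y k / s\<bar>" unfolding div_by_1 by (rule abs_exp_minus_1_le)
      also have "\<dots> = \<bar>y k\<bar> * exp \<bar>y k / s\<bar> / s" using s by simp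
      also have "\<dots> \<le> S * exp Cy / s"
      proof (intro divide_right_mono mult_mono)
        have "\<bar>y k\<bar> \<le> S"
        proof (cases "\<bar>y k\<bar> \<le> 1")
          case False
          then have "\<bar>y k\<bar> * 1 \<le> \<bar>y k\<bar> * \<bar>y k\<bar>" by (intro mult_left_mono) auto
          then show ?thesis using yS[OF that] by (simp add: power2_eq_square)
        qed (use S1 in simp)
        then show "\<bar>y k\<bar> \<le> S" .
      qed (use s yc[OF that] S1 in auto)
      finally show ?thesis .
    qed
    define T where "T j l = (\<Sum>\<kappa>\<le>K. q \<kappa> * ((a (Suc j) * of_bool (Suc j \<le> \<kappa>) - a j * of_bool (j \<le> \<kappa>))
         * (a (Suc l) * of_bool (Suc l \<le> \<kappa>) - a l * of_bool (l \<le> \<kappa>))))" for j l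
    have ob: "of_bool (i \<le> \<kappa>) * of_bool (j \<le> \<kappa>) = (of_bool (max i j \<le> \<kappa>) :: real)" for i j \<kappa> :: nat by auto
    have T_eq: "T j l = a (Suc j) * a (Suc l) * w (max (Suc j) (Suc l)) - a (Suc j) * a l * w (max (Suc j) l)
        - a j * a (Suc l) * w (max j (Suc l)) + a j * a l * w (max j l)" if "j < K" "l < K" for j l
    proof -
      have "T j l = a (Suc j) * a (Suc l) * (\<Sum>\<kappa>\<le>K. q \<kappa> * of_bool (max (Suc j) (Suc l) \<le> \<kappa>))
         - a (Suc j) * a l * (\<Sum>\<kappa>\<le>K. q \<kappa> * of_bool (max (Suc j) l \<le> \<kappa>))
        - a j * a (Suc l) * (\<Sum>\<kappa>\<le>K. q \<kappa> * of_bool (max j (Suc l) \<le> \<kappa>))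
        + a j * a l * (\<Sum>\<kappa>\<le>K. q \<kappa> * of_bool (max j l \<le> \<kappa>))"
        unfolding T_def sum_distrib_left sum_subtractf[symmetric] sum.distrib[symmetric] ob[symmetric]
        by (intro sum.cong refl) (simp only: algebra_simps)
      then show ?thesis using that qb[of "max (Suc j) (Suc l)"] qb[of "max (Suc j) l"] qb[of "max j (Suc l)"] qb[of "max j l"] by simp
    qed
    \<comment> \<open>For \<open>y = 0\<close> the products have mean
      \<open>a i * a k / a (max i k)\<close>, which is \<open>a\<close> at the smaller index: the
      covariance of a process with orthogonal increments. Hence only the diagonal survives.\<close>
    have T0: "a (Suc j) * a (Suc l) * (1 / a (max (Suc j) (Suc l))) - a (Suc j) * a l * (1 / a (max (Suc j) l))
        - a j * a (Suc l) * (1 / a (max j (Suc l))) + a j * a l * (1 / a (max j l)) = (if j = l then a (Suc j) - a j else 0)" if "j < K" "l < K" for j l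
    proof -
      have nz: "a j \<noteq> 0" "a (Suc j) \<noteq> 0" "a l \<noteq> 0" "a (Suc l) \<noteq> 0"
        using a(1)[of j] a(1)[of "Suc j"] a(1)[of l] a(1)[of "Suc l"] that by auto
      consider "j = l" | "j < l" | "l < j" by linarith
      then show ?thesis
      proof cases
        case 1 then show ?thesis using nz by simp
      next
        case 2
        then have "max (Suc j) (Suc l) = Suc l" "max (Suc j) l = l" "max j (Suc l) = Suc l" "max j l = l" by auto
        then show ?thesis using nz 2 by simp
      next
        case 3
        then have "max (Suc j) (Suc l) = Suc j" "max (Suc j) l = Suc j" "max j (Suc l) = j" "max j l = j" by auto
        then show ?thesis using nz 3 by simp
      qed
    qed
    have Tb: "\<bar>T j l - (if j = l then a (Suc j) - a j else 0)\<bar> \<le> 4 * (A\<^sup>2 * (S * exp Cy / s))" if jl: "j < K" "l < K" for j l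
    proof -
      have one: "\<bar>a i * a k * (w m - 1 / a m)\<bar> \<le> A\<^sup>2 * (S * exp Cy / s)" if "i \<le> K" "k \<le> K" "m \<le> K" for i k m
      proof -
        have "\<bar>a i * a k\<bar> \<le> A * A" unfolding abs_mult using a(1,2)[of i] a(1,2)[of k] that by (intro mult_mono) auto
        then show ?thesis unfolding abs_mult[of "a i * a k"] power2_eq_square
          using dw[OF that(3)] A1 by (intro mult_mono) auto
      qed
      have four: "\<bar>z\<bar> \<le> 4 * e" if "z = b1 - b2 - b3 + b4" "\<bar>b1\<bar> \<le> e" "\<bar>b2\<bar> \<le> e" "\<bar>b3\<bar> \<le> e" "\<bar>b4\<bar> \<le> e"
        for z b1 b2 b3 b4 e :: real
        using that by linarith
      have "T j l - (if j = l then a (Suc j) - a j else 0) =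
         a (Suc j) * a (Suc l) * (w (max (Suc j) (Suc l)) - 1 / a (max (Suc j) (Suc l)))
         - a (Suc j) * a l * (w (max (Suc j) l) - 1 / a (max (Suc j) l))
         - a j * a (Suc l) * (w (max j (Suc l)) - 1 / a (max j (Suc l)))
         + a j * a l * (w (max j l) - 1 / a (max j l))"
        unfolding T_eq[OF jl] T0[OF jl, symmetric] by (simp only: right_diff_distrib)
      moreover have "\<bar>a (Suc j) * a (Suc l) * (w (max (Suc j) (Suc l)) - 1 / a (max (Suc j) (Suc l)))\<bar> \<le> A\<^sup>2 * (S * exp Cy / s)"
        "\<bar>a (Suc j) * a l * (w (max (Suc j) l) - 1 / a (max (Suc j) l))\<bar> \<le> A\<^sup>2 * (S * exp Cy / s)"
        "\<bar>a j * a (Suc l) * (w (max j (Suc l)) - 1 / a (max j (Suc l)))\<bar> \<le> A\<^sup>2 * (S * exp Cy / s)"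
        "\<bar>a j * a l * (w (max j l) - 1 / a (max j l))\<bar> \<le> A\<^sup>2 * (S * exp Cy / s)"
        by (rule one; use jl in simp)+
      ultimately show ?thesis by (rule four)
    qed
    have "s2 = (\<Sum>j<K. \<Sum>l<K. u j * u l * T j l)"
    proof -
      define e where "e j \<kappa> = a (Suc j) * of_bool (Suc j \<le> \<kappa>) - a j * of_bool (j \<le> \<kappa>)" for j \<kappa>
      have sq: "q \<kappa> * (x \<kappa>)\<^sup>2 = (\<Sum>j<K. \<Sum>l<K. u j * u l * (q \<kappa> * (e j \<kappa> * e l \<kappa>)))" for \<kappa>
      proof -
        have "(x \<kappa>)\<^sup>2 = (\<Sum>j<K. \<Sum>l<K. (u j * e j \<kappa>) * (u l * e l \<kappa>))"
          unfolding x_def e_def power2_eq_square by (rule sum_product)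
        then show ?thesis by (simp only: sum_distrib_left mult_ac)
      qed
      have "s2 = (\<Sum>j<K. \<Sum>\<kappa>\<le>K. \<Sum>l<K. u j * u l * (q \<kappa> * (e j \<kappa> * e l \<kappa>)))"
        unfolding s2_def sq by (rule sum.swap)
      also have "\<dots> = (\<Sum>j<K. \<Sum>l<K. \<Sum>\<kappa>\<le>K. u j * u l * (q \<kappa> * (e j \<kappa> * e l \<kappa>)))"
        by (rule sum.cong[OF refl], rule sum.swap)
      finally show ?thesis by (simp only: T_def e_def sum_distrib_left)
    qed
    moreover have "\<sigma> = (\<Sum>j<K. \<Sum>l<K. u j * u l * (if j = l then a (Suc j) - a j else 0))"
    proof -
      have "(\<Sum>l<K. u j * u l * (if j = l then a (Suc j) - a j else 0)) = (u j)\<^sup>2 * (a (Suc j) - a j)" if "j < K" for j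
      proof -
        have "(\<Sum>l<K. u j * u l * (if j = l then a (Suc j) - a j else 0)) = (\<Sum>l<K. if j = l then (u j)\<^sup>2 * (a (Suc j) - a j) else 0)"
          by (intro sum.cong) (auto simp: power2_eq_square)
        then show ?thesis using that by simp
      qed
      then show ?thesis unfolding \<sigma>_def by (intro sum.cong) auto
    qed
    ultimately have "s2 - \<sigma> = (\<Sum>j<K. \<Sum>l<K. u j * u l * (T j l - (if j = l then a (Suc j) - a j else 0)))"
      by (simp only: right_diff_distrib sum_subtractf)
    also have "\<bar>\<dots>\<bar> \<le> (\<Sum>j<K. \<Sum>l<K. \<bar>u j\<bar> * \<bar>u l\<bar> * (4 * (A\<^sup>2 * (S * exp Cy / s))))"
    proof (rule order_trans[OF sum_abs sum_mono], rule order_trans[OF sum_abs sum_mono])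
      fix j l assume "j \<in> {..<K}" "l \<in> {..<K}"
      then have jl: "j < K" "l < K" by auto
      show "\<bar>u j * u l * (T j l - (if j = l then a (Suc j) - a j else 0))\<bar> \<le> \<bar>u j\<bar> * \<bar>u l\<bar> * (4 * (A\<^sup>2 * (S * exp Cy / s)))"
        unfolding abs_mult by (intro mult_left_mono Tb[OF jl]) simp
    qed
    also have "\<dots> = U * U * (4 * (A\<^sup>2 * (S * exp Cy / s)))"
    proof -
      have "U * U = (\<Sum>j<K. \<Sum>l<K. \<bar>u j\<bar> * \<bar>u l\<bar>)" unfolding U_def by (rule sum_product)
      then show ?thesis by (simp only: sum_distrib_right)
    qed
    finally show ?thesis by (simp add: power2_eq_square mult_ac)
  qed
  have Db: "D\<^sup>2 \<le> 4 * U\<^sup>2 * S"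
  proof -
    have "\<bar>D\<bar> \<le> (\<Sum>j<K. \<bar>u j\<bar> * (2 * sqrt S))" unfolding D_def
    proof (intro order_trans[OF sum_abs] sum_mono)
      fix j assume "j \<in> {..<K}"
      then have "\<bar>y j\<bar> \<le> sqrt S" "\<bar>y (Suc j)\<bar> \<le> sqrt S" using yS[of j] yS[of "Suc j"] by (auto intro: real_le_rsqrt)
      then show "\<bar>u j * (y (Suc j) - y j)\<bar> \<le> \<bar>u j\<bar> * (2 * sqrt S)"
        unfolding abs_mult by (intro mult_left_mono) auto
    qed
    also have "\<dots> = 2 * U * sqrt S" unfolding sum_distrib_right[symmetric] U_def[symmetric] by simp
    finally have "\<bar>D\<bar>\<^sup>2 \<le> (2 * U * sqrt S)\<^sup>2" by (intro power_mono) auto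
    then show ?thesis using S1 by (simp add: power_mult_distrib)
  qed
  have \<sigma>0: "\<sigma> \<ge> 0" unfolding \<sigma>_def using a(3) by (intro sum_nonneg) auto
  define m where "m = (\<Sum>\<kappa>\<le>K. of_real (q \<kappa>) * exp (\<i> * of_real (- x \<kappa> / s)))"
  \<comment> \<open>An \<open>n\<close>-th root of the target, so that the two powers can be
    compared through \<open>m - b\<close> inside the unit disc.\<close>
  define b where "b = exp (\<i> * of_real (D / n) - of_real (\<sigma> / 2 / n))"
  have m1: "norm m \<le> 1"
  proof -
    have "norm m \<le> (\<Sum>\<kappa>\<le>K. q \<kappa>)" unfolding m_def
      by (intro sum_norm_le) (use q0 in \<open>auto simp: norm_mult norm_exp_eq_Re\<close>)
    then show ?thesis using qsum by simp
  qed
  have b1: "norm b \<le> 1" unfolding b_def using \<sigma>0 by (simp add: norm_exp_eq_Re)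
  have bn: "b ^ n = exp (\<i> * of_real D - of_real (\<sigma> / 2))"
    unfolding b_def exp_of_nat_mult[symmetric] using n by (simp add: algebra_simps)
  have M: "norm (m - (1 - \<i> * of_real (s1 / s) - of_real (s2 / (2 * real n)))) \<le> X^3 / (6 * s^3)"
  proof -
    have nn: "complex_of_nat n = of_real s * of_real s" using s(2) by (metis of_real_mult of_real_of_nat_eq)
    have "1 - \<i> * of_real (s1 / s) - of_real (s2 / (2 * real n)) = (\<Sum>\<kappa>\<le>K. of_real (q \<kappa>) * (1 + \<i> * of_real (- x \<kappa> / s) - of_real ((- x \<kappa> / s)\<^sup>2 / 2)))"
    proof -
      have "(\<Sum>\<kappa>\<le>K. of_real (q \<kappa>) * (1 + \<i> * of_real (- x \<kappa> / s) - of_real ((- x \<kappa> / s)\<^sup>2 / 2)))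
        = of_real (\<Sum>\<kappa>\<le>K. q \<kappa>) - \<i> * of_real (\<Sum>\<kappa>\<le>K. q \<kappa> * x \<kappa> / s) - of_real (\<Sum>\<kappa>\<le>K. q \<kappa> * (x \<kappa>)\<^sup>2 / (2 * real n))"
        unfolding of_real_sum sum_distrib_left sum_subtractf[symmetric] s(2)
        by (intro sum.cong refl) (simp add: algebra_simps power2_eq_square nn)
      then show ?thesis unfolding qsum s1_def s2_def sum_divide_distrib by simp
    qed
    then have "m - (1 - \<i> * of_real (s1 / s) - of_real (s2 / (2 * real n))) = (\<Sum>\<kappa>\<le>K. of_real (q \<kappa>) *
       (exp (\<i> * of_real (- x \<kappa> / s)) - (1 + \<i> * of_real (- x \<kappa> / s) - of_real ((- x \<kappa> / s)\<^sup>2 / 2))))"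
      by (simp only: m_def right_diff_distrib sum_subtractf)
    also have "norm \<dots> \<le> (\<Sum>\<kappa>\<le>K. q \<kappa> * (X^3 / (6 * s^3)))"
    proof (intro sum_norm_le)
      fix \<kappa> assume \<kappa>: "\<kappa> \<in> {..K}"
      have "norm (exp (\<i> * of_real (- x \<kappa> / s)) - (1 + \<i> * of_real (- x \<kappa> / s) - of_real ((- x \<kappa> / s)\<^sup>2 / 2))) \<le> \<bar>- x \<kappa> / s\<bar>^3 / 6"
      proof -
        have ts: "(\<Sum>k\<le>2. (\<i> * complex_of_real t) ^ k / fact k) = 1 + \<i> * of_real t - of_real (t\<^sup>2 / 2)" for t
          by (simp add: eval_nat_numeral complex_eq_iff)
        have e: "y ^ Suc 2 / fact (Suc 2) = y^3 / 6" for y :: real by (simp add: eval_nat_numeral)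
        show ?thesis using iexp_approx1[of "- x \<kappa> / s" 2] unfolding ts e .
      qed
      also have "\<dots> \<le> (X / s)^3 / 6"
        using s xb[of \<kappa>] by (intro divide_right_mono power_mono) (auto simp: divide_right_mono)
      finally have "norm (exp (\<i> * of_real (- x \<kappa> / s)) - (1 + \<i> * of_real (- x \<kappa> / s) - of_real ((- x \<kappa> / s)\<^sup>2 / 2))) \<le> X^3 / (6 * s^3)"
        by (simp add: power_divide mult.commute)
      then show "norm (of_real (q \<kappa>) * (exp (\<i> * of_real (- x \<kappa> / s)) - (1 + \<i> * of_real (- x \<kappa> / s) - of_real ((- x \<kappa> / s)\<^sup>2 / 2)))) \<le> q \<kappa> * (X^3 / (6 * s^3))"
        unfolding norm_mult norm_of_real using q0[of \<kappa>] \<kappa> by (intro mult_mono) auto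
    qed
    also have "\<dots> = X^3 / (6 * s^3)" unfolding sum_distrib_right[symmetric] qsum by simp
    finally show ?thesis .
  qed
  have Bb: "norm (b - (1 + (\<i> * of_real (D / n) - of_real (\<sigma> / 2 / n)))) \<le> (\<bar>D / n\<bar> + \<sigma> / 2 / n)\<^sup>2"
    unfolding b_def using \<sigma>0 by (intro exp_taylor_halfplane) auto
  have mid: "norm ((1 - \<i> * of_real (s1 / s) - of_real (s2 / (2 * real n))) - (1 + (\<i> * of_real (D / n) - of_real (\<sigma> / 2 / n))))
      \<le> (2 * U * exp Cy * S / s + 2 * U\<^sup>2 * A\<^sup>2 * exp Cy * S / s) / n"
  proof -
    have "(1 - \<i> * of_real (s1 / s) - of_real (s2 / (2 * real n))) - (1 + (\<i> * of_real (D / n) - of_real (\<sigma> / 2 / n)))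
       = - (\<i> * of_real ((s * s1 + D) / n)) - of_real ((s2 - \<sigma>) / (2 * real n))"
      unfolding s(2) using s(1) by (simp add: complex_eq_iff field_simps)
    also have "norm \<dots> \<le> \<bar>s * s1 + D\<bar> / n + \<bar>s2 - \<sigma>\<bar> / (2 * real n)"
      by (intro order_trans[OF norm_triangle_ineq4] add_mono) (simp_all only: norm_minus_cancel norm_mult norm_ii norm_of_real, simp_all)
    also have "\<dots> \<le> (2 * U * exp Cy * S / s) / n + (4 * U\<^sup>2 * A\<^sup>2 * exp Cy * S / s) / (2 * real n)"
      using E1 E2 by (intro add_mono divide_right_mono) auto
    also have "\<dots> = (2 * U * exp Cy * S / s + 2 * U\<^sup>2 * A\<^sup>2 * exp Cy * S / s) / n"
      by (simp add: add_divide_distrib)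
    finally show ?thesis .
  qed
  have "norm (m - b) \<le> X^3 / (6 * s^3) + (2 * U * exp Cy * S / s + 2 * U\<^sup>2 * A\<^sup>2 * exp Cy * S / s) / n + (\<bar>D / n\<bar> + \<sigma> / 2 / n)\<^sup>2"
  proof -
    have tri: "norm (m - b) \<le> e1 + e2 + e3" if "norm (m - m') \<le> e1" "norm (m' - b') \<le> e2" "norm (b - b') \<le> e3" for m m' b b' :: complex and e1 e2 e3
    proof -
      have "norm (b' - b) \<le> e3" using that(3) by (simp only: norm_minus_commute)
      then have "norm ((m - m') + (m' - b') + (b' - b)) \<le> e1 + e2 + e3"
        by (rule norm_triangle_mono[OF norm_triangle_mono[OF that(1,2)]])
      then show ?thesis by simp
    qed
    show ?thesis by (rule tri[OF M mid Bb])
  qed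
  also have "\<dots> \<le> X^3 / 6 * S / s / n + (2 * U * exp Cy * S / s + 2 * U\<^sup>2 * A\<^sup>2 * exp Cy * S / s) / n + (8 * U\<^sup>2 + \<sigma>\<^sup>2 / 2) * S / s / n"
  proof (intro add_mono order_refl)
    have X0: "X \<ge> 0" using U0 A1 by (simp add: X_def)
    have "X^3 / (6 * s^3) = X^3 / 6 * 1 / s / n" unfolding s(2) by (simp add: power3_eq_cube)
    also have "\<dots> \<le> X^3 / 6 * S / s / n" using X0 S1 s by (intro divide_right_mono mult_left_mono) auto
    finally show "X^3 / (6 * s^3) \<le> X^3 / 6 * S / s / n" .
    have "(\<bar>D / n\<bar> + \<sigma> / 2 / n)\<^sup>2 = (\<bar>D\<bar> + \<sigma> / 2)\<^sup>2 / n / n"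
      using n by (simp add: power2_eq_square field_simps)
    also have "\<dots> \<le> (2 * D\<^sup>2 + \<sigma>\<^sup>2 / 2) / n / n"
    proof (intro divide_right_mono)
      have "0 \<le> (\<bar>D\<bar> - \<sigma> / 2)\<^sup>2" by simp
      then show "(\<bar>D\<bar> + \<sigma> / 2)\<^sup>2 \<le> 2 * D\<^sup>2 + \<sigma>\<^sup>2 / 2" by (simp add: power2_eq_square algebra_simps)
    qed auto
    also have "\<dots> \<le> ((8 * U\<^sup>2 + \<sigma>\<^sup>2 / 2) * S) / n / n"
    proof (intro divide_right_mono)
      have "\<sigma>\<^sup>2 / 2 * 1 \<le> \<sigma>\<^sup>2 / 2 * S" using S1 by (intro mult_left_mono) auto
      then show "2 * D\<^sup>2 + \<sigma>\<^sup>2 / 2 \<le> (8 * U\<^sup>2 + \<sigma>\<^sup>2 / 2) * S" using Db by (simp add: algebra_simps)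
    qed auto
    also have "\<dots> \<le> (8 * U\<^sup>2 + \<sigma>\<^sup>2 / 2) * S / s / n"
    proof (intro divide_right_mono divide_left_mono)
      show "s \<le> real n" unfolding s(2) using s(1) mult_left_mono[of 1 s s] by simp
    qed (use S1 s n in auto)
    finally show "(\<bar>D / n\<bar> + \<sigma> / 2 / n)\<^sup>2 \<le> (8 * U\<^sup>2 + \<sigma>\<^sup>2 / 2) * S / s / n" .
  qed
  also have "\<dots> = (2 * U * exp Cy + 2 * U\<^sup>2 * A\<^sup>2 * exp Cy + X^3 / 6 + 8 * U\<^sup>2 + \<sigma>\<^sup>2 / 2) * S / s / n"
    by (simp only: add_divide_distrib distrib_right)
  finally have mb: "norm (m - b) \<le> (2 * U * exp Cy + 2 * U\<^sup>2 * A\<^sup>2 * exp Cy + X^3 / 6 + 8 * U\<^sup>2 + \<sigma>\<^sup>2 / 2) * S / s / n" .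
  have "norm (m ^ n - b ^ n) \<le> n * norm (m - b)" by (rule norm_power_diff[OF m1 b1])
  also have "\<dots> \<le> n * ((2 * U * exp Cy + 2 * U\<^sup>2 * A\<^sup>2 * exp Cy + X^3 / 6 + 8 * U\<^sup>2 + \<sigma>\<^sup>2 / 2) * S / s / n)"
    by (intro mult_left_mono mb) auto
  also have "\<dots> = (2 * U * exp Cy + 2 * U\<^sup>2 * A\<^sup>2 * exp Cy + X^3 / 6 + 8 * U\<^sup>2 + \<sigma>\<^sup>2 / 2) * S / s"
    using n by simp
  finally show ?thesis unfolding bn m_def D_def X_def S_def s_def .
qed

text \<open>The default times are known through joint survival probabilities, so a product of linear
  combinations of survival indicators is expanded over all maps \<open>\<kappa>\<close> from
  obligors to grid indices. Each term has the product form of \<open>mm_binomial_defaults\<close>,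
  and since all obligors have the same conditional law, the expansion folds back into an
  \<open>n\<close>-th power.\<close>

lemma binomial_mixture_expectation:
  fixes Z :: "real \<Rightarrow> 'a \<Rightarrow> 'd::finite" and d :: "nat \<Rightarrow> complex"
  assumes Z: "ctmc M A Z" and mm: "mm_binomial_defaults M lam Z n \<tau>" and lam: "\<And>i. lam $ i \<ge> 0"
    and t: "\<And>k. k \<le> K \<Longrightarrow> t k \<ge> 0"
  shows "(\<integral>\<omega>. (\<Prod>i<n. \<Sum>k\<le>K. d k * of_bool (\<tau> i \<omega> > ereal (t k))) \<partial>M)
       = (\<integral>\<omega>. (\<Sum>k\<le>K. d k * of_real (exp (- integral {0..t k} (\<lambda>s. lam $ Z s \<omega>)))) ^ n \<partial>M)"
proof -
  interpret prob_space M using Z by (simp add: ctmc_def)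
  define P where "P = PiE {..<n} (\<lambda>_. {..K})"
  define L where "L k \<omega> = integral {0..t k} (\<lambda>s. lam $ Z s \<omega>)" for k \<omega>
  have finP: "finite P" unfolding P_def by (intro finite_PiE) auto
  have expand: "(\<Prod>i<n. \<Sum>k\<le>K. F i k) = (\<Sum>\<kappa>\<in>P. \<Prod>i<n. F i (\<kappa> i))" for F :: "nat \<Rightarrow> nat \<Rightarrow> complex"
    unfolding P_def by (rule prod_sum_PiE) auto
  have [measurable]: "\<tau> i \<in> borel_measurable M" if "i < n" for i
    using mm that by (simp add: mm_binomial_defaults_def)
  have [measurable]: "L k \<in> borel_measurable M" for k
    unfolding L_def[abs_def] by (rule ctmc_path_integral_measurable[OF Z]) simp
  \<comment> \<open>In the non-integrable case the integral is 0 by convention.\<close>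
  have L0: "0 \<le> L k \<omega>" for k \<omega>
    unfolding L_def using lam by (cases "(\<lambda>s. lam $ Z s \<omega>) integrable_on {0..t k}") (auto intro: integral_nonneg simp: not_integrable_integral)
  have prob: "prob {\<omega>\<in>space M. \<forall>i<n. \<tau> i \<omega> > ereal (t (\<kappa> i))} = (\<integral>\<omega>. (\<Prod>i<n. exp (- L (\<kappa> i) \<omega>)) \<partial>M)" if "\<kappa> \<in> P" for \<kappa>
  proof -
    have tp: "\<forall>i<n. t (\<kappa> i) \<ge> 0" using that t by (auto simp: P_def PiE_def Pi_def)
    have "space M \<in> sigma_sets (space M) {{\<omega>\<in>space M. Z s \<omega> = j} | s j. s \<ge> 0}" by (rule sigma_sets_top)
    with mm tp have "prob (space M \<inter> {\<omega>\<in>space M. \<forall>i<n. \<tau> i \<omega> > ereal (t (\<kappa> i))})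
        = (\<integral>\<omega>\<in>space M. (\<Prod>i<n. exp (- integral {0..t (\<kappa> i)} (\<lambda>s. lam $ Z s \<omega>))) \<partial>M)"
      unfolding mm_binomial_defaults_def by (elim conjE) (drule bspec, assumption, drule spec, erule mp)
    moreover have "space M \<inter> {\<omega>\<in>space M. \<forall>i<n. \<tau> i \<omega> > ereal (t (\<kappa> i))} = {\<omega>\<in>space M. \<forall>i<n. \<tau> i \<omega> > ereal (t (\<kappa> i))}" by auto
    ultimately show ?thesis by (simp add: set_integral_space[OF _] L_def set_lebesgue_integral_def cong: Bochner_Integration.integral_cong)
  qed
  have "(\<integral>\<omega>. (\<Prod>i<n. \<Sum>k\<le>K. d k * of_bool (\<tau> i \<omega> > ereal (t k))) \<partial>M)
     = (\<integral>\<omega>. (\<Sum>\<kappa>\<in>P. (\<Prod>i<n. d (\<kappa> i)) * of_real (indicator {\<omega>\<in>space M. \<forall>i<n. \<tau> i \<omega> > ereal (t (\<kappa> i))} \<omega>)) \<partial>M)"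
  proof (intro Bochner_Integration.integral_cong refl)
    fix \<omega> assume "\<omega> \<in> space M"
    have "(\<Prod>i<n. of_bool (\<tau> i \<omega> > ereal (t (\<kappa> i)))) = complex_of_real (indicator {\<omega>\<in>space M. \<forall>i<n. \<tau> i \<omega> > ereal (t (\<kappa> i))} \<omega>)" for \<kappa>
    proof (cases "\<forall>i<n. \<tau> i \<omega> > ereal (t (\<kappa> i))")
      case True then show ?thesis using \<open>\<omega> \<in> space M\<close> by simp
    next
      case False
      then have "(\<Prod>i<n. of_bool (\<tau> i \<omega> > ereal (t (\<kappa> i)))) = (0 :: complex)" by (intro prod_zero) auto
      then show ?thesis using False by simp
    qed
    then show "(\<Prod>i<n. \<Sum>k\<le>K. d k * of_bool (\<tau> i \<omega> > ereal (t k)))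
       = (\<Sum>\<kappa>\<in>P. (\<Prod>i<n. d (\<kappa> i)) * of_real (indicator {\<omega>\<in>space M. \<forall>i<n. \<tau> i \<omega> > ereal (t (\<kappa> i))} \<omega>))"
      unfolding expand prod.distrib by simp
  qed
  also have "\<dots> = (\<Sum>\<kappa>\<in>P. (\<Prod>i<n. d (\<kappa> i)) * of_real (prob {\<omega>\<in>space M. \<forall>i<n. \<tau> i \<omega> > ereal (t (\<kappa> i))}))"
  proof (subst Bochner_Integration.integral_sum)
    fix \<kappa>
    have ev: "{\<omega>\<in>space M. \<forall>i<n. \<tau> i \<omega> > ereal (t (\<kappa> i))} \<in> sets M" by measurable
    then have i: "integrable M (indicat_real {\<omega>\<in>space M. \<forall>i<n. \<tau> i \<omega> > ereal (t (\<kappa> i))})"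
      by (intro integrable_real_indicator) (auto simp: less_top[symmetric])
    then show "integrable M (\<lambda>\<omega>. (\<Prod>i<n. d (\<kappa> i)) * of_real (indicat_real {\<omega>\<in>space M. \<forall>i<n. \<tau> i \<omega> > ereal (t (\<kappa> i))} \<omega>))"
      by (intro Bochner_Integration.integrable_mult_right integrable_of_real)
  qed (simp add: Int_absorb1 subset_eq)
  also have "\<dots> = (\<Sum>\<kappa>\<in>P. \<integral>\<omega>. (\<Prod>i<n. d (\<kappa> i) * of_real (exp (- L (\<kappa> i) \<omega>))) \<partial>M)"
    by (intro sum.cong refl) (simp add: prob prod.distrib of_real_prod[symmetric] del: of_real_prod)
  also have "\<dots> = (\<integral>\<omega>. (\<Sum>\<kappa>\<in>P. \<Prod>i<n. d (\<kappa> i) * of_real (exp (- L (\<kappa> i) \<omega>))) \<partial>M)"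
  proof (intro Bochner_Integration.integral_sum[symmetric])
    fix \<kappa> assume "\<kappa> \<in> P"
    show "integrable M (\<lambda>\<omega>. \<Prod>i<n. d (\<kappa> i) * of_real (exp (- L (\<kappa> i) \<omega>)))"
    proof (rule Bochner_Integration.integrable_bound[OF integrable_const[of "\<Prod>i<n. norm (d (\<kappa> i))"]])
      show "AE \<omega> in M. norm (\<Prod>i<n. d (\<kappa> i) * of_real (exp (- L (\<kappa> i) \<omega>))) \<le> norm (\<Prod>i<n. norm (d (\<kappa> i)))"
        using L0 by (intro AE_I2) (auto simp: prod_norm[symmetric] norm_mult abs_prod intro!: prod_mono mult_left_le)
    qed measurable
  qed
  also have "\<dots> = (\<integral>\<omega>. (\<Sum>k\<le>K. d k * of_real (exp (- L k \<omega>))) ^ n \<partial>M)"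
    unfolding expand[of "\<lambda>i k. d k * of_real (exp (- L k \<omega>))" for \<omega>, symmetric] by simp
  finally show ?thesis unfolding L_def .
qed

section \<open>Finite-dimensional limits of the scaled process\<close>

text \<open>Turns a function of the cell index into a linear combination of survival indicators, the
  form in which \<open>binomial_mixture_expectation\<close> applies.\<close>

lemma telescope_of_bool:
  fixes c :: "nat \<Rightarrow> 'e::ring_1"
  assumes "\<kappa> \<le> K"
  shows "(\<Sum>k\<le>K. (c k - (if k = 0 then 0 else c (k - 1))) * of_bool (k \<le> \<kappa>)) = c \<kappa>"
  using assms
proof (induction K)
  case (Suc K)
  have tel: "(\<Sum>k\<le>m. c k - (if k = 0 then 0 else c (k - 1))) = c m" for m
    by (induction m) auto
  show ?case
  proof (cases "\<kappa> \<le> K")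
    case True
    then show ?thesis using Suc by simp
  next
    case False
    then have "\<kappa> = Suc K" using Suc by simp
    then show ?thesis using tel[of "Suc K"] by (simp del: sum.atMost_Suc)
  qed
qed simp

text \<open>\<open>\<kappa>\<close> is the cell of the default time, with everything beyond the last
  grid time put into cell \<open>K\<close>. Exceeding \<open>t 0\<close> makes the maximum well
  defined.\<close>

lemma exceed_index:
  fixes x :: ereal and t :: "nat \<Rightarrow> real"
  assumes "mono t" "x > ereal (t 0)"
  obtains \<kappa> where "\<kappa> \<le> K" "\<And>k. k \<le> K \<Longrightarrow> x > ereal (t k) \<longleftrightarrow> k \<le> \<kappa>"
proof -
  define S where "S = {k. k \<le> K \<and> x > ereal (t k)}"
  have S: "finite S" "0 \<in> S" using assms by (auto simp: S_def)
  show ?thesis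
  proof (rule that[of "Max S"])
    have mx: "Max S \<in> S" using S by (intro Max_in) auto
    then show "Max S \<le> K" by (simp add: S_def)
    fix k assume k: "k \<le> K"
    show "x > ereal (t k) \<longleftrightarrow> k \<le> Max S"
    proof
      assume "x > ereal (t k)"
      then show "k \<le> Max S" using S k by (intro Max_ge) (auto simp: S_def)
    next
      assume "k \<le> Max S"
      then have "ereal (t k) \<le> ereal (t (Max S))" using assms(1) by (simp add: monoD)
      also have "\<dots> < x" using mx by (simp add: S_def)
      finally show "x > ereal (t k)" .
    qed
  qed
qed

lemma counting_process_eq:
  "real (counting_process n \<tau> t \<omega>) = real n - (\<Sum>i<n. of_bool (\<tau> i \<omega> > ereal t))"
proof -
  have "{i. i < n \<and> \<tau> i \<omega> \<le> ereal t} = {..<n} \<inter> {i. \<tau> i \<omega> \<le> ereal t}" by auto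
  then have "real (counting_process n \<tau> t \<omega>) = (\<Sum>i<n. of_bool (\<tau> i \<omega> \<le> ereal t))"
    by (simp add: counting_process_def)
  also have "\<dots> = (\<Sum>i<n. 1 - of_bool (\<tau> i \<omega> > ereal t))"
    by (intro sum.cong) (auto simp: not_le)
  finally show ?thesis by (simp add: sum_subtractf)
qed

lemma counting_process_measurable:
  assumes "mm_binomial_defaults M lam Z n \<tau>"
  shows "(\<lambda>\<omega>. real (counting_process n \<tau> t \<omega>)) \<in> borel_measurable M"
proof -
  have [measurable]: "\<tau> i \<in> borel_measurable M" if "i < n" for i
    using assms that by (simp add: mm_binomial_defaults_def)
  show ?thesis unfolding counting_process_eq by measurable
qed

text \<open>The case of the single grid time 0, where the integrated intensity vanishes. Values in
  \<open>ereal\<close> could otherwise be zero or negative.\<close>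

lemma mm_binomial_positive:
  assumes Z: "ctmc M A Z" and mm: "mm_binomial_defaults M lam Z n \<tau>" and lam: "\<And>i. lam $ i \<ge> 0"
  shows "AE \<omega> in M. \<forall>i<n. \<tau> i \<omega> > ereal 0"
proof -
  interpret prob_space M using Z by (simp add: ctmc_def)
  have [measurable]: "\<tau> i \<in> borel_measurable M" if "i < n" for i
    using mm that by (simp add: mm_binomial_defaults_def)
  have ev: "{\<omega>\<in>space M. \<forall>i<n. \<tau> i \<omega> > ereal 0} \<in> sets M" by measurable
  have e: "(\<Prod>i<n. of_bool (\<tau> i \<omega> > ereal 0)) = complex_of_real (indicator {\<omega>\<in>space M. \<forall>i<n. \<tau> i \<omega> > ereal 0} \<omega>)" if "\<omega> \<in> space M" for \<omega>
  proof (cases "\<forall>i<n. \<tau> i \<omega> > ereal 0")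
    case True then show ?thesis using that by simp
  next
    case False
    then have "(\<Prod>i<n. of_bool (\<tau> i \<omega> > ereal 0)) = (0 :: complex)" by (intro prod_zero) auto
    then show ?thesis using False by simp
  qed
  have "(\<integral>\<omega>. (\<Prod>i<n. \<Sum>k\<le>(0::nat). 1 * of_bool (\<tau> i \<omega> > ereal 0)) \<partial>M)
       = (\<integral>\<omega>. (\<Sum>k\<le>(0::nat). 1 * complex_of_real (exp (- integral {0..0} (\<lambda>s. lam $ Z s \<omega>)))) ^ n \<partial>M)"
    by (rule binomial_mixture_expectation[OF Z mm lam]) simp
  then have "(\<integral>\<omega>. (\<Prod>i<n. of_bool (\<tau> i \<omega> > ereal 0)) \<partial>M) = (1 :: complex)" by (simp add: prob_space)
  also have "(\<integral>\<omega>. (\<Prod>i<n. of_bool (\<tau> i \<omega> > ereal 0)) \<partial>M)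
     = (\<integral>\<omega>. complex_of_real (indicator {\<omega>\<in>space M. \<forall>i<n. \<tau> i \<omega> > ereal 0} \<omega>) \<partial>M)"
    by (intro Bochner_Integration.integral_cong refl e)
  also have "\<dots> = complex_of_real (prob {\<omega>\<in>space M. \<forall>i<n. \<tau> i \<omega> > ereal 0})"
    by (simp add: Int_absorb1 subset_eq)
  finally have "prob {\<omega>\<in>space M. \<forall>i<n. \<tau> i \<omega> > ereal 0} = 1" by (simp only: of_real_eq_1_iff)
  then show ?thesis using AE_prob_1 by force
qed

context modulated_chain
begin

definition rho :: "real \<Rightarrow> real" where "rho t = 1 - exp (- linf * t)"

definition Nhat :: "nat \<Rightarrow> (nat \<Rightarrow> 'a \<Rightarrow> ereal) \<Rightarrow> real \<Rightarrow> 'a \<Rightarrow> real" where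
  "Nhat n \<tau> t \<omega> = (real (counting_process n \<tau> t \<omega>) - real n * rho t) / sqrt (real n)"

lemma Nhat_measurable: "mm_binomial_defaults M lam Z n \<tau> \<Longrightarrow> Nhat n \<tau> t \<in> borel_measurable M"
  unfolding Nhat_def[abs_def] by (intro borel_measurable_divide borel_measurable_diff counting_process_measurable borel_measurable_const)

lemma compensator_cells:
  assumes Z: "ctmc M A Z" and \<eta>: "\<eta> > 0" and \<omega>: "\<omega> \<in> space M"
  shows "integral {0..real k * \<eta>} (\<lambda>s. lam $ Z s \<omega>) = (\<Sum>j<k. cell Z \<eta> j \<omega>) + linf * (real k * \<eta>)"
    and "0 \<le> cell Z \<eta> j \<omega> + linf * \<eta>" "cell Z \<eta> j \<omega> + linf * \<eta> \<le> B * \<eta>"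
proof -
  have io: "(\<lambda>s. h (Z s \<omega>)) integrable_on {a..b}" if "0 \<le> a" "a \<le> b" for a b and h :: "'d \<Rightarrow> real"
    using ctmc_path_integral(1)[OF Z that(1) _ \<omega>, of b h] that(2) integrable_on_refl[of "\<lambda>s. h (Z s \<omega>)" b]
    by (cases "a = b") auto
  have c: "integral {real j * \<eta>..real (Suc j) * \<eta>} (\<lambda>s. lam $ Z s \<omega>) = cell Z \<eta> j \<omega> + linf * \<eta>" for j
  proof -
    have "cell Z \<eta> j \<omega> = integral {real j * \<eta>..real (Suc j) * \<eta>} (\<lambda>s. lam $ Z s \<omega>) - integral {real j * \<eta>..real (Suc j) * \<eta>} (\<lambda>s. linf)"
      unfolding cell_def g_def using \<eta> by (intro integral_diff io integrable_const_ivl) (auto intro!: mult_right_mono)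
    also have "integral {real j * \<eta>..real (Suc j) * \<eta>} (\<lambda>s. linf) = linf * \<eta>"
      using \<eta> by (simp add: algebra_simps)
    finally show ?thesis by simp
  qed
  show "integral {0..real k * \<eta>} (\<lambda>s. lam $ Z s \<omega>) = (\<Sum>j<k. cell Z \<eta> j \<omega>) + linf * (real k * \<eta>)"
  proof (induction k)
    case (Suc k)
    have "integral {0..real (Suc k) * \<eta>} (\<lambda>s. lam $ Z s \<omega>) = integral {0..real k * \<eta>} (\<lambda>s. lam $ Z s \<omega>)
       + integral {real k * \<eta>..real (Suc k) * \<eta>} (\<lambda>s. lam $ Z s \<omega>)"
      using \<eta> by (intro Henstock_Kurzweil_Integration.integral_combine[symmetric] io) (auto intro!: mult_right_mono)
    then show ?case unfolding c Suc by (simp add: algebra_simps)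
  qed simp
  show "0 \<le> cell Z \<eta> j \<omega> + linf * \<eta>"
    unfolding c[symmetric] using \<eta> lam_nonneg by (intro integral_nonneg io) (auto intro!: mult_right_mono)
  have "integral {real j * \<eta>..real (Suc j) * \<eta>} (\<lambda>s. lam $ Z s \<omega>) \<le> integral {real j * \<eta>..real (Suc j) * \<eta>} (\<lambda>s. B)"
    using \<eta> B_bounds(4) by (intro integral_le io integrable_const_ivl) (auto intro!: mult_right_mono)
  also have "\<dots> = B * \<eta>" using \<eta> by (simp add: algebra_simps)
  finally show "cell Z \<eta> j \<omega> + linf * \<eta> \<le> B * \<eta>" unfolding c .
qed

lemma cell_second_moment:
  assumes Z: "ctmc M (real n *\<^sub>R Q) Z" and n: "n \<ge> 1" and \<eta>: "\<eta> > 0"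
  shows "(\<integral>\<omega>. (sqrt n * cell Z \<eta> k \<omega>)\<^sup>2 \<partial>M) \<le> 48 * B\<^sup>2 * exp (2 * \<eta>)"
proof -
  interpret prob_space M using Z by (simp add: ctmc_def)
  \<comment> \<open>The largest parameter that \<open>cell_exp_abs_moment\<close> admits for every
    \<open>n \<ge> 1\<close>.\<close>
  define z where "z = 1 / (2 * B)"
  have B1: "B \<ge> 1" by (rule B_bounds)
  have z: "z \<ge> 0" "z * B = 1 / 2" using B1 by (auto simp: z_def)
  have zz: "1 / z\<^sup>2 = 4 * B\<^sup>2" by (simp add: z_def power2_eq_square)
  have sq: "x\<^sup>2 \<le> 8 * B\<^sup>2 * exp (z * \<bar>x\<bar>)" for x :: real
  proof -
    have "1 + z * \<bar>x\<bar> + (z * \<bar>x\<bar>)\<^sup>2 / 2 \<le> exp (z * \<bar>x\<bar>)" using z by (intro exp_lower_Taylor_quadratic) auto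
    moreover have "0 \<le> z * \<bar>x\<bar>" using z by simp
    ultimately have "(z * \<bar>x\<bar>)\<^sup>2 / 2 \<le> exp (z * \<bar>x\<bar>)" by linarith
    then have "(8 * B\<^sup>2) * ((z * \<bar>x\<bar>)\<^sup>2 / 2) \<le> (8 * B\<^sup>2) * exp (z * \<bar>x\<bar>)" by (intro mult_left_mono) auto
    also have "(8 * B\<^sup>2) * ((z * \<bar>x\<bar>)\<^sup>2 / 2) = x\<^sup>2" using B1 by (simp add: z_def power_mult_distrib power_divide)
    finally show ?thesis .
  qed
  note [measurable] = cell_measurable[OF Z \<eta>]
  have i2: "integrable M (\<lambda>\<omega>. exp (z * (sqrt n * \<bar>cell Z \<eta> k \<omega>\<bar>)))"
    using exp_cell_integrable[OF Z \<eta>, of "z * sqrt n" k] by (simp add: mult.assoc)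
  have le: "(sqrt n * cell Z \<eta> k \<omega>)\<^sup>2 \<le> 8 * B\<^sup>2 * exp (z * (sqrt n * \<bar>cell Z \<eta> k \<omega>\<bar>))" for \<omega>
    using sq[of "sqrt n * cell Z \<eta> k \<omega>"] by (simp add: abs_mult)
  have "(\<integral>\<omega>. (sqrt n * cell Z \<eta> k \<omega>)\<^sup>2 \<partial>M) \<le> (\<integral>\<omega>. 8 * B\<^sup>2 * exp (z * (sqrt n * \<bar>cell Z \<eta> k \<omega>\<bar>)) \<partial>M)"
  proof (rule integral_mono)
    show "integrable M (\<lambda>\<omega>. (sqrt n * cell Z \<eta> k \<omega>)\<^sup>2)"
      by (rule Bochner_Integration.integrable_bound[OF Bochner_Integration.integrable_mult_right[OF i2, of "8 * B\<^sup>2"]])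
         (use le in \<open>auto simp: abs_mult\<close>)
  qed (use i2 le in auto)
  also have "\<dots> = 8 * B\<^sup>2 * (\<integral>\<omega>. exp (z * (sqrt n * \<bar>cell Z \<eta> k \<omega>\<bar>)) \<partial>M)" by simp
  also have "\<dots> \<le> 8 * B\<^sup>2 * (6 * exp ((2 * B\<^sup>2 * z\<^sup>2 + 1) * \<eta>))"
    using z n by (intro mult_left_mono cell_exp_abs_moment[OF Z n \<eta>]) (auto simp: z(2))
  also have "2 * B\<^sup>2 * z\<^sup>2 + 1 = 3 / 2" using B1 by (simp add: z_def power2_eq_square)
  also have "8 * B\<^sup>2 * (6 * exp (3 / 2 * \<eta>)) \<le> 8 * B\<^sup>2 * (6 * exp (2 * \<eta>))"
    using \<eta> by (intro mult_left_mono) auto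
  finally show ?thesis by simp
qed

text \<open>Merging \<open>k\<close> cells into one of width \<open>k * \<eta>\<close> lets the
  moment bounds for a single cell serve for partial sums.\<close>

lemma sum_cells_eq_cell:
  assumes Z: "ctmc M A Z" and \<eta>: "\<eta> > 0" and \<omega>: "\<omega> \<in> space M" and k: "k \<ge> 1"
  shows "(\<Sum>j<k. cell Z \<eta> j \<omega>) = cell Z (real k * \<eta>) 0 \<omega>"
  using compensator_cells(1)[OF Z \<eta> \<omega>, of k] compensator_cells(1)[OF Z _ \<omega>, of "real k * \<eta>" 1] \<eta> k by simp

lemma sum_cells_second_moment:
  assumes Z: "ctmc M (real n *\<^sub>R Q) Z" and n: "n \<ge> 1" and \<eta>: "\<eta> > 0" and k: "k \<le> K"
  shows "(\<integral>\<omega>. (sqrt n * (\<Sum>j<k. cell Z \<eta> j \<omega>))\<^sup>2 \<partial>M) \<le> 48 * B\<^sup>2 * exp (2 * (real K * \<eta>))"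
proof (cases "k \<ge> 1")
  case True
  have "(\<integral>\<omega>. (sqrt n * (\<Sum>j<k. cell Z \<eta> j \<omega>))\<^sup>2 \<partial>M) = (\<integral>\<omega>. (sqrt n * cell Z (real k * \<eta>) 0 \<omega>)\<^sup>2 \<partial>M)"
    using True by (intro Bochner_Integration.integral_cong refl) (simp add: sum_cells_eq_cell[OF Z \<eta>])
  also have "\<dots> \<le> 48 * B\<^sup>2 * exp (2 * (real k * \<eta>))"
    using True \<eta> by (intro cell_second_moment[OF Z n]) auto
  also have "\<dots> \<le> 48 * B\<^sup>2 * exp (2 * (real K * \<eta>))"
    using k \<eta> by (intro mult_left_mono) auto
  finally show ?thesis .
next
  case False
  then have "k = 0" by simp
  then show ?thesis by simp
qed

text \<open>Limiting variance of \<open>exp (linf * t) * Nhat\<close> at time \<open>t\<close>.\<close>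
definition Kvar :: "real \<Rightarrow> real" where "Kvar t = (exp (linf * t) - 1) + V * t"

text \<open>Exact for every \<open>n\<close>. The weight \<open>a k\<close> turns the centring into
  the constant \<open>sqrt n\<close>, which cancels in increments, so the exponent is a sum over
  obligors of \<open>- x \<kappa> / sqrt n\<close> with \<open>\<kappa>\<close> the cell of default;
  conditional independence gives the \<open>n\<close>-th power.\<close>

lemma scaled_Nhat_char:
  fixes Z :: "real \<Rightarrow> 'a \<Rightarrow> 'd" and u :: "nat \<Rightarrow> real" and K n :: nat
  assumes Z: "ctmc M (real n *\<^sub>R Q) Z" and mm: "mm_binomial_defaults M lam Z n \<tau>" and n: "n \<ge> 1" and \<eta>: "\<eta> > 0"
  defines "a \<equiv> \<lambda>k. exp (linf * (real k * \<eta>))"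
  defines "x \<equiv> \<lambda>\<kappa>. \<Sum>j<K. u j * (a (Suc j) * of_bool (Suc j \<le> \<kappa>) - a j * of_bool (j \<le> \<kappa>))"
    and "w \<equiv> \<lambda>\<omega> k. exp (- integral {0..real k * \<eta>} (\<lambda>s. lam $ Z s \<omega>))"
  shows "(\<integral>\<omega>. iexp (\<Sum>k<K. u k * (a (Suc k) * Nhat n \<tau> (real (Suc k) * \<eta>) \<omega> - a k * Nhat n \<tau> (real k * \<eta>) \<omega>)) \<partial>M)
     = (\<integral>\<omega>. (\<Sum>\<kappa>\<le>K. of_real (w \<omega> \<kappa> - (if \<kappa> < K then w \<omega> (Suc \<kappa>) else 0)) * iexp (- x \<kappa> / sqrt n)) ^ n \<partial>M)"
proof -
  interpret prob_space M using Z by (simp add: ctmc_def)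
  define s where "s = sqrt (real n)"
  have s: "s \<ge> 1" "real n = s * s" using n by (auto simp: s_def)
  define t where "t k = real k * \<eta>" for k
  have tm: "mono t" using \<eta> by (auto simp: t_def mono_def intro!: mult_right_mono)
  have an: "a k * Nhat n \<tau> (t k) \<omega> = s - a k * (\<Sum>i<n. of_bool (\<tau> i \<omega> > ereal (t k))) / s" for k \<omega>
  proof -
    have "a k * exp (- linf * t k) = 1" by (simp add: a_def t_def exp_add[symmetric])
    then have e: "a k * (real n * exp (- linf * t k)) = s * s" using s by (simp add: mult.left_commute)
    have "a k * Nhat n \<tau> (t k) \<omega> = (a k * (real n * exp (- linf * t k)) - a k * (\<Sum>i<n. of_bool (\<tau> i \<omega> > ereal (t k)))) / s"
      unfolding Nhat_def rho_def counting_process_eq s_def[symmetric] using s by (simp add: field_simps)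
    then show ?thesis unfolding e using s by (simp add: diff_divide_distrib)
  qed
  define \<psi> where "\<psi> \<kappa> = iexp (- x \<kappa> / s)" for \<kappa>
  define d where "d k = \<psi> k - (if k = 0 then 0 else \<psi> (k - 1))" for k
  have "(\<integral>\<omega>. iexp (\<Sum>k<K. u k * (a (Suc k) * Nhat n \<tau> (t (Suc k)) \<omega> - a k * Nhat n \<tau> (t k) \<omega>)) \<partial>M)
     = (\<integral>\<omega>. (\<Prod>i<n. \<Sum>k\<le>K. d k * of_bool (\<tau> i \<omega> > ereal (t k))) \<partial>M)"
  proof (rule integral_cong_AE)
    have [measurable]: "\<tau> i \<in> borel_measurable M" if "i < n" for i
      using mm that by (simp add: mm_binomial_defaults_def)
    note [measurable] = Nhat_measurable[OF mm]
    show "(\<lambda>\<omega>. iexp (\<Sum>k<K. u k * (a (Suc k) * Nhat n \<tau> (t (Suc k)) \<omega> - a k * Nhat n \<tau> (t k) \<omega>))) \<in> borel_measurable M" by measurable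
    show "(\<lambda>\<omega>. \<Prod>i<n. \<Sum>k\<le>K. d k * of_bool (\<tau> i \<omega> > ereal (t k))) \<in> borel_measurable M" by measurable
    show "AE \<omega> in M. iexp (\<Sum>k<K. u k * (a (Suc k) * Nhat n \<tau> (t (Suc k)) \<omega> - a k * Nhat n \<tau> (t k) \<omega>))
       = (\<Prod>i<n. \<Sum>k\<le>K. d k * of_bool (\<tau> i \<omega> > ereal (t k)))"
      using mm_binomial_positive[OF Z mm lam_nonneg]
    proof eventually_elim
      case (elim \<omega>)
      \<comment> \<open>Outside a null set every default time has a cell \<open>\<kappa>\<close>,
        and the coefficients \<open>d\<close> telescope to \<open>\<psi> \<kappa>\<close>.\<close>
      have fac: "(\<Sum>k\<le>K. d k * of_bool (\<tau> i \<omega> > ereal (t k)))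
         = iexp (- (\<Sum>j<K. u j * (a (Suc j) * of_bool (\<tau> i \<omega> > ereal (t (Suc j))) - a j * of_bool (\<tau> i \<omega> > ereal (t j)))) / s)"
        if i: "i < n" for i
      proof -
        have pos: "\<tau> i \<omega> > ereal (t 0)" using elim i by (simp add: t_def)
        obtain \<kappa> where \<kappa>: "\<kappa> \<le> K" "\<And>k. k \<le> K \<Longrightarrow> \<tau> i \<omega> > ereal (t k) \<longleftrightarrow> k \<le> \<kappa>"
          using exceed_index[OF tm pos] by metis
        have "(\<Sum>k\<le>K. d k * of_bool (\<tau> i \<omega> > ereal (t k))) = (\<Sum>k\<le>K. d k * of_bool (k \<le> \<kappa>))"
          using \<kappa>(2) by (intro sum.cong) auto
        also have "\<dots> = \<psi> \<kappa>" unfolding d_def by (rule telescope_of_bool[OF \<kappa>(1)])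
        also have "x \<kappa> = (\<Sum>j<K. u j * (a (Suc j) * of_bool (\<tau> i \<omega> > ereal (t (Suc j))) - a j * of_bool (\<tau> i \<omega> > ereal (t j))))"
          unfolding x_def using \<kappa>(2) by (intro sum.cong) auto
        then have "\<psi> \<kappa> = iexp (- (\<Sum>j<K. u j * (a (Suc j) * of_bool (\<tau> i \<omega> > ereal (t (Suc j))) - a j * of_bool (\<tau> i \<omega> > ereal (t j)))) / s)"
          unfolding \<psi>_def by (simp only:)
        finally show ?thesis .
      qed
      have "(\<Sum>k<K. u k * (a (Suc k) * Nhat n \<tau> (t (Suc k)) \<omega> - a k * Nhat n \<tau> (t k) \<omega>))
        = (\<Sum>k<K. \<Sum>i<n. - (u k * (a (Suc k) * of_bool (\<tau> i \<omega> > ereal (t (Suc k))) - a k * of_bool (\<tau> i \<omega> > ereal (t k)))) / s)"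
      proof (intro sum.cong refl)
        fix k
        have "u k * (a (Suc k) * Nhat n \<tau> (t (Suc k)) \<omega> - a k * Nhat n \<tau> (t k) \<omega>)
          = - u k / s * (a (Suc k) * (\<Sum>i<n. of_bool (\<tau> i \<omega> > ereal (t (Suc k)))) - a k * (\<Sum>i<n. of_bool (\<tau> i \<omega> > ereal (t k))))"
          unfolding an using s by (simp add: field_simps)
        also have "\<dots> = (\<Sum>i<n. - u k / s * (a (Suc k) * of_bool (\<tau> i \<omega> > ereal (t (Suc k))) - a k * of_bool (\<tau> i \<omega> > ereal (t k))))"
          by (simp only: sum_distrib_left[symmetric] sum_subtractf)
        finally show "u k * (a (Suc k) * Nhat n \<tau> (t (Suc k)) \<omega> - a k * Nhat n \<tau> (t k) \<omega>)
          = (\<Sum>i<n. - (u k * (a (Suc k) * of_bool (\<tau> i \<omega> > ereal (t (Suc k))) - a k * of_bool (\<tau> i \<omega> > ereal (t k)))) / s)"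
          by simp
      qed
      also have "\<dots> = (\<Sum>i<n. - (\<Sum>j<K. u j * (a (Suc j) * of_bool (\<tau> i \<omega> > ereal (t (Suc j))) - a j * of_bool (\<tau> i \<omega> > ereal (t j)))) / s)"
        by (subst sum.swap) (simp only: sum_negf[symmetric] sum_divide_distrib)
      finally show ?case
        by (simp only: of_real_sum sum_distrib_left exp_sum[OF finite_lessThan]) (intro prod.cong refl, simp only: lessThan_iff fac)
    qed
  qed
  also have "\<dots> = (\<integral>\<omega>. (\<Sum>k\<le>K. d k * of_real (exp (- integral {0..t k} (\<lambda>s. lam $ Z s \<omega>)))) ^ n \<partial>M)"
    using \<eta> by (intro binomial_mixture_expectation[OF Z mm lam_nonneg]) (simp add: t_def)
  also have "\<dots> = (\<integral>\<omega>. (\<Sum>\<kappa>\<le>K. of_real (w \<omega> \<kappa> - (if \<kappa> < K then w \<omega> (Suc \<kappa>) else 0)) * \<psi> \<kappa>) ^ n \<partial>M)"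
    using sum_cells[of "w \<omega>" K \<psi> for \<omega>] unfolding scaleR_conv_of_real
    by (simp only: d_def w_def t_def mult.commute)
  finally show ?thesis unfolding t_def \<psi>_def s_def .
qed

text \<open>Independence of the cells emerges in the limit: they are split off one at a time, each
  with the error of \<open>cell_char\<close>.\<close>

lemma cells_char_limit:
  fixes M :: "nat \<Rightarrow> 'a measure"
  assumes Z: "\<And>n. ctmc (M n) (real n *\<^sub>R Q) (Z n)" and \<eta>: "\<eta> > 0"
  shows "(\<lambda>n. \<integral>\<omega>. exp (\<Sum>k<K. \<i> * of_real (u k * sqrt n) * of_real (cell (Z n) \<eta> k \<omega>)) \<partial>M n)
     \<longlonglongrightarrow> of_real (exp (- (\<Sum>k<K. (u k)\<^sup>2 * (V * \<eta>)) / 2))"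
proof (induction K)
  case 0
  have "prob_space (M n)" for n using Z[of n] by (simp add: ctmc_def)
  then show ?case by (simp add: prob_space.prob_space)
next
  case (Suc K)
  let ?E = "\<lambda>K n. \<integral>\<omega>. exp (\<Sum>k<K. \<i> * of_real (u k * sqrt n) * of_real (cell (Z n) \<eta> k \<omega>)) \<partial>M n"
  let ?c = "complex_of_real (exp (- (u K)\<^sup>2 * V / 2 * \<eta>))"
  let ?C = "\<eta> * err (u K) + 2 * ((\<bar>u K\<bar> + (u K)\<^sup>2) * B)"
  have "(\<lambda>n. ?E (Suc K) n - ?c * ?E K n) \<longlonglongrightarrow> 0"
  proof (rule Lim_null_comparison)
    show "\<forall>\<^sub>F n in sequentially. norm (?E (Suc K) n - ?c * ?E K n) \<le> ?C / sqrt n"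
      using cell_char[OF Z _ \<eta>, where u = u and k = K] by (intro eventually_sequentiallyI[of 1]) simp
    show "(\<lambda>n. ?C / sqrt (real n)) \<longlonglongrightarrow> 0" by real_asymp
  qed
  from tendsto_add[OF this tendsto_mult[OF tendsto_const[of ?c] Suc]]
  have "?E (Suc K) \<longlonglongrightarrow> ?c * of_real (exp (- (\<Sum>k<K. (u k)\<^sup>2 * (V * \<eta>)) / 2))" by simp
  also have "?c * of_real (exp (- (\<Sum>k<K. (u k)\<^sup>2 * (V * \<eta>)) / 2)) = of_real (exp (- (\<Sum>k<Suc K. (u k)\<^sup>2 * (V * \<eta>)) / 2))"
    by (simp only: of_real_mult[symmetric] exp_add[symmetric]) (simp add: field_simps)
  finally show ?case .
qed

text \<open>Given the chain, the binomial part contributes the deterministic factor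
  \<open>exp (- \<sigma> / 2)\<close>; what stays random is the exponential of the centred cells.
  The error of \<open>mixture_char_approx\<close> is integrated with the second moments of the
  partial sums. In \<open>Kvar\<close>, the exponential part comes from \<open>\<sigma>\<close> and
  the part \<open>V * t\<close> from the cells.\<close>

theorem scaled_Nhat_fdd:
  fixes M :: "nat \<Rightarrow> 'a measure" and u :: "nat \<Rightarrow> real"
  assumes Z: "\<And>n. ctmc (M n) (real n *\<^sub>R Q) (Z n)" and mm: "\<And>n. mm_binomial_defaults (M n) lam (Z n) n (\<tau> n)" and \<eta>: "\<eta> > 0"
  shows "(\<lambda>n. \<integral>\<omega>. iexp (\<Sum>k<K. u k * (exp (linf * (real (Suc k) * \<eta>)) * Nhat n (\<tau> n) (real (Suc k) * \<eta>) \<omega>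
        - exp (linf * (real k * \<eta>)) * Nhat n (\<tau> n) (real k * \<eta>) \<omega>)) \<partial>M n)
     \<longlonglongrightarrow> of_real (exp (- (\<Sum>k<K. (u k)\<^sup>2 * (Kvar (real (Suc k) * \<eta>) - Kvar (real k * \<eta>))) / 2))"
proof -
  define a where "a k = exp (linf * (real k * \<eta>))" for k
  define \<sigma> where "\<sigma> = (\<Sum>j<K. (u j)\<^sup>2 * (a (Suc j) - a j))"
  define U where "U = (\<Sum>j<K. \<bar>u j\<bar>)"
  define A where "A = a K"
  \<comment> \<open>From \<open>cell_bound\<close>: up to time \<open>K * \<eta>\<close> the centred
    integrated intensity is at most \<open>K * \<eta> * B\<close>.\<close>
  define Cy where "Cy = real K * \<eta> * B"
  define C where "C = 2 * U * exp Cy + 2 * U\<^sup>2 * A\<^sup>2 * exp Cy + (2 * U * A)^3 / 6 + 8 * U\<^sup>2 + \<sigma>\<^sup>2 / 2"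
  define C2 where "C2 = 1 + real (Suc K) * (48 * B\<^sup>2 * exp (2 * (real K * \<eta>)))"
  let ?E = "\<lambda>n. \<integral>\<omega>. iexp (\<Sum>k<K. u k * (a (Suc k) * Nhat n (\<tau> n) (real (Suc k) * \<eta>) \<omega> - a k * Nhat n (\<tau> n) (real k * \<eta>) \<omega>)) \<partial>M n"
  let ?F = "\<lambda>n. \<integral>\<omega>. exp (\<Sum>k<K. \<i> * of_real (u k * sqrt n) * of_real (cell (Z n) \<eta> k \<omega>)) \<partial>M n"
  have a_mono: "a k \<le> a l" if "k \<le> l" for k l
    using that linf_nonneg \<eta> by (simp add: a_def mult_left_mono mult_right_mono)
  have a0: "a 0 = 1" by (simp add: a_def)
  have \<sigma>0: "\<sigma> \<ge> 0" unfolding \<sigma>_def using a_mono by (intro sum_nonneg) auto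
  have U0: "U \<ge> 0" unfolding U_def by (intro sum_nonneg) auto
  have A1: "A \<ge> 1" using a_mono[of 0 K] a0 by (simp add: A_def)
  have C0: "C \<ge> 0" unfolding C_def using U0 A1 by (intro add_nonneg_nonneg) auto
  have bound: "norm (?E n - of_real (exp (- \<sigma> / 2)) * ?F n) \<le> C * C2 / sqrt n" if n: "n \<ge> 1" for n
  proof -
    interpret prob_space "M n" using Z[of n] by (simp add: ctmc_def)
    define y where "y \<omega> k = sqrt n * (\<Sum>j<k. cell (Z n) \<eta> j \<omega>)" for \<omega> k
    define w where "w \<omega> k = exp (- integral {0..real k * \<eta>} (\<lambda>s. lam $ Z n s \<omega>))" for \<omega> k
    define x where "x \<kappa> = (\<Sum>j<K. u j * (a (Suc j) * of_bool (Suc j \<le> \<kappa>) - a j * of_bool (j \<le> \<kappa>)))" for \<kappa>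
    define m where "m \<omega> = (\<Sum>\<kappa>\<le>K. of_real (w \<omega> \<kappa> - (if \<kappa> < K then w \<omega> (Suc \<kappa>) else 0)) * iexp (- x \<kappa> / sqrt n)) ^ n" for \<omega>
    define b where "b \<omega> = exp (\<i> * of_real (\<Sum>j<K. u j * (y \<omega> (Suc j) - y \<omega> j)) - of_real (\<sigma> / 2))" for \<omega>
    have pt: "norm (m \<omega> - b \<omega>) \<le> C * (1 + (\<Sum>k\<le>K. (y \<omega> k)\<^sup>2)) / sqrt n" if \<omega>: "\<omega> \<in> space (M n)" for \<omega>
      unfolding m_def b_def x_def C_def \<sigma>_def U_def
    proof (rule mixture_char_approx[OF n])
      show "1 \<le> a k" for k using a_mono[of 0 k] a0 by simp
      show "a k \<le> A" if "k \<le> K" for k using a_mono[OF that] by (simp add: A_def)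
      show "a k \<le> a (Suc k)" for k by (rule a_mono) simp
      show "a 0 = 1" by (rule a0)
      show "y \<omega> 0 = 0" by (simp add: y_def)
      show "\<bar>y \<omega> k\<bar> \<le> Cy * sqrt n" if "k \<le> K" for k
      proof -
        have "\<bar>\<Sum>j<k. cell (Z n) \<eta> j \<omega>\<bar> \<le> (\<Sum>j<k. \<eta> * B)"
          by (intro order_trans[OF sum_abs] sum_mono cell_bound[OF Z \<eta> \<omega>])
        also have "\<dots> \<le> real K * (\<eta> * B)" using that \<eta> B_bounds(5) by (simp add: mult_right_mono)
        finally have "sqrt n * \<bar>\<Sum>j<k. cell (Z n) \<eta> j \<omega>\<bar> \<le> sqrt n * (real K * (\<eta> * B))"
          by (intro mult_left_mono) auto
        then show ?thesis by (simp add: y_def abs_mult Cy_def mult_ac)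
      qed
      show "w \<omega> k = exp (- y \<omega> k / sqrt n) / a k" for k
        unfolding w_def compensator_cells(1)[OF Z \<eta> \<omega>] y_def a_def using n by (simp add: exp_diff[symmetric])
      show "w \<omega> (Suc k) \<le> w \<omega> k" for k
        unfolding w_def compensator_cells(1)[OF Z \<eta> \<omega>] using compensator_cells(2)[OF Z \<eta> \<omega>, of k] by (simp add: algebra_simps)
    qed
    note [measurable] = cell_measurable[OF Z \<eta>, of n]
    have [measurable]: "(\<lambda>\<omega>. y \<omega> k) \<in> borel_measurable (M n)" for k unfolding y_def by measurable
    have [measurable]: "(\<lambda>\<omega>. w \<omega> k) \<in> borel_measurable (M n)" for k
      unfolding w_def by (intro measurable_compose[OF _ borel_measurable_exp] borel_measurable_uminus ctmc_path_integral_measurable[OF Z]) simp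
    have y2: "integrable (M n) (\<lambda>\<omega>. (y \<omega> k)\<^sup>2)" for k
    proof (rule Bochner_Integration.integrable_bound[OF integrable_const[of "(sqrt n * (real k * (\<eta> * B)))\<^sup>2"]])
      show "AE \<omega> in M n. norm ((y \<omega> k)\<^sup>2) \<le> norm ((sqrt n * (real k * (\<eta> * B)))\<^sup>2)"
      proof (rule AE_I2)
        fix \<omega> assume \<omega>: "\<omega> \<in> space (M n)"
        have "\<bar>\<Sum>j<k. cell (Z n) \<eta> j \<omega>\<bar> \<le> (\<Sum>j<k. \<eta> * B)"
          by (intro order_trans[OF sum_abs] sum_mono cell_bound[OF Z \<eta> \<omega>])
        then have "\<bar>y \<omega> k\<bar> \<le> sqrt n * (real k * (\<eta> * B))"
          unfolding y_def abs_mult by (auto intro!: mult_mono)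
        then have "\<bar>y \<omega> k\<bar>\<^sup>2 \<le> (sqrt n * (real k * (\<eta> * B)))\<^sup>2" by (intro power_mono) auto
        then show "norm ((y \<omega> k)\<^sup>2) \<le> norm ((sqrt n * (real k * (\<eta> * B)))\<^sup>2)" by simp
      qed
    qed measurable
    have iS: "integrable (M n) (\<lambda>\<omega>. C * (1 + (\<Sum>k\<le>K. (y \<omega> k)\<^sup>2)) / sqrt n)"
      using y2 by (intro Bochner_Integration.integrable_divide Bochner_Integration.integrable_mult_right Bochner_Integration.integrable_add Bochner_Integration.integrable_sum integrable_const)
    have bb: "norm (b \<omega>) \<le> 1" for \<omega> unfolding b_def using \<sigma>0 by (simp add: norm_exp_eq_Re)
    have [measurable]: "b \<in> borel_measurable (M n)" "m \<in> borel_measurable (M n)"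
      unfolding b_def[abs_def] m_def[abs_def] by measurable
    have ib: "integrable (M n) b"
      by (rule Bochner_Integration.integrable_bound[OF integrable_const[of "1::real"]]) (use bb in auto)
    have imb: "integrable (M n) (\<lambda>\<omega>. m \<omega> - b \<omega>)"
    proof (rule Bochner_Integration.integrable_bound[OF iS])
      show "AE \<omega> in M n. norm (m \<omega> - b \<omega>) \<le> norm (C * (1 + (\<Sum>k\<le>K. (y \<omega> k)\<^sup>2)) / sqrt n)"
        unfolding real_norm_def by (intro AE_I2 order_trans[OF pt abs_ge_self])
    qed measurable
    have im: "integrable (M n) m" using Bochner_Integration.integrable_add[OF imb ib] by simp
    have "?E n = (\<integral>\<omega>. m \<omega> \<partial>M n)"
      using scaled_Nhat_char[OF Z mm n \<eta>, where K = K and u = u] unfolding m_def x_def w_def a_def .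
    moreover have "of_real (exp (- \<sigma> / 2)) * ?F n = (\<integral>\<omega>. b \<omega> \<partial>M n)"
    proof -
      have beq: "b \<omega> = of_real (exp (- \<sigma> / 2)) * exp (\<Sum>k<K. \<i> * of_real (u k * sqrt n) * of_real (cell (Z n) \<eta> k \<omega>))" for \<omega>
      proof -
        have "(\<Sum>j<K. u j * (y \<omega> (Suc j) - y \<omega> j)) = (\<Sum>j<K. u j * sqrt n * cell (Z n) \<eta> j \<omega>)"
          by (intro sum.cong refl) (simp add: y_def algebra_simps)
        then have "\<i> * of_real (\<Sum>j<K. u j * (y \<omega> (Suc j) - y \<omega> j)) = (\<Sum>k<K. \<i> * of_real (u k * sqrt n) * of_real (cell (Z n) \<eta> k \<omega>))"
          by (simp add: sum_distrib_left mult.assoc)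
        moreover have "exp (A - complex_of_real (\<sigma> / 2)) = of_real (exp (- \<sigma> / 2)) * exp A" for A
          unfolding diff_conv_add_uminus exp_add of_real_minus[symmetric] exp_of_real by simp
        ultimately show ?thesis unfolding b_def by (simp only:)
      qed
      show ?thesis by (simp only: beq integral_mult_right_zero)
    qed
    ultimately have "?E n - of_real (exp (- \<sigma> / 2)) * ?F n = (\<integral>\<omega>. m \<omega> - b \<omega> \<partial>M n)"
      using Bochner_Integration.integral_diff[OF im ib] by simp
    also have "norm \<dots> \<le> (\<integral>\<omega>. norm (m \<omega> - b \<omega>) \<partial>M n)" by (rule integral_norm_bound)
    also have "\<dots> \<le> (\<integral>\<omega>. C * (1 + (\<Sum>k\<le>K. (y \<omega> k)\<^sup>2)) / sqrt n \<partial>M n)"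
      by (intro integral_mono integrable_norm imb iS pt)
    also have "\<dots> = C * (1 + (\<Sum>k\<le>K. \<integral>\<omega>. (y \<omega> k)\<^sup>2 \<partial>M n)) / sqrt n"
    proof -
      have "(\<integral>\<omega>. 1 + (\<Sum>k\<le>K. (y \<omega> k)\<^sup>2) \<partial>M n) = (\<integral>\<omega>. 1 \<partial>M n) + (\<integral>\<omega>. (\<Sum>k\<le>K. (y \<omega> k)\<^sup>2) \<partial>M n)"
        by (intro Bochner_Integration.integral_add Bochner_Integration.integrable_sum y2 integrable_const)
      also have "(\<integral>\<omega>. (\<Sum>k\<le>K. (y \<omega> k)\<^sup>2) \<partial>M n) = (\<Sum>k\<le>K. \<integral>\<omega>. (y \<omega> k)\<^sup>2 \<partial>M n)"
        by (intro Bochner_Integration.integral_sum y2)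
      finally have e: "(\<integral>\<omega>. 1 + (\<Sum>k\<le>K. (y \<omega> k)\<^sup>2) \<partial>M n) = 1 + (\<Sum>k\<le>K. \<integral>\<omega>. (y \<omega> k)\<^sup>2 \<partial>M n)"
        by (simp add: prob_space)
      show ?thesis by (simp only: integral_divide_zero integral_mult_right_zero e)
    qed
    also have "\<dots> \<le> C * C2 / sqrt n"
    proof (intro divide_right_mono mult_left_mono C0)
      have "(\<Sum>k\<le>K. \<integral>\<omega>. (y \<omega> k)\<^sup>2 \<partial>M n) \<le> (\<Sum>k\<le>K. 48 * B\<^sup>2 * exp (2 * (real K * \<eta>)))"
        unfolding y_def by (intro sum_mono sum_cells_second_moment[OF Z n \<eta>]) auto
      then show "1 + (\<Sum>k\<le>K. \<integral>\<omega>. (y \<omega> k)\<^sup>2 \<partial>M n) \<le> C2" by (simp add: C2_def)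
    qed simp
    finally show ?thesis .
  qed
  have "(\<lambda>n. ?E n - of_real (exp (- \<sigma> / 2)) * ?F n) \<longlonglongrightarrow> 0"
  proof (rule Lim_null_comparison)
    show "\<forall>\<^sub>F n in sequentially. norm (?E n - of_real (exp (- \<sigma> / 2)) * ?F n) \<le> C * C2 / sqrt n"
      using bound by (intro eventually_sequentiallyI[of 1]) simp
    show "(\<lambda>n. C * C2 / sqrt (real n)) \<longlonglongrightarrow> 0" by real_asymp
  qed
  from tendsto_add[OF this tendsto_mult[OF tendsto_const[of "of_real (exp (- \<sigma> / 2))"] cells_char_limit[OF Z \<eta>, of u K]]]
  have "?E \<longlonglongrightarrow> of_real (exp (- \<sigma> / 2)) * of_real (exp (- (\<Sum>k<K. (u k)\<^sup>2 * (V * \<eta>)) / 2))" by simp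
  also have "of_real (exp (- \<sigma> / 2)) * of_real (exp (- (\<Sum>k<K. (u k)\<^sup>2 * (V * \<eta>)) / 2))
     = complex_of_real (exp (- (\<Sum>k<K. (u k)\<^sup>2 * (Kvar (real (Suc k) * \<eta>) - Kvar (real k * \<eta>))) / 2))"
  proof -
    have "(\<Sum>k<K. (u k)\<^sup>2 * (Kvar (real (Suc k) * \<eta>) - Kvar (real k * \<eta>))) = \<sigma> + (\<Sum>k<K. (u k)\<^sup>2 * (V * \<eta>))"
      unfolding \<sigma>_def sum.distrib[symmetric] by (intro sum.cong refl) (simp add: Kvar_def a_def algebra_simps)
    then show ?thesis by (simp only: of_real_mult[symmetric] exp_add[symmetric]) (simp add: add_divide_distrib)
  qed
  finally show ?thesis unfolding a_def .
qed

end

section \<open>Moments and oscillation of the scaled process\<close>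

lemma counting_process_mono: "s \<le> t \<Longrightarrow> counting_process n \<tau> s \<omega> \<le> counting_process n \<tau> t \<omega>"
  unfolding counting_process_def by (intro card_mono) (auto intro: order_trans)

lemma counting_increment_mgf:
  fixes Z :: "real \<Rightarrow> 'a \<Rightarrow> 'd::finite"
  assumes Z: "ctmc M A Z" and mm: "mm_binomial_defaults M lam Z n \<tau>" and lam: "\<And>i. lam $ i \<ge> 0"
    and st: "0 \<le> s" "s \<le> t"
  shows "(\<integral>\<omega>. exp (z * (real (counting_process n \<tau> t \<omega>) - real (counting_process n \<tau> s \<omega>))) \<partial>M)
    = (\<integral>\<omega>. (1 + (exp z - 1) * (exp (- integral {0..s} (\<lambda>s. lam $ Z s \<omega>)) - exp (- integral {0..t} (\<lambda>s. lam $ Z s \<omega>)))) ^ n \<partial>M)"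
proof -
  interpret prob_space M using Z by (simp add: ctmc_def)
  have [measurable]: "\<tau> i \<in> borel_measurable M" if "i < n" for i
    using mm that by (simp add: mm_binomial_defaults_def)
  note [measurable] = counting_process_measurable[OF mm]
  \<comment> \<open>The thresholds 0, \<open>s\<close>, \<open>t\<close> with the coefficients
    \<open>d\<close> represent \<open>exp z\<close> for a default after \<open>s\<close> and not
    after \<open>t\<close>, and 1 otherwise. Threshold 0 supplies the constant term, as defaults are
    positive almost surely.\<close>
  define t' where "t' k = (if k = 0 then 0 else if k = 1 then s else t)" for k :: nat
  define d where "d k = (if k = 0 then 1 else if k = 1 then complex_of_real (exp z - 1) else - complex_of_real (exp z - 1))" for k :: nat
  have three: "(\<Sum>k\<le>2. h k) = h 0 + h 1 + h 2" for h :: "nat \<Rightarrow> complex"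
    by (simp add: eval_nat_numeral)
  have "complex_of_real (\<integral>\<omega>. exp (z * (real (counting_process n \<tau> t \<omega>) - real (counting_process n \<tau> s \<omega>))) \<partial>M)
     = (\<integral>\<omega>. complex_of_real (exp (z * (real (counting_process n \<tau> t \<omega>) - real (counting_process n \<tau> s \<omega>)))) \<partial>M)"
    by (rule integral_complex_of_real[symmetric])
  also have "\<dots> = (\<integral>\<omega>. (\<Prod>i<n. \<Sum>k\<le>2. d k * of_bool (\<tau> i \<omega> > ereal (t' k))) \<partial>M)"
  proof (rule integral_cong_AE)
    show "AE \<omega> in M. complex_of_real (exp (z * (real (counting_process n \<tau> t \<omega>) - real (counting_process n \<tau> s \<omega>))))
        = (\<Prod>i<n. \<Sum>k\<le>2. d k * of_bool (\<tau> i \<omega> > ereal (t' k)))"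
      using mm_binomial_positive[OF Z mm lam]
    proof eventually_elim
      case (elim \<omega>)
      have "real (counting_process n \<tau> t \<omega>) - real (counting_process n \<tau> s \<omega>) = (\<Sum>i<n. of_bool (\<tau> i \<omega> > ereal s) - of_bool (\<tau> i \<omega> > ereal t))"
        unfolding counting_process_eq by (simp add: sum_subtractf)
      then have "complex_of_real (exp (z * (real (counting_process n \<tau> t \<omega>) - real (counting_process n \<tau> s \<omega>))))
         = (\<Prod>i<n. complex_of_real (exp (z * (of_bool (\<tau> i \<omega> > ereal s) - of_bool (\<tau> i \<omega> > ereal t)))))"
        by (simp only: sum_distrib_left exp_sum[OF finite_lessThan] of_real_prod)
      also have "\<dots> = (\<Prod>i<n. \<Sum>k\<le>2. d k * of_bool (\<tau> i \<omega> > ereal (t' k)))"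
      proof (intro prod.cong refl)
        fix i assume "i \<in> {..<n}"
        then have p: "\<tau> i \<omega> > ereal 0" using elim by auto
        show "complex_of_real (exp (z * (of_bool (\<tau> i \<omega> > ereal s) - of_bool (\<tau> i \<omega> > ereal t)))) = (\<Sum>k\<le>2. d k * of_bool (\<tau> i \<omega> > ereal (t' k)))"
        proof (cases "\<tau> i \<omega> > ereal t")
          case True
          then have "\<tau> i \<omega> > ereal s" using st by (meson ereal_less_eq(3) le_less_trans)
          then show ?thesis using True p unfolding three by (simp add: d_def t'_def)
        next
          case False
          then show ?thesis using p unfolding three by (cases "\<tau> i \<omega> > ereal s") (simp_all add: d_def t'_def)
        qed
      qed
      finally show ?case .
    qed
  qed measurable
  also have "\<dots> = (\<integral>\<omega>. (\<Sum>k\<le>2. d k * of_real (exp (- integral {0..t' k} (\<lambda>s. lam $ Z s \<omega>)))) ^ n \<partial>M)"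
    using st by (intro binomial_mixture_expectation[OF Z mm lam]) (auto simp: t'_def)
  also have "\<dots> = (\<integral>\<omega>. complex_of_real ((1 + (exp z - 1) * (exp (- integral {0..s} (\<lambda>s. lam $ Z s \<omega>)) - exp (- integral {0..t} (\<lambda>s. lam $ Z s \<omega>)))) ^ n) \<partial>M)"
    unfolding three by (intro Bochner_Integration.integral_cong refl) (simp add: d_def t'_def algebra_simps)
  also have "\<dots> = complex_of_real (\<integral>\<omega>. (1 + (exp z - 1) * (exp (- integral {0..s} (\<lambda>s. lam $ Z s \<omega>)) - exp (- integral {0..t} (\<lambda>s. lam $ Z s \<omega>)))) ^ n \<partial>M)"
    by (rule integral_complex_of_real)
  finally show ?thesis by (simp only: of_real_eq_iff)
qed

lemma abs_exp_minus_diff_le: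
  fixes a b :: real
  assumes "0 \<le> a" "0 \<le> b"
  shows "\<bar>exp (- a) - exp (- b)\<bar> \<le> \<bar>a - b\<bar>"
proof -
  have *: "exp (- a) - exp (- b) \<le> b - a" if "0 \<le> a" "a \<le> b" for a b :: real
  proof -
    have "exp (- a) - exp (- b) = exp (- a) * (1 - exp (- (b - a)))" by (simp add: algebra_simps exp_add[symmetric])
    also have "\<dots> \<le> 1 * (1 - exp (- (b - a)))" using that by (intro mult_right_mono) auto
    also have "\<dots> \<le> b - a" using exp_ge_add_one_self[of "a - b"] unfolding minus_diff_eq mult_1_left by linarith
    finally show ?thesis .
  qed
  show ?thesis using *[of a b] *[of b a] assms by (cases "a \<le> b") auto
qed

context modulated_chain
begin

text \<open>Bounds exponential moments with exponents \<open>\<plusminus> 1 / sqrt \<eta>\<close> of an increment over time \<open>\<eta>\<close>; this scaling turns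
  \<open>x^4 \<le> 256 * exp x\<close> into a fourth-moment bound with the factor \<open>\<eta>\<^sup>2\<close> needed for chaining.\<close>
definition momC :: "real \<Rightarrow> real" where
  "momC T = 3 * exp (3 * B) * (exp ((8 * B^4 + 1) * T) + exp (8 * B\<^sup>2 + 1))"

text \<open>Given the chain, the increment is binomial with success probability \<open>q\<close>, so
  its generating function is at most \<open>exp (n * (exp \<delta> - 1) * q)\<close>. With
  \<open>\<delta> = z / sqrt n\<close> the second-order part is bounded because
  \<open>q \<le> B * \<eta>\<close> and \<open>z\<^sup>2 = 1 / \<eta>\<close>. There remains
  \<open>q\<close> minus its deterministic counterpart \<open>dr\<close>, controlled by the past
  fluctuation \<open>Y\<close>, damped by \<open>\<eta>\<close>, and by that of the current cell,
  \<open>c\<close>. The lower bounds on \<open>n\<close> and on \<open>n * \<eta>\<close> make the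
  exponents admissible for these two.\<close>

lemma Nhat_increment_exp_moment:
  fixes Z :: "real \<Rightarrow> 'a \<Rightarrow> 'd" and \<eta> z T :: real
  assumes Z: "ctmc M (real n *\<^sub>R Q) Z" and mm: "mm_binomial_defaults M lam Z n \<tau>"
    and n: "n \<ge> 1" "16 * B^4 \<le> n" and \<eta>: "0 < \<eta>" "\<eta> \<le> 1" "16 * B\<^sup>2 \<le> real n * \<eta>"
    and T: "real k * \<eta> \<le> T" and z: "\<bar>z\<bar> = 1 / sqrt \<eta>"
  shows "(\<integral>\<omega>. exp (z * (Nhat n \<tau> (real (Suc k) * \<eta>) \<omega> - Nhat n \<tau> (real k * \<eta>) \<omega>)) \<partial>M) \<le> momC T"
proof -
  interpret prob_space M using Z by (simp add: ctmc_def)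
  define s where "s = real k * \<eta>"
  define t where "t = real (Suc k) * \<eta>"
  define sn where "sn = sqrt (real n)"
  define \<delta> where "\<delta> = z / sn"
  define L where "L t \<omega> = integral {0..t} (\<lambda>s. lam $ Z s \<omega>)" for t \<omega>
  define q where "q \<omega> = exp (- L s \<omega>) - exp (- L t \<omega>)" for \<omega>
  define dr where "dr = rho t - rho s"
  define Y where "Y \<omega> = sn * \<bar>\<Sum>j<k. cell Z \<eta> j \<omega>\<bar>" for \<omega>
  define c where "c \<omega> = sn * \<bar>cell Z \<eta> k \<omega>\<bar>" for \<omega>
  have B1: "B \<ge> 1" by (rule B_bounds)
  have sn: "sn \<ge> 1" "real n = sn * sn" using n by (auto simp: sn_def)
  have st: "0 \<le> s" "s \<le> t" "t = s + \<eta>" using \<eta> by (auto simp: s_def t_def algebra_simps)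
  have z2: "z\<^sup>2 = 1 / \<eta>"
  proof -
    have "z\<^sup>2 = \<bar>z\<bar>\<^sup>2" by simp
    also have "\<dots> = 1 / \<eta>" unfolding z using \<eta> by (simp add: power_divide)
    finally show ?thesis .
  qed
  have z\<eta>: "\<bar>z\<bar> * \<eta> \<le> 1"
  proof -
    have "\<bar>z\<bar> * \<eta> = sqrt \<eta>" unfolding z using \<eta> real_sqrt_mult_self[of \<eta>] by (simp add: field_simps)
    also have "\<dots> \<le> 1" using \<eta> by simp
    finally show ?thesis .
  qed
  \<comment> \<open>Here \<open>16 * B\<^sup>2 \<le> n * \<eta>\<close> enters: the exponent
    \<open>2 * \<bar>z\<bar>\<close> must be admissible for one cell.\<close>
  have zB: "2 * \<bar>z\<bar> * B \<le> sn / 2"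
  proof -
    have "(2 * \<bar>z\<bar> * B)\<^sup>2 = 4 * B\<^sup>2 / \<eta>" using z2 by (simp add: power_mult_distrib)
    also have "\<dots> \<le> n / 4" using \<eta> by (simp add: field_simps)
    also have "\<dots> = (sn / 2)\<^sup>2" unfolding sn(2) by (simp add: power2_eq_square)
    finally show ?thesis using sn(1) by - (rule power2_le_imp_le[of _ "sn / 2"], simp_all)
  qed
  have \<delta>1: "\<bar>\<delta>\<bar> \<le> 1"
  proof -
    have "\<bar>z\<bar> * 1 \<le> \<bar>z\<bar> * B" using B1 by (intro mult_left_mono) auto
    then have "\<bar>z\<bar> \<le> sn" using zB sn by linarith
    then show ?thesis using sn by (simp add: \<delta>_def)
  qed
  have ed: "exp \<delta> - 1 \<le> \<delta> + 3 * \<delta>\<^sup>2"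
  proof -
    have "exp \<delta> - 1 - \<delta> \<le> \<delta>\<^sup>2 * exp \<bar>\<delta>\<bar>" using abs_exp_minus_1_minus_le[of \<delta>] by linarith
    also have "\<dots> \<le> \<delta>\<^sup>2 * 3"
    proof (intro mult_left_mono)
      have "exp \<bar>\<delta>\<bar> \<le> exp 1" using \<delta>1 by simp
      then show "exp \<bar>\<delta>\<bar> \<le> 3" using exp_le by linarith
    qed simp
    finally show ?thesis by simp
  qed
  have [measurable]: "L t \<in> borel_measurable M" for t
    unfolding L_def[abs_def] by (rule ctmc_path_integral_measurable[OF Z]) simp
  note [measurable] = cell_measurable[OF Z \<eta>(1)]
  have Ls: "L s \<omega> = (\<Sum>j<k. cell Z \<eta> j \<omega>) + linf * s" and Lt: "L t \<omega> = L s \<omega> + (cell Z \<eta> k \<omega> + linf * \<eta>)"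
    and Ls0: "0 \<le> L s \<omega>" if "\<omega> \<in> space M" for \<omega>
  proof -
    show a: "L s \<omega> = (\<Sum>j<k. cell Z \<eta> j \<omega>) + linf * s"
      unfolding L_def s_def by (rule compensator_cells(1)[OF Z \<eta>(1) that])
    show "L t \<omega> = L s \<omega> + (cell Z \<eta> k \<omega> + linf * \<eta>)"
      unfolding a unfolding L_def t_def compensator_cells(1)[OF Z \<eta>(1) that] by (simp add: s_def algebra_simps)
    have "0 \<le> (\<Sum>j<k. cell Z \<eta> j \<omega> + linf * \<eta>)" by (intro sum_nonneg compensator_cells(2)[OF Z \<eta>(1) that])
    also have "\<dots> = L s \<omega>" unfolding a by (simp add: sum.distrib s_def)
    finally show "0 \<le> L s \<omega>" .
  qed
  have pt: "(1 + (exp \<delta> - 1) * q \<omega>) ^ n * exp (- z * sn * dr) \<le> exp (3 * B) * (1 / 2 * (exp (2 * \<bar>z\<bar> * B * \<eta> * Y \<omega>) + exp (2 * \<bar>z\<bar> * c \<omega>)))"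
    if \<omega>: "\<omega> \<in> space M" for \<omega>
  proof -
    let ?C = "cell Z \<eta> k \<omega> + linf * \<eta>"
    have C: "0 \<le> ?C" "?C \<le> B * \<eta>" using compensator_cells(2,3)[OF Z \<eta>(1) \<omega>] by auto
    have qe: "q \<omega> = exp (- L s \<omega>) * (1 - exp (- ?C))" unfolding q_def Lt[OF \<omega>] by (simp add: algebra_simps exp_add[symmetric])
    have oneC: "0 \<le> 1 - exp (- ?C)" "1 - exp (- ?C) \<le> B * \<eta>" 
    proof -
      have one: "0 \<le> 1 - exp (- x)" "1 - exp (- x) \<le> y" if "0 \<le> x" "x \<le> y" for x y :: real
        using that exp_ge_add_one_self[of "- x"] by (simp, linarith)
      show "0 \<le> 1 - exp (- ?C)" "1 - exp (- ?C) \<le> B * \<eta>" using one[OF C] by blast+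
    qed
    have q: "0 \<le> q \<omega>" "q \<omega> \<le> 1" "q \<omega> \<le> B * \<eta>"
    proof -
      show "0 \<le> q \<omega>" unfolding qe using oneC by simp
      have "q \<omega> \<le> 1 * (1 - exp (- ?C))" unfolding qe using oneC Ls0[OF \<omega>] by (intro mult_right_mono) auto
      then show "q \<omega> \<le> B * \<eta>" using oneC by simp
      have "q \<omega> \<le> 1" if "q \<omega> \<le> 1 * (1 - e)" "0 < e" for e :: real using that by simp
      then show "q \<omega> \<le> 1" using \<open>q \<omega> \<le> 1 * (1 - exp (- ?C))\<close> exp_gt_zero by blast
    qed
    have e: "1 + (exp \<delta> - 1) * q \<omega> = (1 - q \<omega>) + exp \<delta> * q \<omega>" by (simp add: algebra_simps)
    have nn: "0 \<le> 1 + (exp \<delta> - 1) * q \<omega>" unfolding e using q by (intro add_nonneg_nonneg mult_nonneg_nonneg) auto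
    have "(1 + (exp \<delta> - 1) * q \<omega>) ^ n \<le> exp ((exp \<delta> - 1) * q \<omega>) ^ n"
      by (intro power_mono nn exp_ge_add_one_self)
    also have "\<dots> = exp (n * ((exp \<delta> - 1) * q \<omega>))" by (simp add: exp_of_nat_mult)
    also have "\<dots> \<le> exp (n * ((\<delta> + 3 * \<delta>\<^sup>2) * q \<omega>))"
      unfolding exp_le_cancel_iff by (intro mult_left_mono mult_right_mono ed q) auto
    also have "n * ((\<delta> + 3 * \<delta>\<^sup>2) * q \<omega>) = z * sn * q \<omega> + 3 * (z\<^sup>2 * q \<omega>)"
      unfolding sn(2) \<delta>_def using sn(1) by (simp add: field_simps power2_eq_square)
    finally have 1: "(1 + (exp \<delta> - 1) * q \<omega>) ^ n * exp (- z * sn * dr) \<le> exp (z * sn * q \<omega> + 3 * (z\<^sup>2 * q \<omega>)) * exp (- z * sn * dr)"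
      by (intro mult_right_mono) auto
    have zq: "z\<^sup>2 * q \<omega> \<le> B"
    proof -
      have "z\<^sup>2 * q \<omega> \<le> z\<^sup>2 * (B * \<eta>)" using q by (intro mult_left_mono) auto
      also have "\<dots> = B" using \<eta> by (simp add: z2)
      finally show ?thesis .
    qed
    \<comment> \<open>The difference is split into an error in the survival up to \<open>s\<close>
      and one in the current cell; the first is multiplied by a cell probability of at most
      \<open>B * \<eta>\<close>.\<close>
    have qd: "sn * \<bar>q \<omega> - dr\<bar> \<le> B * \<eta> * Y \<omega> + c \<omega>"
    proof -
      have dre: "dr = exp (- (linf * s)) * (1 - exp (- (linf * \<eta>)))"
        unfolding dr_def rho_def st(3) by (simp add: algebra_simps exp_add[symmetric] mult_minus_left)
      have "q \<omega> - dr = (exp (- L s \<omega>) - exp (- (linf * s))) * (1 - exp (- ?C)) + exp (- (linf * s)) * (exp (- (linf * \<eta>)) - exp (- ?C))"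
        unfolding qe dre by (simp add: algebra_simps)
      also have "\<bar>\<dots>\<bar> \<le> \<bar>\<Sum>j<k. cell Z \<eta> j \<omega>\<bar> * (B * \<eta>) + 1 * \<bar>cell Z \<eta> k \<omega>\<bar>"
      proof (rule order_trans[OF abs_triangle_ineq add_mono])
        have "\<bar>exp (- L s \<omega>) - exp (- (linf * s))\<bar> \<le> \<bar>\<Sum>j<k. cell Z \<eta> j \<omega>\<bar>"
          using abs_exp_minus_diff_le[of "L s \<omega>" "linf * s"] Ls0[OF \<omega>] linf_nonneg st Ls[OF \<omega>] by simp
        then show "\<bar>(exp (- L s \<omega>) - exp (- (linf * s))) * (1 - exp (- ?C))\<bar> \<le> \<bar>\<Sum>j<k. cell Z \<eta> j \<omega>\<bar> * (B * \<eta>)"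
          unfolding abs_mult using oneC by (intro mult_mono) auto
        have "\<bar>exp (- (linf * \<eta>)) - exp (- ?C)\<bar> \<le> \<bar>cell Z \<eta> k \<omega>\<bar>"
          using abs_exp_minus_diff_le[of "linf * \<eta>" ?C] C(1) linf_nonneg \<eta> by simp
        then show "\<bar>exp (- (linf * s)) * (exp (- (linf * \<eta>)) - exp (- ?C))\<bar> \<le> 1 * \<bar>cell Z \<eta> k \<omega>\<bar>"
          unfolding abs_mult using linf_nonneg st by (intro mult_mono) auto
      qed
      finally have "sn * \<bar>q \<omega> - dr\<bar> \<le> sn * (\<bar>\<Sum>j<k. cell Z \<eta> j \<omega>\<bar> * (B * \<eta>) + 1 * \<bar>cell Z \<eta> k \<omega>\<bar>)"
        using sn by (intro mult_left_mono) auto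
      then show ?thesis unfolding Y_def c_def by (simp add: algebra_simps)
    qed
    have "z * sn * q \<omega> + 3 * (z\<^sup>2 * q \<omega>) + (- z * sn * dr) = z * (sn * (q \<omega> - dr)) + 3 * (z\<^sup>2 * q \<omega>)"
      by (simp add: algebra_simps)
    also have "\<dots> \<le> \<bar>z\<bar> * (B * \<eta> * Y \<omega> + c \<omega>) + 3 * B"
    proof (intro add_mono)
      have "z * (sn * (q \<omega> - dr)) \<le> \<bar>z\<bar> * (sn * \<bar>q \<omega> - dr\<bar>)"
        using abs_ge_self[of "z * (sn * (q \<omega> - dr))"] sn(1) by (simp add: abs_mult)
      also have "\<dots> \<le> \<bar>z\<bar> * (B * \<eta> * Y \<omega> + c \<omega>)" by (intro mult_left_mono qd) auto
      finally show "z * (sn * (q \<omega> - dr)) \<le> \<bar>z\<bar> * (B * \<eta> * Y \<omega> + c \<omega>)" .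
    qed (use zq in simp)
    finally have "exp (z * sn * q \<omega> + 3 * (z\<^sup>2 * q \<omega>)) * exp (- z * sn * dr) \<le> exp (\<bar>z\<bar> * (B * \<eta> * Y \<omega> + c \<omega>) + 3 * B)"
      unfolding exp_add[symmetric] by simp
    also have "\<dots> = exp (3 * B) * (exp (\<bar>z\<bar> * B * \<eta> * Y \<omega>) * exp (\<bar>z\<bar> * c \<omega>))"
      by (simp add: exp_add[symmetric] algebra_simps)
    \<comment> \<open>\<open>Y\<close> and \<open>c\<close> are dependent, so their product is
      separated by the inequality between product and squares, at the price of doubled
      exponents.\<close>
    also have "\<dots> \<le> exp (3 * B) * (1 / 2 * ((exp (\<bar>z\<bar> * B * \<eta> * Y \<omega>))\<^sup>2 + (exp (\<bar>z\<bar> * c \<omega>))\<^sup>2))"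
    proof (intro mult_left_mono)
      show "exp (\<bar>z\<bar> * B * \<eta> * Y \<omega>) * exp (\<bar>z\<bar> * c \<omega>) \<le> 1 / 2 * ((exp (\<bar>z\<bar> * B * \<eta> * Y \<omega>))\<^sup>2 + (exp (\<bar>z\<bar> * c \<omega>))\<^sup>2)"
        using sum_squares_bound[of "exp (\<bar>z\<bar> * B * \<eta> * Y \<omega>)" "exp (\<bar>z\<bar> * c \<omega>)"] by simp
    qed simp
    also have "\<dots> = exp (3 * B) * (1 / 2 * (exp (2 * \<bar>z\<bar> * B * \<eta> * Y \<omega>) + exp (2 * \<bar>z\<bar> * c \<omega>)))"
      by (simp add: exp_double[symmetric] mult.assoc)
    finally show ?thesis using 1 by linarith
  qed
  have iY: "integrable M (\<lambda>\<omega>. exp (2 * \<bar>z\<bar> * B * \<eta> * Y \<omega>))" and bY: "(\<integral>\<omega>. exp (2 * \<bar>z\<bar> * B * \<eta> * Y \<omega>) \<partial>M) \<le> 6 * exp ((8 * B^4 + 1) * T)"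
  proof -
    have T0: "T \<ge> 0" using T \<eta> by (meson mult_nonneg_nonneg of_nat_0_le_iff less_imp_le order_trans)
    have "integrable M (\<lambda>\<omega>. exp (2 * \<bar>z\<bar> * B * \<eta> * Y \<omega>)) \<and> (\<integral>\<omega>. exp (2 * \<bar>z\<bar> * B * \<eta> * Y \<omega>) \<partial>M) \<le> 6 * exp ((8 * B^4 + 1) * T)"
    proof (cases "k \<ge> 1")
      case False
      then have "k = 0" by simp
      then have "Y \<omega> = 0" for \<omega> by (simp add: Y_def)
      moreover have "1 * 1 \<le> 6 * exp ((8 * B^4 + 1) * T)" using T0 by (intro mult_mono) auto
      ultimately show ?thesis by (simp add: prob_space)
    next
      case True
      define z' where "z' = 2 * \<bar>z\<bar> * B * \<eta>"
      have k\<eta>: "0 < real k * \<eta>" using True \<eta> by simp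
      have e: "exp (2 * \<bar>z\<bar> * B * \<eta> * Y \<omega>) = exp (z' * (sqrt n * \<bar>cell Z (real k * \<eta>) 0 \<omega>\<bar>))" if "\<omega> \<in> space M" for \<omega>
        using sum_cells_eq_cell[OF Z \<eta>(1) that True] by (simp add: Y_def z'_def sn_def)
      have z'0: "z' \<ge> 0" using \<eta> B1 by (simp add: z'_def)
      \<comment> \<open>Since \<open>\<bar>z\<bar> * \<eta> \<le> 1\<close>, the exponent of the
        past stays bounded as \<open>\<eta>\<close> shrinks.\<close>
      have z'2: "z' \<le> 2 * B"
      proof -
        have "2 * B * (\<bar>z\<bar> * \<eta>) \<le> 2 * B * 1" using z\<eta> B1 by (intro mult_left_mono) auto
        then show ?thesis by (simp add: z'_def mult_ac)
      qed
      have z'B: "z' * B \<le> sqrt n / 2"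
      proof -
        have "(2 * B * B)\<^sup>2 = 4 * B^4" by (simp add: power2_eq_square power4_eq_xxxx)
        also have "\<dots> \<le> n / 4" using n by simp
        also have "\<dots> = (sn / 2)\<^sup>2" unfolding sn(2) by (simp add: power2_eq_square)
        finally have "2 * B * B \<le> sn / 2" using sn(1) by - (rule power2_le_imp_le[of _ "sn / 2"], simp_all)
        moreover have "z' * B \<le> 2 * B * B" using z'2 B1 by (intro mult_right_mono) auto
        ultimately show ?thesis by (simp add: sn_def)
      qed
      have "(\<integral>\<omega>. exp (z' * (sqrt n * \<bar>cell Z (real k * \<eta>) 0 \<omega>\<bar>)) \<partial>M) \<le> 6 * exp ((2 * B\<^sup>2 * z'\<^sup>2 + 1) * (real k * \<eta>))"
        by (rule cell_exp_abs_moment[OF Z n(1) k\<eta> z'0 z'B])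
      also have "\<dots> \<le> 6 * exp ((8 * B^4 + 1) * T)"
      proof -
        have "z'\<^sup>2 \<le> (2 * B)\<^sup>2" using z'0 z'2 by (intro power_mono)
        then have "2 * B\<^sup>2 * z'\<^sup>2 \<le> 2 * B\<^sup>2 * (2 * B)\<^sup>2" by (intro mult_left_mono) auto
        also have "\<dots> = 8 * B^4" by (simp add: power2_eq_square power4_eq_xxxx)
        finally have "(2 * B\<^sup>2 * z'\<^sup>2 + 1) * (real k * \<eta>) \<le> (8 * B^4 + 1) * T"
          using T k\<eta> by (intro mult_mono) auto
        then show ?thesis by simp
      qed
      finally have "(\<integral>\<omega>. exp (z' * (sqrt n * \<bar>cell Z (real k * \<eta>) 0 \<omega>\<bar>)) \<partial>M) \<le> 6 * exp ((8 * B^4 + 1) * T)" .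
      moreover have "integrable M (\<lambda>\<omega>. exp (z' * (sqrt n * \<bar>cell Z (real k * \<eta>) 0 \<omega>\<bar>)))"
        using exp_cell_integrable[OF Z k\<eta>, of "z' * sqrt n" 0] by (simp add: mult.assoc)
      ultimately show ?thesis
        by (simp add: e cong: Bochner_Integration.integrable_cong Bochner_Integration.integral_cong)
    qed
    then show "integrable M (\<lambda>\<omega>. exp (2 * \<bar>z\<bar> * B * \<eta> * Y \<omega>))" "(\<integral>\<omega>. exp (2 * \<bar>z\<bar> * B * \<eta> * Y \<omega>) \<partial>M) \<le> 6 * exp ((8 * B^4 + 1) * T)" by auto
  qed
  have ic: "integrable M (\<lambda>\<omega>. exp (2 * \<bar>z\<bar> * c \<omega>))"
    using exp_cell_integrable[OF Z \<eta>(1), of "2 * \<bar>z\<bar> * sn" k] by (simp add: c_def mult.assoc)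
  have bc: "(\<integral>\<omega>. exp (2 * \<bar>z\<bar> * c \<omega>) \<partial>M) \<le> 6 * exp (8 * B\<^sup>2 + 1)"
  proof -
    have "(\<integral>\<omega>. exp (2 * \<bar>z\<bar> * c \<omega>) \<partial>M) \<le> 6 * exp ((2 * B\<^sup>2 * (2 * \<bar>z\<bar>)\<^sup>2 + 1) * \<eta>)"
      unfolding c_def sn_def using zB by (intro cell_exp_abs_moment[OF Z n(1) \<eta>(1)]) (auto simp: sn_def)
    also have "(2 * B\<^sup>2 * (2 * \<bar>z\<bar>)\<^sup>2 + 1) * \<eta> = 8 * B\<^sup>2 + \<eta>" using \<eta> by (simp add: power_mult_distrib z2 field_simps)
    also have "6 * exp (8 * B\<^sup>2 + \<eta>) \<le> 6 * exp (8 * B\<^sup>2 + 1)" using \<eta> by simp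
    finally show ?thesis .
  qed
  have iR: "integrable M (\<lambda>\<omega>. exp (3 * B) * (1 / 2 * (exp (2 * \<bar>z\<bar> * B * \<eta> * Y \<omega>) + exp (2 * \<bar>z\<bar> * c \<omega>))))"
    by (intro Bochner_Integration.integrable_mult_right Bochner_Integration.integrable_add iY ic)
  have "(\<integral>\<omega>. exp (z * (Nhat n \<tau> t \<omega> - Nhat n \<tau> s \<omega>)) \<partial>M)
     = (\<integral>\<omega>. exp (\<delta> * (real (counting_process n \<tau> t \<omega>) - real (counting_process n \<tau> s \<omega>))) * exp (- z * sn * dr) \<partial>M)"
  proof (intro Bochner_Integration.integral_cong refl)
    fix \<omega>
    have "z * (Nhat n \<tau> t \<omega> - Nhat n \<tau> s \<omega>) = \<delta> * (real (counting_process n \<tau> t \<omega>) - real (counting_process n \<tau> s \<omega>)) + - z * sn * dr"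
      unfolding Nhat_def \<delta>_def sn_def[symmetric] dr_def sn(2) using sn(1) by (simp add: field_simps)
    then show "exp (z * (Nhat n \<tau> t \<omega> - Nhat n \<tau> s \<omega>)) = exp (\<delta> * (real (counting_process n \<tau> t \<omega>) - real (counting_process n \<tau> s \<omega>))) * exp (- z * sn * dr)"
      by (simp only: exp_add)
  qed
  also have "\<dots> = (\<integral>\<omega>. exp (\<delta> * (real (counting_process n \<tau> t \<omega>) - real (counting_process n \<tau> s \<omega>))) \<partial>M) * exp (- z * sn * dr)"
    by (rule integral_mult_left_zero)
  also have "\<dots> = (\<integral>\<omega>. (1 + (exp \<delta> - 1) * q \<omega>) ^ n \<partial>M) * exp (- z * sn * dr)"
    unfolding q_def L_def counting_increment_mgf[OF Z mm lam_nonneg st(1,2)] ..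
  also have "\<dots> = (\<integral>\<omega>. (1 + (exp \<delta> - 1) * q \<omega>) ^ n * exp (- z * sn * dr) \<partial>M)"
    by (rule integral_mult_left_zero[symmetric])
  also have "\<dots> \<le> (\<integral>\<omega>. exp (3 * B) * (1 / 2 * (exp (2 * \<bar>z\<bar> * B * \<eta> * Y \<omega>) + exp (2 * \<bar>z\<bar> * c \<omega>))) \<partial>M)"
    by (rule integral_mono'[OF iR pt]) simp_all
  also have "\<dots> = exp (3 * B) * (1 / 2 * ((\<integral>\<omega>. exp (2 * \<bar>z\<bar> * B * \<eta> * Y \<omega>) \<partial>M) + (\<integral>\<omega>. exp (2 * \<bar>z\<bar> * c \<omega>) \<partial>M)))"
    by (simp only: integral_mult_right_zero Bochner_Integration.integral_add[OF iY ic])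
  also have "\<dots> \<le> exp (3 * B) * (1 / 2 * (6 * exp ((8 * B^4 + 1) * T) + 6 * exp (8 * B\<^sup>2 + 1)))"
    by (intro mult_left_mono add_mono bY bc) auto
  also have "\<dots> = momC T" by (simp add: momC_def)
  finally show ?thesis unfolding t_def s_def .
qed

lemma Nhat_bound:
  assumes n: "n \<ge> 1" and t: "t \<ge> 0" shows "\<bar>Nhat n \<tau> t \<omega>\<bar> \<le> sqrt n"
proof -
  have c: "real (counting_process n \<tau> t \<omega>) \<le> n"
    unfolding counting_process_def using card_mono[of "{..<n}" "{i. i < n \<and> \<tau> i \<omega> \<le> ereal t}"] by auto
  have r: "0 \<le> rho t" "rho t \<le> 1" using linf_nonneg t by (auto simp: rho_def)
  then have "0 \<le> real n * rho t" "real n * rho t \<le> real n" by (auto intro: mult_left_le)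
  then have "\<bar>real (counting_process n \<tau> t \<omega>) - real n * rho t\<bar> \<le> real n" using c by linarith
  then have "\<bar>Nhat n \<tau> t \<omega>\<bar> \<le> real n / sqrt n" unfolding Nhat_def using n by (simp add: divide_right_mono)
  then show ?thesis by (simp add: real_div_sqrt)
qed

lemma Nhat_increment_4th_moment:
  fixes Z :: "real \<Rightarrow> 'a \<Rightarrow> 'd" and \<eta> z T :: real
  assumes Z: "ctmc M (real n *\<^sub>R Q) Z" and mm: "mm_binomial_defaults M lam Z n \<tau>"
    and n: "n \<ge> 1" "16 * B^4 \<le> n" and \<eta>: "0 < \<eta>" "\<eta> \<le> 1" "16 * B\<^sup>2 \<le> real n * \<eta>"
    and T: "real k * \<eta> \<le> T"
  shows "integrable M (\<lambda>\<omega>. (Nhat n \<tau> (real (Suc k) * \<eta>) \<omega> - Nhat n \<tau> (real k * \<eta>) \<omega>)^4)"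
    and "(\<integral>\<omega>. (Nhat n \<tau> (real (Suc k) * \<eta>) \<omega> - Nhat n \<tau> (real k * \<eta>) \<omega>)^4 \<partial>M) \<le> 512 * momC T * \<eta>\<^sup>2"
proof -
  interpret prob_space M using Z by (simp add: ctmc_def)
  define X where "X \<omega> = Nhat n \<tau> (real (Suc k) * \<eta>) \<omega> - Nhat n \<tau> (real k * \<eta>) \<omega>" for \<omega>
  define z where "z = 1 / sqrt \<eta>"
  have [measurable]: "X \<in> borel_measurable M" unfolding X_def[abs_def] using Nhat_measurable[OF mm] by measurable
  have Xb: "\<bar>X \<omega>\<bar> \<le> 2 * sqrt n" for \<omega>
    unfolding X_def using Nhat_bound[OF n(1), of "real (Suc k) * \<eta>" \<tau> \<omega>] Nhat_bound[OF n(1), of "real k * \<eta>" \<tau> \<omega>] \<eta> by simp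
  have "\<bar>X \<omega>^4\<bar> \<le> (2 * sqrt n)^4" for \<omega>
    unfolding power_abs by (intro power_mono Xb) auto
  then show i4: "integrable M (\<lambda>\<omega>. (Nhat n \<tau> (real (Suc k) * \<eta>) \<omega> - Nhat n \<tau> (real k * \<eta>) \<omega>)^4)"
    unfolding X_def[symmetric]
    by (intro Bochner_Integration.integrable_bound[OF integrable_const[of "(2 * sqrt n)^4"]]) auto
  have ie: "integrable M (\<lambda>\<omega>. exp (w * X \<omega>))" for w
  proof (rule Bochner_Integration.integrable_bound[OF integrable_const[of "exp (\<bar>w\<bar> * (2 * sqrt n))"]])
    show "AE \<omega> in M. norm (exp (w * X \<omega>)) \<le> norm (exp (\<bar>w\<bar> * (2 * sqrt n)))"
    proof (rule AE_I2)
      fix \<omega>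
      have "w * X \<omega> \<le> \<bar>w\<bar> * \<bar>X \<omega>\<bar>" by (metis abs_ge_self abs_mult)
      also have "\<dots> \<le> \<bar>w\<bar> * (2 * sqrt n)" using Xb by (intro mult_left_mono) auto
      finally show "norm (exp (w * X \<omega>)) \<le> norm (exp (\<bar>w\<bar> * (2 * sqrt n)))" by simp
    qed
  qed measurable
  have le: "X \<omega>^4 \<le> 256 * \<eta>\<^sup>2 * (exp (z * X \<omega>) + exp (- z * X \<omega>))" for \<omega>
  proof -
    have z0: "z > 0" using \<eta> by (simp add: z_def)
    have z4: "z^4 * \<eta>\<^sup>2 = 1"
    proof -
      have "z^4 = (z\<^sup>2)\<^sup>2" by simp
      also have "z\<^sup>2 = 1 / \<eta>" using \<eta> by (simp add: z_def power_divide)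
      finally show ?thesis using \<eta> by (simp add: power_divide)
    qed
    have "(z * \<bar>X \<omega>\<bar>)^4 \<le> 256 * exp (z * \<bar>X \<omega>\<bar>)" using z0 by (intro pow4_le_exp) auto
    also have "exp (z * \<bar>X \<omega>\<bar>) \<le> exp (z * X \<omega>) + exp (- z * X \<omega>)"
      by (cases "X \<omega> \<ge> 0") (simp_all add: less_imp_le add_increasing add_increasing2)
    finally have "\<eta>\<^sup>2 * (z * \<bar>X \<omega>\<bar>)^4 \<le> \<eta>\<^sup>2 * (256 * (exp (z * X \<omega>) + exp (- z * X \<omega>)))"
      by (intro mult_left_mono) auto
    also have "\<eta>\<^sup>2 * (z * \<bar>X \<omega>\<bar>)^4 = X \<omega>^4" using z4 by (simp add: power_mult_distrib mult.commute)
    finally show ?thesis by (simp add: mult_ac)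
  qed
  have m: "(\<integral>\<omega>. exp (w * X \<omega>) \<partial>M) \<le> momC T" if "\<bar>w\<bar> = 1 / sqrt \<eta>" for w
    unfolding X_def by (rule Nhat_increment_exp_moment[OF Z mm n \<eta> T that])
  have "(\<integral>\<omega>. X \<omega>^4 \<partial>M) \<le> (\<integral>\<omega>. 256 * \<eta>\<^sup>2 * (exp (z * X \<omega>) + exp (- z * X \<omega>)) \<partial>M)"
    using i4 unfolding X_def[symmetric]
    by (intro integral_mono le Bochner_Integration.integrable_mult_right Bochner_Integration.integrable_add ie)
  also have "\<dots> = 256 * \<eta>\<^sup>2 * ((\<integral>\<omega>. exp (z * X \<omega>) \<partial>M) + (\<integral>\<omega>. exp (- z * X \<omega>) \<partial>M))"
    by (simp only: integral_mult_right_zero Bochner_Integration.integral_add[OF ie ie])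
  also have "\<dots> \<le> 256 * \<eta>\<^sup>2 * (momC T + momC T)"
    using \<eta> by (intro mult_left_mono add_mono m) (auto simp: z_def)
  finally show "(\<integral>\<omega>. (Nhat n \<tau> (real (Suc k) * \<eta>) \<omega> - Nhat n \<tau> (real k * \<eta>) \<omega>)^4 \<partial>M) \<le> 512 * momC T * \<eta>\<^sup>2"
    unfolding X_def by (simp add: mult_ac)
qed

end

section \<open>Dyadic chaining\<close>

definition dyadic_floor :: "nat \<Rightarrow> real \<Rightarrow> real" where
  "dyadic_floor l t = of_int \<lfloor>2 ^ l * t\<rfloor> / 2 ^ l"

text \<open>Passing to a coarser level drops the last \<open>L - l\<close> binary digits of the
  finest index.\<close>

lemma dyadic_floor_eq_div:
  assumes "t \<ge> 0" "l \<le> L"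
  shows "dyadic_floor l t = real (nat \<lfloor>2 ^ L * t\<rfloor> div 2 ^ (L - l)) / 2 ^ l"
proof -
  have "\<lfloor>2 ^ l * t\<rfloor> = \<lfloor>2 ^ L * t / real_of_int (2 ^ (L - l))\<rfloor>"
  proof -
    have "(2::real) ^ L = 2 ^ l * 2 ^ (L - l)" using assms(2) by (simp flip: power_add)
    then show ?thesis by simp
  qed
  also have "\<dots> = \<lfloor>2 ^ L * t\<rfloor> div 2 ^ (L - l)" by (rule floor_divide_real_eq_div) simp
  also have "\<dots> = int (nat \<lfloor>2 ^ L * t\<rfloor> div 2 ^ (L - l))"
    using assms by (simp add: zdiv_int)
  finally show ?thesis by (simp add: dyadic_floor_def)
qed

text \<open>Halving an even index stays at the same point, halving an odd one moves to the left
  neighbour on the finer grid; each level therefore costs at most one of its increments.\<close>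

lemma dyadic_chaining:
  fixes x :: "real \<Rightarrow> real"
  assumes step: "\<And>l j. l0 < l \<Longrightarrow> l \<le> l0 + d \<Longrightarrow> j < T * 2 ^ l \<Longrightarrow> \<bar>x (real (Suc j) / 2 ^ l) - x (real j / 2 ^ l)\<bar> \<le> m l"
    and m0: "\<And>l. m l \<ge> 0" and k: "k < T * 2 ^ (l0 + d)"
  shows "\<bar>x (real k / 2 ^ (l0 + d)) - x (real (k div 2 ^ d) / 2 ^ l0)\<bar> \<le> (\<Sum>l\<in>{l0<..l0 + d}. m l)"
  using step k
proof (induction d arbitrary: k)
  case 0
  then show ?case by simp
next
  case (Suc d)
  define k' where "k' = k div 2"
  have k': "k' < T * 2 ^ (l0 + d)" using Suc.prems(2) by (simp add: k'_def)
  have 1: "\<bar>x (real k' / 2 ^ (l0 + d)) - x (real (k' div 2 ^ d) / 2 ^ l0)\<bar> \<le> (\<Sum>l\<in>{l0<..l0 + d}. m l)"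
    by (rule Suc.IH[OF Suc.prems(1) k']) auto
  have e: "real k' / 2 ^ (l0 + d) = real (2 * k') / 2 ^ (l0 + Suc d)" by simp
  have 2: "\<bar>x (real k / 2 ^ (l0 + Suc d)) - x (real k' / 2 ^ (l0 + d))\<bar> \<le> m (l0 + Suc d)"
  proof (cases "even k")
    case True
    then have "k = 2 * k'" by (simp add: k'_def)
    then show ?thesis unfolding e using m0 by simp
  next
    case False
    then have "k = Suc (2 * k')" by (simp add: k'_def)
    then show ?thesis unfolding e using Suc.prems(1)[of "l0 + Suc d" "2 * k'"] Suc.prems(2) by simp
  qed
  have "k div 2 ^ Suc d = k' div 2 ^ d" by (simp add: k'_def div_mult2_eq)
  moreover have "{l0<..l0 + Suc d} = insert (l0 + Suc d) {l0<..l0 + d}" by auto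
  ultimately show ?case using 1 2 by simp
qed

context modulated_chain
begin

text \<open>For times below the finest chaining level: the counting process is monotone, so its
  movement inside a cell is at most that over the whole cell, up to the drift of the
  centring.\<close>

lemma Nhat_between:
  assumes n: "n \<ge> 1" and s: "0 \<le> s" "s \<le> t" "t \<le> s + h"
  shows "\<bar>Nhat n \<tau> t \<omega> - Nhat n \<tau> s \<omega>\<bar> \<le> \<bar>Nhat n \<tau> (s + h) \<omega> - Nhat n \<tau> s \<omega>\<bar> + sqrt n * (linf * h)"
proof -
  define sn where "sn = sqrt (real n)"
  have sn: "sn > 0" "real n = sn * sn" using n by (auto simp: sn_def)
  define N where "N t = real (counting_process n \<tau> t \<omega>)" for t
  have N: "N s \<le> N t" "N t \<le> N (s + h)" unfolding N_def using s by (auto intro!: counting_process_mono)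
  have r: "0 \<le> rho b - rho a" "rho b - rho a \<le> linf * (b - a)" if "0 \<le> a" "a \<le> b" for a b
  proof -
    have "exp (- (linf * a)) - exp (- (linf * b)) \<le> \<bar>linf * a - linf * b\<bar>"
      using abs_exp_minus_diff_le[of "linf * a" "linf * b"] linf_nonneg that by auto
    also have "\<dots> = linf * (b - a)" using that linf_nonneg by (simp add: right_diff_distrib[symmetric] abs_mult)
    finally show "rho b - rho a \<le> linf * (b - a)" by (simp add: rho_def)
    show "0 \<le> rho b - rho a" unfolding rho_def using that linf_nonneg by (simp add: mult_left_mono)
  qed
  have X: "Nhat n \<tau> b \<omega> - Nhat n \<tau> a \<omega> = (N b - N a) / sn - sn * (rho b - rho a)" for a b
    unfolding Nhat_def N_def sn_def[symmetric] sn(2) using sn(1) by (simp add: field_simps)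
  have h0: "h \<ge> 0" using s by simp
  have r1: "sn * (rho t - rho s) \<le> sn * (linf * h)" "0 \<le> sn * (rho t - rho s)"
  proof -
    have "rho t - rho s \<le> linf * (t - s)" using r(2)[of s t] s by simp
    also have "\<dots> \<le> linf * h" using s linf_nonneg by (intro mult_left_mono) auto
    finally show "sn * (rho t - rho s) \<le> sn * (linf * h)" using sn by (intro mult_left_mono) auto
    show "0 \<le> sn * (rho t - rho s)" using r(1)[of s t] s sn by simp
  qed
  have r2: "sn * (rho (s + h) - rho s) \<le> sn * (linf * h)"
    using r(2)[of s "s + h"] s h0 sn by simp
  have "0 \<le> (N t - N s) / sn" "(N t - N s) / sn \<le> (N (s + h) - N s) / sn"
    using N sn by (auto intro!: divide_right_mono)
  then show ?thesis unfolding X sn_def[symmetric] using r1 r2 by linarith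
qed

text \<open>Level \<open>l\<close> has \<open>T * 2 ^ l\<close> increments with fourth moments of
  order \<open>(1 / 2 ^ l)\<^sup>2\<close>, so their sum has mean of order \<open>1 / 2 ^ l\<close>.
  Splitting by \<open>abs_le_pow4\<close> at \<open>r ^ l\<close> balances both parts when
  \<open>r^4 = 1 / 2\<close>, and the resulting bounds \<open>C * r ^ l\<close> are summable over
  the levels.\<close>

theorem Nhat_oscillation:
  fixes M :: "nat \<Rightarrow> 'a measure" and T :: nat and \<epsilon> :: real
  assumes Z: "\<And>n. ctmc (M n) (real n *\<^sub>R Q) (Z n)" and mm: "\<And>n. mm_binomial_defaults (M n) lam (Z n) n (\<tau> n)"
    and \<epsilon>: "\<epsilon> > 0"
  shows "\<exists>l0. \<forall>l\<ge>l0. \<forall>\<^sub>F n in sequentially. \<exists>W. integrable (M n) W \<and> (\<integral>\<omega>. W \<omega> \<partial>M n) \<le> \<epsilon> \<and>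
     (\<forall>\<omega>\<in>space (M n). \<forall>t::real. 0 \<le> t \<and> t < real T \<longrightarrow> \<bar>Nhat n (\<tau> n) t \<omega> - Nhat n (\<tau> n) (dyadic_floor l t) \<omega>\<bar> \<le> W \<omega>)"
proof -
  define r :: real where "r = 2 powr (- 1 / 4)"
  have r0: "0 < r" "r < 1" by (auto simp: r_def powr_less_one)
  have r4: "r^4 = 1 / 2"
  proof -
    have "r^4 = 2 powr (real 4 * (- 1 / 4))" unfolding r_def by (simp add: powr_power)
    then show ?thesis by (simp add: powr_minus_divide)
  qed
  define C where "C = 1 + real T * (512 * momC (real T))"
  have mC: "momC T \<ge> 0" for T by (simp add: momC_def)
  have C1: "C \<ge> 1" using mC by (simp add: C_def)
  have "(\<lambda>l. C * (r ^ l / (1 - r))) \<longlonglongrightarrow> C * (0 / (1 - r))"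
    using r0 by (intro tendsto_intros LIMSEQ_power_zero) auto
  then have "\<forall>\<^sub>F l in sequentially. C * (r ^ l / (1 - r)) < \<epsilon> / 3"
    using \<epsilon> by (intro order_tendstoD) auto
  then obtain l0 where l0: "\<And>l. l \<ge> l0 \<Longrightarrow> C * (r ^ l / (1 - r)) < \<epsilon> / 3"
    by (auto simp: eventually_sequentially)
  \<comment> \<open>The finest mesh is of order \<open>n powr (- 3 / 4)\<close>: much longer than
    \<open>1 / n\<close>, as the moment bounds require, and much shorter than
    \<open>1 / sqrt n\<close>, so that the drift \<open>sqrt n * linf / 2 ^ L n\<close>
    vanishes.\<close>
  define L where "L n = nat \<lfloor>3 / 4 * log 2 (real n)\<rfloor>" for n
  have Lb: "2 ^ L n \<le> real n powr (3 / 4)" "real n powr (3 / 4) < 2 * 2 ^ L n" if "n \<ge> 1" for n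
  proof -
    have y: "3 / 4 * log 2 (real n) \<ge> 0" using that by simp
    have pw: "real n powr (3 / 4) = 2 powr (3 / 4 * log 2 (real n))"
    proof -
      have "2 powr (3 / 4 * log 2 (real n)) = (2 powr log 2 (real n)) powr (3 / 4)" by (simp only: powr_powr mult.commute)
      then show ?thesis using that by simp
    qed
    have "real (L n) \<le> 3 / 4 * log 2 (real n)" "3 / 4 * log 2 (real n) < real (L n) + 1"
      using y unfolding L_def by linarith+
    then have "2 powr real (L n) \<le> real n powr (3 / 4)" "real n powr (3 / 4) < 2 powr (real (L n) + 1)"
      unfolding pw by auto
    then show "2 ^ L n \<le> real n powr (3 / 4)" "real n powr (3 / 4) < 2 * 2 ^ L n"
      by (auto simp: powr_add powr_realpow)
  qed
  have Linf: "filterlim L at_top sequentially" unfolding L_def by real_asymp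
  have ev1: "\<forall>\<^sub>F n in sequentially. C * r ^ L n < \<epsilon> / 3"
  proof -
    have "(\<lambda>n. C * r ^ L n) \<longlonglongrightarrow> C * 0"
      using r0 by (intro tendsto_intros filterlim_compose[OF LIMSEQ_power_zero Linf]) auto
    then show ?thesis using \<epsilon> by (intro order_tendstoD) auto
  qed
  have ev2: "\<forall>\<^sub>F n in sequentially. 2 * linf * (sqrt (real n) / real n powr (3 / 4)) < \<epsilon> / 3"
  proof -
    have "(\<lambda>n::nat. sqrt (real n) / real n powr (3 / 4)) \<longlonglongrightarrow> 0" by real_asymp
    then have "(\<lambda>n. 2 * linf * (sqrt (real n) / real n powr (3 / 4))) \<longlonglongrightarrow> 2 * linf * 0" by (intro tendsto_intros)
    then show ?thesis using \<epsilon> by (intro order_tendstoD) auto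
  qed
  have ev3: "\<forall>\<^sub>F n in sequentially. 16 * B\<^sup>2 \<le> real n / real n powr (3 / 4)"
  proof -
    have "filterlim (\<lambda>n::nat. real n / real n powr (3 / 4)) at_top sequentially" by real_asymp
    then show ?thesis by (simp add: filterlim_at_top)
  qed
  have ev4: "\<forall>\<^sub>F n in sequentially. 16 * B^4 \<le> real n"
    using filterlim_real_sequentially by (simp add: filterlim_at_top)
  show ?thesis
  proof (intro exI[of _ l0] allI impI)
    fix l assume l: "l \<ge> l0"
    have ev5: "\<forall>\<^sub>F n in sequentially. l \<le> L n" using Linf by (simp add: filterlim_at_top)
    show "\<forall>\<^sub>F n in sequentially. \<exists>W. integrable (M n) W \<and> (\<integral>\<omega>. W \<omega> \<partial>M n) \<le> \<epsilon> \<and>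
     (\<forall>\<omega>\<in>space (M n). \<forall>t::real. 0 \<le> t \<and> t < real T \<longrightarrow> \<bar>Nhat n (\<tau> n) t \<omega> - Nhat n (\<tau> n) (dyadic_floor l t) \<omega>\<bar> \<le> W \<omega>)"
      using ev1 ev2 ev3 ev4 ev5 eventually_ge_at_top[of 1]
    proof eventually_elim
      case (elim n)
      interpret prob_space "M n" using Z[of n] by (simp add: ctmc_def)
      note n = elim(6)
      define X where "X t \<omega> = Nhat n (\<tau> n) t \<omega>" for t \<omega>
      define D where "D l j \<omega> = X (real (Suc j) / 2 ^ l) \<omega> - X (real j / 2 ^ l) \<omega>" for l j \<omega>
      define m where "m l \<omega> = r ^ l + (\<Sum>j<T * 2 ^ l. (D l j \<omega>)^4) / (r ^ l)^3" for l \<omega>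
      \<comment> \<open>Chaining from level \<open>l\<close> to \<open>L n\<close>, one further
        increment of the finest level, and the drift within it.\<close>
      define W where "W \<omega> = (\<Sum>l'\<in>{l<..L n}. m l' \<omega>) + m (L n) \<omega> + sqrt n * (linf * (1 / 2 ^ L n))" for \<omega>
      have mom: "integrable (M n) (\<lambda>\<omega>. (D l' j \<omega>)^4)" "(\<integral>\<omega>. (D l' j \<omega>)^4 \<partial>M n) \<le> 512 * momC (real T) * (1 / 2 ^ l')\<^sup>2"
        if "l' \<le> L n" "j < T * 2 ^ l'" for l' j
      proof -
        have \<eta>: "0 < 1 / (2::real) ^ l'" "1 / (2::real) ^ l' \<le> 1" by auto
        have c: "16 * B\<^sup>2 \<le> real n * (1 / 2 ^ l')"
        proof -
          have "(2::real) ^ l' \<le> 2 ^ L n" using that by (intro power_increasing) auto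
          also have "\<dots> \<le> real n powr (3 / 4)" by (rule Lb[OF n])
          finally have "real n / real n powr (3 / 4) \<le> real n / 2 ^ l'" by (intro divide_left_mono) (use n in auto)
          then show ?thesis using elim(3) by simp
        qed
        have "real j \<le> real (T * 2 ^ l')" using that by (simp only: of_nat_le_iff less_imp_le)
        then have T: "real j * (1 / 2 ^ l') \<le> real T" by (simp add: field_simps)
        show "integrable (M n) (\<lambda>\<omega>. (D l' j \<omega>)^4)" "(\<integral>\<omega>. (D l' j \<omega>)^4 \<partial>M n) \<le> 512 * momC (real T) * (1 / 2 ^ l')\<^sup>2"
          using Nhat_increment_4th_moment[OF Z mm n elim(4) \<eta> c T] by (simp_all add: D_def X_def)
      qed
      have im: "integrable (M n) (m l')" if "l' \<le> L n" for l'
        unfolding m_def[abs_def] using mom(1)[OF that]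
        by (intro Bochner_Integration.integrable_add integrable_const Bochner_Integration.integrable_divide Bochner_Integration.integrable_sum) auto
      have em: "(\<integral>\<omega>. m l' \<omega> \<partial>M n) \<le> C * r ^ l'" if "l' \<le> L n" for l'
      proof -
        have i: "integrable (M n) (\<lambda>\<omega>. (\<Sum>j<T * 2 ^ l'. (D l' j \<omega>)^4) / (r ^ l')^3)"
          using mom(1)[OF that] by (intro Bochner_Integration.integrable_divide Bochner_Integration.integrable_sum) auto
        have "(\<integral>\<omega>. m l' \<omega> \<partial>M n) = r ^ l' + (\<integral>\<omega>. (\<Sum>j<T * 2 ^ l'. (D l' j \<omega>)^4) / (r ^ l')^3 \<partial>M n)"
          unfolding m_def Bochner_Integration.integral_add[OF integrable_const i] by (simp add: prob_space)
        also have "(\<integral>\<omega>. (\<Sum>j<T * 2 ^ l'. (D l' j \<omega>)^4) / (r ^ l')^3 \<partial>M n) = (\<Sum>j<T * 2 ^ l'. \<integral>\<omega>. (D l' j \<omega>)^4 \<partial>M n) / (r ^ l')^3"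
          unfolding integral_divide_zero using mom(1)[OF that]
          by (subst Bochner_Integration.integral_sum) auto
        also have "\<dots> \<le> (\<Sum>j<T * 2 ^ l'. 512 * momC (real T) * (1 / 2 ^ l')\<^sup>2) / (r ^ l')^3"
          using mom(2)[OF that] r0 by (intro divide_right_mono sum_mono) auto
        also have "\<dots> = real T * (512 * momC (real T)) * r ^ l'"
        proof -
          have "(r ^ l')^4 = 1 / 2 ^ l'"
          proof -
            have "(r ^ l')^4 = (r^4) ^ l'" by (simp only: power_mult[symmetric] mult.commute)
            then show ?thesis unfolding r4 by (simp add: power_divide)
          qed
          then have "1 / 2 ^ l' / (r ^ l')^3 = r ^ l'"
            using r0 by (simp add: field_simps power4_eq_xxxx power3_eq_cube)
          moreover have "(\<Sum>j<T * 2 ^ l'. 512 * momC (real T) * (1 / 2 ^ l')\<^sup>2) / (r ^ l')^3 = real T * (512 * momC (real T)) * (1 / 2 ^ l' / (r ^ l')^3)"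
            by (simp add: power2_eq_square)
          ultimately show ?thesis by simp
        qed
        finally show ?thesis by (simp add: C_def algebra_simps)
      qed
      have iW: "integrable (M n) W"
        unfolding W_def[abs_def] by (intro Bochner_Integration.integrable_add Bochner_Integration.integrable_sum integrable_const im) auto
      have "(\<integral>\<omega>. W \<omega> \<partial>M n) = (\<Sum>l'\<in>{l<..L n}. \<integral>\<omega>. m l' \<omega> \<partial>M n) + (\<integral>\<omega>. m (L n) \<omega> \<partial>M n) + sqrt n * (linf * (1 / 2 ^ L n))"
      proof -
        have i1: "integrable (M n) (\<lambda>\<omega>. \<Sum>l'\<in>{l<..L n}. m l' \<omega>)" by (intro Bochner_Integration.integrable_sum im) auto
        have i2: "integrable (M n) (\<lambda>\<omega>. (\<Sum>l'\<in>{l<..L n}. m l' \<omega>) + m (L n) \<omega>)" by (intro Bochner_Integration.integrable_add i1 im) auto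
        show ?thesis unfolding W_def Bochner_Integration.integral_add[OF i2 integrable_const] Bochner_Integration.integral_add[OF i1 im[OF order_refl]]
          by (subst Bochner_Integration.integral_sum) (auto intro!: im simp: prob_space)
      qed
      also have "\<dots> \<le> \<epsilon> / 3 + \<epsilon> / 3 + \<epsilon> / 3"
      proof (intro add_mono)
        have "(\<Sum>l'\<in>{l<..L n}. \<integral>\<omega>. m l' \<omega> \<partial>M n) \<le> (\<Sum>l'\<in>{l<..L n}. C * r ^ l')" by (intro sum_mono em) auto
        also have "\<dots> = C * (\<Sum>l'=Suc l..L n. r ^ l')" by (simp add: sum_distrib_left atLeastSucAtMost_greaterThanAtMost)
        also have "\<dots> \<le> C * (r ^ l / (1 - r))"
        proof (intro mult_left_mono)
          show "(\<Sum>l'=Suc l..L n. r ^ l') \<le> r ^ l / (1 - r)"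
          proof (cases "Suc l \<le> L n")
            case True
            have "(1 - r) * (\<Sum>l'=Suc l..L n. r ^ l') = r ^ Suc l - r ^ Suc (L n)" by (rule sum_gp_multiplied[OF True])
            also have "\<dots> \<le> r ^ l"
            proof -
              have "r ^ Suc l \<le> r ^ l" using r0 by (intro power_decreasing) auto
              moreover have "0 \<le> r ^ Suc (L n)" using r0 by simp
              ultimately show ?thesis by linarith
            qed
            finally show ?thesis using r0 by (simp add: pos_le_divide_eq mult.commute)
          qed (use r0 in simp)
        qed (use C1 in simp)
        also have "\<dots> \<le> \<epsilon> / 3" using l0[OF l] by simp
        finally show "(\<Sum>l'\<in>{l<..L n}. \<integral>\<omega>. m l' \<omega> \<partial>M n) \<le> \<epsilon> / 3" .
        show "(\<integral>\<omega>. m (L n) \<omega> \<partial>M n) \<le> \<epsilon> / 3" using em[of "L n"] elim(1) by simp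
        have p: "real n powr (3 / 4) > 0" using n by simp
        have "1 / 2 ^ L n \<le> 2 / real n powr (3 / 4)" using Lb(2)[OF n] p by (simp add: field_simps)
        then have "sqrt n * (linf * (1 / 2 ^ L n)) \<le> sqrt n * (linf * (2 / real n powr (3 / 4)))"
          using linf_nonneg by (intro mult_left_mono) auto
        also have "\<dots> = 2 * linf * (sqrt (real n) / real n powr (3 / 4))" by simp
        finally show "sqrt n * (linf * (1 / 2 ^ L n)) \<le> \<epsilon> / 3" using elim(2) by linarith
      qed
      finally have EW: "(\<integral>\<omega>. W \<omega> \<partial>M n) \<le> \<epsilon>" by simp
      have pt: "\<bar>X t \<omega> - X (dyadic_floor l t) \<omega>\<bar> \<le> W \<omega>" if t: "0 \<le> t" "t < real T" for t \<omega>
      proof -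
        define k where "k = nat \<lfloor>2 ^ L n * t\<rfloor>"
        have kt: "real k \<le> 2 ^ L n * t" "2 ^ L n * t < real k + 1"
        proof -
          have "0 \<le> 2 ^ L n * t" using t by simp
          then show "real k \<le> 2 ^ L n * t" "2 ^ L n * t < real k + 1" unfolding k_def by linarith+
        qed
        have kT: "k < T * 2 ^ L n"
        proof -
          have "2 ^ L n * t < 2 ^ L n * real T" using t by (intro mult_strict_left_mono) auto
          with kt(1) have "real k < 2 ^ L n * real T" by (rule le_less_trans)
          then have "real k < real (T * 2 ^ L n)" by (simp add: mult.commute)
          then show ?thesis by (simp only: of_nat_less_iff)
        qed
        have m0: "m l' \<omega> \<ge> 0" for l' unfolding m_def using r0 by (intro add_nonneg_nonneg divide_nonneg_nonneg sum_nonneg) auto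
        have Dm: "\<bar>D l' j \<omega>\<bar> \<le> m l' \<omega>" if "j < T * 2 ^ l'" for l' j
        proof -
          have "\<bar>D l' j \<omega>\<bar> \<le> r ^ l' + (D l' j \<omega>)^4 / (r ^ l')^3" using r0 by (intro abs_le_pow4) simp
          also have "\<dots> \<le> m l' \<omega>" unfolding m_def
            using r0 that by (intro add_left_mono divide_right_mono member_le_sum) auto
          finally show ?thesis .
        qed
        define a where "a = real k / 2 ^ L n"
        have a: "0 \<le> a" "a \<le> t" "t \<le> a + 1 / 2 ^ L n" using kt by (auto simp: a_def field_simps)
        have "\<bar>X t \<omega> - X a \<omega>\<bar> \<le> \<bar>X (a + 1 / 2 ^ L n) \<omega> - X a \<omega>\<bar> + sqrt n * (linf * (1 / 2 ^ L n))"
          unfolding X_def by (rule Nhat_between[OF n a])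
        also have "X (a + 1 / 2 ^ L n) \<omega> - X a \<omega> = D (L n) k \<omega>"
          by (simp add: D_def a_def add_divide_distrib add.commute)
        also have "\<bar>\<dots>\<bar> \<le> m (L n) \<omega>" by (rule Dm[OF kT])
        finally have 1: "\<bar>X t \<omega> - X a \<omega>\<bar> \<le> m (L n) \<omega> + sqrt n * (linf * (1 / 2 ^ L n))" by simp
        have ld: "l + (L n - l) = L n" using elim(5) by simp
        have "\<bar>X (real k / 2 ^ (l + (L n - l))) \<omega> - X (real (k div 2 ^ (L n - l)) / 2 ^ l) \<omega>\<bar> \<le> (\<Sum>l'\<in>{l<..l + (L n - l)}. m l' \<omega>)"
          by (rule dyadic_chaining[where x = "\<lambda>t. X t \<omega>" and T = T]) (use Dm m0 kT ld in \<open>auto simp: D_def\<close>)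
        then have 2: "\<bar>X a \<omega> - X (dyadic_floor l t) \<omega>\<bar> \<le> (\<Sum>l'\<in>{l<..L n}. m l' \<omega>)"
          unfolding ld dyadic_floor_eq_div[OF t(1) elim(5)] a_def k_def[symmetric] .
        show ?thesis unfolding W_def using 1 2 by linarith
      qed
      show ?case
      proof (rule exI[of _ W], intro conjI iW EW ballI allI impI)
        fix \<omega> t assume "0 \<le> t \<and> t < real T"
        then show "\<bar>Nhat n (\<tau> n) t \<omega> - Nhat n (\<tau> n) (dyadic_floor l t) \<omega>\<bar> \<le> W \<omega>"
          using pt[of t \<omega>] by (simp add: X_def)
      qed
    qed
  qed
qed

lemma Nhat_0: 
  assumes "ctmc M A Z" "mm_binomial_defaults M lam Z n \<tau>"
  shows "AE \<omega> in M. Nhat n \<tau> 0 \<omega> = 0"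
  using mm_binomial_positive[OF assms lam_nonneg]
proof eventually_elim
  case (elim \<omega>)
  then have "{i. i < n \<and> \<tau> i \<omega> \<le> ereal 0} = {}" by (auto simp: not_le)
  then show ?case unfolding Nhat_def rho_def counting_process_def by simp
qed

text \<open>At a fixed dyadic time the value telescopes from 0 over \<open>k\<close> increments,
  each controlled through \<open>\<bar>x\<bar> \<le> 1 + x^4\<close>.\<close>

lemma Nhat_first_moment:
  fixes M :: "nat \<Rightarrow> 'a measure"
  assumes Z: "\<And>n. ctmc (M n) (real n *\<^sub>R Q) (Z n)" and mm: "\<And>n. mm_binomial_defaults (M n) lam (Z n) n (\<tau> n)"
  shows "\<exists>C. \<forall>\<^sub>F n in sequentially. integrable (M n) (Nhat n (\<tau> n) (real k / 2 ^ l)) \<and> (\<integral>\<omega>. \<bar>Nhat n (\<tau> n) (real k / 2 ^ l) \<omega>\<bar> \<partial>M n) \<le> C"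
proof -
  define C where "C = real k * (1 + 512 * momC (real k) * (1 / 2 ^ l)\<^sup>2)"
  have "\<forall>\<^sub>F n in sequentially. max (16 * B^4) (16 * B\<^sup>2 * 2 ^ l) \<le> real n"
    using filterlim_real_sequentially unfolding filterlim_at_top by blast
  then have "\<forall>\<^sub>F n in sequentially. integrable (M n) (Nhat n (\<tau> n) (real k / 2 ^ l)) \<and> (\<integral>\<omega>. \<bar>Nhat n (\<tau> n) (real k / 2 ^ l) \<omega>\<bar> \<partial>M n) \<le> C"
    using eventually_ge_at_top[of 1]
  proof eventually_elim
    case (elim n)
    interpret prob_space "M n" using Z[of n] by (simp add: ctmc_def)
    note [measurable] = Nhat_measurable[OF mm]
    define X where "X j \<omega> = Nhat n (\<tau> n) (real j * (1 / 2 ^ l)) \<omega>" for j \<omega>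
    have iX: "integrable (M n) (X j)" for j
      unfolding X_def[abs_def] using elim
      by (intro Bochner_Integration.integrable_bound[OF integrable_const[of "sqrt (real n)"]]) (auto intro!: AE_I2 Nhat_bound)
    have mom: "integrable (M n) (\<lambda>\<omega>. (X (Suc j) \<omega> - X j \<omega>)^4)" "(\<integral>\<omega>. (X (Suc j) \<omega> - X j \<omega>)^4 \<partial>M n) \<le> 512 * momC (real k) * (1 / 2 ^ l)\<^sup>2" if "j < k" for j
    proof -
      have \<eta>: "0 < 1 / (2::real) ^ l" "1 / (2::real) ^ l \<le> 1" by auto
      have c: "16 * B\<^sup>2 \<le> real n * (1 / 2 ^ l)" using elim by (simp add: field_simps)
      have "real j * (1 / 2 ^ l) \<le> real j * 1" by (intro mult_left_mono) auto
      then have T: "real j * (1 / 2 ^ l) \<le> real k" using that by simp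
      show "integrable (M n) (\<lambda>\<omega>. (X (Suc j) \<omega> - X j \<omega>)^4)" "(\<integral>\<omega>. (X (Suc j) \<omega> - X j \<omega>)^4 \<partial>M n) \<le> 512 * momC (real k) * (1 / 2 ^ l)\<^sup>2"
        unfolding X_def using elim by (intro Nhat_increment_4th_moment[OF Z mm _ _ \<eta> c T]; simp)+
    qed
    have "\<bar>X k \<omega>\<bar> \<le> \<bar>X 0 \<omega>\<bar> + (\<Sum>j<k. 1 + (X (Suc j) \<omega> - X j \<omega>)^4)" for \<omega>
    proof -
      have "X k \<omega> = X 0 \<omega> + (\<Sum>j<k. X (Suc j) \<omega> - X j \<omega>)" using sum_lessThan_telescope[of "\<lambda>j. X j \<omega>" k] by simp
      then have "\<bar>X k \<omega>\<bar> \<le> \<bar>X 0 \<omega>\<bar> + \<bar>\<Sum>j<k. X (Suc j) \<omega> - X j \<omega>\<bar>" by linarith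
      also have "\<bar>\<Sum>j<k. X (Suc j) \<omega> - X j \<omega>\<bar> \<le> (\<Sum>j<k. 1 + (X (Suc j) \<omega> - X j \<omega>)^4)"
      proof (rule order_trans[OF sum_abs sum_mono])
        fix j show "\<bar>X (Suc j) \<omega> - X j \<omega>\<bar> \<le> 1 + (X (Suc j) \<omega> - X j \<omega>)^4" using abs_le_pow4[of 1 "X (Suc j) \<omega> - X j \<omega>"] by simp
      qed
      finally show ?thesis by simp
    qed
    note pb = this
    have "AE \<omega> in M n. X 0 \<omega> = 0" using Nhat_0[OF Z mm, of n] by (simp add: X_def)
    then have AEb: "AE \<omega> in M n. \<bar>X k \<omega>\<bar> \<le> (\<Sum>j<k. 1 + (X (Suc j) \<omega> - X j \<omega>)^4)"
    proof eventually_elim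
      case (elim \<omega>)
      then show ?case using pb[of \<omega>] by simp
    qed
    have "(\<integral>\<omega>. \<bar>X k \<omega>\<bar> \<partial>M n) \<le> (\<integral>\<omega>. (\<Sum>j<k. 1 + (X (Suc j) \<omega> - X j \<omega>)^4) \<partial>M n)"
      using iX mom(1) AEb by (intro integral_mono_AE integrable_abs Bochner_Integration.integrable_sum Bochner_Integration.integrable_add integrable_const) auto
    also have "\<dots> = (\<Sum>j<k. \<integral>\<omega>. 1 + (X (Suc j) \<omega> - X j \<omega>)^4 \<partial>M n)"
      using mom(1) by (intro Bochner_Integration.integral_sum Bochner_Integration.integrable_add integrable_const) auto
    also have "\<dots> \<le> (\<Sum>j<k. 1 + 512 * momC (real k) * (1 / 2 ^ l)\<^sup>2)"
    proof (intro sum_mono)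
      fix j assume "j \<in> {..<k}"
      then have j: "j < k" by simp
      show "(\<integral>\<omega>. 1 + (X (Suc j) \<omega> - X j \<omega>)^4 \<partial>M n) \<le> 1 + 512 * momC (real k) * (1 / 2 ^ l)\<^sup>2"
        unfolding Bochner_Integration.integral_add[OF integrable_const mom(1)[OF j]] using mom(2)[OF j] by (simp add: prob_space)
    qed
    also have "\<dots> = C" by (simp add: C_def)
    moreover have "X k = Nhat n (\<tau> n) (real k / 2 ^ l)" by (simp add: X_def fun_eq_iff)
    ultimately show ?case using iX[of k] by simp
  qed
  then show ?thesis by blast
qed

end

section \<open>A criterion for convergence in distribution to a continuous limit\<close>

text \<open>Restricting to rational times keeps \<open>path_dist\<close> measurable for the product sigma-algebra; on cadlag
  paths it metrises locally uniform convergence.\<close>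
definition path_dist :: "(real \<Rightarrow> real) \<Rightarrow> (real \<Rightarrow> real) \<Rightarrow> real" where
  "path_dist x y = (SUP q\<in>\<rat> \<inter> {0..}. min \<bar>x q - y q\<bar> (1 / (1 + q)))"

lemma min_horizon_le_1: "q \<ge> 0 \<Longrightarrow> min a (1 / (1 + q)) \<le> 1" for a q :: real
  by (rule min.coboundedI2) (simp add: divide_le_eq_1)

lemma path_dist_bdd: "bdd_above ((\<lambda>q. min \<bar>x q - y q\<bar> (1 / (1 + q))) ` (\<rat> \<inter> {0..}))" for x y :: "real \<Rightarrow> real"
proof (rule bdd_aboveI[of _ 1])
  fix z assume "z \<in> (\<lambda>q. min \<bar>x q - y q\<bar> (1 / (1 + q))) ` (\<rat> \<inter> {0..})"
  then obtain q where q: "q \<ge> 0" "z = min \<bar>x q - y q\<bar> (1 / (1 + q))" by auto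
  show "z \<le> 1" unfolding q(2) by (rule min_horizon_le_1[OF q(1)])
qed

lemma path_dist_index_ne: "\<rat> \<inter> {0::real..} \<noteq> {}"
  using Rats_0 by auto

lemma path_dist_upper: "q \<in> \<rat> \<Longrightarrow> q \<ge> 0 \<Longrightarrow> min \<bar>x q - y q\<bar> (1 / (1 + q)) \<le> path_dist x y"
  unfolding path_dist_def by (intro cSUP_upper path_dist_bdd) auto

lemma path_dist_least:
  "(\<And>q. q \<in> \<rat> \<Longrightarrow> q \<ge> 0 \<Longrightarrow> min \<bar>x q - y q\<bar> (1 / (1 + q)) \<le> c) \<Longrightarrow> path_dist x y \<le> c"
  unfolding path_dist_def by (intro cSUP_least path_dist_index_ne) auto

lemma path_dist_nonneg: "path_dist x y \<ge> 0"
  using path_dist_upper[of 0 x y] by simp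

lemma path_dist_le_1: "path_dist x y \<le> 1"
  by (intro path_dist_least min_horizon_le_1)

lemma path_dist_commute: "path_dist x y = path_dist y x"
  by (simp add: path_dist_def abs_minus_commute)

lemma path_dist_triangle: "path_dist x z \<le> path_dist x y + path_dist y z"
proof (rule path_dist_least)
  fix q :: real assume q: "q \<in> \<rat>" "q \<ge> 0"
  have "min \<bar>x q - z q\<bar> (1 / (1 + q)) \<le> min \<bar>x q - y q\<bar> (1 / (1 + q)) + min \<bar>y q - z q\<bar> (1 / (1 + q))"
    using q by (auto simp: min_def)
  then show "min \<bar>x q - z q\<bar> (1 / (1 + q)) \<le> path_dist x y + path_dist y z"
    using path_dist_upper[OF q, of x y] path_dist_upper[OF q, of y z] by linarith
qed

lemma path_dist_le_horizon:
  assumes "T \<ge> 0" "a \<ge> 0" "\<And>q. 0 \<le> q \<Longrightarrow> q < T \<Longrightarrow> \<bar>x q - y q\<bar> \<le> a"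
  shows "path_dist x y \<le> max a (1 / (1 + T))"
proof (rule path_dist_least)
  fix q :: real assume q: "q \<in> \<rat>" "q \<ge> 0"
  show "min \<bar>x q - y q\<bar> (1 / (1 + q)) \<le> max a (1 / (1 + T))"
  proof (cases "q < T")
    case True
    then show ?thesis using assms(3)[OF q(2)] by (auto simp: min_def max_def)
  next
    case False
    then have "1 / (1 + q) \<le> 1 / (1 + T)" using assms(1) by (intro divide_left_mono) auto
    then show ?thesis by (auto simp: min_def max_def)
  qed
qed

text \<open>Right continuity transfers the bound from rational times to all times.\<close>

lemma path_dist_all:
  assumes x: "cadlag_path x" and y: "cadlag_path y" and t: "t \<ge> 0"
  shows "min \<bar>x t - y t\<bar> (1 / (1 + t)) \<le> path_dist x y"
proof -
  have "(x \<longlongrightarrow> x t) (at_right t)" "(y \<longlongrightarrow> y t) (at_right t)"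
    using x y t by (auto simp: cadlag_path_def continuous_within)
  then have l: "((\<lambda>s. min \<bar>x s - y s\<bar> (1 / (1 + s))) \<longlongrightarrow> min \<bar>x t - y t\<bar> (1 / (1 + t))) (at_right t)"
    using t by (intro tendsto_intros) auto
  have "\<exists>q\<in>\<rat>. t < q \<and> q < t + 1 / real (Suc k)" for k
    using Rats_dense_in_real[of t "t + 1 / real (Suc k)"] by auto
  then obtain q where q: "\<And>k. q k \<in> \<rat>" "\<And>k. t < q k" "\<And>k. q k < t + 1 / real (Suc k)" by metis
  have "q \<longlonglongrightarrow> t"
  proof (rule tendsto_sandwich)
    show "\<forall>\<^sub>F k in sequentially. t \<le> q k" using q(2) by (simp add: less_imp_le)
    show "\<forall>\<^sub>F k in sequentially. q k \<le> t + 1 / real (Suc k)" using q(3) by (simp add: less_imp_le)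
    show "(\<lambda>k. t + 1 / real (Suc k)) \<longlonglongrightarrow> t"
      using tendsto_add[OF tendsto_const LIMSEQ_Suc[OF lim_const_over_n[of 1]], of t] by simp
  qed simp
  then have "filterlim q (at_right t) sequentially"
    unfolding filterlim_at using q(2) by (auto intro!: always_eventually simp: less_imp_neq[THEN not_sym])
  then have "(\<lambda>k. min \<bar>x (q k) - y (q k)\<bar> (1 / (1 + q k))) \<longlonglongrightarrow> min \<bar>x t - y t\<bar> (1 / (1 + t))"
    by (rule filterlim_compose[OF l])
  moreover have "\<forall>\<^sub>F k in sequentially. min \<bar>x (q k) - y (q k)\<bar> (1 / (1 + q k)) \<le> path_dist x y"
    using q t by (intro always_eventually allI path_dist_upper) (auto intro: less_imp_le order.strict_trans1)
  ultimately show ?thesis by (rule tendsto_upperbound) simp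
qed

lemma continuous_imp_cadlag:
  fixes x :: "real \<Rightarrow> real"
  assumes "continuous_on {0..} x" shows "cadlag_path x"
  unfolding cadlag_path_def
proof (intro conjI allI impI)
  fix t :: real assume t: "0 \<le> t"
  have "(x \<longlongrightarrow> x t) (at t within {0..})" using assms t by (auto simp: continuous_on_def)
  then have "(x \<longlongrightarrow> x t) (at_right t)" by (rule tendsto_within_subset) (use t in auto)
  then show "continuous (at_right t) x" by (simp add: continuous_within)
next
  fix t :: real assume t: "0 < t"
  then have "isCont x t" using assms by (auto intro: continuous_on_interior)
  then show "\<exists>l. (x \<longlongrightarrow> l) (at_left t)"
    by (auto simp: isCont_def intro: tendsto_within_subset[of _ _ _ UNIV])
qed

text \<open>Locally uniform convergence is Skorokhod convergence with identity time changes, so a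
  sequence of paths violating the claim would contradict the continuity of \<open>f\<close>.\<close>

lemma skorokhod_continuous_uniform:
  assumes f: "skorokhod_continuous f" and x: "continuous_on {0..} x" and \<epsilon>: "\<epsilon> > 0"
  shows "\<exists>r>0. \<forall>y. cadlag_path y \<and> path_dist y x < r \<longrightarrow> \<bar>f y - f x\<bar> \<le> \<epsilon>"
proof (rule ccontr)
  assume "\<not> ?thesis"
  then have "\<exists>y. cadlag_path y \<and> path_dist y x < 1 / real (Suc k) \<and> \<not> \<bar>f y - f x\<bar> \<le> \<epsilon>" for k
    by (metis divide_pos_pos of_nat_0_less_iff zero_less_Suc zero_less_one)
  then obtain y where y: "\<And>k. cadlag_path (y k)" "\<And>k. path_dist (y k) x < 1 / real (Suc k)" "\<And>k. \<not> \<bar>f (y k) - f x\<bar> \<le> \<epsilon>" by metis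
  have cx: "cadlag_path x" by (rule continuous_imp_cadlag[OF x])
  have "skorokhod_conv y x"
    unfolding skorokhod_conv_def
  proof (intro exI[of _ "\<lambda>_ t. t"] conjI allI impI)
    fix T e :: real assume T: "T > 0" and e: "e > 0"
    \<comment> \<open>Below \<open>1 / (1 + T)\<close> the truncation in \<open>path_dist\<close> is
      inactive up to time \<open>T\<close>.\<close>
    have "\<forall>\<^sub>F k in sequentially. 1 / real (Suc k) < min e (1 / (1 + T))"
      using T e by (intro order_tendstoD(2)[OF LIMSEQ_Suc[OF lim_const_over_n[of 1]]]) auto
    then show "\<forall>\<^sub>F k in sequentially. \<forall>t\<in>{0..T}. \<bar>y k t - x t\<bar> \<le> e"
    proof eventually_elim
      case (elim k)
      show ?case
      proof
        fix t assume t: "t \<in> {0..T}"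
        have "min \<bar>y k t - x t\<bar> (1 / (1 + t)) < min e (1 / (1 + T))"
          using path_dist_all[OF y(1) cx, of t k] y(2)[of k] elim t by auto
        moreover have "1 / (1 + T) \<le> 1 / (1 + t)" using t by (intro divide_left_mono) auto
        ultimately show "\<bar>y k t - x t\<bar> \<le> e" by (auto simp: min_def split: if_splits)
      qed
    qed
  qed (auto simp: strict_mono_on_def)
  then have "(\<lambda>k. f (y k)) \<longlonglongrightarrow> f x"
    using f y(1) cx unfolding skorokhod_continuous_def by blast
  then have "\<forall>\<^sub>F k in sequentially. dist (f (y k)) (f x) < \<epsilon>" using \<epsilon> by (rule tendstoD)
  then obtain k where "dist (f (y k)) (f x) < \<epsilon>" by (auto simp: eventually_sequentially)
  then show False using y(3)[of k] by (simp add: dist_real_def)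
qed

section \<open>Lipschitz majorants built from countably many balls\<close>

definition rat_step :: "nat \<Rightarrow> rat list \<Rightarrow> real \<Rightarrow> real" where
  "rat_step l as t = (if nat \<lfloor>2 ^ l * t\<rfloor> < length as then real_of_rat (as ! nat \<lfloor>2 ^ l * t\<rfloor>) else 0)"

lemma nat_floor_dyadic:
  assumes "0 \<le> t"
  shows "real (nat \<lfloor>2 ^ l * t\<rfloor>) / 2 ^ l = dyadic_floor l t" "dyadic_floor l t \<le> t" "t < dyadic_floor l t + 1 / 2 ^ l" "0 \<le> dyadic_floor l t"
proof -
  show e: "real (nat \<lfloor>2 ^ l * t\<rfloor>) / 2 ^ l = dyadic_floor l t" using assms by (simp add: dyadic_floor_def)
  show "0 \<le> dyadic_floor l t" unfolding e[symmetric] by simp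
  have "of_int \<lfloor>2 ^ l * t\<rfloor> \<le> 2 ^ l * t" "2 ^ l * t < of_int \<lfloor>2 ^ l * t\<rfloor> + 1" by linarith+
  then show "dyadic_floor l t \<le> t" "t < dyadic_floor l t + 1 / 2 ^ l"
    unfolding dyadic_floor_def by (simp_all add: field_simps)
qed

lemma nat_floor_dyadic_less:
  assumes "0 \<le> t" "t < real T" shows "nat \<lfloor>2 ^ l * t\<rfloor> < T * 2 ^ l"
proof -
  have "2 ^ l * t < 2 ^ l * real T" using assms by (intro mult_strict_left_mono) auto
  then have "\<lfloor>2 ^ l * t\<rfloor> < int (T * 2 ^ l)" by (simp add: floor_less_iff mult.commute)
  then show ?thesis using assms by (simp add: nat_less_iff)
qed

lemma continuous_path_dyadic:
  fixes x :: "real \<Rightarrow> real"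
  assumes x: "continuous_on {0..} x" and \<epsilon>: "\<epsilon> > 0"
  shows "\<exists>l0. \<forall>l\<ge>l0. \<forall>t. 0 \<le> t \<and> t < real T \<longrightarrow> \<bar>x t - x (dyadic_floor l t)\<bar> \<le> \<epsilon>"
proof -
  have "uniformly_continuous_on {0..real T} x"
    by (intro compact_uniformly_continuous continuous_on_subset[OF x]) auto
  then obtain \<delta> where \<delta>: "\<delta> > 0" "\<And>s t. s \<in> {0..real T} \<Longrightarrow> t \<in> {0..real T} \<Longrightarrow> dist s t < \<delta> \<Longrightarrow> dist (x s) (x t) < \<epsilon>"
    using \<epsilon> unfolding uniformly_continuous_on_def by metis
  obtain l0 where l0: "(1 / 2) ^ l0 < \<delta>" using real_arch_pow_inv[OF \<delta>(1), of "1/2"] by auto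
  have "\<bar>x t - x (dyadic_floor l t)\<bar> \<le> \<epsilon>" if "l \<ge> l0" "0 \<le> t" "t < real T" for l t
  proof -
    have "(1 / 2) ^ l \<le> (1 / 2 :: real) ^ l0" using that by (intro power_decreasing) auto
    then have "dist t (dyadic_floor l t) < \<delta>"
      using nat_floor_dyadic[OF that(2), of l] l0 by (simp add: dist_real_def power_divide)
    then have "dist (x t) (x (dyadic_floor l t)) < \<epsilon>"
      using nat_floor_dyadic[OF that(2), of l] that by (intro \<delta>(2)) auto
    then show ?thesis by (simp add: dist_real_def)
  qed
  then show ?thesis by blast
qed

text \<open>Provides a countable family of centres. They are step paths, hence discontinuous in
  general, but only the balls around them matter.\<close>

lemma rat_step_dense:
  assumes x: "continuous_on {0..} x" and \<epsilon>: "\<epsilon> > 0"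
  shows "\<exists>l as. path_dist (rat_step l as) x < \<epsilon>"
proof -
  obtain T where T: "1 / real (Suc T) < \<epsilon>" using \<epsilon> nat_approx_posE by metis
  obtain l where l: "\<And>t. 0 \<le> t \<Longrightarrow> t < real T \<Longrightarrow> \<bar>x t - x (dyadic_floor l t)\<bar> \<le> \<epsilon> / 4"
    using continuous_path_dyadic[OF x, of "\<epsilon> / 4" T] \<epsilon> by auto
  have "\<exists>a. \<bar>real_of_rat a - x (real k / 2 ^ l)\<bar> < \<epsilon> / 4" for k
  proof -
    obtain q where "q \<in> \<rat>" "x (real k / 2 ^ l) < q" "q < x (real k / 2 ^ l) + \<epsilon> / 4"
      using Rats_dense_in_real[of "x (real k / 2 ^ l)" "x (real k / 2 ^ l) + \<epsilon> / 4"] \<epsilon> by auto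
    moreover from \<open>q \<in> \<rat>\<close> obtain a where "q = real_of_rat a" by (rule Rats_cases)
    ultimately show ?thesis by (intro exI[of _ a]) auto
  qed
  then obtain a where a: "\<And>k. \<bar>real_of_rat (a k) - x (real k / 2 ^ l)\<bar> < \<epsilon> / 4" by metis
  define as where "as = map a [0..<T * 2 ^ l]"
  have "path_dist (rat_step l as) x \<le> max (\<epsilon> / 2) (1 / (1 + real T))"
  proof (rule path_dist_le_horizon)
    fix q :: real assume q: "0 \<le> q" "q < real T"
    have "rat_step l as q = real_of_rat (a (nat \<lfloor>2 ^ l * q\<rfloor>))"
      using nat_floor_dyadic_less[OF q, of l] by (simp add: rat_step_def as_def)
    then show "\<bar>rat_step l as q - x q\<bar> \<le> \<epsilon> / 2"
      using a[of "nat \<lfloor>2 ^ l * q\<rfloor>"] l[OF q] unfolding nat_floor_dyadic(1)[OF q(1)] by linarith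
  qed (use \<epsilon> in auto)
  also have "\<dots> < \<epsilon>" using T \<epsilon> by auto
  finally show ?thesis by blast
qed

text \<open>Index \<open>i\<close> codes a ball around a rational step path on which
  \<open>f\<close> hardly varies: each cadlag path in it has a value within
  \<open>\<epsilon>\<close> of \<open>v\<close>. Numbering the balls makes the majorants finite
  minima along a sequence, to which dominated convergence applies.\<close>

definition tube :: "((real \<Rightarrow> real) \<Rightarrow> real) \<Rightarrow> real \<Rightarrow> real \<Rightarrow> nat \<Rightarrow> real \<Rightarrow> bool" where
  "tube f C \<epsilon> i v = (case (from_nat i :: nat \<times> rat list \<times> rat) of (l, as, q) \<Rightarrow>
     0 < q \<and> \<bar>v\<bar> \<le> C \<and> (\<forall>y. cadlag_path y \<and> path_dist y (rat_step l as) < real_of_rat q \<longrightarrow> \<bar>f y - v\<bar> \<le> \<epsilon>))"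

text \<open>Equals \<open>v + \<epsilon>\<close> on the inner half of the ball and rises by
  \<open>2 * C\<close> towards its boundary; as \<open>v \<ge> - C\<close>, it exceeds
  \<open>C\<close>, and so \<open>f\<close>, outside the ball.\<close>

definition envelope_piece :: "((real \<Rightarrow> real) \<Rightarrow> real) \<Rightarrow> real \<Rightarrow> real \<Rightarrow> nat \<Rightarrow> (real \<Rightarrow> real) \<Rightarrow> real" where
  "envelope_piece f C \<epsilon> i x = (case (from_nat i :: nat \<times> rat list \<times> rat) of (l, as, q) \<Rightarrow>
     if \<exists>v. tube f C \<epsilon> i v
     then (SOME v. tube f C \<epsilon> i v) + \<epsilon> + 2 * C * min 1 (max 0 (path_dist x (rat_step l as) * 2 / real_of_rat q - 1))
     else C)"

text \<open>Lipschitz functionals decreasing, at every continuous path, to within \<open>2\<epsilon>\<close> of a Skorokhod-continuous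
  functional bounded by \<open>C\<close>, and dominating it on all cadlag paths.\<close>
primrec envelope :: "((real \<Rightarrow> real) \<Rightarrow> real) \<Rightarrow> real \<Rightarrow> real \<Rightarrow> nat \<Rightarrow> (real \<Rightarrow> real) \<Rightarrow> real" where
  "envelope f C \<epsilon> 0 x = C"
| "envelope f C \<epsilon> (Suc J) x = min (envelope f C \<epsilon> J x) (envelope_piece f C \<epsilon> J x)"

lemma envelope_piece_bounds:
  assumes C: "\<And>x. \<bar>f x\<bar> \<le> C" "C > 0" and \<epsilon>: "\<epsilon> > 0"
  shows "- C \<le> envelope_piece f C \<epsilon> i x"
    and "cadlag_path x \<Longrightarrow> f x \<le> envelope_piece f C \<epsilon> i x"
    and "\<exists>K\<ge>0. \<forall>x y. \<bar>envelope_piece f C \<epsilon> i x - envelope_piece f C \<epsilon> i y\<bar> \<le> K * path_dist x y"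
proof -
  obtain l as q where e: "(from_nat i :: nat \<times> rat list \<times> rat) = (l, as, q)" by (metis prod_cases3)
  define s where "s = rat_step l as"
  define r where "r = real_of_rat q"
  define \<psi> where "\<psi> x = min 1 (max 0 (path_dist x s * 2 / r - 1))" for x
  have "- C \<le> envelope_piece f C \<epsilon> i x \<and> (cadlag_path x \<longrightarrow> f x \<le> envelope_piece f C \<epsilon> i x) \<and>
     (\<exists>K\<ge>0. \<forall>x y. \<bar>envelope_piece f C \<epsilon> i x - envelope_piece f C \<epsilon> i y\<bar> \<le> K * path_dist x y)"
  proof (cases "\<exists>v. tube f C \<epsilon> i v")
    case False
    then have "envelope_piece f C \<epsilon> i x = C" for x by (simp add: envelope_piece_def e)
    then show ?thesis using C(1)[of x] C(2) by (auto intro!: exI[of _ 0] simp: abs_le_iff)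
  next
    case True
    define v where "v = (SOME v. tube f C \<epsilon> i v)"
    have "tube f C \<epsilon> i v" unfolding v_def using True by (rule someI_ex)
    then have v: "0 < r" "\<bar>v\<bar> \<le> C" "\<And>y. cadlag_path y \<Longrightarrow> path_dist y s < r \<Longrightarrow> \<bar>f y - v\<bar> \<le> \<epsilon>"
      by (auto simp: tube_def e s_def r_def)
    have ep: "envelope_piece f C \<epsilon> i x = v + \<epsilon> + 2 * C * \<psi> x" for x
      using True by (simp add: envelope_piece_def e v_def s_def r_def \<psi>_def)
    have \<psi>: "0 \<le> \<psi> x" for x by (simp add: \<psi>_def)
    have 1: "- C \<le> envelope_piece f C \<epsilon> i x"
    proof -
      have "0 \<le> 2 * C * \<psi> x" using C(2) \<psi> by simp
      then show ?thesis unfolding ep using v(2) \<epsilon> by linarith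
    qed
    have 2: "f x \<le> envelope_piece f C \<epsilon> i x" if cx: "cadlag_path x"
    proof (cases "path_dist x s < r")
      case True
      have "0 \<le> 2 * C * \<psi> x" using C(2) \<psi> by simp
      then show ?thesis unfolding ep using v(3)[OF cx True] by linarith
    next
      case False
      then have "1 \<le> path_dist x s * 2 / r - 1" using v(1) by (simp add: pos_le_divide_eq)
      then have "\<psi> x = 1" unfolding \<psi>_def by (auto simp: min_def max_def)
      then show ?thesis unfolding ep using v(2) \<epsilon> C(1)[of x] by auto
    qed
    \<comment> \<open>The ramp has height \<open>2 * C\<close> and slope \<open>2 / r\<close> in the
      distance to the centre.\<close>
    have 3: "\<bar>envelope_piece f C \<epsilon> i x - envelope_piece f C \<epsilon> i y\<bar> \<le> (4 * C / r) * path_dist x y" for x y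
    proof -
      have clip: "\<bar>min 1 (max 0 (a - 1)) - min 1 (max 0 (b - 1))\<bar> \<le> \<bar>a - b\<bar>" for a b :: real
        by (auto simp: min_def max_def)
      have "\<bar>\<psi> x - \<psi> y\<bar> \<le> \<bar>path_dist x s * 2 / r - path_dist y s * 2 / r\<bar>" unfolding \<psi>_def by (rule clip)
      also have "\<dots> = \<bar>path_dist x s - path_dist y s\<bar> * (2 / r)"
      proof -
        have "path_dist x s * 2 / r - path_dist y s * 2 / r = (path_dist x s - path_dist y s) * (2 / r)"
          by (simp add: diff_divide_distrib left_diff_distrib)
        then show ?thesis using v(1) by (simp only: abs_mult) simp
      qed
      also have "\<dots> \<le> path_dist x y * (2 / r)"
      proof (intro mult_right_mono)
        show "\<bar>path_dist x s - path_dist y s\<bar> \<le> path_dist x y"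
          using path_dist_triangle[of x s y] path_dist_triangle[of y s x] path_dist_commute[of x y] by linarith
      qed (use v(1) in simp)
      finally have "2 * C * \<bar>\<psi> x - \<psi> y\<bar> \<le> 2 * C * (path_dist x y * (2 / r))" using C(2) by (intro mult_left_mono) auto
      moreover have "\<bar>envelope_piece f C \<epsilon> i x - envelope_piece f C \<epsilon> i y\<bar> = 2 * C * \<bar>\<psi> x - \<psi> y\<bar>"
      proof -
        have "envelope_piece f C \<epsilon> i x - envelope_piece f C \<epsilon> i y = 2 * C * (\<psi> x - \<psi> y)"
          unfolding ep by (simp add: algebra_simps)
        then show ?thesis using C(2) by (simp add: abs_mult)
      qed
      ultimately show ?thesis by (simp add: mult_ac)
    qed
    have "4 * C / r \<ge> 0" using C(2) v(1) by simp
    with 1 2 3 show ?thesis by blast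
  qed
  then show "- C \<le> envelope_piece f C \<epsilon> i x" "cadlag_path x \<Longrightarrow> f x \<le> envelope_piece f C \<epsilon> i x"
    "\<exists>K\<ge>0. \<forall>x y. \<bar>envelope_piece f C \<epsilon> i x - envelope_piece f C \<epsilon> i y\<bar> \<le> K * path_dist x y" by blast+
qed

lemma envelope_bounds:
  assumes C: "\<And>x. \<bar>f x\<bar> \<le> C" "C > 0" and \<epsilon>: "\<epsilon> > 0"
  shows "\<bar>envelope f C \<epsilon> J x\<bar> \<le> C"
    and "cadlag_path x \<Longrightarrow> f x \<le> envelope f C \<epsilon> J x"
    and "\<exists>K\<ge>0. \<forall>x y. \<bar>envelope f C \<epsilon> J x - envelope f C \<epsilon> J y\<bar> \<le> K * path_dist x y"
proof -
  show "\<bar>envelope f C \<epsilon> J x\<bar> \<le> C"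
  proof (induction J)
    case (Suc J)
    then show ?case using envelope_piece_bounds(1)[where f = f, OF assms, of J x] by (auto simp: min_def abs_le_iff)
  qed (use C in simp)
  show "f x \<le> envelope f C \<epsilon> J x" if "cadlag_path x"
  proof (induction J)
    case (Suc J)
    then show ?case using envelope_piece_bounds(2)[where f = f, OF assms that, of J] by simp
  next
    case 0
    then show ?case using C(1)[of x] by simp
  qed
  show "\<exists>K\<ge>0. \<forall>x y. \<bar>envelope f C \<epsilon> J x - envelope f C \<epsilon> J y\<bar> \<le> K * path_dist x y"
  proof (induction J)
    case 0
    then show ?case by (auto intro!: exI[of _ 0])
  next
    case (Suc J)
    then obtain K where K: "K \<ge> 0" "\<And>x y. \<bar>envelope f C \<epsilon> J x - envelope f C \<epsilon> J y\<bar> \<le> K * path_dist x y" by blast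
    obtain K' where K': "K' \<ge> 0" "\<And>x y. \<bar>envelope_piece f C \<epsilon> J x - envelope_piece f C \<epsilon> J y\<bar> \<le> K' * path_dist x y"
      using envelope_piece_bounds(3)[where f = f, OF assms, of J] by blast
    have "\<bar>envelope f C \<epsilon> (Suc J) x - envelope f C \<epsilon> (Suc J) y\<bar> \<le> (K + K') * path_dist x y" for x y
    proof -
      have m: "\<bar>min a b - min a' b'\<bar> \<le> \<bar>a - a'\<bar> + \<bar>b - b'\<bar>" for a b a' b' :: real by (auto simp: min_def)
      show ?thesis using m[of "envelope f C \<epsilon> J x" "envelope_piece f C \<epsilon> J x" "envelope f C \<epsilon> J y" "envelope_piece f C \<epsilon> J y"]
          K(2)[of x y] K'(2)[of x y] by (simp add: distrib_right)
    qed
    then show ?case using K(1) K'(1) by (intro exI[of _ "K + K'"]) auto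
  qed
qed

text \<open>With continuity radius \<open>r\<close> at \<open>x\<close>, the centre is taken within
  \<open>r / 4\<close> and the radius \<open>q\<close> between \<open>r / 2\<close> and
  \<open>3 * r / 4\<close>: then \<open>x\<close> lies in the inner half of the ball, and the ball
  lies in the \<open>r\<close>-ball around \<open>x\<close>. The value picked by \<open>SOME\<close>
  may differ from \<open>f x\<close> by \<open>\<epsilon>\<close>, hence
  \<open>2 * \<epsilon>\<close>.\<close>

lemma envelope_limit:
  assumes f: "skorokhod_continuous f" and C: "\<And>x. \<bar>f x\<bar> \<le> C" "C > 0" and \<epsilon>: "\<epsilon> > 0"
    and x: "continuous_on {0..} x"
  shows "\<forall>\<^sub>F J in sequentially. envelope f C \<epsilon> J x \<le> f x + 2 * \<epsilon>"
proof -
  obtain r where r: "r > 0" "\<And>y. cadlag_path y \<Longrightarrow> path_dist y x < r \<Longrightarrow> \<bar>f y - f x\<bar> \<le> \<epsilon>"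
    using skorokhod_continuous_uniform[OF f x \<epsilon>] by blast
  obtain l as where s: "path_dist (rat_step l as) x < r / 4" using rat_step_dense[OF x, of "r / 4"] r by auto
  obtain q' where "q' \<in> \<rat>" "r / 2 < q'" "q' < 3 * r / 4" using Rats_dense_in_real[of "r / 2" "3 * r / 4"] r by auto
  then obtain q where q: "r / 2 < real_of_rat q" "real_of_rat q < 3 * r / 4" by (auto elim!: Rats_cases)
  define i where "i = to_nat (l, as, q)"
  have e: "(from_nat i :: nat \<times> rat list \<times> rat) = (l, as, q)" by (simp add: i_def)
  have q0: "0 < real_of_rat q" using q r by linarith
  then have q0': "0 < q" by simp
  have ex: "tube f C \<epsilon> i (f x)"
    unfolding tube_def e
  proof (simp only: prod.case, intro conjI allI impI q0' C)
    fix y assume y: "cadlag_path y \<and> path_dist y (rat_step l as) < real_of_rat q"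
    then have "path_dist y x < r" using path_dist_triangle[of y x "rat_step l as"] s q by linarith
    then show "\<bar>f y - f x\<bar> \<le> \<epsilon>" using y r(2) by blast
  qed
  define v where "v = (SOME v. tube f C \<epsilon> i v)"
  have tv: "tube f C \<epsilon> i v" unfolding v_def by (rule someI[of _ "f x"]) (rule ex)
  have cx: "cadlag_path x" by (rule continuous_imp_cadlag[OF x])
  have dx: "path_dist x (rat_step l as) * 2 < real_of_rat q" using s q path_dist_commute[of x "rat_step l as"] by linarith
  then have "\<bar>f x - v\<bar> \<le> \<epsilon>" using tv cx path_dist_nonneg[of x "rat_step l as"] unfolding tube_def e by auto
  moreover have "envelope_piece f C \<epsilon> i x = v + \<epsilon>"
  proof -
    have "path_dist x (rat_step l as) * 2 / real_of_rat q - 1 \<le> 0" using dx q0 by (simp add: pos_divide_le_eq)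
    then have "min 1 (max 0 (path_dist x (rat_step l as) * 2 / real_of_rat q - 1)) = 0" by auto
    moreover have "\<exists>v. tube f C \<epsilon> i v" using ex by blast
    ultimately show ?thesis unfolding envelope_piece_def e by (simp add: v_def)
  qed
  ultimately have "envelope_piece f C \<epsilon> i x \<le> f x + 2 * \<epsilon>" by linarith
  moreover have "envelope f C \<epsilon> J x \<le> envelope_piece f C \<epsilon> i x" if "J \<ge> Suc i" for J
    using that by (induction rule: dec_induct) auto
  ultimately show ?thesis unfolding eventually_sequentially by (meson order_trans)
qed

lemma path_dist_measurable:
  assumes "\<And>q. q \<in> \<rat> \<Longrightarrow> q \<ge> 0 \<Longrightarrow> (\<lambda>\<omega>. X q \<omega>) \<in> borel_measurable M" "\<And>q. q \<in> \<rat> \<Longrightarrow> q \<ge> 0 \<Longrightarrow> (\<lambda>\<omega>. Y q \<omega>) \<in> borel_measurable M"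
  shows "(\<lambda>\<omega>. path_dist (\<lambda>t. X t \<omega>) (\<lambda>t. Y t \<omega>)) \<in> borel_measurable M"
  unfolding path_dist_def
proof (rule borel_measurable_cSUP)
  show "countable (\<rat> \<inter> {0::real..})" using countable_rat by (rule countable_subset[rotated]) auto
  show "(\<lambda>\<omega>. min \<bar>X q \<omega> - Y q \<omega>\<bar> (1 / (1 + q))) \<in> borel_measurable M" if "q \<in> \<rat> \<inter> {0..}" for q
  proof -
    have [measurable]: "X q \<in> borel_measurable M" "Y q \<in> borel_measurable M" using that assms by auto
    show ?thesis by measurable
  qed
qed (rule path_dist_bdd)

lemma envelope_measurable:
  assumes "\<And>q. q \<ge> 0 \<Longrightarrow> (\<lambda>\<omega>. X q \<omega>) \<in> borel_measurable M"
  shows "(\<lambda>\<omega>. envelope f C \<epsilon> J (\<lambda>t. X t \<omega>)) \<in> borel_measurable M"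
proof (induction J)
  case (Suc J)
  obtain l as q where e: "(from_nat J :: nat \<times> rat list \<times> rat) = (l, as, q)" by (metis prod_cases3)
  have [measurable]: "(\<lambda>\<omega>. path_dist (\<lambda>t. X t \<omega>) (rat_step l as)) \<in> borel_measurable M"
    by (rule path_dist_measurable) (auto intro: assms)
  have "(\<lambda>\<omega>. envelope_piece f C \<epsilon> J (\<lambda>t. X t \<omega>)) \<in> borel_measurable M"
    unfolding envelope_piece_def e prod.case by measurable
  then show ?case using Suc by simp
qed simp

section \<open>From characteristic functions to Lipschitz functions of finitely many values\<close>

inductive trig_fun :: "nat \<Rightarrow> ((nat \<Rightarrow> real) \<Rightarrow> real) \<Rightarrow> bool" for N where
  cos: "trig_fun N (\<lambda>v. c * cos ((\<Sum>k<N. u k * v k) + b))"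
| add: "trig_fun N f \<Longrightarrow> trig_fun N g \<Longrightarrow> trig_fun N (\<lambda>v. f v + g v)"

lemma trig_fun_const: "trig_fun N (\<lambda>_. c)"
  using trig_fun.cos[of N c "\<lambda>_. 0" 0] by simp

text \<open>The phase \<open>b\<close> covers sines, so the product-to-sum formula keeps products in
  the class. It is thus an algebra whose expectations are determined by characteristic
  functions.\<close>

lemma trig_fun_mult:
  assumes "trig_fun N f" "trig_fun N g" shows "trig_fun N (\<lambda>v. f v * g v)"
  using assms
proof (induction f arbitrary: g rule: trig_fun.induct)
  case (cos c u b)
  from cos show ?case
  proof (induction g rule: trig_fun.induct)
    case (cos c' u' b')
    have "c * cos ((\<Sum>k<N. u k * v k) + b) * (c' * cos ((\<Sum>k<N. u' k * v k) + b'))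
      = c * c' / 2 * cos ((\<Sum>k<N. (u k - u' k) * v k) + (b - b')) + c * c' / 2 * cos ((\<Sum>k<N. (u k + u' k) * v k) + (b + b'))" for v
    proof -
      have *: "c * cos x * (c' * cos y) = c * c' / 2 * cos (x - y) + c * c' / 2 * cos (x + y)" for x y
        by (simp add: cos_add cos_diff algebra_simps)
      have "(\<Sum>k<N. (u k - u' k) * v k) + (b - b') = ((\<Sum>k<N. u k * v k) + b) - ((\<Sum>k<N. u' k * v k) + b')"
        "(\<Sum>k<N. (u k + u' k) * v k) + (b + b') = ((\<Sum>k<N. u k * v k) + b) + ((\<Sum>k<N. u' k * v k) + b')"
        by (simp_all add: algebra_simps sum.distrib sum_subtractf)
      then show ?thesis by (simp only: *)
    qed
    then show ?case using trig_fun.add[OF trig_fun.cos trig_fun.cos] by presburger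
  next
    case (add g h)
    have "trig_fun N (\<lambda>v. c * cos ((\<Sum>k<N. u k * v k) + b) * g v + c * cos ((\<Sum>k<N. u k * v k) + b) * h v)"
      by (intro trig_fun.add add.IH)
    then show ?case by (simp add: distrib_left)
  qed
next
  case (add f h)
  have "trig_fun N (\<lambda>v. f v * g v + h v * g v)" by (intro trig_fun.add add.IH add.prems)
  then show ?case by (simp add: distrib_right)
qed

lemma trig_fun_bounded: "trig_fun N f \<Longrightarrow> \<exists>A>0. \<forall>v. \<bar>f v\<bar> \<le> A"
proof (induction rule: trig_fun.induct)
  case (cos c u b)
  have "\<bar>c * cos ((\<Sum>k<N. u k * v k) + b)\<bar> \<le> \<bar>c\<bar> + 1" for v
    unfolding abs_mult using mult_left_mono[OF abs_cos_le_one, of "\<bar>c\<bar>"] by (smt (verit) abs_ge_zero mult_cancel_left2)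
  then show ?case by (intro exI[of _ "\<bar>c\<bar> + 1"]) auto
next
  case (add f g)
  then obtain A A' where "A > 0" "A' > 0" "\<And>v. \<bar>f v\<bar> \<le> A" "\<And>v. \<bar>g v\<bar> \<le> A'" by auto
  then show ?case by (intro exI[of _ "A + A'"]) (auto intro: abs_triangle_ineq[THEN order_trans] add_mono)
qed

lemma trig_fun_continuous: "trig_fun N f \<Longrightarrow> continuous_on UNIV f"
proof (induction rule: trig_fun.induct)
  case (cos c u b)
  show ?case by (intro continuous_intros continuous_on_product_coordinates)
qed (intro continuous_intros)

text \<open>Allows a trigonometric polynomial to be clamped, approximately, without leaving the
  class.\<close>

lemma trig_fun_poly:
  assumes "real_polynomial_function q" "trig_fun N f" shows "trig_fun N (\<lambda>v. q (f v))"
  using assms(1)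
proof (induction rule: real_polynomial_function.induct)
  case (linear h)
  then obtain c where "h = (\<lambda>x. x * c)" unfolding real_bounded_linear by blast
  then show ?case using trig_fun_mult[OF assms(2) trig_fun_const[of N c]] by simp
qed (auto intro: trig_fun_const trig_fun.add trig_fun_mult)

lemma trig_fun_expectation:
  fixes M :: "nat \<Rightarrow> 'a measure" and P :: "'b measure"
  assumes M: "\<And>n. prob_space (M n)" and P: "prob_space P"
    and V: "\<And>n k. (\<lambda>\<omega>. V n \<omega> k) \<in> borel_measurable (M n)" and V': "\<And>k. (\<lambda>\<omega>. V' \<omega> k) \<in> borel_measurable P"
    and char: "\<And>u. (\<lambda>n. \<integral>\<omega>. iexp (\<Sum>k<N. u k * V n \<omega> k) \<partial>M n) \<longlonglongrightarrow> (\<integral>\<omega>. iexp (\<Sum>k<N. u k * V' \<omega> k) \<partial>P)"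
    and f: "trig_fun N f"
  shows "(\<lambda>n. \<integral>\<omega>. f (V n \<omega>) \<partial>M n) \<longlonglongrightarrow> (\<integral>\<omega>. f (V' \<omega>) \<partial>P) \<and> (\<forall>n. integrable (M n) (\<lambda>\<omega>. f (V n \<omega>))) \<and> integrable P (\<lambda>\<omega>. f (V' \<omega>))"
  using f
proof (induction rule: trig_fun.induct)
  case (cos c u b)
  note [measurable] = V V'
  have int: "integrable W (\<lambda>\<omega>. c * cos ((\<Sum>k<N. u k * Y \<omega> k) + b)) \<and>
      (\<integral>\<omega>. c * cos ((\<Sum>k<N. u k * Y \<omega> k) + b) \<partial>W) = Re (of_real c * iexp b * (\<integral>\<omega>. iexp (\<Sum>k<N. u k * Y \<omega> k) \<partial>W))"
    if W: "prob_space W" and [measurable]: "\<And>k. (\<lambda>\<omega>. Y \<omega> k) \<in> borel_measurable W" for W :: "'c measure" and Y :: "'c \<Rightarrow> nat \<Rightarrow> real"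
  proof -
    interpret prob_space W by fact
    have i: "integrable W (\<lambda>\<omega>. iexp (\<Sum>k<N. u k * Y \<omega> k))"
      by (rule Bochner_Integration.integrable_bound[OF integrable_const[of "1::real"]]) (auto simp: norm_exp_eq_Re)
    have i2: "integrable W (\<lambda>\<omega>. of_real c * iexp b * iexp (\<Sum>k<N. u k * Y \<omega> k))"
      by (intro Bochner_Integration.integrable_mult_right i)
    have e: "c * cos ((\<Sum>k<N. u k * Y \<omega> k) + b) = Re (of_real c * iexp b * iexp (\<Sum>k<N. u k * Y \<omega> k))" for \<omega>
    proof -
      have "of_real c * iexp b * iexp x = of_real c * iexp (x + b)" for x :: real
        by (simp add: exp_add[symmetric] distrib_left mult.assoc add.commute)
      moreover have "Re (of_real c * iexp y) = c * cos y" for y by (simp add: Re_exp)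
      ultimately show ?thesis by (simp only:)
    qed
    show ?thesis unfolding e using i2 integral_Re[OF i2] integrable_Re[OF i2] by simp
  qed
  have "(\<lambda>n. Re (of_real c * iexp b * (\<integral>\<omega>. iexp (\<Sum>k<N. u k * V n \<omega> k) \<partial>M n))) \<longlonglongrightarrow> Re (of_real c * iexp b * (\<integral>\<omega>. iexp (\<Sum>k<N. u k * V' \<omega> k) \<partial>P))"
    by (intro tendsto_intros char)
  then show ?case using int[OF M V] int[OF P V'] by simp
next
  case (add f g)
  then show ?case by (auto intro!: tendsto_add)
qed

text \<open>Stone-Weierstrass approximates \<open>F\<close> on a box only, and a trigonometric
  polynomial close to \<open>F\<close> there may be large elsewhere. Composing it with a polynomial
  close to the clamp to \<open>[-C, C]\<close> keeps it in the class and bounded by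
  \<open>C + \<epsilon>\<close> everywhere; the outside of the box is then negligible by the first
  moments.\<close>

lemma fdd_lipschitz_functional:
  fixes M :: "nat \<Rightarrow> 'a measure" and P :: "'b measure" and F :: "(nat \<Rightarrow> real) \<Rightarrow> real"
  assumes M: "\<And>n. prob_space (M n)" and P: "prob_space P"
    and V: "\<And>n k. (\<lambda>\<omega>. V n \<omega> k) \<in> borel_measurable (M n)" and V': "\<And>k. (\<lambda>\<omega>. V' \<omega> k) \<in> borel_measurable P"
    and char: "\<And>u. (\<lambda>n. \<integral>\<omega>. iexp (\<Sum>k<N. u k * V n \<omega> k) \<partial>M n) \<longlonglongrightarrow> (\<integral>\<omega>. iexp (\<Sum>k<N. u k * V' \<omega> k) \<partial>P)"
    and tight: "\<And>k. \<exists>C. \<forall>\<^sub>F n in sequentially. integrable (M n) (\<lambda>\<omega>. V n \<omega> k) \<and> (\<integral>\<omega>. \<bar>V n \<omega> k\<bar> \<partial>M n) \<le> C"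
    and F: "\<And>v. \<bar>F v\<bar> \<le> C" "C > 0" and K: "K \<ge> 0" "\<And>v w a. a \<ge> 0 \<Longrightarrow> (\<And>k. k < N \<Longrightarrow> \<bar>v k - w k\<bar> \<le> a) \<Longrightarrow> \<bar>F v - F w\<bar> \<le> K * a"
    and FV: "\<And>n. (\<lambda>\<omega>. F (V n \<omega>)) \<in> borel_measurable (M n)" and FV': "(\<lambda>\<omega>. F (V' \<omega>)) \<in> borel_measurable P"
  shows "(\<lambda>n. \<integral>\<omega>. F (V n \<omega>) \<partial>M n) \<longlonglongrightarrow> (\<integral>\<omega>. F (V' \<omega>) \<partial>P)"
proof -
  interpret P: prob_space P by fact
  note [measurable] = V V' FV FV'
  \<comment> \<open>A continuous majorant of the indicator of leaving the box, at most
    \<open>(\<Sum>k<N. \<bar>v k\<bar>) / R\<close>.\<close>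
  define b where "b R v = (\<Sum>k<N. min 1 (\<bar>v k\<bar> / R))" for R :: real and v :: "nat \<Rightarrow> real"
  have b0: "b R v \<ge> 0" if "R > 0" for R v unfolding b_def using that by (intro sum_nonneg) auto
  have bN: "b R v \<le> N" for R v
  proof -
    have "b R v \<le> (\<Sum>k<N. 1)" unfolding b_def by (intro sum_mono) auto
    then show ?thesis by simp
  qed
  have [measurable]: "(\<lambda>\<omega>. b R (V n \<omega>)) \<in> borel_measurable (M n)" "(\<lambda>\<omega>. b R (V' \<omega>)) \<in> borel_measurable P" for R n
    unfolding b_def by measurable
  have approx: "\<exists>a. trig_fun N a \<and> (\<forall>v. \<bar>F v - a v\<bar> \<le> 3 * \<epsilon> + (2 * C + \<epsilon>) * b R v)" if R: "R > 0" and \<epsilon>: "\<epsilon> > 0" for R \<epsilon>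
  proof -
    \<comment> \<open>Coordinates from \<open>N\<close> on are fixed at 0, so that the set is
      compact and the class separates its points.\<close>
    define S where "S = (Pi UNIV (\<lambda>k. if k < N then {-R..R} else {0}) :: (nat \<Rightarrow> real) set)"
    have inS: "v k \<in> (if k < N then {-R..R} else {0})" if "v \<in> S" for v k
      using that unfolding S_def by (rule Pi_mem) simp
    interpret function_ring_on "{f. trig_fun N f}" S
    proof
      have "compactin (product_topology (\<lambda>_. euclidean) UNIV) (PiE UNIV (\<lambda>k. if k < N then {-R..R} else {0::real}))"
        unfolding compactin_PiE by auto
      then show "compact S" by (simp add: S_def PiE_UNIV_domain euclidean_product_topology)
      show "continuous_on S f" if "f \<in> {f. trig_fun N f}" for f
        using that trig_fun_continuous continuous_on_subset by blast
      fix x y assume xy: "x \<in> S" "y \<in> S" "x \<noteq> y"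
      then obtain k where k: "x k \<noteq> y k" by auto
      have kN: "k < N"
      proof (rule ccontr)
        assume "\<not> k < N"
        then have "x k = 0 \<and> y k = 0" using inS[OF xy(1), of k] inS[OF xy(2), of k] by simp
        then show False using k by simp
      qed
      have kb: "\<bar>x k\<bar> \<le> R" "\<bar>y k\<bar> \<le> R" using inS[OF xy(1), of k] inS[OF xy(2), of k] kN by (auto simp: abs_le_iff)
      \<comment> \<open>The function \<open>sin (v k / R)\<close> written as a cosine with a phase;
        the scaling keeps its argument in \<open>[-1, 1]\<close>, where the sine is
        injective.\<close>
      define f where "f v = 1 * cos ((\<Sum>j<N. (if j = k then 1 / R else 0) * v j) + - (pi / 2))" for v :: "nat \<Rightarrow> real"
      have fe: "f v = sin (v k / R)" for v
      proof -
        have "(\<Sum>j<N. (if j = k then 1 / R else 0) * v j) = (\<Sum>j<N. if j = k then v k / R else 0)"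
          by (intro sum.cong) auto
        then have "(\<Sum>j<N. (if j = k then 1 / R else 0) * v j) = v k / R" using kN by simp
        then show ?thesis unfolding f_def by (simp add: cos_diff)
      qed
      have "trig_fun N f" unfolding f_def by (rule trig_fun.cos)
      moreover have "f x \<noteq> f y"
      proof
        assume "f x = f y"
        then have s: "sin (x k / R) = sin (y k / R)" by (simp add: fe)
        have r: "- 1 \<le> v / R" "v / R \<le> 1" if "\<bar>v\<bar> \<le> R" for v using that R by (auto simp: field_simps abs_le_iff)
        have "- (pi / 2) \<le> - 1" "1 \<le> pi / 2" using pi_ge_two by auto
        then have "x k / R = y k / R" using r[OF kb(1)] r[OF kb(2)] by (intro sin_inj_pi[OF _ _ _ _ s]) linarith+
        then show False using k R by simp
      qed
      ultimately show "\<exists>f\<in>{f. trig_fun N f}. f x \<noteq> f y" by blast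
    qed (auto intro: trig_fun.add trig_fun_mult trig_fun_const)
    have "continuous_on S F"
      unfolding continuous_on_def
    proof (intro ballI tendstoI)
      fix v and e :: real assume "e > 0"
      define \<delta> where "\<delta> = e / (K + 1)"
      have \<delta>: "\<delta> > 0" "K * \<delta> < e" using \<open>e > 0\<close> K(1) by (auto simp: \<delta>_def field_simps)
      have "\<forall>\<^sub>F w in at v within S. \<forall>k\<in>{..<N}. dist (w k) (v k) < \<delta>"
      proof (intro eventually_ball_finite ballI)
        fix k
        have "((\<lambda>w. w k) \<longlongrightarrow> v k) (at v within S)"
        proof (rule tendsto_within_subset[OF _ subset_UNIV])
          have "continuous_on UNIV (\<lambda>w :: nat \<Rightarrow> real. w k)" by (rule continuous_on_product_coordinates)
          then show "((\<lambda>w. w k) \<longlongrightarrow> v k) (at v within UNIV)" unfolding continuous_on_def by (rule bspec) simp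
        qed
        then show "\<forall>\<^sub>F w in at v within S. dist (w k) (v k) < \<delta>" using \<delta>(1) by (rule tendstoD)
      qed simp
      then show "\<forall>\<^sub>F w in at v within S. dist (F w) (F v) < e"
      proof eventually_elim
        case (elim w)
        have "\<bar>F w - F v\<bar> \<le> K * \<delta>" using elim \<delta>(1) by (intro K(2)) (auto simp: dist_real_def less_imp_le)
        then show ?case using \<delta> by (simp add: dist_real_def)
      qed
    qed
    from Stone_Weierstrass_basic[OF this \<epsilon>] obtain a where a: "trig_fun N a" "\<And>v. v \<in> S \<Longrightarrow> \<bar>F v - a v\<bar> < \<epsilon>" by blast
    obtain A where A: "A > 0" "\<And>v. \<bar>a v\<bar> \<le> A" using trig_fun_bounded[OF a(1)] by blast
    define clamp where "clamp y = max (- C) (min C y)" for y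
    have cl: "\<bar>clamp x - clamp y\<bar> \<le> \<bar>x - y\<bar>" "\<bar>clamp x\<bar> \<le> C" for x y using F(2) by (auto simp: clamp_def min_def max_def)
    have clF: "clamp (F v) = F v" for v using F(1)[of v] by (auto simp: clamp_def min_def max_def abs_le_iff)
    have "continuous_on {-A..A} clamp" unfolding clamp_def by (intro continuous_intros)
    from Stone_Weierstrass_real_polynomial_function[OF compact_Icc this \<epsilon>]
    obtain q where q: "real_polynomial_function q" "\<And>y. y \<in> {-A..A} \<Longrightarrow> \<bar>clamp y - q y\<bar> < \<epsilon>" by metis
    have qa: "\<bar>clamp (a v) - q (a v)\<bar> < \<epsilon>" for v using A(2)[of v] by (intro q(2)) (auto simp: abs_le_iff)
    show ?thesis
    proof (intro exI[of _ "\<lambda>v. q (a v)"] conjI allI trig_fun_poly[OF q(1) a(1)])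
      fix v :: "nat \<Rightarrow> real"
      \<comment> \<open>The Lipschitz hypothesis with \<open>a = 0\<close> shows that
        \<open>F\<close> depends on the first \<open>N\<close> coordinates only, so \<open>v\<close>
        may be moved into the box.\<close>
      define v' where "v' k = (if k < N then v k else 0)" for k
      have "\<bar>F v - F v'\<bar> \<le> K * 0" by (rule K(2)) (auto simp: v'_def)
      then have Fv: "F v = F v'" by simp
      have av: "a v = a v'" using a(1)
      proof (induction rule: trig_fun.induct)
        case (cos c u b)
        have "(\<Sum>k<N. u k * v k) = (\<Sum>k<N. u k * v' k)" by (intro sum.cong) (auto simp: v'_def)
        then show ?case by simp
      qed simp
      show "\<bar>F v - q (a v)\<bar> \<le> 3 * \<epsilon> + (2 * C + \<epsilon>) * b R v"
      proof (cases "\<forall>k<N. \<bar>v k\<bar> \<le> R")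
        case True
        then have "v' \<in> S" by (auto simp: S_def v'_def Pi_iff abs_le_iff)
        then have "\<bar>F v' - a v'\<bar> < \<epsilon>" by (rule a(2))
        then have "\<bar>F v - clamp (a v)\<bar> < \<epsilon>" using cl(1)[of "F v'" "a v'"] clF[of v'] unfolding Fv av by linarith
        then have "\<bar>F v - q (a v)\<bar> \<le> 2 * \<epsilon>" using qa[of v] by linarith
        moreover have "0 \<le> (2 * C + \<epsilon>) * b R v" using b0[OF R, of v] F(2) \<epsilon> by simp
        ultimately show ?thesis using \<epsilon> by linarith
      next
        case False
        then obtain k where k: "k < N" "R < \<bar>v k\<bar>" by (auto simp: not_le)
        have "min 1 (\<bar>v k\<bar> / R) \<le> b R v" unfolding b_def using k R by (intro member_le_sum) auto
        moreover have "min 1 (\<bar>v k\<bar> / R) = 1" using k R by simp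
        ultimately have "(2 * C + \<epsilon>) * 1 \<le> (2 * C + \<epsilon>) * b R v" using F(2) \<epsilon> by (intro mult_left_mono) auto
        moreover have "\<bar>F v - q (a v)\<bar> \<le> 2 * C + \<epsilon>" using qa[of v] cl(2)[of "a v"] F(1)[of v] by linarith
        moreover have "x \<le> 3 * \<epsilon> + z" if "y * 1 \<le> z" "x \<le> y" for x y z using that \<epsilon> by linarith
        ultimately show ?thesis by blast
      qed
    qed
  qed
  have b_int: "integrable W (\<lambda>\<omega>. b R (Y \<omega>))" if W: "prob_space W" and "(\<lambda>\<omega>. b R (Y \<omega>)) \<in> borel_measurable W" "R > 0" for W :: "'c measure" and Y :: "'c \<Rightarrow> nat \<Rightarrow> real" and R
  proof -
    interpret prob_space W by fact
    show ?thesis by (rule Bochner_Integration.integrable_bound[OF integrable_const[of "real N"]]) (use that bN b0 in auto)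
  qed
  have F_int: "integrable W (\<lambda>\<omega>. F (Y \<omega>))" if W: "prob_space W" and "(\<lambda>\<omega>. F (Y \<omega>)) \<in> borel_measurable W" for W :: "'c measure" and Y :: "'c \<Rightarrow> nat \<Rightarrow> real"
  proof -
    interpret prob_space W by fact
    show ?thesis by (rule Bochner_Integration.integrable_bound[OF integrable_const[of C]]) (use that F in auto)
  qed
  have close: "\<bar>(\<integral>\<omega>. F (Y \<omega>) \<partial>W) - (\<integral>\<omega>. a (Y \<omega>) \<partial>W)\<bar> \<le> 3 * \<epsilon> + (2 * C + \<epsilon>) * (\<integral>\<omega>. b R (Y \<omega>) \<partial>W)"
    if W: "prob_space W" and FY: "(\<lambda>\<omega>. F (Y \<omega>)) \<in> borel_measurable W" and bY: "(\<lambda>\<omega>. b R (Y \<omega>)) \<in> borel_measurable W" and R: "R > 0" and iaY: "integrable W (\<lambda>\<omega>. a (Y \<omega>))"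
    and a: "\<And>v. \<bar>F v - a v\<bar> \<le> 3 * \<epsilon> + (2 * C + \<epsilon>) * b R v" for W :: "'c measure" and Y :: "'c \<Rightarrow> nat \<Rightarrow> real" and R a \<epsilon>
  proof -
    interpret prob_space W by fact
    note iF = F_int[OF W FY] and ib = b_int[OF W bY R]
    have "\<bar>(\<integral>\<omega>. F (Y \<omega>) \<partial>W) - (\<integral>\<omega>. a (Y \<omega>) \<partial>W)\<bar> = \<bar>\<integral>\<omega>. F (Y \<omega>) - a (Y \<omega>) \<partial>W\<bar>"
      by (simp only: Bochner_Integration.integral_diff[OF iF iaY])
    also have "\<dots> \<le> (\<integral>\<omega>. \<bar>F (Y \<omega>) - a (Y \<omega>)\<bar> \<partial>W)" by (rule integral_abs_bound)
    also have "\<dots> \<le> (\<integral>\<omega>. 3 * \<epsilon> + (2 * C + \<epsilon>) * b R (Y \<omega>) \<partial>W)"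
      by (intro integral_mono a integrable_abs Bochner_Integration.integrable_diff iF iaY Bochner_Integration.integrable_add integrable_const Bochner_Integration.integrable_mult_right ib)
    also have "\<dots> = 3 * \<epsilon> + (2 * C + \<epsilon>) * (\<integral>\<omega>. b R (Y \<omega>) \<partial>W)"
      by (subst Bochner_Integration.integral_add) (auto intro!: ib simp: prob_space)
    finally show ?thesis .
  qed
  have "\<forall>k. \<exists>C. C > 0 \<and> (\<forall>\<^sub>F n in sequentially. integrable (M n) (\<lambda>\<omega>. V n \<omega> k) \<and> (\<integral>\<omega>. \<bar>V n \<omega> k\<bar> \<partial>M n) \<le> C)"
  proof
    fix k
    obtain C where "\<forall>\<^sub>F n in sequentially. integrable (M n) (\<lambda>\<omega>. V n \<omega> k) \<and> (\<integral>\<omega>. \<bar>V n \<omega> k\<bar> \<partial>M n) \<le> C" using tight by blast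
    then show "\<exists>C. C > 0 \<and> (\<forall>\<^sub>F n in sequentially. integrable (M n) (\<lambda>\<omega>. V n \<omega> k) \<and> (\<integral>\<omega>. \<bar>V n \<omega> k\<bar> \<partial>M n) \<le> C)"
      by (intro exI[of _ "max C 1"]) (auto elim!: eventually_mono)
  qed
  then obtain D where D': "\<forall>k. D k > 0 \<and> (\<forall>\<^sub>F n in sequentially. integrable (M n) (\<lambda>\<omega>. V n \<omega> k) \<and> (\<integral>\<omega>. \<bar>V n \<omega> k\<bar> \<partial>M n) \<le> D k)"
    by (rule choice[THEN exE])
  have D: "D k > 0" "\<forall>\<^sub>F n in sequentially. integrable (M n) (\<lambda>\<omega>. V n \<omega> k) \<and> (\<integral>\<omega>. \<bar>V n \<omega> k\<bar> \<partial>M n) \<le> D k" for k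
    using D'[rule_format, of k] by simp_all
  have bV: "\<forall>\<^sub>F n in sequentially. (\<integral>\<omega>. b R (V n \<omega>) \<partial>M n) \<le> (\<Sum>k<N. D k) / R" if R: "R > 0" for R
  proof -
    have "\<forall>\<^sub>F n in sequentially. \<forall>k\<in>{..<N}. integrable (M n) (\<lambda>\<omega>. V n \<omega> k) \<and> (\<integral>\<omega>. \<bar>V n \<omega> k\<bar> \<partial>M n) \<le> D k"
      by (intro eventually_ball_finite ballI D) simp
    then show ?thesis
    proof eventually_elim
      case (elim n)
      have i: "integrable (M n) (\<lambda>\<omega>. \<Sum>k<N. \<bar>V n \<omega> k\<bar> / R)" using elim by (intro Bochner_Integration.integrable_sum Bochner_Integration.integrable_divide integrable_abs) auto
      have "(\<integral>\<omega>. b R (V n \<omega>) \<partial>M n) \<le> (\<integral>\<omega>. (\<Sum>k<N. \<bar>V n \<omega> k\<bar> / R) \<partial>M n)"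
        by (rule integral_mono[OF b_int[OF M _ R] i]) (auto simp: b_def intro!: sum_mono)
      also have "\<dots> = (\<Sum>k<N. (\<integral>\<omega>. \<bar>V n \<omega> k\<bar> \<partial>M n) / R)" using elim by (subst Bochner_Integration.integral_sum) auto
      also have "\<dots> \<le> (\<Sum>k<N. D k / R)" using elim R by (intro sum_mono divide_right_mono) auto
      finally show ?case by (simp add: sum_divide_distrib)
    qed
  qed
  have bV': "(\<lambda>m. \<integral>\<omega>. b (real (Suc m)) (V' \<omega>) \<partial>P) \<longlonglongrightarrow> 0"
  proof -
    have "(\<lambda>m. \<integral>\<omega>. b (real (Suc m)) (V' \<omega>) \<partial>P) \<longlonglongrightarrow> (\<integral>\<omega>. 0 \<partial>P)"
    proof (rule integral_dominated_convergence[where w = "\<lambda>_. real N"])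
      show "AE \<omega> in P. norm (b (real (Suc m)) (V' \<omega>)) \<le> real N" for m using b0[of "real (Suc m)"] bN by auto
      show "AE \<omega> in P. (\<lambda>m. b (real (Suc m)) (V' \<omega>)) \<longlonglongrightarrow> 0"
      proof (rule AE_I2)
        fix \<omega>
        have "(\<lambda>m. \<Sum>k<N. min 1 (\<bar>V' \<omega> k\<bar> / real (Suc m))) \<longlonglongrightarrow> (\<Sum>k<N. min 1 0)"
          by (intro tendsto_sum tendsto_min tendsto_const LIMSEQ_Suc[OF lim_const_over_n])
        then show "(\<lambda>m. b (real (Suc m)) (V' \<omega>)) \<longlonglongrightarrow> 0" by (simp add: b_def)
      qed
    qed auto
    then show ?thesis by simp
  qed
  show ?thesis
  proof (rule LIMSEQ_I)
    fix e :: real assume e: "e > 0"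
    define \<epsilon> where "\<epsilon> = min 1 (e / 30)"
    have \<epsilon>: "\<epsilon> > 0" "\<epsilon> \<le> 1" "30 * \<epsilon> \<le> e" using e by (auto simp: \<epsilon>_def)
    define \<beta> where "\<beta> = e / (10 * (2 * C + 1))"
    have \<beta>: "\<beta> > 0" "(2 * C + \<epsilon>) * \<beta> \<le> e / 10"
    proof -
      show \<beta>: "\<beta> > 0" using e F(2) by (simp add: \<beta>_def)
      have "(2 * C + \<epsilon>) * \<beta> \<le> (2 * C + 1) * \<beta>" using \<epsilon> \<beta> by (intro mult_right_mono) auto
      also have "\<dots> = e / 10"
      proof -
        have "d * (e / (10 * d)) = e / 10" if "d \<noteq> 0" for d using that by simp
        from this[of "2 * C + 1"] show ?thesis using F(2) unfolding \<beta>_def by simp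
      qed
      finally show "(2 * C + \<epsilon>) * \<beta> \<le> e / 10" .
    qed
    have "\<forall>\<^sub>F m in sequentially. (\<Sum>k<N. D k) / real (Suc m) < \<beta>"
      using \<beta>(1) by (intro order_tendstoD(2)[OF LIMSEQ_Suc[OF lim_const_over_n]])
    moreover have "\<forall>\<^sub>F m in sequentially. (\<integral>\<omega>. b (real (Suc m)) (V' \<omega>) \<partial>P) < \<beta>"
      using \<beta>(1) by (intro order_tendstoD(2)[OF bV'])
    ultimately have "\<forall>\<^sub>F m in sequentially. (\<Sum>k<N. D k) / real (Suc m) < \<beta> \<and> (\<integral>\<omega>. b (real (Suc m)) (V' \<omega>) \<partial>P) < \<beta>"
      by (rule eventually_conj)
    then obtain m where m: "(\<Sum>k<N. D k) / real (Suc m) < \<beta>" "(\<integral>\<omega>. b (real (Suc m)) (V' \<omega>) \<partial>P) < \<beta>"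
      by (auto simp: eventually_sequentially)
    define R where "R = real (Suc m)"
    have R: "R > 0" by (simp add: R_def)
    obtain a where a: "trig_fun N a" "\<And>v. \<bar>F v - a v\<bar> \<le> 3 * \<epsilon> + (2 * C + \<epsilon>) * b R v" using approx[OF R \<epsilon>(1)] by blast
    note ta = trig_fun_expectation[OF M P V V' char a(1)]
    have cP: "\<bar>(\<integral>\<omega>. F (V' \<omega>) \<partial>P) - (\<integral>\<omega>. a (V' \<omega>) \<partial>P)\<bar> \<le> 3 * \<epsilon> + e / 10"
    proof -
      have "\<bar>(\<integral>\<omega>. F (V' \<omega>) \<partial>P) - (\<integral>\<omega>. a (V' \<omega>) \<partial>P)\<bar> \<le> 3 * \<epsilon> + (2 * C + \<epsilon>) * (\<integral>\<omega>. b R (V' \<omega>) \<partial>P)"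
        by (rule close[OF P FV' _ R _ a(2)]) (use ta in auto)
      also have "(2 * C + \<epsilon>) * (\<integral>\<omega>. b R (V' \<omega>) \<partial>P) \<le> (2 * C + \<epsilon>) * \<beta>"
        using m(2) F(2) \<epsilon> by (intro mult_left_mono) (auto simp: R_def)
      finally show ?thesis using \<beta>(2) by linarith
    qed
    have "\<forall>\<^sub>F n in sequentially. dist (\<integral>\<omega>. a (V n \<omega>) \<partial>M n) (\<integral>\<omega>. a (V' \<omega>) \<partial>P) < e / 10"
      using ta e by (intro tendstoD) auto
    with bV[OF R] have "\<forall>\<^sub>F n in sequentially. norm ((\<integral>\<omega>. F (V n \<omega>) \<partial>M n) - (\<integral>\<omega>. F (V' \<omega>) \<partial>P)) < e"
    proof eventually_elim
      case (elim n)
      have "\<bar>(\<integral>\<omega>. F (V n \<omega>) \<partial>M n) - (\<integral>\<omega>. a (V n \<omega>) \<partial>M n)\<bar> \<le> 3 * \<epsilon> + (2 * C + \<epsilon>) * (\<integral>\<omega>. b R (V n \<omega>) \<partial>M n)"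
        by (rule close[OF M FV _ R _ a(2)]) (use ta in auto)
      also have "(2 * C + \<epsilon>) * (\<integral>\<omega>. b R (V n \<omega>) \<partial>M n) \<le> (2 * C + \<epsilon>) * \<beta>"
        using elim(1) m(1) F(2) \<epsilon> by (intro mult_left_mono) (auto simp: R_def)
      finally have "\<bar>(\<integral>\<omega>. F (V n \<omega>) \<partial>M n) - (\<integral>\<omega>. a (V n \<omega>) \<partial>M n)\<bar> \<le> 3 * \<epsilon> + e / 10" using \<beta>(2) by linarith
      then show ?case using cP elim(2) \<epsilon> e unfolding dist_real_def real_norm_def by linarith
    qed
    then show "\<exists>no. \<forall>n\<ge>no. norm ((\<integral>\<omega>. F (V n \<omega>) \<partial>M n) - (\<integral>\<omega>. F (V' \<omega>) \<partial>P)) < e"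
      by (simp add: eventually_sequentially)
  qed
qed

lemma (in prob_space) integrable_bounded:
  fixes h :: "'a \<Rightarrow> real"
  assumes "h \<in> borel_measurable M" "\<And>\<omega>. \<omega> \<in> space M \<Longrightarrow> \<bar>h \<omega>\<bar> \<le> C"
  shows "integrable M h"
  by (rule Bochner_Integration.integrable_bound[OF integrable_const[of C]]) (use assms in \<open>auto intro!: AE_I2 order_trans[OF _ abs_ge_self]\<close>)

text \<open>Rebuilds a step path from dyadic values, so that a functional of paths becomes a
  function of the \<open>T * 2 ^ l\<close> values below the horizon; afterwards the path is
  0.\<close>

definition freeze :: "nat \<Rightarrow> nat \<Rightarrow> (nat \<Rightarrow> real) \<Rightarrow> real \<Rightarrow> real" where
  "freeze T l v t = (if t < real T then v (nat \<lfloor>2 ^ l * t\<rfloor>) else 0)"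

lemma path_dist_freeze:
  assumes "a \<ge> 0" "\<And>t. 0 \<le> t \<Longrightarrow> t < real T \<Longrightarrow> \<bar>x t - x (dyadic_floor l t)\<bar> \<le> a"
  shows "path_dist x (freeze T l (\<lambda>k. x (real k / 2 ^ l))) \<le> max a (1 / (1 + real T))"
proof (rule path_dist_le_horizon)
  fix q :: real assume q: "0 \<le> q" "q < real T"
  then have "freeze T l (\<lambda>k. x (real k / 2 ^ l)) q = x (dyadic_floor l q)"
    by (simp only: freeze_def if_True nat_floor_dyadic(1))
  then show "\<bar>x q - freeze T l (\<lambda>k. x (real k / 2 ^ l)) q\<bar> \<le> a" using assms(2)[OF q] by simp
qed (use assms in auto)

lemma path_dist_freeze_diff:
  assumes "a \<ge> 0" "\<And>k. k < T * 2 ^ l \<Longrightarrow> \<bar>v k - w k\<bar> \<le> a"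
  shows "path_dist (freeze T l v) (freeze T l w) \<le> a"
proof (rule path_dist_least)
  fix q :: real assume q: "q \<in> \<rat>" "q \<ge> 0"
  show "min \<bar>freeze T l v q - freeze T l w q\<bar> (1 / (1 + q)) \<le> a"
    using assms nat_floor_dyadic_less[OF q(2), of T l] by (cases "q < real T") (auto simp: freeze_def intro: min.coboundedI1)
qed

text \<open>The majorant \<open>H J\<close> dominates \<open>f\<close> on the cadlag paths of
  \<open>X\<close> but is close to \<open>f\<close> only on continuous paths, that is, in mean under
  \<open>Y\<close>; this asymmetry yields an upper bound. Being Lipschitz, \<open>H J\<close> may be
  evaluated at frozen paths instead: the cost is the oscillation for \<open>X\<close> and the
  modulus of continuity for \<open>Y\<close>, and frozen values converge by
  \<open>fdd_lipschitz_functional\<close>.\<close>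

lemma one_sided_limit:
  fixes M :: "nat \<Rightarrow> 'a measure" and P :: "'b measure" and X :: "nat \<Rightarrow> real \<Rightarrow> 'a \<Rightarrow> real" and Y :: "real \<Rightarrow> 'b \<Rightarrow> real"
  assumes M: "\<And>n. prob_space (M n)" and P: "prob_space P"
    and X: "\<And>n t. X n t \<in> borel_measurable (M n)" and Y: "\<And>t. Y t \<in> borel_measurable P"
    and Xc: "\<And>n \<omega>. \<omega> \<in> space (M n) \<Longrightarrow> cadlag_path (\<lambda>t. X n t \<omega>)"
    and Yc: "\<And>\<omega>. \<omega> \<in> space P \<Longrightarrow> continuous_on {0..} (\<lambda>t. Y t \<omega>)"
    and char: "\<And>l N u. (\<lambda>n. \<integral>\<omega>. iexp (\<Sum>k<N. u k * X n (real k / 2 ^ l) \<omega>) \<partial>M n) \<longlonglongrightarrow> (\<integral>\<omega>. iexp (\<Sum>k<N. u k * Y (real k / 2 ^ l) \<omega>) \<partial>P)"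
    and tight: "\<And>l k. \<exists>C. \<forall>\<^sub>F n in sequentially. integrable (M n) (X n (real k / 2 ^ l)) \<and> (\<integral>\<omega>. \<bar>X n (real k / 2 ^ l) \<omega>\<bar> \<partial>M n) \<le> C"
    and osc: "\<And>T \<epsilon>. \<epsilon> > 0 \<Longrightarrow> \<exists>l0. \<forall>l\<ge>l0. \<forall>\<^sub>F n in sequentially. \<exists>W. integrable (M n) W \<and> (\<integral>\<omega>. W \<omega> \<partial>M n) \<le> \<epsilon> \<and>
       (\<forall>\<omega>\<in>space (M n). \<forall>t::real. 0 \<le> t \<and> t < real T \<longrightarrow> \<bar>X n t \<omega> - X n (dyadic_floor l t) \<omega>\<bar> \<le> W \<omega>)"
    and f: "f \<in> borel_measurable (Pi\<^sub>M UNIV (\<lambda>_. borel))" "\<And>x. \<bar>f x\<bar> \<le> C" "C > 0" "skorokhod_continuous f"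
    and e: "e > 0"
  shows "\<forall>\<^sub>F n in sequentially. (\<integral>\<omega>. f (\<lambda>t. X n t \<omega>) \<partial>M n) \<le> (\<integral>\<omega>. f (\<lambda>t. Y t \<omega>) \<partial>P) + e"
proof -
  interpret P: prob_space P by fact
  define \<epsilon> where "\<epsilon> = e / 10"
  have \<epsilon>: "\<epsilon> > 0" using e by (simp add: \<epsilon>_def)
  define H where "H J = envelope f C \<epsilon> J" for J
  note Hb = envelope_bounds[where f = f, OF f(2,3) \<epsilon>, folded H_def]
  have HX: "(\<lambda>\<omega>. H J (\<lambda>t. Z t \<omega>)) \<in> borel_measurable W" if "\<And>t. t \<ge> 0 \<Longrightarrow> (\<lambda>\<omega>. Z t \<omega>) \<in> borel_measurable W" for Z J and W :: "'c measure"
    unfolding H_def using that by (rule envelope_measurable)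
  have fX: "(\<lambda>\<omega>. f (\<lambda>t. Z t \<omega>)) \<in> borel_measurable W" if "\<And>t. Z t \<in> borel_measurable W" for Z and W :: "'c measure"
  proof (rule measurable_compose[OF _ f(1)])
    show "(\<lambda>\<omega> t. Z t \<omega>) \<in> measurable W (Pi\<^sub>M UNIV (\<lambda>_. borel))"
      using that by (intro measurable_PiM_single') (auto simp: space_PiM)
  qed
  note [measurable] = X Y
  have [measurable]: "(\<lambda>\<omega>. H J (\<lambda>t. Y t \<omega>)) \<in> borel_measurable P" for J by (rule HX) simp
  have [measurable]: "(\<lambda>\<omega>. f (\<lambda>t. Y t \<omega>)) \<in> borel_measurable P" by (rule fX) simp
  have iH: "integrable P (\<lambda>\<omega>. H J (\<lambda>t. Y t \<omega>))" for J by (rule P.integrable_bounded[of _ C]) (use Hb(1) in auto)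
  have if': "integrable P (\<lambda>\<omega>. f (\<lambda>t. Y t \<omega>))" by (rule P.integrable_bounded[of _ C]) (use f(2) in auto)
  \<comment> \<open>The paths of \<open>Y\<close> are continuous, so the excess over
    \<open>f + 2 * \<epsilon>\<close> is eventually 0 for each outcome.\<close>
  have "(\<lambda>J. \<integral>\<omega>. max 0 (H J (\<lambda>t. Y t \<omega>) - f (\<lambda>t. Y t \<omega>) - 2 * \<epsilon>) \<partial>P) \<longlonglongrightarrow> (\<integral>\<omega>. 0 \<partial>P)"
  proof (rule integral_dominated_convergence[where w = "\<lambda>_. 2 * C"])
    show "AE \<omega> in P. (\<lambda>J. max 0 (H J (\<lambda>t. Y t \<omega>) - f (\<lambda>t. Y t \<omega>) - 2 * \<epsilon>)) \<longlonglongrightarrow> 0"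
    proof (rule AE_I2)
      fix \<omega> assume "\<omega> \<in> space P"
      from envelope_limit[where f = f, OF f(4) f(2,3) \<epsilon> Yc[OF this]]
      show "(\<lambda>J. max 0 (H J (\<lambda>t. Y t \<omega>) - f (\<lambda>t. Y t \<omega>) - 2 * \<epsilon>)) \<longlonglongrightarrow> 0"
        by (intro tendsto_eventually) (auto elim!: eventually_mono simp: H_def)
    qed
    show "AE \<omega> in P. norm (max 0 (H J (\<lambda>t. Y t \<omega>) - f (\<lambda>t. Y t \<omega>) - 2 * \<epsilon>)) \<le> 2 * C" for J
    proof (rule AE_I2)
      fix \<omega> show "norm (max 0 (H J (\<lambda>t. Y t \<omega>) - f (\<lambda>t. Y t \<omega>) - 2 * \<epsilon>)) \<le> 2 * C"
        using Hb(1)[of J "\<lambda>t. Y t \<omega>"] f(2)[of "\<lambda>t. Y t \<omega>"] f(3) \<epsilon> by (auto simp: abs_le_iff max_def)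
    qed
  qed (auto simp: P.prob_space)
  then have "\<forall>\<^sub>F J in sequentially. (\<integral>\<omega>. max 0 (H J (\<lambda>t. Y t \<omega>) - f (\<lambda>t. Y t \<omega>) - 2 * \<epsilon>) \<partial>P) < \<epsilon>"
    using \<epsilon> by (intro order_tendstoD(2)) auto
  then obtain J where J: "(\<integral>\<omega>. max 0 (H J (\<lambda>t. Y t \<omega>) - f (\<lambda>t. Y t \<omega>) - 2 * \<epsilon>) \<partial>P) < \<epsilon>"
    by (auto simp: eventually_sequentially)
  have EHY: "(\<integral>\<omega>. H J (\<lambda>t. Y t \<omega>) \<partial>P) \<le> (\<integral>\<omega>. f (\<lambda>t. Y t \<omega>) \<partial>P) + 3 * \<epsilon>"
  proof -
    have i: "integrable P (\<lambda>\<omega>. H J (\<lambda>t. Y t \<omega>) - f (\<lambda>t. Y t \<omega>) - 2 * \<epsilon>)"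
      by (intro Bochner_Integration.integrable_diff iH if' P.integrable_const)
    have "(\<integral>\<omega>. H J (\<lambda>t. Y t \<omega>) - f (\<lambda>t. Y t \<omega>) - 2 * \<epsilon> \<partial>P) \<le> (\<integral>\<omega>. max 0 (H J (\<lambda>t. Y t \<omega>) - f (\<lambda>t. Y t \<omega>) - 2 * \<epsilon>) \<partial>P)"
      by (intro integral_mono i integrable_max) auto
    moreover have "(\<integral>\<omega>. H J (\<lambda>t. Y t \<omega>) - f (\<lambda>t. Y t \<omega>) - 2 * \<epsilon> \<partial>P) = (\<integral>\<omega>. H J (\<lambda>t. Y t \<omega>) \<partial>P) - (\<integral>\<omega>. f (\<lambda>t. Y t \<omega>) \<partial>P) - 2 * \<epsilon>"
      using iH[of J] if' by (simp add: P.prob_space)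
    ultimately show ?thesis using J by linarith
  qed
  obtain K where K: "K \<ge> 0" "\<And>x y. \<bar>H J x - H J y\<bar> \<le> K * path_dist x y" using Hb(3)[of J] by blast
  \<comment> \<open>\<open>J\<close>, and with it \<open>K\<close>, is fixed by now, so tolerances
    in \<open>path_dist\<close> can be scaled by \<open>K\<close>.\<close>
  define \<gamma> where "\<gamma> = \<epsilon> / (K + 1)"
  have \<gamma>: "\<gamma> > 0" "K * \<gamma> \<le> \<epsilon>" using \<epsilon> K(1) by (auto simp: \<gamma>_def field_simps)
  obtain T0 where T0: "1 / real (Suc T0) < \<gamma>" using \<gamma>(1) nat_approx_posE by metis
  define T where "T = Suc T0"
  have "1 / (1 + real T) \<le> 1 / real (Suc T0)" unfolding T_def by (intro divide_left_mono) auto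
  then have T: "K * (1 / (1 + real T)) \<le> \<epsilon>" using T0 \<gamma> K(1) by (meson less_imp_le mult_left_mono order_trans)
  define fr where "fr l x = freeze T l (\<lambda>k. x (real k / 2 ^ l))" for l and x :: "real \<Rightarrow> real"
  have fr_meas: "(\<lambda>\<omega>. fr l (\<lambda>t. Z t \<omega>) t) \<in> borel_measurable W" if "\<And>t. Z t \<in> borel_measurable W" for Z l t and W :: "'c measure"
    using that by (cases "t < real T") (simp_all add: fr_def freeze_def)
  have pd_meas: "(\<lambda>\<omega>. path_dist (\<lambda>t. Z t \<omega>) (fr l (\<lambda>t. Z t \<omega>))) \<in> borel_measurable W" if "\<And>t. Z t \<in> borel_measurable W" for Z l and W :: "'c measure"
    using path_dist_measurable[of Z W "\<lambda>t \<omega>. fr l (\<lambda>t. Z t \<omega>) t"] that fr_meas[OF that] by simp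
  note [measurable] = pd_meas[OF X] pd_meas[OF Y]
  \<comment> \<open>Uniform continuity below \<open>T\<close> leaves the horizon error
    \<open>1 / (1 + T)\<close>, which is therefore subtracted.\<close>
  have "(\<lambda>l. \<integral>\<omega>. max 0 (path_dist (\<lambda>t. Y t \<omega>) (fr l (\<lambda>t. Y t \<omega>)) - 1 / (1 + real T)) \<partial>P) \<longlonglongrightarrow> (\<integral>\<omega>. 0 \<partial>P)"
  proof (rule integral_dominated_convergence[where w = "\<lambda>_. 1"])
    show "AE \<omega> in P. (\<lambda>l. max 0 (path_dist (\<lambda>t. Y t \<omega>) (fr l (\<lambda>t. Y t \<omega>)) - 1 / (1 + real T))) \<longlonglongrightarrow> 0"
    proof (rule AE_I2, rule LIMSEQ_I)
      fix \<omega> and r :: real assume \<omega>: "\<omega> \<in> space P" and r: "r > 0"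
      obtain l0 where l0: "\<And>l t. l \<ge> l0 \<Longrightarrow> 0 \<le> t \<Longrightarrow> t < real T \<Longrightarrow> \<bar>Y t \<omega> - Y (dyadic_floor l t) \<omega>\<bar> \<le> r / 2"
        using continuous_path_dyadic[OF Yc[OF \<omega>], of "r / 2" T] r by auto
      show "\<exists>no. \<forall>l\<ge>no. norm (max 0 (path_dist (\<lambda>t. Y t \<omega>) (fr l (\<lambda>t. Y t \<omega>)) - 1 / (1 + real T)) - 0) < r"
      proof (intro exI[of _ l0] allI impI)
        fix l assume "l \<ge> l0"
        then have "path_dist (\<lambda>t. Y t \<omega>) (fr l (\<lambda>t. Y t \<omega>)) \<le> max (r / 2) (1 / (1 + real T))"
          unfolding fr_def using l0[of l] r by (intro path_dist_freeze) auto
        also have "\<dots> \<le> r / 2 + 1 / (1 + real T)" using r by simp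
        finally have "path_dist (\<lambda>t. Y t \<omega>) (fr l (\<lambda>t. Y t \<omega>)) - 1 / (1 + real T) \<le> r / 2" by linarith
        then show "norm (max 0 (path_dist (\<lambda>t. Y t \<omega>) (fr l (\<lambda>t. Y t \<omega>)) - 1 / (1 + real T)) - 0) < r"
          using r by (simp add: max_def)
      qed
    qed
    show "AE \<omega> in P. norm (max 0 (path_dist (\<lambda>t. Y t \<omega>) (fr l (\<lambda>t. Y t \<omega>)) - 1 / (1 + real T))) \<le> 1" for l
    proof (rule AE_I2)
      fix \<omega>
      have "0 \<le> 1 / (1 + real T)" by simp
      then show "norm (max 0 (path_dist (\<lambda>t. Y t \<omega>) (fr l (\<lambda>t. Y t \<omega>)) - 1 / (1 + real T))) \<le> 1"
        using path_dist_le_1[of "\<lambda>t. Y t \<omega>" "fr l (\<lambda>t. Y t \<omega>)"] unfolding real_norm_def by linarith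
    qed
  qed (auto simp: P.prob_space)
  then have "\<forall>\<^sub>F l in sequentially. (\<integral>\<omega>. max 0 (path_dist (\<lambda>t. Y t \<omega>) (fr l (\<lambda>t. Y t \<omega>)) - 1 / (1 + real T)) \<partial>P) < \<gamma>"
    using \<gamma> by (intro order_tendstoD(2)) auto
  then obtain l1 where l1: "\<And>l. l \<ge> l1 \<Longrightarrow> (\<integral>\<omega>. max 0 (path_dist (\<lambda>t. Y t \<omega>) (fr l (\<lambda>t. Y t \<omega>)) - 1 / (1 + real T)) \<partial>P) < \<gamma>"
    by (auto simp: eventually_sequentially)
  obtain l0 where l0: "\<And>l. l \<ge> l0 \<Longrightarrow> \<forall>\<^sub>F n in sequentially. \<exists>W. integrable (M n) W \<and> (\<integral>\<omega>. W \<omega> \<partial>M n) \<le> \<gamma> \<and>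
       (\<forall>\<omega>\<in>space (M n). \<forall>t::real. 0 \<le> t \<and> t < real T \<longrightarrow> \<bar>X n t \<omega> - X n (dyadic_floor l t) \<omega>\<bar> \<le> W \<omega>)"
    using osc[OF \<gamma>(1), of T] by blast
  define l where "l = max l0 l1"
  define F where "F v = H J (freeze T l v)" for v
  have Ffr: "H J (fr l x) = F (\<lambda>k. x (real k / 2 ^ l))" for x by (simp add: F_def fr_def)
  have F_meas: "(\<lambda>\<omega>. F (\<lambda>k. Z (real k / 2 ^ l) \<omega>)) \<in> borel_measurable W" if "\<And>t. Z t \<in> borel_measurable W" for Z and W :: "'c measure"
  proof -
    have "(\<lambda>\<omega>. F (\<lambda>k. Z (real k / 2 ^ l) \<omega>)) = (\<lambda>\<omega>. H J (fr l (\<lambda>t. Z t \<omega>)))" by (simp only: Ffr)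
    then show ?thesis using HX[of "\<lambda>t \<omega>. fr l (\<lambda>t. Z t \<omega>) t", OF fr_meas[OF that]] by simp
  qed
  have FEY: "(\<integral>\<omega>. F (\<lambda>k. Y (real k / 2 ^ l) \<omega>) \<partial>P) \<le> (\<integral>\<omega>. H J (\<lambda>t. Y t \<omega>) \<partial>P) + 2 * \<epsilon>"
  proof -
    let ?m = "\<lambda>\<omega>. max 0 (path_dist (\<lambda>t. Y t \<omega>) (fr l (\<lambda>t. Y t \<omega>)) - 1 / (1 + real T))"
    have im: "integrable P ?m"
    proof (rule P.integrable_bounded[of _ 1])
      fix \<omega>
      have "0 \<le> 1 / (1 + real T)" by simp
      then show "\<bar>?m \<omega>\<bar> \<le> 1" using path_dist_le_1[of "\<lambda>t. Y t \<omega>" "fr l (\<lambda>t. Y t \<omega>)"] by linarith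
    qed measurable
    have "(\<integral>\<omega>. F (\<lambda>k. Y (real k / 2 ^ l) \<omega>) \<partial>P) \<le> (\<integral>\<omega>. H J (\<lambda>t. Y t \<omega>) + (K * ?m \<omega> + \<epsilon>) \<partial>P)"
    proof (rule integral_mono)
      show "integrable P (\<lambda>\<omega>. F (\<lambda>k. Y (real k / 2 ^ l) \<omega>))"
        by (rule P.integrable_bounded[of _ C]) (use Hb(1) F_meas[OF Y] in \<open>auto simp: F_def\<close>)
      show "integrable P (\<lambda>\<omega>. H J (\<lambda>t. Y t \<omega>) + (K * ?m \<omega> + \<epsilon>))"
        by (intro Bochner_Integration.integrable_add iH Bochner_Integration.integrable_mult_right im P.integrable_const)
      fix \<omega>
      let ?d = "path_dist (\<lambda>t. Y t \<omega>) (fr l (\<lambda>t. Y t \<omega>))"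
      have "K * ?d \<le> K * (?m \<omega> + 1 / (1 + real T))" using K(1) by (intro mult_left_mono) auto
      then have "K * ?d \<le> K * ?m \<omega> + \<epsilon>" using T unfolding distrib_left by linarith
      then show "F (\<lambda>k. Y (real k / 2 ^ l) \<omega>) \<le> H J (\<lambda>t. Y t \<omega>) + (K * ?m \<omega> + \<epsilon>)"
        using K(2)[of "\<lambda>t. Y t \<omega>" "fr l (\<lambda>t. Y t \<omega>)"] unfolding Ffr by linarith
    qed
    also have "\<dots> = (\<integral>\<omega>. H J (\<lambda>t. Y t \<omega>) \<partial>P) + (K * (\<integral>\<omega>. ?m \<omega> \<partial>P) + \<epsilon>)"
    proof -
      have i2: "integrable P (\<lambda>\<omega>. K * ?m \<omega>)" by (rule Bochner_Integration.integrable_mult_right[OF im])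
      have i1: "integrable P (\<lambda>\<omega>. K * ?m \<omega> + \<epsilon>)" by (intro Bochner_Integration.integrable_add i2 P.integrable_const)
      show ?thesis
        unfolding Bochner_Integration.integral_add[OF iH i1] Bochner_Integration.integral_add[OF i2 P.integrable_const] integral_mult_right_zero
        by (simp add: P.prob_space)
    qed
    also have "K * (\<integral>\<omega>. ?m \<omega> \<partial>P) \<le> K * \<gamma>" using l1[of l] K(1) by (intro mult_left_mono) (auto simp: l_def)
    finally show ?thesis using \<gamma>(2) by linarith
  qed
  have "(\<lambda>n. \<integral>\<omega>. F (\<lambda>k. X n (real k / 2 ^ l) \<omega>) \<partial>M n) \<longlonglongrightarrow> (\<integral>\<omega>. F (\<lambda>k. Y (real k / 2 ^ l) \<omega>) \<partial>P)"
  proof (rule fdd_lipschitz_functional[where N = "T * 2 ^ l" and C = C and K = K and F = F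
      and V = "\<lambda>n \<omega> k. X n (real k / 2 ^ l) \<omega>" and V' = "\<lambda>\<omega> k. Y (real k / 2 ^ l) \<omega>", OF M P])
    show "\<bar>F v - F w\<bar> \<le> K * a" if "a \<ge> 0" "\<And>k. k < T * 2 ^ l \<Longrightarrow> \<bar>v k - w k\<bar> \<le> a" for v w a
    proof -
      have "\<bar>F v - F w\<bar> \<le> K * path_dist (freeze T l v) (freeze T l w)" unfolding F_def by (rule K)
      also have "\<dots> \<le> K * a" by (intro mult_left_mono path_dist_freeze_diff that K(1))
      finally show ?thesis .
    qed
    show "\<bar>F v\<bar> \<le> C" for v unfolding F_def by (rule Hb(1))
  qed (use tight f(3) K(1) char F_meas[OF X] F_meas[OF Y] in auto)
  then have evF: "\<forall>\<^sub>F n in sequentially. (\<integral>\<omega>. F (\<lambda>k. X n (real k / 2 ^ l) \<omega>) \<partial>M n) < (\<integral>\<omega>. F (\<lambda>k. Y (real k / 2 ^ l) \<omega>) \<partial>P) + \<epsilon>"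
    using \<epsilon> by (intro order_tendstoD(2)) auto
  have "\<forall>\<^sub>F n in sequentially. \<exists>W. integrable (M n) W \<and> (\<integral>\<omega>. W \<omega> \<partial>M n) \<le> \<gamma> \<and>
       (\<forall>\<omega>\<in>space (M n). \<forall>t::real. 0 \<le> t \<and> t < real T \<longrightarrow> \<bar>X n t \<omega> - X n (dyadic_floor l t) \<omega>\<bar> \<le> W \<omega>)"
    by (rule l0) (simp add: l_def)
  with evF show ?thesis
  proof eventually_elim
    case (elim n)
    interpret prob_space "M n" by (rule M)
    from elim(2) obtain W where W: "integrable (M n) W" "(\<integral>\<omega>. W \<omega> \<partial>M n) \<le> \<gamma>"
       "\<And>\<omega> t. \<omega> \<in> space (M n) \<Longrightarrow> 0 \<le> t \<Longrightarrow> t < real T \<Longrightarrow> \<bar>X n t \<omega> - X n (dyadic_floor l t) \<omega>\<bar> \<le> W \<omega>" by blast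
    have iF: "integrable (M n) (\<lambda>\<omega>. F (\<lambda>k. X n (real k / 2 ^ l) \<omega>))"
      by (rule integrable_bounded[of _ C]) (use Hb(1) F_meas[OF X] in \<open>auto simp: F_def\<close>)
    have iKW: "integrable (M n) (\<lambda>\<omega>. K * W \<omega> + \<epsilon>)" by (intro Bochner_Integration.integrable_add Bochner_Integration.integrable_mult_right W(1) integrable_const)
    have "(\<integral>\<omega>. f (\<lambda>t. X n t \<omega>) \<partial>M n) \<le> (\<integral>\<omega>. F (\<lambda>k. X n (real k / 2 ^ l) \<omega>) + (K * W \<omega> + \<epsilon>) \<partial>M n)"
    proof (rule integral_mono)
      show "integrable (M n) (\<lambda>\<omega>. f (\<lambda>t. X n t \<omega>))"
        by (rule integrable_bounded[of _ C]) (use f(2) fX[OF X] in auto)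
      show "integrable (M n) (\<lambda>\<omega>. F (\<lambda>k. X n (real k / 2 ^ l) \<omega>) + (K * W \<omega> + \<epsilon>))"
        by (intro Bochner_Integration.integrable_add[OF iF iKW])
      fix \<omega> assume \<omega>: "\<omega> \<in> space (M n)"
      let ?x = "\<lambda>t. X n t \<omega>"
      have W0: "W \<omega> \<ge> 0" using W(3)[OF \<omega>, of 0] by (simp add: T_def)
      have "path_dist ?x (fr l ?x) \<le> max (W \<omega>) (1 / (1 + real T))"
        unfolding fr_def by (rule path_dist_freeze[of "W \<omega>" T ?x l, OF W0 W(3)[OF \<omega>]])
      also have "\<dots> \<le> W \<omega> + 1 / (1 + real T)" using W0 by simp
      finally have "K * path_dist ?x (fr l ?x) \<le> K * (W \<omega> + 1 / (1 + real T))" using K(1) by (intro mult_left_mono)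
      then have "K * path_dist ?x (fr l ?x) \<le> K * W \<omega> + \<epsilon>" using T unfolding distrib_left by linarith
      moreover have "f ?x \<le> H J ?x" by (rule Hb(2)[OF Xc[OF \<omega>]])
      ultimately show "f ?x \<le> F (\<lambda>k. X n (real k / 2 ^ l) \<omega>) + (K * W \<omega> + \<epsilon>)"
        using K(2)[of ?x "fr l ?x"] unfolding Ffr by linarith
    qed
    also have "\<dots> = (\<integral>\<omega>. F (\<lambda>k. X n (real k / 2 ^ l) \<omega>) \<partial>M n) + (K * (\<integral>\<omega>. W \<omega> \<partial>M n) + \<epsilon>)"
      unfolding Bochner_Integration.integral_add[OF iF iKW] Bochner_Integration.integral_add[OF Bochner_Integration.integrable_mult_right[OF W(1)] integrable_const] integral_mult_right_zero
      by (simp add: prob_space)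
    also have "K * (\<integral>\<omega>. W \<omega> \<partial>M n) \<le> K * \<gamma>" using W(2) K(1) by (intro mult_left_mono) auto
    finally show ?case using elim(1) FEY EHY \<gamma>(2) e unfolding \<epsilon>_def by linarith
  qed
qed

theorem conv_distr_D_criterion:
  fixes M :: "nat \<Rightarrow> 'a measure" and P :: "'b measure" and X :: "nat \<Rightarrow> real \<Rightarrow> 'a \<Rightarrow> real" and Y :: "real \<Rightarrow> 'b \<Rightarrow> real"
  assumes M: "\<And>n. prob_space (M n)" and P: "prob_space P"
    and X: "\<And>n t. X n t \<in> borel_measurable (M n)" and Y: "\<And>t. Y t \<in> borel_measurable P"
    and Xc: "\<And>n \<omega>. \<omega> \<in> space (M n) \<Longrightarrow> cadlag_path (\<lambda>t. X n t \<omega>)"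
    and Yc: "\<And>\<omega>. \<omega> \<in> space P \<Longrightarrow> continuous_on {0..} (\<lambda>t. Y t \<omega>)"
    and char: "\<And>l N u. (\<lambda>n. \<integral>\<omega>. iexp (\<Sum>k<N. u k * X n (real k / 2 ^ l) \<omega>) \<partial>M n) \<longlonglongrightarrow> (\<integral>\<omega>. iexp (\<Sum>k<N. u k * Y (real k / 2 ^ l) \<omega>) \<partial>P)"
    and tight: "\<And>l k. \<exists>C. \<forall>\<^sub>F n in sequentially. integrable (M n) (X n (real k / 2 ^ l)) \<and> (\<integral>\<omega>. \<bar>X n (real k / 2 ^ l) \<omega>\<bar> \<partial>M n) \<le> C"
    and osc: "\<And>T \<epsilon>. \<epsilon> > 0 \<Longrightarrow> \<exists>l0. \<forall>l\<ge>l0. \<forall>\<^sub>F n in sequentially. \<exists>W. integrable (M n) W \<and> (\<integral>\<omega>. W \<omega> \<partial>M n) \<le> \<epsilon> \<and>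
       (\<forall>\<omega>\<in>space (M n). \<forall>t::real. 0 \<le> t \<and> t < real T \<longrightarrow> \<bar>X n t \<omega> - X n (dyadic_floor l t) \<omega>\<bar> \<le> W \<omega>)"
  shows "conv_distr_D M X P Y"
  unfolding conv_distr_D_def
proof (intro allI impI, elim conjE)
  fix f :: "(real \<Rightarrow> real) \<Rightarrow> real"
  assume f: "f \<in> borel_measurable (Pi\<^sub>M UNIV (\<lambda>_. borel))" "bounded (range f)" "skorokhod_continuous f"
  obtain C where C: "C > 0" "\<And>x. \<bar>f x\<bar> \<le> C"
    using f(2) unfolding bounded_pos by auto
  have f': "(\<lambda>x. - f x) \<in> borel_measurable (Pi\<^sub>M UNIV (\<lambda>_. borel))" "\<And>x. \<bar>- f x\<bar> \<le> C" "skorokhod_continuous (\<lambda>x. - f x)"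
    using f C unfolding skorokhod_continuous_def by (auto intro: tendsto_minus)
  show "(\<lambda>k. \<integral>\<omega>. f (\<lambda>t. X k t \<omega>) \<partial>M k) \<longlonglongrightarrow> (\<integral>\<omega>. f (\<lambda>t. Y t \<omega>) \<partial>P)"
  proof (rule tendstoI)
    fix e :: real assume "e > 0"
    then have e: "e / 2 > 0" by simp
    note one = one_sided_limit[OF M P X Y Xc Yc char tight osc _ _ C(1) _ e]
    have "\<forall>\<^sub>F n in sequentially. (\<integral>\<omega>. f (\<lambda>t. X n t \<omega>) \<partial>M n) \<le> (\<integral>\<omega>. f (\<lambda>t. Y t \<omega>) \<partial>P) + e / 2"
      by (rule one) (use f C in auto)
    moreover have "\<forall>\<^sub>F n in sequentially. (\<integral>\<omega>. - f (\<lambda>t. X n t \<omega>) \<partial>M n) \<le> (\<integral>\<omega>. - f (\<lambda>t. Y t \<omega>) \<partial>P) + e / 2"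
      by (rule one) (use f' in auto)
    ultimately show "\<forall>\<^sub>F n in sequentially. dist (\<integral>\<omega>. f (\<lambda>t. X n t \<omega>) \<partial>M n) (\<integral>\<omega>. f (\<lambda>t. Y t \<omega>) \<partial>P) < e"
    proof eventually_elim
      case (elim n)
      then show ?case using \<open>e > 0\<close> by (simp add: dist_real_def abs_less_iff)
    qed
  qed
qed

section \<open>Brownian motion on the unit interval\<close>

text \<open>Index \<open>(0, 0)\<close> carries the value of the motion at time 1, and
  \<open>(Suc l, k)\<close> the coefficient of the \<open>k\<close>-th tent of level
  \<open>l\<close>.\<close>

definition gauss_space :: "(nat \<times> nat \<Rightarrow> real) measure" where
  "gauss_space = Pi\<^sub>M UNIV (\<lambda>_. std_normal_distribution)"

lemma prob_space_std_normal: "prob_space std_normal_distribution"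
  using real_dist_normal_dist by (simp add: real_distribution_def)

lemma prob_space_gauss_space: "prob_space gauss_space"
  unfolding gauss_space_def by (intro prob_space_PiM prob_space_std_normal)

lemma gauss_space_coordinate [measurable]: "(\<lambda>\<omega>. \<omega> i) \<in> borel_measurable gauss_space"
proof -
  have "(\<lambda>\<omega>. \<omega> i) \<in> measurable gauss_space std_normal_distribution"
    unfolding gauss_space_def by (rule measurable_component_singleton) simp
  then show ?thesis by simp
qed

lemma gauss_space_distr: "distr gauss_space std_normal_distribution (\<lambda>\<omega>. \<omega> i) = std_normal_distribution"
  unfolding gauss_space_def by (rule distr_PiM_component) (auto intro: prob_space_std_normal)

lemma gauss_space_expectation:
  fixes f :: "real \<Rightarrow> 'b::{banach, second_countable_topology}"
  assumes [measurable]: "f \<in> borel_measurable borel"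
  shows "(\<integral>\<omega>. f (\<omega> i) \<partial>gauss_space) = (\<integral>x. f x \<partial>std_normal_distribution)"
    and "integrable std_normal_distribution f \<Longrightarrow> integrable gauss_space (\<lambda>\<omega>. f (\<omega> i))"
proof -
  have m: "(\<lambda>\<omega>. \<omega> i) \<in> measurable gauss_space std_normal_distribution" by simp
  have f: "f \<in> borel_measurable std_normal_distribution" by simp
  show "(\<integral>\<omega>. f (\<omega> i) \<partial>gauss_space) = (\<integral>x. f x \<partial>std_normal_distribution)"
    by (subst gauss_space_distr[of i, symmetric], subst integral_distr[OF m f]) simp
  show "integrable gauss_space (\<lambda>\<omega>. f (\<omega> i))" if "integrable std_normal_distribution f"
    using integrable_distr_eq[OF m f] that by (simp add: gauss_space_distr)
qed

lemma gauss_space_indep: "prob_space.indep_vars gauss_space (\<lambda>_. std_normal_distribution) (\<lambda>i \<omega>. \<omega> i) UNIV"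
proof -
  interpret prob_space gauss_space by (rule prob_space_gauss_space)
  have "distr gauss_space (Pi\<^sub>M UNIV (\<lambda>_. std_normal_distribution)) (\<lambda>x. \<lambda>i\<in>UNIV. x i) = gauss_space"
    unfolding gauss_space_def restrict_UNIV by (rule distr_id2) simp
  then show ?thesis
    by (subst indep_vars_iff_distr_eq_PiM') (simp_all add: gauss_space_distr, simp add: gauss_space_def)
qed

lemma gauss_space_char:
  assumes I: "finite I"
  shows "(\<integral>\<omega>. iexp (\<Sum>i\<in>I. c i * \<omega> i) \<partial>gauss_space) = of_real (exp (- (\<Sum>i\<in>I. (c i)\<^sup>2) / 2))"
proof -
  interpret prob_space gauss_space by (rule prob_space_gauss_space)
  have e: "iexp (\<Sum>i\<in>I. c i * \<omega> i) = (\<Prod>i\<in>I. iexp (c i * \<omega> i))" for \<omega>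
    by (simp add: sum_distrib_left exp_sum[OF I])
  have "indep_vars (\<lambda>_. borel) (\<lambda>i \<omega>. iexp (c i * \<omega> i)) I"
    by (rule indep_vars_compose2[OF indep_vars_subset[OF gauss_space_indep]]) auto
  moreover have "integrable gauss_space (\<lambda>\<omega>. iexp (c i * \<omega> i))" for i
    by (rule integrable_const_bound[of _ 1]) auto
  ultimately have "(\<integral>\<omega>. iexp (\<Sum>i\<in>I. c i * \<omega> i) \<partial>gauss_space) = (\<Prod>i\<in>I. \<integral>\<omega>. iexp (c i * \<omega> i) \<partial>gauss_space)"
    unfolding e by (intro indep_vars_lebesgue_integral[OF I])
  also have "\<dots> = (\<Prod>i\<in>I. char std_normal_distribution (c i))"
    unfolding char_def by (intro prod.cong refl gauss_space_expectation(1)) simp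
  also have "\<dots> = of_real (exp (- (\<Sum>i\<in>I. (c i)\<^sup>2) / 2))"
    by (simp add: char_std_normal_distribution exp_sum[OF I, symmetric] sum_negf sum_divide_distrib flip: of_real_prod)
  finally show ?thesis .
qed

lemma gauss_space_pow4: "(\<integral>\<omega>. \<omega> i ^ 4 \<partial>gauss_space) = 3" "integrable gauss_space (\<lambda>\<omega>. \<omega> i ^ 4)"
  using std_normal_distribution_even_moments[of 2] gauss_space_expectation[of "\<lambda>x. x ^ 4" i]
  by (simp_all add: fact_numeral)

definition tent :: "real \<Rightarrow> real" where
  "tent x = max 0 (1 - \<bar>2 * x - 1\<bar>)"

text \<open>The standard deviation of a Brownian bridge at the middle of an interval of length
  \<open>1 / 2 ^ l\<close>.\<close>

definition schauder_scale :: "nat \<Rightarrow> real" where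
  "schauder_scale l = sqrt (1 / 2 ^ l) / 2"

definition schauder_level :: "nat \<Rightarrow> (nat \<times> nat \<Rightarrow> real) \<Rightarrow> real \<Rightarrow> real" where
  "schauder_level l \<omega> t = (\<Sum>k<2^l. schauder_scale l * \<omega> (Suc l, k) * tent (2 ^ l * t - real k))"

definition levy_sum :: "nat \<Rightarrow> (nat \<times> nat \<Rightarrow> real) \<Rightarrow> real \<Rightarrow> real" where
  "levy_sum m \<omega> t = \<omega> (0, 0) * t + (\<Sum>l<m. schauder_level l \<omega> t)"

definition levy_increment :: "nat \<Rightarrow> nat \<Rightarrow> (nat \<times> nat \<Rightarrow> real) \<Rightarrow> real" where
  "levy_increment m k \<omega> = levy_sum m \<omega> (real (Suc k) / 2 ^ m) - levy_sum m \<omega> (real k / 2 ^ m)"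

lemma tent_bounds: "0 \<le> tent x" "tent x \<le> 1"
  by (auto simp: tent_def)

lemma tent_outside: "x \<le> 0 \<or> x \<ge> 1 \<Longrightarrow> tent x = 0"
  by (auto simp: tent_def)

lemma tent_of_int: "tent (of_int j) = 0"
proof -
  have "j \<le> 0 \<or> j \<ge> 1" by linarith
  then show ?thesis by (intro tent_outside) auto
qed

lemma tent_half: "tent (1 / 2) = 1"
  by (simp add: tent_def)

text \<open>The hypotheses place \<open>u\<close> and \<open>v\<close> between consecutive multiples
  of 1/2, where \<open>tent\<close> is affine.\<close>

lemma tent_midpoint:
  assumes "of_int j \<le> 2 * u" "u \<le> v" "2 * v \<le> of_int j + 1"
  shows "tent ((u + v) / 2) = (tent u + tent v) / 2"
proof -
  consider "j < 0" | "j = 0" | "j = 1" | "j > 1" by linarith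
  then show ?thesis
  proof cases
    case 1
    then have "real_of_int j \<le> -1" by linarith
    then show ?thesis using assms by (simp add: tent_outside)
  next
    case 4
    then have "real_of_int j \<ge> 2" by linarith
    then show ?thesis using assms by (simp add: tent_outside)
  qed (use assms in \<open>auto simp: tent_def max_def abs_if field_simps\<close>)
qed

text \<open>At these points the arguments of all tents are integers.\<close>

lemma schauder_level_0: "m \<le> l \<Longrightarrow> schauder_level l \<omega> (real k / 2 ^ m) = 0"
proof -
  assume "m \<le> l"
  then obtain d where d: "l = m + d" using le_Suc_ex by blast
  have "2 ^ l * (real k / 2 ^ m) - real k' = of_int (2 ^ d * int k - int k')" for k'
    by (simp add: d power_add)
  then show ?thesis unfolding schauder_level_def by (simp only: tent_of_int) simp
qed

text \<open>A level below \<open>m\<close> is affine on every dyadic cell of length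
  \<open>1 / 2 ^ m\<close>.\<close>

lemma schauder_level_midpoint:
  assumes l: "l < m"
  shows "schauder_level l \<omega> (real (2 * k + 1) / 2 ^ Suc m)
    = (schauder_level l \<omega> (real k / 2 ^ m) + schauder_level l \<omega> (real (Suc k) / 2 ^ m)) / 2"
proof -
  obtain d where d: "m = l + Suc d" using l less_iff_Suc_add by auto
  have tm: "tent (2 ^ l * (real (2 * k + 1) / 2 ^ Suc m) - real k')
    = (tent (2 ^ l * (real k / 2 ^ m) - real k') + tent (2 ^ l * (real (Suc k) / 2 ^ m) - real k')) / 2" for k'
  proof -
    \<comment> \<open>\<open>j\<close> numbers the interval of length 1/2 that contains the rescaled
      cell.\<close>
    define j where "j = int (k div 2 ^ d) - 2 * int k'"
    define u where "u = 2 ^ l * (real k / 2 ^ m) - real k'"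
    define v where "v = 2 ^ l * (real (Suc k) / 2 ^ m) - real k'"
    have pm: "(2::real) ^ m = 2 ^ l * (2 * 2 ^ d)" by (simp add: d power_add)
    have u: "2 * u = real k / 2 ^ d - 2 * real k'" unfolding u_def pm by (simp add: field_simps)
    have v: "2 * v = real (Suc k) / 2 ^ d - 2 * real k'" unfolding v_def pm by (simp add: field_simps)
    have k1: "k div 2 ^ d * 2 ^ d \<le> k" by (rule div_times_less_eq_dividend)
    then have "real (k div 2 ^ d) * 2 ^ d \<le> real k"
      by (metis of_nat_le_iff of_nat_mult of_nat_numeral of_nat_power)
    then have a: "real (k div 2 ^ d) \<le> real k / 2 ^ d" by (simp add: pos_le_divide_eq)
    have "Suc k \<le> Suc (k div 2 ^ d) * 2 ^ d"
      using dividend_less_div_times[of "2 ^ d" k] by (simp add: Suc_le_eq)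
    then have "real (Suc k) \<le> real (Suc (k div 2 ^ d)) * 2 ^ d"
      by (metis of_nat_le_iff of_nat_mult of_nat_numeral of_nat_power)
    then have b: "real (Suc k) / 2 ^ d \<le> real (k div 2 ^ d) + 1" by (simp add: pos_divide_le_eq add.commute)
    have uv: "u \<le> v" unfolding u_def v_def by (simp add: divide_right_mono)
    have "tent ((u + v) / 2) = (tent u + tent v) / 2"
      by (rule tent_midpoint[of j]) (use a b u v uv in \<open>simp_all add: j_def\<close>)
    moreover have "(u + v) / 2 = 2 ^ l * (real (2 * k + 1) / 2 ^ Suc m) - real k'"
      unfolding u_def v_def by (simp add: field_simps)
    ultimately show ?thesis unfolding u_def v_def by (simp only:)
  qed
  show ?thesis unfolding schauder_level_def tm
    by (simp add: sum.distrib[symmetric] sum_divide_distrib field_simps)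
qed

lemma schauder_level_peak:
  assumes k: "k < 2 ^ m"
  shows "schauder_level m \<omega> (real (2 * k + 1) / 2 ^ Suc m) = schauder_scale m * \<omega> (Suc m, k)"
proof -
  have t: "tent (2 ^ m * (real (2 * k + 1) / 2 ^ Suc m) - real k') = (if k' = k then 1 else 0)" for k'
  proof -
    have e: "2 ^ m * (real (2 * k + 1) / 2 ^ Suc m) - real k' = real k - real k' + 1 / 2" by (simp add: field_simps)
    show ?thesis
    proof (cases "k' = k")
      case True then show ?thesis unfolding e by (simp add: tent_half)
    next
      case False
      then have "real k - real k' \<le> -1 \<or> real k - real k' \<ge> 1" by linarith
      then show ?thesis unfolding e using False by (auto intro!: tent_outside)
    qed
  qed
  show ?thesis unfolding schauder_level_def t using k by (simp add: if_distrib[of "\<lambda>x. _ * x"] sum.delta cong: if_cong)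
qed

text \<open>Halving a cell splits its increment equally and moves the midpoint by a fresh normal.
  Under \<open>gauss_space\<close> the two halves have variance
  \<open>1 / 2 ^ m / 4 + 1 / 2 ^ m / 4\<close> each and are uncorrelated, as Brownian increments
  must be.\<close>

lemma levy_increment_refine:
  assumes k: "k < 2 ^ m"
  shows "levy_increment (Suc m) (2 * k) \<omega> = levy_increment m k \<omega> / 2 + schauder_scale m * \<omega> (Suc m, k)"
    and "levy_increment (Suc m) (2 * k + 1) \<omega> = levy_increment m k \<omega> / 2 - schauder_scale m * \<omega> (Suc m, k)"
proof -
  let ?u = "real k / 2 ^ m" and ?v = "real (Suc k) / 2 ^ m" and ?w = "real (2 * k + 1) / 2 ^ Suc m"
  have w: "?w = (?u + ?v) / 2" by (simp add: field_simps)
  have "(\<Sum>l<m. schauder_level l \<omega> ?w) = ((\<Sum>l<m. schauder_level l \<omega> ?u) + (\<Sum>l<m. schauder_level l \<omega> ?v)) / 2"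
    unfolding sum.distrib[symmetric] sum_divide_distrib
    by (intro sum.cong refl schauder_level_midpoint) simp
  then have mid: "levy_sum m \<omega> ?w = (levy_sum m \<omega> ?u + levy_sum m \<omega> ?v) / 2"
    unfolding levy_sum_def by (subst (1) w) argo
  have S: "levy_sum (Suc m) \<omega> t = levy_sum m \<omega> t + schauder_level m \<omega> t" for t by (simp add: levy_sum_def)
  have a: "real (2 * k) / 2 ^ Suc m = ?u" "real (Suc (2 * k + 1)) / 2 ^ Suc m = ?v" by (simp_all add: field_simps)
  have b: "real (Suc (2 * k)) / 2 ^ Suc m = ?w" by simp
  show "levy_increment (Suc m) (2 * k) \<omega> = levy_increment m k \<omega> / 2 + schauder_scale m * \<omega> (Suc m, k)"
    unfolding levy_increment_def a b S mid schauder_level_0[OF order_refl] schauder_level_peak[OF k]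
    by argo
  show "levy_increment (Suc m) (2 * k + 1) \<omega> = levy_increment m k \<omega> / 2 - schauder_scale m * \<omega> (Suc m, k)"
    unfolding levy_increment_def a b S mid schauder_level_0[OF order_refl] schauder_level_peak[OF k] by argo
qed

lemma sum_lessThan_double: "(\<Sum>k<2 * N. f k) = (\<Sum>k<N. f (2 * k) + f (2 * k + 1))" for f :: "nat \<Rightarrow> 'a::comm_monoid_add"
  by (induction N) (simp_all add: add.assoc)

text \<open>An isometry instead of independence of increments: their combinations are combinations
  of the underlying normals with the right square sum. The induction step is the parallelogram
  identity for \<open>b\<close> and \<open>e\<close>; \<open>fst i \<le> m\<close> makes the next
  level fresh.\<close>

lemma levy_increment_combination:
  fixes a :: "nat \<Rightarrow> real"
  shows "\<exists>I c. finite I \<and> I \<subseteq> {i. fst i \<le> m} \<and> (\<forall>\<omega>. (\<Sum>k<2^m. a k * levy_increment m k \<omega>) = (\<Sum>i\<in>I. c i * \<omega> i))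
    \<and> (\<Sum>i\<in>I. (c i)\<^sup>2) = (\<Sum>k<2^m. (a k)\<^sup>2) / 2 ^ m"
proof (induction m arbitrary: a)
  case 0
  have "levy_increment 0 0 \<omega> = \<omega> (0, 0)" for \<omega> by (simp add: levy_increment_def levy_sum_def)
  then show ?case by (intro exI[of _ "{(0, 0)}"] exI[of _ "\<lambda>_. a 0"]) simp
next
  case (Suc m)
  define b where "b k = (a (2 * k) + a (2 * k + 1)) / 2" for k
  define e where "e k = (a (2 * k) - a (2 * k + 1)) * schauder_scale m" for k
  from Suc[of b] obtain I c where I: "finite I" "I \<subseteq> {i. fst i \<le> m}"
    and c: "\<And>\<omega>. (\<Sum>k<2^m. b k * levy_increment m k \<omega>) = (\<Sum>i\<in>I. c i * \<omega> i)"
    and v: "(\<Sum>i\<in>I. (c i)\<^sup>2) = (\<Sum>k<2^m. (b k)\<^sup>2) / 2 ^ m" by auto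
  define J :: "(nat \<times> nat) set" where "J = Pair (Suc m) ` {..<2^m}"
  define c' where "c' i = (if fst i = Suc m then e (snd i) else c i)" for i
  have J: "finite J" "I \<inter> J = {}" using I by (auto simp: J_def)
  have sJ: "(\<Sum>i\<in>J. h i) = (\<Sum>k<2^m. h (Suc m, k))" for h :: "nat \<times> nat \<Rightarrow> real"
    unfolding J_def by (subst sum.reindex) (auto simp: inj_on_def)
  have cI: "c' i = c i" if "i \<in> I" for i using I that by (auto simp: c'_def)
  have cJ: "c' (Suc m, k) = e k" for k by (simp add: c'_def)
  have sc: "(schauder_scale m)\<^sup>2 = 1 / 2 ^ m / 4" by (simp add: schauder_scale_def power_divide)
  have "(\<Sum>k<2^Suc m. a k * levy_increment (Suc m) k \<omega>) = (\<Sum>i\<in>I \<union> J. c' i * \<omega> i)" for \<omega>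
  proof -
    have "(\<Sum>k<2^Suc m. a k * levy_increment (Suc m) k \<omega>)
      = (\<Sum>k<2^m. b k * levy_increment m k \<omega> + e k * \<omega> (Suc m, k))"
      unfolding power_Suc sum_lessThan_double
      by (intro sum.cong refl) (simp only: lessThan_iff levy_increment_refine b_def e_def, simp add: field_simps)
    also have "\<dots> = (\<Sum>i\<in>I. c' i * \<omega> i) + (\<Sum>i\<in>J. c' i * \<omega> i)"
      by (simp add: sum.distrib c sJ cI cJ)
    finally show ?thesis unfolding sum.union_disjoint[OF I(1) J(1,2)] .
  qed
  moreover have "(\<Sum>i\<in>I \<union> J. (c' i)\<^sup>2) = (\<Sum>k<2^Suc m. (a k)\<^sup>2) / 2 ^ Suc m"
  proof -
    have "(\<Sum>i\<in>I \<union> J. (c' i)\<^sup>2) = (\<Sum>i\<in>I. (c' i)\<^sup>2) + (\<Sum>i\<in>J. (c' i)\<^sup>2)"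
      by (rule sum.union_disjoint[OF I(1) J(1,2)])
    also have "\<dots> = (\<Sum>k<2^m. (b k)\<^sup>2 / 2 ^ m + (e k)\<^sup>2)"
      by (simp add: cI sJ cJ v sum.distrib sum_divide_distrib)
    also have "\<dots> = (\<Sum>k<2^m. ((a (2 * k))\<^sup>2 + (a (2 * k + 1))\<^sup>2) / 2 ^ Suc m)"
      by (intro sum.cong refl) (simp add: b_def e_def power_mult_distrib sc, simp add: power2_eq_square field_simps)
    also have "\<dots> = (\<Sum>k<2^Suc m. (a k)\<^sup>2) / 2 ^ Suc m"
      unfolding power_Suc sum_lessThan_double by (simp add: sum_divide_distrib)
    finally show ?thesis .
  qed
  moreover have "I \<union> J \<subseteq> {i. fst i \<le> Suc m}" using I by (auto simp: J_def)
  ultimately show ?case using I(1) J(1) by (intro exI[of _ "I \<union> J"] exI[of _ c']) simp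
qed

lemma levy_increment_char:
  "(\<integral>\<omega>. iexp (\<Sum>k<2^m. a k * levy_increment m k \<omega>) \<partial>gauss_space) = of_real (exp (- (\<Sum>k<2^m. (a k)\<^sup>2) / 2 ^ m / 2))"
proof -
  obtain I c where I: "finite I"
    and c: "\<And>\<omega>. (\<Sum>k<2^m. a k * levy_increment m k \<omega>) = (\<Sum>i\<in>I. c i * \<omega> i)"
    and v: "(\<Sum>i\<in>I. (c i)\<^sup>2) = (\<Sum>k<2^m. (a k)\<^sup>2) / 2 ^ m" using levy_increment_combination[of m a] by auto
  show ?thesis unfolding c gauss_space_char[OF I] v by simp
qed

text \<open>Obtained from \<open>\<bar>x\<bar> \<le> a + x^4 / a^3\<close> with \<open>a = 2 powr (l / 4)\<close>, for which the expectations are summable over \<open>l\<close>.\<close>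
definition level_bound :: "nat \<Rightarrow> (nat \<times> nat \<Rightarrow> real) \<Rightarrow> real" where
  "level_bound l \<omega> = schauder_scale l * (sqrt (sqrt 2) ^ l + (\<Sum>k<2^l. \<omega> (Suc l, k) ^ 4) / (sqrt (sqrt 2) ^ l) ^ 3)"

lemma level_bound_nonneg: "level_bound l \<omega> \<ge> 0"
  unfolding level_bound_def schauder_scale_def
  by (intro mult_nonneg_nonneg add_nonneg_nonneg divide_nonneg_nonneg sum_nonneg) auto

lemma schauder_level_le: "\<bar>schauder_level l \<omega> t\<bar> \<le> level_bound l \<omega>"
proof -
  let ?r = "sqrt (sqrt 2) ^ l" and ?n = "nat \<lfloor>2 ^ l * t\<rfloor>"
  define b where "b = ?r + (\<Sum>k<2^l. \<omega> (Suc l, k) ^ 4) / ?r ^ 3"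
  have r: "?r > 0" by simp
  have s0: "schauder_scale l \<ge> 0" by (simp add: schauder_scale_def)
  have b0: "b \<ge> 0" unfolding b_def by (intro add_nonneg_nonneg divide_nonneg_nonneg sum_nonneg) auto
  \<comment> \<open>At any time at most one tent of the level is nonzero, so the level is bounded by
    its largest coefficient and not by their sum.\<close>
  have t: "tent (2 ^ l * t - real k) = 0" if "k \<noteq> ?n" for k
  proof (rule tent_outside)
    show "2 ^ l * t - real k \<le> 0 \<or> 1 \<le> 2 ^ l * t - real k"
    proof (cases "int k \<le> \<lfloor>2 ^ l * t\<rfloor>")
      case True
      then have "int k + 1 \<le> \<lfloor>2 ^ l * t\<rfloor>" using that by linarith
      then have "real_of_int (int k + 1) \<le> 2 ^ l * t" by (simp only: le_floor_iff)
      then show ?thesis by simp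
    next
      case False
      then show ?thesis by linarith
    qed
  qed
  have w: "\<bar>\<omega> (Suc l, k)\<bar> \<le> b" if "k < 2 ^ l" for k
  proof -
    have "\<omega> (Suc l, k) ^ 4 \<le> (\<Sum>k<2^l. \<omega> (Suc l, k) ^ 4)" using that by (intro member_le_sum) auto
    then show ?thesis unfolding b_def
      using abs_le_pow4[OF r, of "\<omega> (Suc l, k)"] divide_right_mono[of "\<omega> (Suc l, k) ^ 4" _ "?r ^ 3"] r by fastforce
  qed
  have "\<bar>schauder_level l \<omega> t\<bar> \<le> (\<Sum>k<2^l. \<bar>schauder_scale l * \<omega> (Suc l, k) * tent (2 ^ l * t - real k)\<bar>)"
    unfolding schauder_level_def by (rule sum_abs)
  also have "\<dots> \<le> (\<Sum>k<2^l. if k = ?n then schauder_scale l * b else 0)"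
  proof (rule sum_mono)
    fix k :: nat assume k: "k \<in> {..<2 ^ l}"
    show "\<bar>schauder_scale l * \<omega> (Suc l, k) * tent (2 ^ l * t - real k)\<bar> \<le> (if k = ?n then schauder_scale l * b else 0)"
    proof (cases "k = ?n")
      case True
      have "\<bar>\<omega> (Suc l, k)\<bar> * \<bar>tent (2 ^ l * t - real k)\<bar> \<le> b * 1"
        using w[of k] k b0 tent_bounds[of "2 ^ l * t - real k"] by (intro mult_mono) auto
      then show ?thesis using True s0 mult_left_mono[of _ "b * 1" "schauder_scale l"] by (simp add: abs_mult mult.assoc)
    qed (simp add: t)
  qed
  also have "\<dots> \<le> schauder_scale l * b" using s0 b0 by (simp add: sum.delta)
  finally show ?thesis unfolding level_bound_def b_def .
qed

lemma level_bound_measurable [measurable]: "level_bound l \<in> borel_measurable gauss_space"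
  unfolding level_bound_def by measurable

lemma level_bound_expectation: "(\<integral>\<omega>. level_bound l \<omega> \<partial>gauss_space) = 2 * (1 / sqrt (sqrt 2)) ^ l"
  "integrable gauss_space (level_bound l)"
proof -
  interpret prob_space gauss_space by (rule prob_space_gauss_space)
  \<comment> \<open>In terms of \<open>?r\<close>, the scale is \<open>1 / ?r ^ 2 / 2\<close>, and
    there are \<open>?r ^ 4\<close> normals with fourth moment 3, so both summands are of order
    \<open>1 / ?r\<close>.\<close>
  let ?r = "sqrt (sqrt 2) ^ l"
  have i: "integrable gauss_space (\<lambda>\<omega>. (\<Sum>k<2^l. \<omega> (Suc l, k) ^ 4) / ?r ^ 3)"
    by (intro integrable_divide Bochner_Integration.integrable_sum gauss_space_pow4)
  show "integrable gauss_space (level_bound l)" unfolding level_bound_def using i by simp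
  have "(\<integral>\<omega>. level_bound l \<omega> \<partial>gauss_space) = schauder_scale l * (?r + 3 * 2 ^ l / ?r ^ 3)"
    unfolding level_bound_def using i
    by (simp add: prob_space Bochner_Integration.integral_sum gauss_space_pow4)
  also have "schauder_scale l = 1 / ?r ^ 2 / 2"
    by (simp add: schauder_scale_def real_sqrt_divide real_sqrt_power power_mult[symmetric] power_mult_distrib flip: power_mult)
       (simp add: power_mult mult.commute[of l])
  also have "2 ^ l = ?r ^ 4"
  proof -
    have "sqrt (sqrt 2) ^ 4 = 2" using power_mult[of "sqrt (sqrt 2)" 2 2] by simp
    then have "(sqrt (sqrt 2) ^ 4) ^ l = 2 ^ l" by simp
    then show ?thesis by (simp add: power_mult[symmetric] mult.commute)
  qed
  also have "1 / ?r ^ 2 / 2 * (?r + 3 * ?r ^ 4 / ?r ^ 3) = 2 * (1 / ?r)"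
    by (simp add: field_simps power2_eq_square power3_eq_cube power4_eq_xxxx)
  finally show "(\<integral>\<omega>. level_bound l \<omega> \<partial>gauss_space) = 2 * (1 / sqrt (sqrt 2)) ^ l" by (simp add: power_one_over)
qed

lemma AE_level_bound_summable: "AE \<omega> in gauss_space. (\<Sum>l. ennreal (level_bound l \<omega>)) < \<top>"
proof -
  have "(\<integral>\<^sup>+\<omega>. (\<Sum>l. ennreal (level_bound l \<omega>)) \<partial>gauss_space) = (\<Sum>l. \<integral>\<^sup>+\<omega>. ennreal (level_bound l \<omega>) \<partial>gauss_space)"
    by (rule nn_integral_suminf) simp
  also have "\<dots> = (\<Sum>l. ennreal (2 * (1 / sqrt (sqrt 2)) ^ l))"
    by (simp add: nn_integral_eq_integral level_bound_expectation level_bound_nonneg)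
  also have "\<dots> < \<top>"
  proof -
    have "summable (\<lambda>l. 2 * (1 / sqrt (sqrt 2)) ^ l)" by (intro summable_mult summable_geometric) simp
    then show ?thesis by (subst suminf_ennreal2) auto
  qed
  finally have "(\<integral>\<^sup>+\<omega>. (\<Sum>l. ennreal (level_bound l \<omega>)) \<partial>gauss_space) \<noteq> \<infinity>" by simp
  then have "AE \<omega> in gauss_space. (\<Sum>l. ennreal (level_bound l \<omega>)) \<noteq> \<infinity>"
    by (intro nn_integral_PInf_AE) auto
  then show ?thesis by eventually_elim (simp add: less_top)
qed

text \<open>The zero path on the exceptional null set makes every path continuous, as
  \<open>gaussian_martingale\<close> demands.\<close>

definition levy_path :: "real \<Rightarrow> (nat \<times> nat \<Rightarrow> real) \<Rightarrow> real" where
  "levy_path t \<omega> = (if (\<Sum>l. ennreal (level_bound l \<omega>)) < \<top> then \<omega> (0, 0) * t + (\<Sum>l. schauder_level l \<omega> t) else 0)"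

lemma levy_path_measurable [measurable]: "levy_path t \<in> borel_measurable gauss_space"
proof -
  have [measurable]: "(\<lambda>\<omega>. schauder_level l \<omega> t) \<in> borel_measurable gauss_space" for l
    unfolding schauder_level_def by measurable
  show ?thesis unfolding levy_path_def by measurable
qed

lemma levy_path_0: "levy_path 0 \<omega> = 0"
  using schauder_level_0[of 0 _ \<omega> 0] by (simp add: levy_path_def)

lemma continuous_levy_path: "continuous_on S (\<lambda>t. levy_path t \<omega>)"
proof (cases "(\<Sum>l. ennreal (level_bound l \<omega>)) < \<top>")
  case True
  have "summable (\<lambda>l. level_bound l \<omega>)"
    by (rule summable_suminf_not_top) (use True level_bound_nonneg in auto)
  then have u: "uniform_limit S (\<lambda>n t. \<Sum>l<n. schauder_level l \<omega> t) (\<lambda>t. \<Sum>l. schauder_level l \<omega> t) sequentially"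
    by (intro Weierstrass_m_test) (use schauder_level_le in auto)
  have "continuous_on S (\<lambda>t. \<Sum>l. schauder_level l \<omega> t)"
    by (rule uniform_limit_theorem[OF _ u]) (auto simp: schauder_level_def tent_def intro!: always_eventually continuous_intros)
  then show ?thesis using True unfolding levy_path_def by (auto intro!: continuous_intros)
qed (simp add: levy_path_def)

lemma levy_path_dyadic:
  assumes "(\<Sum>l. ennreal (level_bound l \<omega>)) < \<top>"
  shows "levy_path (real k / 2 ^ m) \<omega> = levy_sum m \<omega> (real k / 2 ^ m)"
proof -
  have "(\<Sum>l. schauder_level l \<omega> (real k / 2 ^ m)) = (\<Sum>l<m. schauder_level l \<omega> (real k / 2 ^ m))"
    by (rule suminf_finite) (auto intro: schauder_level_0)
  then show ?thesis using assms by (simp add: levy_path_def levy_sum_def)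
qed

lemma sum_power2_orthogonal:
  fixes b :: "nat \<Rightarrow> real"
  assumes "\<And>i j. i < j \<Longrightarrow> b i * b j = 0"
  shows "(\<Sum>j<n. b j)\<^sup>2 = (\<Sum>j<n. (b j)\<^sup>2)"
proof (induction n)
  case (Suc n)
  have "(\<Sum>j<n. b j) * b n = 0" unfolding sum_distrib_right using assms by (intro sum.neutral) auto
  then show ?case by (simp add: power2_sum Suc)
qed simp

text \<open>The coefficient \<open>u j\<close> is spread over the level-\<open>m\<close> cells
  between \<open>\<kappa> j\<close> and \<open>\<kappa> (Suc j)\<close>. These blocks are disjoint,
  so squares add; repeated indices give empty blocks.\<close>

lemma levy_path_dyadic_char:
  fixes \<kappa> :: "nat \<Rightarrow> nat"
  assumes \<kappa>: "incseq \<kappa>" "\<And>j. \<kappa> j \<le> 2 ^ m"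
  shows "(\<integral>\<omega>. iexp (\<Sum>j<n. u j * (levy_path (real (\<kappa> (Suc j)) / 2 ^ m) \<omega> - levy_path (real (\<kappa> j) / 2 ^ m) \<omega>)) \<partial>gauss_space)
    = of_real (exp (- (\<Sum>j<n. (u j)\<^sup>2 * (real (\<kappa> (Suc j)) / 2 ^ m - real (\<kappa> j) / 2 ^ m)) / 2))"
proof -
  define b where "b k j = (if k \<in> {\<kappa> j..<\<kappa> (Suc j)} then u j else 0)" for k j
  define a where "a k = (\<Sum>j<n. b k j)" for k
  have sub: "{\<kappa> j..<\<kappa> (Suc j)} \<subseteq> {..<2 ^ m}" for j using \<kappa>(2)[of "Suc j"] by auto
  have ind: "(\<Sum>k<2^m. (if k \<in> {\<kappa> j..<\<kappa> (Suc j)} then c else 0) * h k) = c * (\<Sum>k=\<kappa> j..<\<kappa> (Suc j). h k)" for j c and h :: "nat \<Rightarrow> real"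
    unfolding sum_distrib_left using sub[of j] by (intro sum.mono_neutral_cong_right) auto
  have tel: "(\<Sum>k=\<kappa> j..<\<kappa> (Suc j). levy_increment m k \<omega>) = levy_sum m \<omega> (real (\<kappa> (Suc j)) / 2 ^ m) - levy_sum m \<omega> (real (\<kappa> j) / 2 ^ m)" for j \<omega>
    unfolding levy_increment_def using incseq_SucD[OF \<kappa>(1), of j]
    by (rule sum_Suc_diff'[of "\<kappa> j" "\<kappa> (Suc j)" "\<lambda>k. levy_sum m \<omega> (real k / 2 ^ m)"])
  have comb: "(\<Sum>k<2^m. a k * levy_increment m k \<omega>)
     = (\<Sum>j<n. u j * (levy_sum m \<omega> (real (\<kappa> (Suc j)) / 2 ^ m) - levy_sum m \<omega> (real (\<kappa> j) / 2 ^ m)))" for \<omega>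
    unfolding a_def b_def sum_distrib_right by (subst sum.swap) (simp only: ind tel)
  have sq: "(a k)\<^sup>2 = (\<Sum>j<n. (b k j)\<^sup>2)" for k
    unfolding a_def
  proof (rule sum_power2_orthogonal)
    fix i j :: nat assume "i < j"
    then have "\<kappa> (Suc i) \<le> \<kappa> j" using incseqD[OF \<kappa>(1), of "Suc i" j] by simp
    then show "b k i * b k j = 0" by (auto simp: b_def)
  qed
  have b2: "(b k j)\<^sup>2 = (if k \<in> {\<kappa> j..<\<kappa> (Suc j)} then (u j)\<^sup>2 else 0) * 1" for k j by (simp add: b_def)
  have "(\<Sum>k<2^m. (a k)\<^sup>2) = (\<Sum>j<n. (u j)\<^sup>2 * (\<Sum>k=\<kappa> j..<\<kappa> (Suc j). 1))"
    unfolding sq b2 by (subst sum.swap) (simp only: ind)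
  then have "(\<Sum>k<2^m. (a k)\<^sup>2) / 2 ^ m = (\<Sum>j<n. (u j)\<^sup>2 * (real (\<kappa> (Suc j)) / 2 ^ m - real (\<kappa> j) / 2 ^ m))"
    using incseq_SucD[OF \<kappa>(1)] by (simp add: sum_divide_distrib of_nat_diff diff_divide_distrib[symmetric])
  moreover have "(\<integral>\<omega>. iexp (\<Sum>j<n. u j * (levy_path (real (\<kappa> (Suc j)) / 2 ^ m) \<omega> - levy_path (real (\<kappa> j) / 2 ^ m) \<omega>)) \<partial>gauss_space)
    = (\<integral>\<omega>. iexp (\<Sum>k<2^m. a k * levy_increment m k \<omega>) \<partial>gauss_space)"
  proof (rule integral_cong_AE)
    have "(\<lambda>\<omega>. levy_increment m k \<omega>) \<in> borel_measurable gauss_space" for k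
      unfolding levy_increment_def levy_sum_def schauder_level_def by measurable
    then show "(\<lambda>\<omega>. iexp (\<Sum>k<2^m. a k * levy_increment m k \<omega>)) \<in> borel_measurable gauss_space" by measurable
    show "AE \<omega> in gauss_space. iexp (\<Sum>j<n. u j * (levy_path (real (\<kappa> (Suc j)) / 2 ^ m) \<omega> - levy_path (real (\<kappa> j) / 2 ^ m) \<omega>))
       = iexp (\<Sum>k<2^m. a k * levy_increment m k \<omega>)"
      using AE_level_bound_summable by eventually_elim (simp only: comb levy_path_dyadic)
  qed measurable
  ultimately show ?thesis using levy_increment_char[of a m] by simp
qed

text \<open>Times are approximated by dyadic ones from below; path continuity carries the formula
  over to the limit.\<close>

lemma levy_path_char:
  assumes t: "incseq t" "\<And>j. t j \<in> {0..1}"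
  shows "(\<integral>\<omega>. iexp (\<Sum>j<n. u j * (levy_path (t (Suc j)) \<omega> - levy_path (t j) \<omega>)) \<partial>gauss_space)
    = of_real (exp (- (\<Sum>j<n. (u j)\<^sup>2 * (t (Suc j) - t j)) / 2))"
proof -
  interpret prob_space gauss_space by (rule prob_space_gauss_space)
  define \<kappa> where "\<kappa> m j = nat \<lfloor>2 ^ m * t j\<rfloor>" for m j
  define d where "d m j = real (\<kappa> m j) / 2 ^ m" for m j
  have \<kappa>: "incseq (\<kappa> m)" for m
    unfolding \<kappa>_def using t(1) by (intro incseq_SucI nat_mono floor_mono mult_left_mono) (auto dest: incseq_SucD)
  have \<kappa>1: "\<kappa> m j \<le> 2 ^ m" for m j
  proof -
    have "2 ^ m * t j \<le> of_int (2 ^ m)" using t(2)[of j] by simp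
    then have "\<lfloor>2 ^ m * t j\<rfloor> \<le> \<lfloor>of_int (2 ^ m) :: real\<rfloor>" by (rule floor_mono)
    then show ?thesis unfolding \<kappa>_def floor_of_int by (simp add: nat_le_iff)
  qed
  have d: "(\<lambda>m. d m j) \<longlonglongrightarrow> t j" for j
  proof (rule tendsto_sandwich[of "\<lambda>m. t j - 1 / 2 ^ m" _ _ "\<lambda>_. t j"])
    have t0: "t j \<ge> 0" using t(2)[of j] by simp
    show "\<forall>\<^sub>F m in sequentially. t j - 1 / 2 ^ m \<le> d m j" "\<forall>\<^sub>F m in sequentially. d m j \<le> t j"
      unfolding d_def \<kappa>_def nat_floor_dyadic(1)[OF t0]
      using nat_floor_dyadic(2,3)[OF t0] by (auto intro!: always_eventually simp: algebra_simps less_imp_le)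
    have "(\<lambda>m. t j - (1 / 2) ^ m) \<longlonglongrightarrow> t j - 0" by (intro tendsto_intros LIMSEQ_power_zero) auto
    then show "(\<lambda>m. t j - 1 / 2 ^ m) \<longlonglongrightarrow> t j" by (simp add: power_one_over)
  qed simp
  let ?S = "\<lambda>t \<omega>. iexp (\<Sum>j<n. u j * (levy_path (t (Suc j)) \<omega> - levy_path (t j) \<omega>))"
  have c: "((\<lambda>m. levy_path (d m j) \<omega>) \<longlongrightarrow> levy_path (t j) \<omega>) sequentially" for j \<omega>
    using continuous_levy_path[of UNIV \<omega>] d[of j] by (intro continuous_on_tendsto_compose[of UNIV "\<lambda>t. levy_path t \<omega>"]) auto
  have "(\<lambda>m. \<integral>\<omega>. ?S (d m) \<omega> \<partial>gauss_space) \<longlonglongrightarrow> (\<integral>\<omega>. ?S t \<omega> \<partial>gauss_space)"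
    by (rule integral_dominated_convergence[where w = "\<lambda>_. 1"]) (auto intro!: tendsto_intros c AE_I2)
  moreover have "(\<lambda>m. \<integral>\<omega>. ?S (d m) \<omega> \<partial>gauss_space) \<longlonglongrightarrow> of_real (exp (- (\<Sum>j<n. (u j)\<^sup>2 * (t (Suc j) - t j)) / 2))"
    unfolding d_def levy_path_dyadic_char[OF \<kappa> \<kappa>1] unfolding d_def[symmetric] by (intro tendsto_intros d) simp_all
  ultimately show ?thesis by (rule LIMSEQ_unique)
qed

section \<open>Two independent copies on the real line\<close>

lemma inj_gauss_pair_real: "\<exists>j :: (nat \<times> nat \<Rightarrow> real) \<times> (nat \<times> nat \<Rightarrow> real) \<Rightarrow> real. inj j"
proof -
  obtain g :: "nat set \<Rightarrow> real" where g: "bij g"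
    using nat_sets_eqpoll_reals unfolding eqpoll_def by auto
  define h where "h = inv g"
  have h: "h x = h y \<longleftrightarrow> x = y" for x y
    using g unfolding h_def by (metis bij_inv_eq_iff)
  \<comment> \<open>Each coordinate is a set of naturals through \<open>h\<close>; tagging with the
    component \<open>b\<close> and the index \<open>i\<close> merges all of them into a single set
    of naturals, which \<open>g\<close> maps to a real.\<close>
  define e where "e w = {to_nat (b, i, n) | b i n. n \<in> h ((if b then fst w else snd w) i)}"
    for w :: "(nat \<times> nat \<Rightarrow> real) \<times> (nat \<times> nat \<Rightarrow> real)"
  have e: "to_nat (b, i, n) \<in> e w \<longleftrightarrow> n \<in> h ((if b then fst w else snd w) i)" for b :: bool and i :: "nat \<times> nat" and n :: nat and w
    unfolding e_def by (cases i) auto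
  have "inj e"
  proof (rule injI)
    fix v w assume "e v = e w"
    then have "h ((if b then fst v else snd v) i) = h ((if b then fst w else snd w) i)" for b i
      using e[of b i _ v] e[of b i _ w] by blast
    then have "(if b then fst v else snd v) i = (if b then fst w else snd w) i" for b i by (simp only: h)
    from this[of True] this[of False] have "fst v = fst w" "snd v = snd w" by (simp_all add: fun_eq_iff)
    then show "v = w" by (rule prod_eqI)
  qed
  then have "inj (g \<circ> e)" using g by (intro inj_compose[OF bij_is_inj])
  then show ?thesis by blast
qed

text \<open>The product measure is transported along \<open>j\<close>, and the copies are the two
  projections after inverting \<open>j\<close>.\<close>

lemma independent_copies_exist:
  fixes N :: "'a measure" and j :: "'a \<times> 'a \<Rightarrow> 'b"
  assumes N: "prob_space N" and j: "inj j"
  shows "\<exists>(P :: 'b measure) X1 X2. prob_space P \<and> distr P N X1 = N \<and> distr P N X2 = N \<and> prob_space.indep_var P N X1 N X2"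
proof -
  interpret N: prob_space N by fact
  interpret NN: pair_prob_space N N ..
  define P where "P = embed_measure (N \<Otimes>\<^sub>M N) j"
  define X1 where "X1 = (\<lambda>y. fst (inv j y))"
  define X2 where "X2 = (\<lambda>y. snd (inv j y))"
  have jm: "j \<in> measurable (N \<Otimes>\<^sub>M N) P" unfolding P_def by (rule measurable_embed_measure2[OF j])
  have PD: "P = distr (N \<Otimes>\<^sub>M N) P j" unfolding P_def by (rule embed_measure_eq_distr[OF j])
  have X: "X1 \<in> measurable P N" "X2 \<in> measurable P N"
    unfolding P_def X1_def X2_def by (rule measurable_embed_measure1, simp add: j)+
  have P: "prob_space P" by (subst PD) (rule NN.P.prob_space_distr[OF jm])
  have d1: "distr P N X1 = N"
  proof -
    have "distr P N X1 = distr (distr (N \<Otimes>\<^sub>M N) P j) N X1" by (subst PD) (rule refl)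
    also have "\<dots> = distr (N \<Otimes>\<^sub>M N) N (X1 \<circ> j)" by (rule distr_distr[OF X(1) jm])
    also have "X1 \<circ> j = fst" using j by (auto simp: X1_def)
    finally show ?thesis by (simp only: N.distr_pair_fst)
  qed
  have pr: "distr P (N \<Otimes>\<^sub>M N) (\<lambda>x. (X1 x, X2 x)) = N \<Otimes>\<^sub>M N"
  proof -
    have m: "(\<lambda>x. (X1 x, X2 x)) \<in> measurable P (N \<Otimes>\<^sub>M N)" using X by measurable
    have "distr P (N \<Otimes>\<^sub>M N) (\<lambda>x. (X1 x, X2 x)) = distr (distr (N \<Otimes>\<^sub>M N) P j) (N \<Otimes>\<^sub>M N) (\<lambda>x. (X1 x, X2 x))"
      by (subst PD) (rule refl)
    also have "\<dots> = distr (N \<Otimes>\<^sub>M N) (N \<Otimes>\<^sub>M N) ((\<lambda>x. (X1 x, X2 x)) \<circ> j)" by (rule distr_distr[OF m jm])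
    also have "(\<lambda>x. (X1 x, X2 x)) \<circ> j = (\<lambda>x. x)" using j by (auto simp: X1_def X2_def)
    finally show ?thesis by (simp add: distr_id)
  qed
  have d2: "distr P N X2 = N"
  proof -
    have sw: "distr (N \<Otimes>\<^sub>M N) (N \<Otimes>\<^sub>M N) (\<lambda>(x, y). (y, x)) = N \<Otimes>\<^sub>M N"
      using NN.distr_pair_swap by simp
    have "distr P N X2 = distr (distr (N \<Otimes>\<^sub>M N) P j) N X2" by (subst PD) (rule refl)
    also have "\<dots> = distr (N \<Otimes>\<^sub>M N) N (X2 \<circ> j)" by (rule distr_distr[OF X(2) jm])
    also have "X2 \<circ> j = fst \<circ> (\<lambda>(x, y). (y, x))" using j by (auto simp: X2_def)
    also have "distr (N \<Otimes>\<^sub>M N) N \<dots> = distr (distr (N \<Otimes>\<^sub>M N) (N \<Otimes>\<^sub>M N) (\<lambda>(x, y). (y, x))) N fst"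
      by (rule distr_distr[symmetric]) measurable
    finally show ?thesis by (simp only: sw N.distr_pair_fst)
  qed
  have "prob_space.indep_var P N X1 N X2"
    unfolding prob_space.indep_var_distribution_eq[OF P] using X by (simp add: d1 d2 pr)
  then show ?thesis using P d1 d2 by blast
qed

lemma levy_path_time_change_char:
  fixes \<phi> :: "real \<Rightarrow> real" and s :: "nat \<Rightarrow> real"
  assumes X: "X \<in> measurable P gauss_space" "distr P gauss_space X = gauss_space"
    and \<phi>: "mono_on {0..} \<phi>" "\<And>t. t \<ge> 0 \<Longrightarrow> \<phi> t \<in> {0..1}" and s: "incseq s" "\<And>j. s j \<ge> 0"
  shows "(\<integral>\<xi>. iexp (\<Sum>j<n. u j * (c * levy_path (\<phi> (s (Suc j))) (X \<xi>) - c * levy_path (\<phi> (s j)) (X \<xi>))) \<partial>P)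
    = of_real (exp (- (\<Sum>j<n. (u j)\<^sup>2 * (c\<^sup>2 * \<phi> (s (Suc j)) - c\<^sup>2 * \<phi> (s j))) / 2))"
proof -
  let ?F = "\<lambda>\<omega>. iexp (\<Sum>j<n. (u j * c) * (levy_path (\<phi> (s (Suc j))) \<omega> - levy_path (\<phi> (s j)) \<omega>))"
  have "(\<integral>\<xi>. iexp (\<Sum>j<n. u j * (c * levy_path (\<phi> (s (Suc j))) (X \<xi>) - c * levy_path (\<phi> (s j)) (X \<xi>))) \<partial>P) = (\<integral>\<xi>. ?F (X \<xi>) \<partial>P)"
    by (simp only: right_diff_distrib mult.assoc)
  also have "\<dots> = (\<integral>\<omega>. ?F \<omega> \<partial>distr P gauss_space X)"
    by (rule integral_distr[symmetric, OF X(1)]) measurable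
  also have "\<dots> = of_real (exp (- (\<Sum>j<n. (u j * c)\<^sup>2 * (\<phi> (s (Suc j)) - \<phi> (s j))) / 2))"
    unfolding X(2) using s \<phi>
    by (intro levy_path_char[of "\<lambda>j. \<phi> (s j)"] incseq_SucI) (auto intro: mono_onD dest: incseq_SucD)
  also have "(\<Sum>j<n. (u j * c)\<^sup>2 * (\<phi> (s (Suc j)) - \<phi> (s j))) = (\<Sum>j<n. (u j)\<^sup>2 * (c\<^sup>2 * \<phi> (s (Suc j)) - c\<^sup>2 * \<phi> (s j)))"
    by (simp only: power_mult_distrib right_diff_distrib mult.assoc)
  finally show ?thesis .
qed

lemma gaussian_martingale_levy_path:
  fixes \<phi> :: "real \<Rightarrow> real"
  assumes X: "X \<in> measurable P gauss_space" "distr P gauss_space X = gauss_space"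
    and \<phi>: "mono_on {0..} \<phi>" "\<And>t. t \<ge> 0 \<Longrightarrow> \<phi> t \<in> {0..1}" "continuous_on {0..} \<phi>" "\<phi> 0 = 0"
  shows "gaussian_martingale P (\<lambda>t \<xi>. c * levy_path (\<phi> t) (X \<xi>)) (\<lambda>t. c\<^sup>2 * \<phi> t)"
  unfolding gaussian_martingale_def
proof (intro conjI allI impI ballI)
  note X(1)[measurable]
  show "(\<lambda>\<xi>. c * levy_path (\<phi> t) (X \<xi>)) \<in> borel_measurable P" for t by measurable
  show "c * levy_path (\<phi> 0) (X \<xi>) = 0" for \<xi> by (simp add: \<phi>(4) levy_path_0)
  show "continuous_on {0..} (\<lambda>t. c * levy_path (\<phi> t) (X \<xi>))" for \<xi>
    by (intro continuous_intros continuous_on_compose2[OF continuous_levy_path[of UNIV] \<phi>(3)]) auto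
  fix ts :: "real list" and u :: "nat \<Rightarrow> real"
  assume ts: "sorted_wrt (<) ts \<and> ts \<noteq> [] \<and> hd ts \<ge> 0"
  define n where "n = length ts - 1"
  \<comment> \<open>The characteristic function is stated for infinite increasing sequences, so
    \<open>min j n\<close> continues the list by its last time.\<close>
  define s where "s j = ts ! min j n" for j
  have n: "n < length ts" using ts by (simp add: n_def)
  have sorted: "sorted ts" using ts by (simp add: strict_sorted_imp_sorted)
  then have s: "incseq s" unfolding s_def incseq_def using n by (auto intro!: sorted_nth_mono)
  have "s 0 \<ge> 0" using ts hd_conv_nth[of ts] by (simp add: s_def)
  then have s0: "s j \<ge> 0" for j using incseqD[OF s, of 0 j] by simp
  have "(\<integral>\<xi>. iexp (\<Sum>j<n. u j * (c * levy_path (\<phi> (s (Suc j))) (X \<xi>) - c * levy_path (\<phi> (s j)) (X \<xi>))) \<partial>P)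
    = of_real (exp (- (\<Sum>j<n. (u j)\<^sup>2 * (c\<^sup>2 * \<phi> (s (Suc j)) - c\<^sup>2 * \<phi> (s j))) / 2))"
    by (rule levy_path_time_change_char[OF X \<phi>(1,2) s s0])
  moreover have "(\<Sum>j<n. f j (s (Suc j)) (s j)) = (\<Sum>j<n. f j (ts ! Suc j) (ts ! j))" for f :: "nat \<Rightarrow> real \<Rightarrow> real \<Rightarrow> real"
    by (intro sum.cong refl) (simp add: s_def)
  note this[of "\<lambda>j x y. u j * (c * levy_path (\<phi> x) (X _) - c * levy_path (\<phi> y) (X _))"]
    this[of "\<lambda>j x y. (u j)\<^sup>2 * (c\<^sup>2 * \<phi> x - c\<^sup>2 * \<phi> y)"]
  ultimately show "(\<integral>\<xi>. cis (\<Sum>m<length ts - 1. u m * (c * levy_path (\<phi> (ts ! Suc m)) (X \<xi>) - c * levy_path (\<phi> (ts ! m)) (X \<xi>))) \<partial>P)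
     = of_real (exp (- (\<Sum>m<length ts - 1. (u m)\<^sup>2 * (c\<^sup>2 * \<phi> (ts ! Suc m) - c\<^sup>2 * \<phi> (ts ! m))) / 2))"
    unfolding n_def[symmetric] cis_conv_exp by (simp only:)
qed

lemma (in prob_space) indep_var_char_sum:
  assumes "indep_var N1 X1 N2 X2" and [measurable]: "U \<in> borel_measurable N1" "W \<in> borel_measurable N2"
  shows "(\<integral>\<xi>. iexp (U (X1 \<xi>) + W (X2 \<xi>)) \<partial>M) = (\<integral>\<xi>. iexp (U (X1 \<xi>)) \<partial>M) * (\<integral>\<xi>. iexp (W (X2 \<xi>)) \<partial>M)"
proof -
  have [measurable]: "X1 \<in> measurable M N1" "X2 \<in> measurable M N2"
    using assms(1) by (auto dest: indep_var_rv1 indep_var_rv2)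
  have "indep_var borel ((\<lambda>x. iexp (U x)) \<circ> X1) borel ((\<lambda>x. iexp (W x)) \<circ> X2)"
    by (rule indep_var_compose[OF assms(1)]) measurable
  then have "(\<integral>\<xi>. iexp (U (X1 \<xi>)) * iexp (W (X2 \<xi>)) \<partial>M) = (\<integral>\<xi>. iexp (U (X1 \<xi>)) \<partial>M) * (\<integral>\<xi>. iexp (W (X2 \<xi>)) \<partial>M)"
    by (intro indep_var_lebesgue_integral) (auto simp: comp_def intro!: integrable_const_bound[of _ 1])
  then show ?thesis by (simp add: distrib_left exp_add)
qed

section \<open>The Ornstein--Uhlenbeck limit\<close>

text \<open>Variation of constants after integration by parts: for \<open>x 0 = 0\<close> this is
  the integral of \<open>exp (- a * (t - s))\<close> against \<open>dx\<close>, given a pathwise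
  meaning for any continuous \<open>x\<close>.\<close>

definition ou_path :: "real \<Rightarrow> (real \<Rightarrow> real) \<Rightarrow> real \<Rightarrow> real" where
  "ou_path a x t = x t - a * exp (- a * t) * integral {0..t} (\<lambda>s. exp (a * s) * x s)"

lemma exp_weighted_continuous:
  fixes x :: "real \<Rightarrow> real"
  assumes "continuous_on {0..} x"
  shows "continuous_on {0..} (\<lambda>s. exp (a * s) * x s)"
  by (intro continuous_intros assms)

lemma exp_weighted_primitive:
  fixes x :: "real \<Rightarrow> real"
  assumes x: "continuous_on {0..} x" and t: "t \<in> {0..T}"
  shows "((\<lambda>t. integral {0..t} (\<lambda>s. exp (a * s) * x s)) has_vector_derivative exp (a * t) * x t) (at t within {0..T})"
  using t by (intro integral_has_vector_derivative continuous_on_subset[OF exp_weighted_continuous[OF x]]) auto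

lemma continuous_on_halfline:
  fixes f :: "real \<Rightarrow> real"
  assumes "\<And>T. continuous_on {0..T} f"
  shows "continuous_on {0..} f"
proof -
  have "continuous (at t within {0..}) f" if "t \<ge> 0" for t
  proof -
    have "at t within {0..} = at t within {0..t+1}"
      by (rule at_within_nhd[of t "{..<t+1}"]) auto
    then show ?thesis using assms[of "t + 1"] that by (simp add: continuous_on_eq_continuous_within)
  qed
  then show ?thesis by (simp add: continuous_on_eq_continuous_within)
qed

lemma ou_path_continuous:
  assumes x: "continuous_on {0..} x"
  shows "continuous_on {0..} (ou_path a x)"
proof (rule continuous_on_halfline)
  fix T
  have "continuous_on {0..T} (\<lambda>t. integral {0..t} (\<lambda>s. exp (a * s) * x s))"
    by (rule continuous_on_vector_derivative) (rule exp_weighted_primitive[OF x])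
  then show "continuous_on {0..T} (ou_path a x)"
    unfolding ou_path_def by (intro continuous_intros continuous_on_subset[OF x]) auto
qed

text \<open>The weighted primitive times \<open>exp (- a * t)\<close> has derivative
  \<open>ou_path a x\<close>, so it is the integral of the solution; substituting it into the
  definition gives the equation.\<close>

lemma ou_path_equation:
  assumes x: "continuous_on {0..} x" and t: "t \<ge> 0"
  shows "ou_path a x t = - a * integral {0..t} (ou_path a x) + x t"
proof -
  let ?J = "\<lambda>t. integral {0..t} (\<lambda>s. exp (a * s) * x s)"
  have "((\<lambda>t. exp (- a * t) * ?J t) has_vector_derivative ou_path a x s) (at s within {0..t})" if s: "s \<in> {0..t}" for s
  proof -
    have J: "(?J has_real_derivative exp (a * s) * x s) (at s within {0..t})"
      using exp_weighted_primitive[OF x s] by (simp add: has_real_derivative_iff_has_vector_derivative)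
    have E: "((\<lambda>t. exp (- a * t)) has_real_derivative - a * exp (- a * s)) (at s within {0..t})"
      by (auto intro!: derivative_eq_intros)
    have "exp (- a * s) * (exp (a * s) * x s) = x s" by (simp add: mult.assoc[symmetric] flip: exp_add)
    then have "- a * exp (- a * s) * ?J s + exp (a * s) * x s * exp (- a * s) = ou_path a x s"
      unfolding ou_path_def by (simp add: mult.commute mult.left_commute)
    then have "((\<lambda>t. exp (- a * t) * ?J t) has_real_derivative ou_path a x s) (at s within {0..t})"
      using DERIV_mult[OF E J] by (simp only:)
    then show ?thesis by (simp add: has_real_derivative_iff_has_vector_derivative)
  qed
  then have "(ou_path a x has_integral exp (- a * t) * ?J t - exp (- a * 0) * ?J 0) {0..t}"
    by (rule fundamental_theorem_of_calculus[OF t])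
  then have "integral {0..t} (ou_path a x) = exp (- a * t) * ?J t" by (simp add: integral_unique)
  then show ?thesis by (simp add: ou_path_def)
qed

lemma ou_path_0: "ou_path a x 0 = x 0"
  by (simp add: ou_path_def)

lemma exp_weighted_riemann_sums:
  fixes x :: "real \<Rightarrow> real"
  assumes x: "continuous_on {0..} x" and A: "A \<ge> 0" "\<eta> > 0"
  shows "(\<lambda>r. \<Sum>l<r. \<eta> / real r * (exp (a * (A + real (Suc l) * (\<eta> / real r))) * x (A + real (Suc l) * (\<eta> / real r))))
    \<longlonglongrightarrow> integral {A..A + \<eta>} (\<lambda>s. exp (a * s) * x s)"
proof -
  define y where "y s = exp (a * s) * x s" for s
  have c: "continuous_on {A..A + \<eta>} y"
    unfolding y_def by (rule continuous_on_subset[OF exp_weighted_continuous[OF x]]) (use A in auto)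
  obtain B where B: "\<And>s. s \<in> {A..A + \<eta>} \<Longrightarrow> \<bar>y s\<bar> \<le> B"
    using compact_imp_bounded[OF compact_continuous_image[OF c]] unfolding bounded_iff by (metis compact_Icc image_eqI real_norm_def)
  have r: "(y \<longlongrightarrow> y s) (at_right s)" if "A \<le> s" "s < A + \<eta>" for s
  proof -
    have "(y \<longlongrightarrow> y s) (at s within {A..A + \<eta>})" using c that by (simp add: continuous_on_def)
    moreover have "at_right s \<le> at s within {A..A + \<eta>}"
    proof -
      have "at_right s = at s within {s<..<A + \<eta>}" by (rule at_within_nhd[of s "{..<A + \<eta>}"]) (use that in auto)
      also have "\<dots> \<le> at s within {A..A + \<eta>}" by (rule at_le) (use that in auto)
      finally show ?thesis .
    qed
    ultimately show ?thesis by (rule tendsto_mono[rotated])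
  qed
  have "(\<lambda>r. \<Sum>l<r. (A + \<eta> - A) / real r * y (A + real (Suc l) * ((A + \<eta> - A) / real r))) \<longlonglongrightarrow> integral {A..A + \<eta>} y"
    by (rule riemann_sums_right(2)) (use A r B in auto)
  then show ?thesis by (simp add: y_def[abs_def])
qed

lemma ou_path_measurable:
  assumes X: "\<And>t. X t \<in> borel_measurable P" and c: "\<And>\<omega>. \<omega> \<in> space P \<Longrightarrow> continuous_on {0..} (\<lambda>t. X t \<omega>)"
  shows "(\<lambda>\<omega>. ou_path a (\<lambda>t. X t \<omega>) t) \<in> borel_measurable P"
proof -
  note X[measurable]
  have "(\<lambda>\<omega>. integral {0..t} (\<lambda>s. exp (a * s) * X s \<omega>)) \<in> borel_measurable P"
  proof (cases "t > 0")
    case True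
    show ?thesis
      by (rule borel_measurable_LIMSEQ_real[OF exp_weighted_riemann_sums[OF c order_refl True, simplified]]) measurable
  qed (cases "t = 0"; simp)
  then show ?thesis unfolding ou_path_def by measurable
qed

text \<open>Summation by parts turns the sums approximating the Wiener integral of \<open>exp (a * s)\<close>
  into right-endpoint Riemann sums.\<close>

lemma ou_path_increment_limit:
  fixes x :: "real \<Rightarrow> real"
  assumes x: "continuous_on {0..} x" and A: "A \<ge> 0" "\<eta> > 0"
  shows "(\<lambda>r. \<Sum>l<r. exp (a * (A + real l * (\<eta> / real r))) * (x (A + real (Suc l) * (\<eta> / real r)) - x (A + real l * (\<eta> / real r))))
    \<longlonglongrightarrow> exp (a * (A + \<eta>)) * ou_path a x (A + \<eta>) - exp (a * A) * ou_path a x A"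
proof -
  define y where "y s = exp (a * s) * x s" for s
  define R where "R r = (\<Sum>l<r. \<eta> / real r * y (A + real (Suc l) * (\<eta> / real r)))" for r
  let ?J = "\<lambda>t. integral {0..t} y"
  have yc: "continuous_on {0..} y" unfolding y_def by (rule exp_weighted_continuous[OF x])
  have yi: "y integrable_on {0..A + \<eta>}"
    by (rule integrable_continuous_real[OF continuous_on_subset[OF yc]]) auto
  have "?J A + integral {A..A + \<eta>} y = ?J (A + \<eta>)"
    by (rule Henstock_Kurzweil_Integration.integral_combine[OF _ _ yi]) (use A in auto)
  moreover have "exp (a * t) * ou_path a x t = y t - a * ?J t" for t
  proof -
    have "exp (a * t) * exp (- a * t) = 1" by (simp flip: exp_add)
    then have "exp (a * t) * (a * exp (- a * t) * ?J t) = a * ?J t" by (simp add: mult.left_commute)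
    then show ?thesis unfolding ou_path_def y_def[abs_def] right_diff_distrib by (simp only:)
  qed
  moreover have "a * (?J A + integral {A..A + \<eta>} y) = a * ?J A + a * integral {A..A + \<eta>} y" by (rule distrib_left)
  ultimately have lim: "exp (a * (A + \<eta>)) * ou_path a x (A + \<eta>) - exp (a * A) * ou_path a x A
     = y (A + \<eta>) - y A - a * integral {A..A + \<eta>} y" by simp
  have R: "R \<longlonglongrightarrow> integral {A..A + \<eta>} y"
    using exp_weighted_riemann_sums[OF x A, of a] by (simp add: R_def[abs_def] y_def[abs_def])
  have d: "(\<lambda>r. (1 - exp (- a * (\<eta> / real r))) / (\<eta> / real r)) \<longlonglongrightarrow> a"
    using A by real_asymp
  have "(\<lambda>r. y (A + \<eta>) - y A - (1 - exp (- a * (\<eta> / real r))) / (\<eta> / real r) * R r) \<longlonglongrightarrow> y (A + \<eta>) - y A - a * integral {A..A + \<eta>} y"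
    by (intro tendsto_intros R d)
  moreover have "\<forall>\<^sub>F r in sequentially. y (A + \<eta>) - y A - (1 - exp (- a * (\<eta> / real r))) / (\<eta> / real r) * R r
     = (\<Sum>l<r. exp (a * (A + real l * (\<eta> / real r))) * (x (A + real (Suc l) * (\<eta> / real r)) - x (A + real l * (\<eta> / real r))))"
    using eventually_gt_at_top[of 0]
  proof eventually_elim
    case (elim r)
    define \<delta> where "\<delta> = \<eta> / real r"
    define s where "s l = A + real l * \<delta>" for l
    have \<delta>: "\<delta> > 0" using A elim by (simp add: \<delta>_def)
    have s: "s 0 = A" "s r = A + \<eta>" using elim by (simp_all add: s_def \<delta>_def)
    have "exp (a * s l) * (x (s (Suc l)) - x (s l)) = (y (s (Suc l)) - y (s l)) - (1 - exp (- a * \<delta>)) * y (s (Suc l))" for l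
    proof -
      have "exp (a * s l) = exp (- a * \<delta>) * exp (a * s (Suc l))" by (simp add: s_def algebra_simps flip: exp_add)
      then have "exp (- a * \<delta>) * y (s (Suc l)) = exp (a * s l) * x (s (Suc l))" by (simp only: y_def mult.assoc)
      then show ?thesis unfolding y_def left_diff_distrib right_diff_distrib mult_1 by linarith
    qed
    then have "(\<Sum>l<r. exp (a * s l) * (x (s (Suc l)) - x (s l)))
      = (\<Sum>l<r. y (s (Suc l)) - y (s l)) - (\<Sum>l<r. (1 - exp (- a * \<delta>)) * y (s (Suc l)))"
      by (simp only: sum_subtractf)
    also have "(\<Sum>l<r. y (s (Suc l)) - y (s l)) = y (A + \<eta>) - y A"
      using sum_lessThan_telescope[of "\<lambda>l. y (s l)" r] s by simp
    also have "(\<Sum>l<r. (1 - exp (- a * \<delta>)) * y (s (Suc l))) = (1 - exp (- a * \<delta>)) / \<delta> * R r"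
      using \<delta> unfolding R_def \<delta>_def[symmetric] s_def[symmetric] by (simp add: sum_distrib_left)
    finally show ?case unfolding s_def \<delta>_def by simp
  qed
  ultimately show ?thesis unfolding lim by (rule Lim_transform_eventually)
qed

lemma sum_lessThan_blocks: "(\<Sum>j<K * r. f j) = (\<Sum>k<K. \<Sum>l<r. f (k * r + l))" for f :: "nat \<Rightarrow> 'a::comm_monoid_add"
proof (induction K)
  case (Suc K)
  have "(\<Sum>j<K * r + n. f j) = (\<Sum>j<K * r. f j) + (\<Sum>l<n. f (K * r + l))" for n
    by (induction n) (simp_all add: add.assoc)
  from this[of r] Suc show ?case by (simp add: add.commute)
qed simp

text \<open>For these brackets the sums have a closed form: the part from
  \<open>exp (- a * t)\<close> telescopes up to a factor tending to 1, and the part from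
  \<open>exp (- 2 * a * t)\<close> is the same in every step.\<close>

lemma ou_variance_limit:
  fixes a V :: real
  assumes V: "a = 0 \<Longrightarrow> V = 0" and \<eta>: "\<eta> > 0"
    and h: "\<And>t. h t = 1 - exp (- a * t) + V / (2 * a) * (1 - exp (- 2 * a * t))"
  shows "(\<lambda>r. \<Sum>l<r. (exp (a * (A + real l * (\<eta> / real r))))\<^sup>2 * (h (A + real (Suc l) * (\<eta> / real r)) - h (A + real l * (\<eta> / real r))))
    \<longlonglongrightarrow> exp (a * (A + \<eta>)) - exp (a * A) + V * \<eta>"
proof -
  define F where "F r = exp (- a * (\<eta> / real r)) * (exp (a * (A + \<eta>)) - exp (a * A)) + V / (2 * a) * (real r * (1 - exp (- 2 * a * (\<eta> / real r))))" for r
  have d: "(\<lambda>r. real r * (1 - exp (- 2 * a * (\<eta> / real r)))) \<longlonglongrightarrow> 2 * a * \<eta>"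
    using \<eta> by real_asymp
  have e: "(\<lambda>r. exp (- a * (\<eta> / real r))) \<longlonglongrightarrow> 1" by real_asymp
  have "F \<longlonglongrightarrow> 1 * (exp (a * (A + \<eta>)) - exp (a * A)) + V / (2 * a) * (2 * a * \<eta>)"
    unfolding F_def by (intro tendsto_intros d e)
  \<comment> \<open>For \<open>a = 0\<close> both \<open>V / (2 * a)\<close> and \<open>V\<close>
    are 0, so the limit agrees.\<close>
  then have F: "F \<longlonglongrightarrow> exp (a * (A + \<eta>)) - exp (a * A) + V * \<eta>"
    using V by (cases "a = 0") simp_all
  have "\<forall>\<^sub>F r in sequentially. F r = (\<Sum>l<r. (exp (a * (A + real l * (\<eta> / real r))))\<^sup>2 * (h (A + real (Suc l) * (\<eta> / real r)) - h (A + real l * (\<eta> / real r))))"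
    using eventually_gt_at_top[of 0]
  proof eventually_elim
    case (elim r)
    define \<delta> where "\<delta> = \<eta> / real r"
    define s where "s l = A + real l * \<delta>" for l
    have s: "s 0 = A" "s r = A + \<eta>" using elim by (simp_all add: s_def \<delta>_def)
    have "(exp (a * s l))\<^sup>2 * (h (s (Suc l)) - h (s l))
      = exp (- a * \<delta>) * (exp (a * s (Suc l)) - exp (a * s l)) + V / (2 * a) * (1 - exp (- 2 * a * \<delta>))" for l
    proof -
      have 1: "(exp (a * s l))\<^sup>2 * exp (- a * s (Suc l)) = exp (- a * \<delta>) * exp (a * s l)"
        "(exp (a * s l))\<^sup>2 * exp (- a * s l) = exp (- a * \<delta>) * exp (a * s (Suc l))"
        "(exp (a * s l))\<^sup>2 * exp (- 2 * a * s (Suc l)) = exp (- 2 * a * \<delta>)"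
        "(exp (a * s l))\<^sup>2 * exp (- 2 * a * s l) = 1"
        by (simp_all add: s_def power2_eq_square algebra_simps flip: exp_add)
      have "(exp (a * s l))\<^sup>2 * (h (s (Suc l)) - h (s l)) = (exp (a * s l))\<^sup>2 * exp (- a * s l) - (exp (a * s l))\<^sup>2 * exp (- a * s (Suc l))
        + V / (2 * a) * ((exp (a * s l))\<^sup>2 * exp (- 2 * a * s l) - (exp (a * s l))\<^sup>2 * exp (- 2 * a * s (Suc l)))"
        unfolding h by (simp only: algebra_simps)
      then show ?thesis unfolding 1 by (simp only: right_diff_distrib)
    qed
    then have "(\<Sum>l<r. (exp (a * s l))\<^sup>2 * (h (s (Suc l)) - h (s l)))
      = exp (- a * \<delta>) * (\<Sum>l<r. exp (a * s (Suc l)) - exp (a * s l)) + real r * (V / (2 * a) * (1 - exp (- 2 * a * \<delta>)))"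
      by (simp add: sum.distrib sum_distrib_left)
    also have "(\<Sum>l<r. exp (a * s (Suc l)) - exp (a * s l)) = exp (a * (A + \<eta>)) - exp (a * A)"
      using sum_lessThan_telescope[of "\<lambda>l. exp (a * s l)" r] s by simp
    finally show ?case unfolding s_def \<delta>_def F_def by (simp only: mult_ac)
  qed
  then show ?thesis using F by (rule Lim_transform_eventually[rotated])
qed

text \<open>Increments of \<open>exp (a * t)\<close> times the solution are limits of weighted sums
  of increments of \<open>X\<close>. Before the limit, the \<open>K\<close> cells with
  \<open>r\<close> points each form one increasing sequence of times, to which \<open>char\<close>
  applies. For \<open>a = linf\<close> the variances are those in
  \<open>scaled_Nhat_fdd\<close>.\<close>

lemma ou_path_char:
  fixes a V \<eta> :: real and u :: "nat \<Rightarrow> real"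
  assumes P: "prob_space P" and V: "a = 0 \<Longrightarrow> V = 0" and \<eta>: "\<eta> > 0"
    and X: "\<And>t. X t \<in> borel_measurable P" and c: "\<And>\<omega>. \<omega> \<in> space P \<Longrightarrow> continuous_on {0..} (\<lambda>t. X t \<omega>)"
    and h: "\<And>t. h t = 1 - exp (- a * t) + V / (2 * a) * (1 - exp (- 2 * a * t))"
    and char: "\<And>s u n. incseq s \<Longrightarrow> (\<And>j. s j \<ge> (0::real)) \<Longrightarrow>
      (\<integral>\<omega>. iexp (\<Sum>j<n. u j * (X (s (Suc j)) \<omega> - X (s j) \<omega>)) \<partial>P) = of_real (exp (- (\<Sum>j<n. (u j)\<^sup>2 * (h (s (Suc j)) - h (s j))) / 2))"
  shows "(\<integral>\<omega>. iexp (\<Sum>k<K. u k * (exp (a * (real (Suc k) * \<eta>)) * ou_path a (\<lambda>t. X t \<omega>) (real (Suc k) * \<eta>)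
        - exp (a * (real k * \<eta>)) * ou_path a (\<lambda>t. X t \<omega>) (real k * \<eta>))) \<partial>P)
    = of_real (exp (- (\<Sum>k<K. (u k)\<^sup>2 * (exp (a * (real (Suc k) * \<eta>)) - exp (a * (real k * \<eta>)) + V * \<eta>)) / 2))"
proof -
  interpret prob_space P by fact
  note X[measurable]
  define D where "D r k \<omega> = (\<Sum>l<r. exp (a * (real k * \<eta> + real l * (\<eta> / real r))) *
      (X (real k * \<eta> + real (Suc l) * (\<eta> / real r)) \<omega> - X (real k * \<eta> + real l * (\<eta> / real r)) \<omega>))" for r k \<omega>
  define v where "v r k = (\<Sum>l<r. (exp (a * (real k * \<eta> + real l * (\<eta> / real r))))\<^sup>2 *
      (h (real k * \<eta> + real (Suc l) * (\<eta> / real r)) - h (real k * \<eta> + real l * (\<eta> / real r))))" for r k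
  define E where "E k \<omega> = exp (a * (real (Suc k) * \<eta>)) * ou_path a (\<lambda>t. X t \<omega>) (real (Suc k) * \<eta>)
        - exp (a * (real k * \<eta>)) * ou_path a (\<lambda>t. X t \<omega>) (real k * \<eta>)" for k \<omega>
  have S: "real (Suc k) * \<eta> = real k * \<eta> + \<eta>" for k by (simp add: algebra_simps)
  have [measurable]: "E k \<in> borel_measurable P" "D r k \<in> borel_measurable P" for r k
    using ou_path_measurable[OF X c, of a] unfolding E_def[abs_def] D_def[abs_def] by measurable
  have D: "(\<lambda>r. D r k \<omega>) \<longlonglongrightarrow> E k \<omega>" if "\<omega> \<in> space P" for k \<omega>
    unfolding D_def E_def S by (rule ou_path_increment_limit[OF c[OF that]]) (use \<eta> in auto)
  have v: "(\<lambda>r. v r k) \<longlonglongrightarrow> exp (a * (real (Suc k) * \<eta>)) - exp (a * (real k * \<eta>)) + V * \<eta>" for k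
    unfolding v_def S by (rule ou_variance_limit[OF V \<eta> h])
  have "(\<integral>\<omega>. iexp (\<Sum>k<K. u k * D r k \<omega>) \<partial>P) = of_real (exp (- (\<Sum>k<K. (u k)\<^sup>2 * v r k) / 2))" if r: "r > 0" for r
  proof -
    define \<delta> where "\<delta> = \<eta> / real r"
    \<comment> \<open>\<open>j div r\<close> recovers the cell that contains the \<open>j\<close>-th
      fine increment.\<close>
    define w where "w j = u (j div r) * exp (a * (real j * \<delta>))" for j
    have \<delta>: "\<delta> > 0" using \<eta> r by (simp add: \<delta>_def)
    have pos: "real k * \<eta> + real l * (\<eta> / real r) = real (k * r + l) * \<delta>" for k l using r by (simp add: \<delta>_def field_simps)
    have wl: "w (k * r + l) = u k * exp (a * (real (k * r + l) * \<delta>))" if "l < r" for k l using that by (simp add: w_def)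
    have 1: "(\<Sum>k<K. u k * D r k \<omega>) = (\<Sum>j<K * r. w j * (X (real (Suc j) * \<delta>) \<omega> - X (real j * \<delta>) \<omega>))" for \<omega>
      unfolding sum_lessThan_blocks D_def pos sum_distrib_left
      by (intro sum.cong refl) (simp only: lessThan_iff wl mult.assoc add_Suc_right)
    have 2: "(\<Sum>k<K. (u k)\<^sup>2 * v r k) = (\<Sum>j<K * r. (w j)\<^sup>2 * (h (real (Suc j) * \<delta>) - h (real j * \<delta>)))"
      unfolding sum_lessThan_blocks v_def pos sum_distrib_left
      by (intro sum.cong refl) (simp only: lessThan_iff wl mult.assoc power_mult_distrib add_Suc_right)
    show ?thesis unfolding 1 2 using \<delta> by (intro char) (auto intro!: incseq_SucI mult_right_mono)
  qed
  then have "\<forall>\<^sub>F r in sequentially. (\<integral>\<omega>. iexp (\<Sum>k<K. u k * D r k \<omega>) \<partial>P) = of_real (exp (- (\<Sum>k<K. (u k)\<^sup>2 * v r k) / 2))"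
    by (rule eventually_mono[OF eventually_gt_at_top[of 0]])
  moreover have "(\<lambda>r. complex_of_real (exp (- (\<Sum>k<K. (u k)\<^sup>2 * v r k) / 2)))
     \<longlonglongrightarrow> of_real (exp (- (\<Sum>k<K. (u k)\<^sup>2 * (exp (a * (real (Suc k) * \<eta>)) - exp (a * (real k * \<eta>)) + V * \<eta>)) / 2))"
    by (intro tendsto_intros v) simp_all
  ultimately have "(\<lambda>r. \<integral>\<omega>. iexp (\<Sum>k<K. u k * D r k \<omega>) \<partial>P)
     \<longlonglongrightarrow> of_real (exp (- (\<Sum>k<K. (u k)\<^sup>2 * (exp (a * (real (Suc k) * \<eta>)) - exp (a * (real k * \<eta>)) + V * \<eta>)) / 2))"
    by (simp add: tendsto_cong)
  moreover have "(\<lambda>r. \<integral>\<omega>. iexp (\<Sum>k<K. u k * D r k \<omega>) \<partial>P) \<longlonglongrightarrow> (\<integral>\<omega>. iexp (\<Sum>k<K. u k * E k \<omega>) \<partial>P)"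
    by (rule integral_dominated_convergence[where w = "\<lambda>_. 1"]) (auto intro!: tendsto_intros D AE_I2)
  ultimately show ?thesis unfolding E_def by (rule LIMSEQ_unique[rotated])
qed

section \<open>Cadlag paths and identification of the limit\<close>

lemma cadlag_counting_process: "cadlag_path (\<lambda>t. real (counting_process n \<tau> t \<omega>))"
proof -
  have r: "((\<lambda>t. of_bool (\<tau> i \<omega> > ereal t)) \<longlongrightarrow> (of_bool (\<tau> i \<omega> > ereal t) :: real)) (at_right t)" for i and t :: real
  proof (rule tendsto_eventually)
    show "\<forall>\<^sub>F s in at_right t. (of_bool (\<tau> i \<omega> > ereal s) :: real) = of_bool (\<tau> i \<omega> > ereal t)"
    proof (cases "\<tau> i \<omega> > ereal t")
      case True
      then obtain b where b: "ereal t < ereal b" "ereal b < \<tau> i \<omega>" using ereal_dense2 by blast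
      have "\<forall>\<^sub>F s in at_right t. s < b" using b by (intro eventually_at_right_less eventually_at_rightI[of t b]) auto
      then show ?thesis
      proof eventually_elim
        case (elim s)
        then have "ereal s < \<tau> i \<omega>" using b(2) by (metis ereal_less(2) less_ereal.simps(1) less_trans)
        then show ?case using True by simp
      qed
    next
      case False
      have "\<forall>\<^sub>F s in at_right t. s > t" by (rule eventually_at_right_less)
      then show ?thesis
      proof eventually_elim
        case (elim s)
        then have "\<not> \<tau> i \<omega> > ereal s" using False by (metis less_ereal.simps(1) less_trans not_less_iff_gr_or_eq)
        then show ?case using False by simp
      qed
    qed
  qed
  \<comment> \<open>Seen from the left, a default exactly at \<open>t\<close> has not happened yet,
    hence \<open>\<ge>\<close> in the limit.\<close>
  have l: "((\<lambda>t. of_bool (\<tau> i \<omega> > ereal t)) \<longlongrightarrow> (of_bool (\<tau> i \<omega> \<ge> ereal t) :: real)) (at_left t)" for i and t :: real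
  proof (rule tendsto_eventually)
    show "\<forall>\<^sub>F s in at_left t. (of_bool (\<tau> i \<omega> > ereal s) :: real) = of_bool (\<tau> i \<omega> \<ge> ereal t)"
    proof (cases "\<tau> i \<omega> \<ge> ereal t")
      case True
      have "\<forall>\<^sub>F s in at_left t. s < t" by (simp add: eventually_at_filter)
      then show ?thesis
      proof eventually_elim
        case (elim s)
        then have "ereal s < \<tau> i \<omega>" using True by (meson less_ereal.simps(1) less_le_trans)
        then show ?case using True by simp
      qed
    next
      case False
      then obtain b where b: "\<tau> i \<omega> < ereal b" "ereal b < ereal t" using ereal_dense2[of "\<tau> i \<omega>" "ereal t"] by (auto simp: not_le)
      have "\<forall>\<^sub>F s in at_left t. b < s" using b by (intro eventually_at_leftI[of b t]) auto
      then show ?thesis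
      proof eventually_elim
        case (elim s)
        then have "\<not> ereal s < \<tau> i \<omega>" using b(1) by (metis less_ereal.simps(1) less_trans less_asym)
        then show ?case using False by simp
      qed
    qed
  qed
  show ?thesis
    unfolding cadlag_path_def counting_process_eq continuous_within
  proof (intro conjI allI impI)
    fix t :: real
    show "((\<lambda>t. real n - (\<Sum>i<n. of_bool (\<tau> i \<omega> > ereal t))) \<longlongrightarrow> real n - (\<Sum>i<n. of_bool (\<tau> i \<omega> > ereal t))) (at_right t)"
      by (intro tendsto_intros r)
    have "((\<lambda>t. real n - (\<Sum>i<n. of_bool (\<tau> i \<omega> > ereal t))) \<longlongrightarrow> real n - (\<Sum>i<n. of_bool (\<tau> i \<omega> \<ge> ereal t))) (at_left t)"
      by (intro tendsto_intros l)
    then show "\<exists>l. ((\<lambda>t. real n - (\<Sum>i<n. of_bool (\<tau> i \<omega> > ereal t))) \<longlongrightarrow> l) (at_left t)" by blast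
  qed
qed

text \<open>Turns coefficients of values into coefficients of increments, the form in which both
  characteristic functions are known.\<close>

lemma sum_weighted_telescope:
  fixes y c :: "nat \<Rightarrow> real"
  shows "(\<Sum>k<N. c k * (y k - y 0)) = (\<Sum>j<N. (\<Sum>k\<in>{j<..<N}. c k) * (y (Suc j) - y j))"
proof (induction N)
  case (Suc N)
  have "{j<..<Suc N} = insert N {j<..<N}" if "j < N" for j using that by auto
  then have "(\<Sum>j<N. (\<Sum>k\<in>{j<..<Suc N}. c k) * (y (Suc j) - y j)) = (\<Sum>j<N. c N * (y (Suc j) - y j) + (\<Sum>k\<in>{j<..<N}. c k) * (y (Suc j) - y j))"
    by (intro sum.cong refl) (simp add: distrib_right)
  also have "\<dots> = c N * (y N - y 0) + (\<Sum>k<N. c k * (y k - y 0))"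
    by (simp add: sum.distrib Suc sum_lessThan_telescope flip: sum_distrib_left)
  moreover have "{N<..<Suc N} = {}" by auto
  ultimately show ?case by simp
qed simp

lemma mono_on_exp_saturation: "a \<ge> 0 \<Longrightarrow> mono_on {0..} (\<lambda>t. 1 - exp (- a * t))" for a :: real
  by (intro mono_onI) (simp add: mult_left_mono)

context modulated_chain
begin

lemma cadlag_Nhat: "cadlag_path (\<lambda>t. Nhat n \<tau> t \<omega>)"
proof -
  have c: "continuous F rho" if "F = at t within S" for F t S
    unfolding that rho_def by (intro continuous_intros)
  then have r: "(rho \<longlongrightarrow> rho t) (at t within S)" for t S by (simp add: continuous_within)
  have r': "(rho \<longlongrightarrow> rho t) (at_left t)" for t by (rule r)
  show ?thesis
    unfolding cadlag_path_def Nhat_def continuous_within divide_inverse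
  proof (intro conjI allI impI)
    fix t :: real assume "t \<ge> 0"
    then have "((\<lambda>t. real (counting_process n \<tau> t \<omega>)) \<longlongrightarrow> real (counting_process n \<tau> t \<omega>)) (at_right t)"
      using cadlag_counting_process[of n \<tau> \<omega>] unfolding cadlag_path_def continuous_within by blast
    then show "((\<lambda>t. (real (counting_process n \<tau> t \<omega>) - real n * rho t) * inverse (sqrt (real n))) \<longlongrightarrow>
      (real (counting_process n \<tau> t \<omega>) - real n * rho t) * inverse (sqrt (real n))) (at_right t)"
      by (intro tendsto_intros r)
  next
    fix t :: real assume "t > 0"
    then obtain l where "((\<lambda>t. real (counting_process n \<tau> t \<omega>)) \<longlongrightarrow> l) (at_left t)"
      using cadlag_counting_process[of n \<tau> \<omega>] unfolding cadlag_path_def by blast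
    then have "((\<lambda>t. (real (counting_process n \<tau> t \<omega>) - real n * rho t) * inverse (sqrt (real n))) \<longlongrightarrow>
      (l - real n * rho t) * inverse (sqrt (real n))) (at_left t)"
      by (intro tendsto_intros r)
    then show "\<exists>l. ((\<lambda>t. (real (counting_process n \<tau> t \<omega>) - real n * rho t) * inverse (sqrt (real n))) \<longlongrightarrow> l) (at_left t)" by blast
  qed
qed

lemma Nhat_fdd_limit:
  fixes M :: "nat \<Rightarrow> 'a measure" and u :: "nat \<Rightarrow> real" and Y :: "real \<Rightarrow> 'b \<Rightarrow> real" and l N :: nat
  assumes Z: "\<And>n. ctmc (M n) (real n *\<^sub>R Q) (Z n)" and mm: "\<And>n. mm_binomial_defaults (M n) lam (Z n) n (\<tau> n)"
    and Y0: "\<And>\<omega>. Y 0 \<omega> = 0"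
    and Y: "\<And>(v :: nat \<Rightarrow> real) K \<eta>. \<eta> > 0 \<Longrightarrow> (\<integral>\<omega>. iexp (\<Sum>k<K. v k * (exp (linf * (real (Suc k) * \<eta>)) * Y (real (Suc k) * \<eta>) \<omega>
        - exp (linf * (real k * \<eta>)) * Y (real k * \<eta>) \<omega>)) \<partial>P)
      = of_real (exp (- (\<Sum>k<K. (v k)\<^sup>2 * (exp (linf * (real (Suc k) * \<eta>)) - exp (linf * (real k * \<eta>)) + V * \<eta>)) / 2))"
  shows "(\<lambda>n. \<integral>\<omega>. iexp (\<Sum>k<N. u k * Nhat n (\<tau> n) (real k / 2 ^ l) \<omega>) \<partial>M n) \<longlonglongrightarrow> (\<integral>\<omega>. iexp (\<Sum>k<N. u k * Y (real k / 2 ^ l) \<omega>) \<partial>P)"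
proof -
  define \<eta> :: real where "\<eta> = 1 / 2 ^ l"
  define e where "e k = exp (linf * (real k * \<eta>))" for k :: nat
  \<comment> \<open>Dividing by \<open>e k\<close> undoes the exponential weight; the tail sum
    passes from values to increments.\<close>
  define v where "v j = (\<Sum>k\<in>{j<..<N}. u k / e k)" for j
  have \<eta>: "\<eta> > 0" by (simp add: \<eta>_def)
  have tel: "(\<Sum>k<N. u k * x (real k / 2 ^ l)) = (\<Sum>j<N. v j * (e (Suc j) * x (real (Suc j) * \<eta>) - e j * x (real j * \<eta>)))"
    if "x 0 = 0" for x :: "real \<Rightarrow> real"
  proof -
    have "(\<Sum>k<N. u k * x (real k / 2 ^ l)) = (\<Sum>k<N. u k / e k * (e k * x (real k * \<eta>) - e 0 * x (real 0 * \<eta>)))"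
      using that by (intro sum.cong refl) (simp add: e_def \<eta>_def)
    then show ?thesis unfolding sum_weighted_telescope[of "\<lambda>k. u k / e k" "\<lambda>k. e k * x (real k * \<eta>)"] v_def .
  qed
  have var: "Kvar (real (Suc k) * \<eta>) - Kvar (real k * \<eta>) = e (Suc k) - e k + V * \<eta>" for k
    by (simp add: Kvar_def e_def algebra_simps)
  have lim: "(\<integral>\<omega>. iexp (\<Sum>k<N. u k * Y (real k / 2 ^ l) \<omega>) \<partial>P) = of_real (exp (- (\<Sum>k<N. (v k)\<^sup>2 * (e (Suc k) - e k + V * \<eta>)) / 2))"
    unfolding tel[of "\<lambda>t. Y t _", OF Y0] unfolding e_def by (rule Y[OF \<eta>])
  \<comment> \<open>The telescoping needs the value 0 at time 0, which is known for
    \<open>Nhat\<close> almost surely only.\<close>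
  have pre: "(\<integral>\<omega>. iexp (\<Sum>k<N. u k * Nhat n (\<tau> n) (real k / 2 ^ l) \<omega>) \<partial>M n)
     = (\<integral>\<omega>. iexp (\<Sum>j<N. v j * (e (Suc j) * Nhat n (\<tau> n) (real (Suc j) * \<eta>) \<omega> - e j * Nhat n (\<tau> n) (real j * \<eta>) \<omega>)) \<partial>M n)" for n
  proof (rule integral_cong_AE)
    note [measurable] = Nhat_measurable[OF mm[of n]]
    show "(\<lambda>\<omega>. iexp (\<Sum>k<N. u k * Nhat n (\<tau> n) (real k / 2 ^ l) \<omega>)) \<in> borel_measurable (M n)"
      "(\<lambda>\<omega>. iexp (\<Sum>j<N. v j * (e (Suc j) * Nhat n (\<tau> n) (real (Suc j) * \<eta>) \<omega> - e j * Nhat n (\<tau> n) (real j * \<eta>) \<omega>))) \<in> borel_measurable (M n)"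
      by measurable
    show "AE \<omega> in M n. iexp (\<Sum>k<N. u k * Nhat n (\<tau> n) (real k / 2 ^ l) \<omega>)
      = iexp (\<Sum>j<N. v j * (e (Suc j) * Nhat n (\<tau> n) (real (Suc j) * \<eta>) \<omega> - e j * Nhat n (\<tau> n) (real j * \<eta>) \<omega>))"
      using Nhat_0[OF Z[of n] mm[of n]]
    proof eventually_elim
      case (elim \<omega>)
      show ?case by (simp only: tel[of "\<lambda>t. Nhat n (\<tau> n) t \<omega>", OF elim])
    qed
  qed
  show ?thesis unfolding lim pre var[symmetric] unfolding e_def by (rule scaled_Nhat_fdd[OF Z mm \<eta>])
qed

theorem Nhat_converges:
  fixes M :: "nat \<Rightarrow> 'a measure"
  assumes Z: "\<And>n. ctmc (M n) (real n *\<^sub>R Q) (Z n)" and mm: "\<And>n. mm_binomial_defaults (M n) lam (Z n) n (\<tau> n)"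
  shows "\<exists>(P :: real measure) W G Nh. prob_space P \<and>
      gaussian_martingale P W (\<lambda>t. 1 - exp (- linf * t)) \<and>
      gaussian_martingale P G (\<lambda>t. V / (2 * linf) * (1 - exp (- 2 * linf * t))) \<and>
      prob_space.indep_var P
         (Pi\<^sub>M {0..} (\<lambda>_. borel)) (\<lambda>\<omega>. restrict (\<lambda>t. W t \<omega>) {0..})
         (Pi\<^sub>M {0..} (\<lambda>_. borel)) (\<lambda>\<omega>. restrict (\<lambda>t. G t \<omega>) {0..}) \<and>
      (\<forall>t\<ge>0. Nh t \<in> borel_measurable P) \<and>
      (\<forall>\<omega>\<in>space P. continuous_on {0..} (\<lambda>t. Nh t \<omega>) \<and>
         (\<forall>t\<ge>0. Nh t \<omega> = - linf * integral {0..t} (\<lambda>s. Nh s \<omega>) + W t \<omega> + G t \<omega>)) \<and>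
      conv_distr_D M (\<lambda>n. Nhat n (\<tau> n)) P Nh"
proof -
  obtain j :: "(nat \<times> nat \<Rightarrow> real) \<times> (nat \<times> nat \<Rightarrow> real) \<Rightarrow> real" where j: "inj j"
    using inj_gauss_pair_real by blast
  obtain P :: "real measure" and X1 X2 where P: "prob_space P"
    and d: "distr P gauss_space X1 = gauss_space" "distr P gauss_space X2 = gauss_space"
    and ind: "prob_space.indep_var P gauss_space X1 gauss_space X2"
    using independent_copies_exist[OF prob_space_gauss_space j] by blast
  interpret prob_space P by fact
  have X [measurable]: "X1 \<in> measurable P gauss_space" "X2 \<in> measurable P gauss_space"
    using ind by (auto dest: indep_var_rv1 indep_var_rv2)
  define \<phi> where "\<phi> b t = 1 - exp (- b * t)" for b t :: real
  \<comment> \<open>The clock with rate \<open>2 * linf\<close> runs in the unit interval, where the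
    constructed motion is defined; \<open>c\<close> supplies the remaining factor of the bracket of
    \<open>G\<close>.\<close>
  define c where "c = sqrt (V / (2 * linf))"
  \<comment> \<open>The factor 1 gives \<open>W\<close> the shape of
    \<open>gaussian_martingale_levy_path\<close>.\<close>
  define W where "W t \<xi> = 1 * levy_path (\<phi> linf t) (X1 \<xi>)" for t \<xi>
  define G where "G t \<xi> = c * levy_path (\<phi> (2 * linf) t) (X2 \<xi>)" for t \<xi>
  define S where "S t \<xi> = W t \<xi> + G t \<xi>" for t \<xi>
  define Nh where "Nh t \<xi> = ou_path linf (\<lambda>t. S t \<xi>) t" for t \<xi>
  have c2: "c\<^sup>2 = V / (2 * linf)" unfolding c_def using V_nonneg linf_nonneg by (intro real_sqrt_pow2) auto
  have \<phi>: "mono_on {0..} (\<phi> b)" "\<And>t. t \<ge> 0 \<Longrightarrow> \<phi> b t \<in> {0..1}" "continuous_on {0..} (\<phi> b)" "\<phi> b 0 = 0" if "b \<ge> 0" for b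
    using mono_on_exp_saturation[OF that] that unfolding \<phi>_def[abs_def] by (auto intro!: continuous_intros)
  have l2: "2 * linf \<ge> 0" using linf_nonneg by simp
  have gW: "gaussian_martingale P W (\<lambda>t. 1 - exp (- linf * t))"
    using gaussian_martingale_levy_path[OF X(1) d(1) \<phi>[OF linf_nonneg], of 1]
    unfolding W_def[abs_def] by (simp add: \<phi>_def)
  have gG: "gaussian_martingale P G (\<lambda>t. V / (2 * linf) * (1 - exp (- 2 * linf * t)))"
    using gaussian_martingale_levy_path[OF X(2) d(2) \<phi>[OF l2], of c]
    unfolding G_def[abs_def] c2 by (simp add: \<phi>_def)
  have S: "S t \<in> borel_measurable P" for t unfolding S_def[abs_def] W_def G_def by measurable
  have S0: "S 0 \<xi> = 0" for \<xi> by (simp add: S_def W_def G_def \<phi>_def levy_path_0)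
  have Sc: "continuous_on {0..} (\<lambda>t. S t \<xi>)" for \<xi>
    unfolding S_def W_def G_def
    by (intro continuous_intros continuous_on_compose2[OF continuous_levy_path[of UNIV]] \<phi>(3) linf_nonneg l2) auto
  have ind': "indep_var (Pi\<^sub>M {0..} (\<lambda>_. borel)) (\<lambda>\<omega>. restrict (\<lambda>t. W t \<omega>) {0..}) (Pi\<^sub>M {0..} (\<lambda>_. borel)) (\<lambda>\<omega>. restrict (\<lambda>t. G t \<omega>) {0..})"
    using indep_var_compose[OF ind, of "\<lambda>\<omega>. \<lambda>t\<in>{0..}. 1 * levy_path (\<phi> linf t) \<omega>" "Pi\<^sub>M {0..} (\<lambda>_. borel)"
        "\<lambda>\<omega>. \<lambda>t\<in>{0..}. c * levy_path (\<phi> (2 * linf) t) \<omega>" "Pi\<^sub>M {0..} (\<lambda>_. borel)"]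
    unfolding W_def G_def comp_def by (auto intro!: measurable_restrict)
  define h where "h t = 1 - exp (- linf * t) + V / (2 * linf) * (1 - exp (- 2 * linf * t))" for t
  have h: "h t = 1\<^sup>2 * \<phi> linf t + c\<^sup>2 * \<phi> (2 * linf) t" for t by (simp add: h_def \<phi>_def c2)
  have Schar: "(\<integral>\<xi>. iexp (\<Sum>j<n. u j * (S (s (Suc j)) \<xi> - S (s j) \<xi>)) \<partial>P) = of_real (exp (- (\<Sum>j<n. (u j)\<^sup>2 * (h (s (Suc j)) - h (s j))) / 2))"
    if s: "incseq s" "\<And>j. s j \<ge> 0" for s u n
  proof -
    let ?U = "\<lambda>\<omega>. \<Sum>j<n. u j * (1 * levy_path (\<phi> linf (s (Suc j))) \<omega> - 1 * levy_path (\<phi> linf (s j)) \<omega>)"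
    let ?T = "\<lambda>\<omega>. \<Sum>j<n. u j * (c * levy_path (\<phi> (2 * linf) (s (Suc j))) \<omega> - c * levy_path (\<phi> (2 * linf) (s j)) \<omega>)"
    have "(\<Sum>j<n. u j * (S (s (Suc j)) \<xi> - S (s j) \<xi>)) = ?U (X1 \<xi>) + ?T (X2 \<xi>)" for \<xi>
      unfolding S_def W_def G_def sum.distrib[symmetric] by (intro sum.cong refl) algebra
    then have "(\<integral>\<xi>. iexp (\<Sum>j<n. u j * (S (s (Suc j)) \<xi> - S (s j) \<xi>)) \<partial>P) = (\<integral>\<xi>. iexp (?U (X1 \<xi>) + ?T (X2 \<xi>)) \<partial>P)"
      by (simp only:)
    also have "\<dots> = (\<integral>\<xi>. iexp (?U (X1 \<xi>)) \<partial>P) * (\<integral>\<xi>. iexp (?T (X2 \<xi>)) \<partial>P)"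
      by (rule indep_var_char_sum[OF ind]) measurable
    also have "\<dots> = of_real (exp (- (\<Sum>j<n. (u j)\<^sup>2 * (1\<^sup>2 * \<phi> linf (s (Suc j)) - 1\<^sup>2 * \<phi> linf (s j))) / 2)) *
        of_real (exp (- (\<Sum>j<n. (u j)\<^sup>2 * (c\<^sup>2 * \<phi> (2 * linf) (s (Suc j)) - c\<^sup>2 * \<phi> (2 * linf) (s j))) / 2))"
      by (simp only: levy_path_time_change_char[OF X(1) d(1) \<phi>(1,2)[OF linf_nonneg] s]
          levy_path_time_change_char[OF X(2) d(2) \<phi>(1,2)[OF l2] s])
    also have "\<dots> = of_real (exp (- (\<Sum>j<n. (u j)\<^sup>2 * (h (s (Suc j)) - h (s j))) / 2))"
    proof -
      have "(\<Sum>j<n. (u j)\<^sup>2 * (h (s (Suc j)) - h (s j))) = (\<Sum>j<n. (u j)\<^sup>2 * (1\<^sup>2 * \<phi> linf (s (Suc j)) - 1\<^sup>2 * \<phi> linf (s j)))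
         + (\<Sum>j<n. (u j)\<^sup>2 * (c\<^sup>2 * \<phi> (2 * linf) (s (Suc j)) - c\<^sup>2 * \<phi> (2 * linf) (s j)))"
        unfolding h sum.distrib[symmetric] by (intro sum.cong refl) (simp only: algebra_simps)
      then show ?thesis by (simp only: of_real_mult[symmetric] exp_add[symmetric] add_divide_distrib minus_add_distrib)
    qed
    finally show ?thesis .
  qed
  have Nm: "Nh t \<in> borel_measurable P" for t
    unfolding Nh_def[abs_def] by (rule ou_path_measurable[OF S Sc])
  have Nc: "continuous_on {0..} (\<lambda>t. Nh t \<xi>)" for \<xi>
    unfolding Nh_def by (rule ou_path_continuous[OF Sc])
  have Neq: "Nh t \<xi> = - linf * integral {0..t} (\<lambda>s. Nh s \<xi>) + W t \<xi> + G t \<xi>" if "t \<ge> 0" for t \<xi>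
    using ou_path_equation[OF Sc that, of linf \<xi>] by (simp add: Nh_def[abs_def] S_def)
  have N0: "Nh 0 \<xi> = 0" for \<xi> by (simp add: Nh_def ou_path_0 S0)
  \<comment> \<open>These characteristic functions agree with the limits in
    \<open>scaled_Nhat_fdd\<close>, which identifies the limit process.\<close>
  note Nchar = ou_path_char[where X = S and h = h, OF P V_zero _ S Sc h_def Schar, folded Nh_def]
  have Mp: "prob_space (M n)" for n using Z[of n] by (simp add: ctmc_def)
  have "conv_distr_D M (\<lambda>n. Nhat n (\<tau> n)) P Nh"
  proof (rule conv_distr_D_criterion[OF Mp P])
    show "Nhat n (\<tau> n) t \<in> borel_measurable (M n)" for n t by (rule Nhat_measurable[OF mm])
    show "cadlag_path (\<lambda>t. Nhat n (\<tau> n) t \<omega>)" for n \<omega> by (rule cadlag_Nhat)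
    show "(\<lambda>n. \<integral>\<omega>. iexp (\<Sum>k<N. u k * Nhat n (\<tau> n) (real k / 2 ^ l) \<omega>) \<partial>M n) \<longlonglongrightarrow> (\<integral>\<omega>. iexp (\<Sum>k<N. u k * Nh (real k / 2 ^ l) \<omega>) \<partial>P)" for l N u
      by (rule Nhat_fdd_limit[OF Z mm N0 Nchar])
  qed (rule Nm Nc Nhat_first_moment[OF Z mm] Nhat_oscillation[OF Z mm], assumption?)+
  then show ?thesis using P gW gG ind' Nm Nc Neq by (intro exI[of _ P] exI[of _ W] exI[of _ G] exI[of _ Nh]) blast
qed

end

theorem theorem5p3:
  fixes Q :: "real^'d::finite^'d" and p :: "real^'d" and lam :: "real^'d"
    and M :: "nat \<Rightarrow> 'a measure" and Z :: "nat \<Rightarrow> real \<Rightarrow> 'a \<Rightarrow> 'd"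
    and \<tau> :: "nat \<Rightarrow> nat \<Rightarrow> 'a \<Rightarrow> ereal"
  assumes "is_generator Q" and "irreducible_generator Q"
    and "Q *v p = 0" and "(\<Sum>i\<in>UNIV. p $ i) = 1"
    and "\<forall>i. lam $ i \<ge> 0"
    and "\<forall>n. ctmc (M n) (real n *\<^sub>R Q) (Z n)"
    and "\<forall>n. mm_binomial_defaults (M n) lam (Z n) n (\<tau> n)"
  shows "let linf = lam \<bullet> p; V = asympt_var Q p lam;
             rho = (\<lambda>t. 1 - exp (- linf * t));
             Nhat = (\<lambda>n t \<omega>. (real (counting_process n (\<tau> n) t \<omega>) - real n * rho t) / sqrt (real n))
         in \<exists>(P :: real measure) B G Nh. prob_space P \<and>
              gaussian_martingale P B (\<lambda>t. 1 - exp (- linf * t)) \<and>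
              gaussian_martingale P G (\<lambda>t. V / (2 * linf) * (1 - exp (- 2 * linf * t))) \<and>
              prob_space.indep_var P
                 (Pi\<^sub>M {0..} (\<lambda>_. borel)) (\<lambda>\<omega>. restrict (\<lambda>t. B t \<omega>) {0..})
                 (Pi\<^sub>M {0..} (\<lambda>_. borel)) (\<lambda>\<omega>. restrict (\<lambda>t. G t \<omega>) {0..}) \<and>
              (\<forall>t\<ge>0. Nh t \<in> borel_measurable P) \<and>
              (\<forall>\<omega>\<in>space P. continuous_on {0..} (\<lambda>t. Nh t \<omega>) \<and>
                 (\<forall>t\<ge>0. Nh t \<omega> = - linf * integral {0..t} (\<lambda>s. Nh s \<omega>) + B t \<omega> + G t \<omega>)) \<and>
              conv_distr_D M Nhat P Nh"
proof -
  interpret C: modulated_chain Q p lam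
    using assms by unfold_locales auto
  have N: "C.Nhat n \<tau>' = (\<lambda>t \<omega>. (real (counting_process n \<tau>' t \<omega>) - real n * (1 - exp (- (lam \<bullet> p) * t))) / sqrt (real n))"
    for n and \<tau>' :: "nat \<Rightarrow> 'a \<Rightarrow> ereal"
    by (intro ext) (simp only: C.Nhat_def C.rho_def C.linf_def)
  have "ctmc (M n) (real n *\<^sub>R Q) (Z n)" "mm_binomial_defaults (M n) lam (Z n) n (\<tau> n)" for n
    using assms by auto
  from C.Nhat_converges[OF this] show ?thesis
    unfolding Let_def N C.linf_def C.V_def .
qed

end
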